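(* Let $a<b$ be real numbers, and suppose that $E=[a,b]\cup\{x_k\}_{k\ge1}$ is compact, where $x_k\in\mathbb{R}\setminus[a,b]$ are distinct, and let $x_*\in\overline{\mathbb{R}}\setminus E$. Then the Widom factors $\mathcal{W}_n(E,x_* )$, $n\ge1$, are bounded if and only if \[ \sum_{k=1}^{\infty}\mathrm{dist}(x_k,[a,b])^{1/2}<\infty . \] Moreover, the Widom factors admit the asymptotic formula (with a possibly infinite limit) \[ \lim_{n\to\infty}\mathcal{W}_n(E,x_* )=2\exp\big[\mathcal{IR}(E,x_* )\big]. \]
   Context: $\overline{\mathbb{R}}=\mathbb{R}\cup\{\infty\}$, and $\exp(\infty)=\infty$. For a compact non-polar set $E\subset\mathbb{R}$ (i.e. logarithmic capacity $\mathrm{Cap}(E)>0$), $G_E(z,x_* )$ is the Green function of $\Omega_E=\overline{\mathbb{C}}\setminus E$ with pole at $x_*$, and $G_E(z)=G_E(z,\infty)$. It is extended to $x\in E$ by the upper boundary value $G_E(x,x_* )=\limsup_{\Omega_E\ni z\to x}G_E(z,x_* )$. A point $x\in E$ is irregular if $G_E(x,x_* )>0$ (independent of $x_*$); $E^{\mathrm{ir}}$ denotes the set of irregular points. Irregularity coefficient: $\mathcal{IR}(E,x_* )=\sum_{x\in E^{\mathrm{ir}}}G_E(x,x_* )\in[0,\infty]$, equal to $0$ if $E^{\mathrm{ir}}=\emptyset$ and to $\infty$ if $E^{\mathrm{ir}}$ is uncountable. Widom factors ($\|\cdot\|_E$ is the supremum norm on $E$). Chebyshev case ($x_*=\infty$):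 $T_{n,\infty}$ is the unique monic polynomial of degree $n$ minimizing $\|\cdot\|_E$, and $\mathcal{W}_n(E,\infty)=\|T_{n,\infty}\|_E/\mathrm{Cap}(E)^n$. Residual case ($x_*\in\mathbb{R}\setminus E$): $T_{n,x_*}$ is the unique polynomial minimizing $\|P\|_E$ among all polynomials $P$ of degree at most $n$ with $P(x_* )=1$; with $\mathrm{Cap}(E,x_* )=\exp[-G_E(x_* )]$, $\mathcal{W}_n(E,x_* )=\|T_{n,x_*}\|_E\,[\mathrm{Cap}(E,x_* )^n+\mathrm{Cap}(E,x_* )^{-n}]$. *)

theory Defs
  imports
    "HOL-Probability.Probability"
    "HOL-Computational_Algebra.Polynomial"
begin

section \<open>Logarithmic capacity and polar sets on the real line\<close>

fun exp_ereal :: "ereal \<Rightarrow> ereal" where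
  "exp_ereal (ereal r) = ereal (exp r)"
| "exp_ereal PInfty = \<infinity>"
| "exp_ereal MInfty = 0"

text \<open>The diagonal needs its own case because \<open>ln 0 = 0\<close> in HOL.\<close>

definition log_kernel :: "real \<Rightarrow> real \<Rightarrow> ereal" where
  "log_kernel s t = (if s = t then \<infinity> else ereal (- ln \<bar>s - t\<bar>))"

text \<open>The energy \<open>\<integral>\<integral> log (1 / |s - t|) d\<mu>(s) d\<mu>(t)\<close>, as positive part minus negative part
  (\<open>e2ennreal\<close> sends negative values to \<open>0\<close>). If \<open>\<mu>\<close> is finite and has compact
  support, the subtrahend is finite, so \<open>\<infinity> - \<infinity>\<close> does not occur.\<close>

definition log_energy :: "real measure \<Rightarrow> ereal" where
  "log_energy \<mu> =
     enn2ereal (\<integral>\<^sup>+ s. (\<integral>\<^sup>+ t. e2ennreal (log_kernel s t) \<partial>\<mu>) \<partial>\<mu>)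
   - enn2ereal (\<integral>\<^sup>+ s. (\<integral>\<^sup>+ t. e2ennreal (- log_kernel s t) \<partial>\<mu>) \<partial>\<mu>)"

definition prob_measures_on :: "real set \<Rightarrow> real measure set" where
  "prob_measures_on K = {\<mu>. prob_space \<mu> \<and> sets \<mu> = sets borel \<and> emeasure \<mu> (- K) = 0}"

text \<open>The capacity \<open>exp (- inf I)\<close> of a compact set, \<open>I\<close> being the energy. The
  infimum is \<open>\<infinity>\<close>, and the capacity \<open>0\<close>, if no probability measure on \<open>K\<close> has
  finite energy (in particular for \<open>K = {}\<close>).\<close>

definition Cap :: "real set \<Rightarrow> real" where
  "Cap K = real_of_ereal (exp_ereal (- (INF \<mu>\<in>prob_measures_on K. log_energy \<mu>)))"

definition polar :: "real set \<Rightarrow> bool" where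
  "polar S \<longleftrightarrow> (\<forall>K. compact K \<and> K \<subseteq> S \<longrightarrow> Cap K = 0)"


section \<open>Harmonic functions on the Riemann sphere\<close>

text \<open>Twice continuously differentiable functions with vanishing Laplacian; \<open>ux\<close>, \<open>uxy\<close>
  etc. are the partial derivatives.\<close>

definition harmonic_on :: "complex set \<Rightarrow> (complex \<Rightarrow> real) \<Rightarrow> bool" where
  "harmonic_on U u \<longleftrightarrow> open U \<and>
     (\<exists>ux uy uxx uxy uyx uyy.
        continuous_on U uxx \<and> continuous_on U uxy \<and> continuous_on U uyx \<and> continuous_on U uyy \<and>
        (\<forall>z\<in>U.
           (u has_derivative (\<lambda>h. ux z * Re h + uy z * Im h)) (at z) \<and>
           (ux has_derivative (\<lambda>h. uxx z * Re h + uxy z * Im h)) (at z) \<and>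
           (uy has_derivative (\<lambda>h. uyx z * Re h + uyy z * Im h)) (at z) \<and>
           uxx z + uyy z = 0))"

text \<open>The Riemann sphere is the one-point compactification of the plane: \<open>Some z\<close> is the
  finite point \<open>z\<close> and \<open>None\<close> is the point at infinity.\<close>

abbreviation riemann_sphere :: "complex option topology" where
  "riemann_sphere \<equiv> Alexandroff_compactification euclidean"

definition inversion_chart :: "complex \<Rightarrow> complex option" where
  "inversion_chart z = (if z = 0 then None else Some (inverse z))"

definition sphere_harmonic_on :: "complex option set \<Rightarrow> (complex option \<Rightarrow> real) \<Rightarrow> bool" where
  "sphere_harmonic_on W u \<longleftrightarrow>
     harmonic_on {z. Some z \<in> W} (\<lambda>z. u (Some z)) \<and>
     harmonic_on {z. inversion_chart z \<in> W} (\<lambda>z. u (inversion_chart z))"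


section \<open>Green functions\<close>

text \<open>The complement in the Riemann sphere of a subset \<open>E\<close> of the real line.\<close>

definition Omega :: "real set \<Rightarrow> complex option set" where
  "Omega E = - (Some ` complex_of_real ` E)"

definition log_pole :: "complex option \<Rightarrow> (complex option \<Rightarrow> ereal) \<Rightarrow> bool" where
  "log_pole w g =
     (case w of
        None \<Rightarrow> (\<exists>R B. \<forall>z. R < cmod z \<longrightarrow>
                   \<bar>g (Some z) - ereal (ln (cmod z))\<bar> \<le> ereal B)
      | Some c \<Rightarrow> (\<exists>r>0. \<exists>B. \<forall>z. 0 < cmod (z - c) \<and> cmod (z - c) < r \<longrightarrow>
                   \<bar>g (Some z) + ereal (ln (cmod (z - c)))\<bar> \<le> ereal B))"

text \<open>\<open>g\<close> is a Green function of \<open>Omega E\<close> with pole \<open>w\<close>: harmonic off the pole, bounded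
  outside every neighbourhood of the pole, with a logarithmic singularity at the pole, and
  with boundary limit \<open>0\<close> outside a polar subset of \<open>E\<close>, which is the boundary
  of \<open>Omega E\<close> for compact \<open>E\<close>. If \<open>E\<close> is not polar, this determines \<open>g\<close> on \<open>Omega E\<close>,
  and nothing is required elsewhere.\<close>

definition is_green_function ::
    "real set \<Rightarrow> complex option \<Rightarrow> (complex option \<Rightarrow> ereal) \<Rightarrow> bool" where
  "is_green_function E w g \<longleftrightarrow>
     (\<forall>z\<in>Omega E - {w}. \<bar>g z\<bar> \<noteq> \<infinity>) \<and>
     sphere_harmonic_on (Omega E - {w}) (\<lambda>z. real_of_ereal (g z)) \<and>
     (\<forall>U. openin riemann_sphere U \<and> w \<in> U \<longrightarrow>
        (\<exists>B. \<forall>z\<in>Omega E - U. \<bar>g z\<bar> \<le> ereal B)) \<and>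
     g w = \<infinity> \<and> log_pole w g \<and>
     polar {t\<in>E. \<not> ((\<lambda>z. g (Some z)) \<longlongrightarrow> 0)
                     (at (complex_of_real t) within - complex_of_real ` E)}"

definition green_inside :: "real set \<Rightarrow> complex option \<Rightarrow> complex option \<Rightarrow> ereal" where
  "green_inside E w = (SOME g. is_green_function E w g)"

text \<open>\<open>green E w z\<close> is the Green function with pole \<open>w\<close> at the point \<open>z\<close>, where the points
  of \<open>E\<close> receive the upper boundary value.\<close>

definition green :: "real set \<Rightarrow> complex option \<Rightarrow> complex option \<Rightarrow> ereal" where
  "green E w z =
     (if z \<in> Omega E then green_inside E w z
      else Limsup (at (the z) within - complex_of_real ` E) (\<lambda>\<zeta>. green_inside E w (Some \<zeta>)))"


section \<open>Irregular points\<close>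

text \<open>From here on \<open>w :: real option\<close> is a point of the extended real line, \<open>None\<close> being
  the point at infinity.\<close>

abbreviation sphere_pt :: "real option \<Rightarrow> complex option" where
  "sphere_pt \<equiv> map_option complex_of_real"

definition irregular_points :: "real set \<Rightarrow> real option \<Rightarrow> real set" where
  "irregular_points E w = {t\<in>E. green E (sphere_pt w) (sphere_pt (Some t)) > 0}"

text \<open>The unordered sum of positive extended reals is the supremum of the finite partial sums.
  It is \<open>0\<close> over the empty set and \<open>\<infinity>\<close> over an uncountable set.\<close>

definition irregularity_coeff :: "real set \<Rightarrow> real option \<Rightarrow> ereal" where
  "irregularity_coeff E w =
     (\<Sum>\<^sub>\<infinity>t\<in>irregular_points E w. green E (sphere_pt w) (sphere_pt (Some t)))"


section \<open>Extremal polynomials and Widom factors\<close>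

definition poly_sup_norm :: "real set \<Rightarrow> complex poly \<Rightarrow> real" where
  "poly_sup_norm E p = (SUP t\<in>E. cmod (poly p (complex_of_real t)))"

text \<open>The polynomials competing in the Chebyshev problem (\<open>None\<close>) and in the residual
  problem (\<open>Some y\<close>).\<close>

definition admissible_poly :: "nat \<Rightarrow> real option \<Rightarrow> complex poly \<Rightarrow> bool" where
  "admissible_poly n w p =
     (case w of
        None \<Rightarrow> degree p = n \<and> lead_coeff p = 1
      | Some y \<Rightarrow> degree p \<le> n \<and> poly p (complex_of_real y) = 1)"

definition extremal_poly :: "real set \<Rightarrow> real option \<Rightarrow> nat \<Rightarrow> complex poly" where
  "extremal_poly E w n = arg_min (poly_sup_norm E) (admissible_poly n w)"

definition Cap_at :: "real set \<Rightarrow> real \<Rightarrow> real" where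
  "Cap_at E y = exp (- real_of_ereal (green E None (sphere_pt (Some y))))"

definition widom_factor :: "real set \<Rightarrow> real option \<Rightarrow> nat \<Rightarrow> real" where
  "widom_factor E w n =
     (case w of
        None \<Rightarrow> poly_sup_norm E (extremal_poly E w n) / Cap E ^ n
      | Some y \<Rightarrow> poly_sup_norm E (extremal_poly E w n) *
                  (Cap_at E y ^ n + inverse (Cap_at E y) ^ n))"

end

theory Submission
  imports Defs
    "HOL-Complex_Analysis.Complex_Analysis"
    "HOL-Computational_Algebra.Fundamental_Theorem_Algebra"
    "HOL-Real_Asymp.Real_Asymp"
begin

text \<open>
  A Moebius map carries \<open>[a, b]\<close> to \<open>[-1, 1]\<close> and the pole to infinity. It turns the two extremal
  problems into one: minimize the largest quotient \<open>|p(s)| / |q(s)| ^ n\<close> over real monic \<open>p\<close> of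
  degree \<open>n\<close>, where \<open>s\<close> runs through the image \<open>X\<close> of \<open>E\<close> and the weight \<open>q\<close> is \<open>1\<close> in the Chebyshev
  case and \<open>s - s0\<close> in the residual case, \<open>s0\<close> being the image of infinity. If \<open>L\<close> is the minimum,
  the Widom factor is \<open>L * 2 ^ n\<close>, respectively \<open>2 * L * cosh (n * g s0)\<close>, where
  \<open>g w = arcosh ((|w - 1| + |w + 1|) / 2)\<close> is the Green function of the complement of \<open>[-1, 1]\<close>
  (\<open>widom_factor_eq\<close>).

  The points outside \<open>[a, b]\<close> form a countable, hence polar, set. Therefore the capacity and the
  Green function of \<open>E\<close> are those of \<open>[a, b]\<close> (\<open>Cap_interval_countable\<close>,
  \<open>green_function_unique\<close>), the irregular points are exactly the points outside the interval, and
  the irregularity coefficient is the sum of \<open>g\<close> over \<open>X - [-1, 1]\<close>.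

  The limit comes from two bounds obtained by averaging. The mean of \<open>ln |w - c|\<close> over the arcsine
  law in \<open>c\<close> is \<open>g w - ln 2\<close> (\<open>ln_dist_cos_mean\<close>). For the upper bound, the minimizer \<open>p\<close> attains
  its extreme quotients with alternating signs at \<open>n + 1\<close> points
  (\<open>weighted_chebyshev_alternation\<close>). Hence, for \<open>|c| < 1\<close>, the polynomial \<open>p / L - c * q ^ n\<close> has a
  zero in each of the \<open>n\<close> gaps between these points. Over its zeros, \<open>g\<close> sums to at most its sum over
  \<open>X - [-1, 1]\<close>, because \<open>g\<close> at a zero is at most \<open>g\<close> at the neighbouring alternation point further
  out. Averaging the logarithm of the polynomial over \<open>c\<close> and over the interval gives
  \<open>extremal_upper\<close>. For the lower bound, fix a finite set of points outside the interval and perturb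
  \<open>p / L - c * q ^ n\<close> by small polynomials of lower degree so that it vanishes at all of them; each
  prescribed zero \<open>s\<close> raises the logarithmic mean by \<open>g s\<close>, and this forces \<open>L\<close> to be large
  (\<open>widom_lower_bound_finite\<close>). Together the bounds give \<open>normalized_widom_limit\<close>.

  Finally \<open>sinh (g s) = sqrt (s ^ 2 - 1)\<close> makes \<open>g\<close> at the image of a point of \<open>E\<close> outside the interval
  comparable to the square root of the distance of that point to \<open>[a, b]\<close>
  (\<open>G_comparable_sqrt_dist\<close>). So the limit is finite if and only if the series of square roots
  converges.
\<close>

section \<open>Logarithmic means and the Green function of a slit\<close>

text \<open>The Green function, with pole at infinity, of the complement of \<open>[-1, 1]\<close>. Its level curves are
  the ellipses with foci \<open>-1\<close> and \<open>1\<close>, which is where the sum of the two distances comes from.\<close>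

definition green_slit :: "complex \<Rightarrow> real" where
  "green_slit w = arcosh ((cmod (w - 1) + cmod (w + 1)) / 2)"

lemma foci_sum_ge: "(cmod (w - 1) + cmod (w + 1)) / 2 \<ge> 1"
  using norm_triangle_ineq4[of "w+1" "w-1"] by simp

lemma foci_sum_ge_cmod: "(cmod (w - 1) + cmod (w + 1)) / 2 \<ge> cmod w"
  using norm_triangle_ineq[of "w+1" "w-1"] by (simp add: mult_2[symmetric] norm_mult)

lemma foci_sum_le: "(cmod (w - 1) + cmod (w + 1)) / 2 \<le> cmod w + 1"
  using norm_triangle_ineq[of w 1] norm_triangle_ineq4[of w 1] by simp

lemma green_slit_real: "green_slit (complex_of_real w) = arcosh (max 1 \<bar>w\<bar>)"
proof -
  have "cmod (complex_of_real w - 1) = \<bar>w - 1\<bar>" "cmod (complex_of_real w + 1) = \<bar>w + 1\<bar>"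
    by (metis norm_of_real of_real_1 of_real_diff) (metis norm_of_real of_real_1 of_real_add)
  then have "(cmod (complex_of_real w - 1) + cmod (complex_of_real w + 1)) / 2 = max 1 \<bar>w\<bar>"
    by (auto simp: max_def abs_if)
  then show ?thesis by (simp add: green_slit_def)
qed

lemma green_slit_nonneg: "0 \<le> green_slit w"
  unfolding green_slit_def using foci_sum_ge by simp

lemma green_slit_mono: "\<bar>v\<bar> \<le> \<bar>w\<bar> \<Longrightarrow> green_slit (complex_of_real v) \<le> green_slit (complex_of_real w)"
  by (cases "1 \<le> \<bar>v\<bar>") (auto simp: green_slit_real max_def le_less)

lemma continuous_on_green_slit: "continuous_on S green_slit"
proof -
  define f where "f w = (cmod (w - 1) + cmod (w + 1)) / 2" for w
  have f1: "1 \<le> f w" for w unfolding f_def by (rule foci_sum_ge)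
  have cf: "continuous_on S f"
    unfolding f_def by (intro continuous_intros) auto
  have ca: "continuous_on {1..} (arcosh :: real \<Rightarrow> real)"
    by (rule continuous_on_arcosh) auto
  have "continuous_on S (\<lambda>w. arcosh (f w))"
    by (rule continuous_on_compose2[OF ca cf]) (use f1 in auto)
  then show ?thesis unfolding f_def green_slit_def .
qed

text \<open>The mean value property of the harmonic function \<open>ln |1 - z|\<close> in the unit disc, taken on the
  circle of radius \<open>u\<close>.\<close>

lemma ln_norm_circle_mean:
  fixes u :: real and c :: complex
  assumes "0 \<le> u" "u < 1" "cmod c = 1"
  shows "((\<lambda>x. ln (cmod (1 - u * c * cis (2 * pi * x)))) has_integral 0) {0..1}"
proof (cases "u = 0")
  case True
  then show ?thesis by simp
next
  case False
  with assms have u: "0 < u" by simp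
  define f where "f z = Ln (1 - c * z)" for z :: complex
  have pos: "Re (1 - c * z) > 0" if "cmod z \<le> u" for z :: complex
  proof -
    have "Re (c * z) \<le> cmod (c * z)" by (rule complex_Re_le_cmod)
    also have "\<dots> < 1" using that assms by (simp add: norm_mult)
    finally show ?thesis by simp
  qed
  have nz: "1 - c * z \<noteq> 0" if "cmod z \<le> u" for z :: complex
    using pos[OF that] by (metis less_irrefl zero_complex.simps(1))
  have hol: "f holomorphic_on cball 0 u"
    unfolding f_def
  proof (intro holomorphic_intros)
    fix z :: complex assume "z \<in> cball 0 u"
    then have "Re (1 - c * z) > 0" using pos by simp
    then show "1 - c * z \<notin> \<real>\<^sub>\<le>\<^sub>0"
      by (auto simp: complex_nonpos_Reals_iff)
  qed
  have "((\<lambda>z. f z / (z - 0)) has_contour_integral 2 * complex_of_real pi * \<i> * f 0) (circlepath 0 u)"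
    by (rule Cauchy_integral_circlepath_simple[OF hol]) (use u in simp)
  then have "((\<lambda>x. f (circlepath 0 u x) / circlepath 0 u x *
      vector_derivative (circlepath 0 u) (at x within {0..1})) has_integral 0) {0..1}"
    by (simp add: has_contour_integral_def f_def)
  then have *: "((\<lambda>x. 2 * complex_of_real pi * \<i> * f (circlepath 0 u x)) has_integral 0) {0..1}"
  proof (rule has_integral_eq[rotated])
    fix x :: real assume "x \<in> {0..1}"
    then show "f (circlepath 0 u x) / circlepath 0 u x *
      vector_derivative (circlepath 0 u) (at x within {0..1}) = 2 * complex_of_real pi * \<i> * f (circlepath 0 u x)"
      using u by (simp add: vector_derivative_circlepath01) (simp add: circlepath field_simps)
  qed
  have "((\<lambda>x. (1 / (2 * complex_of_real pi * \<i>)) * (2 * complex_of_real pi * \<i> * f (circlepath 0 u x))) has_integral (1 / (2 * complex_of_real pi * \<i>)) * 0) {0..1}"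
    by (rule has_integral_mult_right[OF *])
  then have "((\<lambda>x. f (circlepath 0 u x)) has_integral 0) {0..1}"
    by simp
  then have "((Re \<circ> (\<lambda>x. f (circlepath 0 u x))) has_integral Re 0) {0..1}"
    by (rule has_integral_linear) (rule bounded_linear_Re)
  then have "((Re \<circ> (\<lambda>x. f (circlepath 0 u x))) has_integral 0) {0..1}" by simp
  then show ?thesis
  proof (rule has_integral_eq[rotated])
    fix x :: real assume "x \<in> {0..1}"
    have e: "circlepath 0 u x = u * cis (2 * pi * x)"
      by (simp add: circlepath cis_conv_exp mult_ac)
    have "1 - c * circlepath 0 u x \<noteq> 0"
      by (rule nz) (simp add: e norm_mult u less_imp_le)
    then show "(Re \<circ> (\<lambda>x. f (circlepath 0 u x))) x = ln (cmod (1 - u * c * cis (2 * pi * x)))"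
      by (simp add: f_def e mult_ac)
  qed
qed


lemma ln_dist_cos_mean_outside:
  fixes w \<sigma> :: real
  assumes "1 < w" and \<sigma>: "\<sigma> = 1 \<or> \<sigma> = -1"
  shows "((\<lambda>x. ln \<bar>w - \<sigma> * cos (2 * pi * x)\<bar>) has_integral arcosh w - ln 2) {0..1}"
proof -
  define u where "u = exp (- arcosh w)"
  have a: "arcosh w > 0" using assms by simp
  have u: "0 < u" "u < 1" using a by (auto simp: u_def)
  have w: "w = (u + 1 / u) / 2"
  proof -
    have "cosh (arcosh w) = w" using assms by simp
    then show ?thesis by (simp add: u_def cosh_def exp_minus field_simps)
  qed
  have "((\<lambda>x. 2 * ln (cmod (1 - complex_of_real u * complex_of_real \<sigma> * cis (2 * pi * x)))) has_integral 2 * 0) {0..1}"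
    by (rule has_integral_mult_right, rule ln_norm_circle_mean) (use u \<sigma> in auto)
  moreover have "((\<lambda>x. - ln (2 * u)) has_integral - ln (2 * u)) {0..1::real}"
    using has_integral_const_real[of "- ln (2 * u)" 0 1] by simp
  ultimately have "((\<lambda>x. 2 * ln (cmod (1 - complex_of_real u * complex_of_real \<sigma> * cis (2 * pi * x))) + - ln (2 * u)) has_integral 2 * 0 + - ln (2 * u)) {0..1}"
    by (rule has_integral_add)
  moreover have "2 * 0 + - ln (2 * u) = arcosh w - ln 2"
    using u by (simp add: ln_mult) (simp add: u_def)
  ultimately have *: "((\<lambda>x. 2 * ln (cmod (1 - complex_of_real u * complex_of_real \<sigma> * cis (2 * pi * x))) + - ln (2 * u)) has_integral arcosh w - ln 2) {0..1}"
    by (simp only:)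
  show ?thesis
  proof (rule has_integral_eq[OF _ *])
    fix x :: real
    let ?t = "2 * pi * x"
    have sq: "(cmod (1 - complex_of_real u * complex_of_real \<sigma> * cis ?t))\<^sup>2 = 1 + u\<^sup>2 - 2 * u * (\<sigma> * cos ?t)"
    proof -
      have "(cmod (1 - complex_of_real u * complex_of_real \<sigma> * cis ?t))\<^sup>2 = (1 - u * \<sigma> * cos ?t)\<^sup>2 + (u * \<sigma> * sin ?t)\<^sup>2"
        by (simp add: cmod_power2)
      also have "\<dots> = 1 - 2 * u * (\<sigma> * cos ?t) + \<sigma>\<^sup>2 * u\<^sup>2 * ((cos ?t)\<^sup>2 + (sin ?t)\<^sup>2)"
        unfolding power2_eq_square by (simp only: algebra_simps)
      also have "\<sigma>\<^sup>2 = 1" using \<sigma> by auto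
      finally show ?thesis by (simp add: sin_cos_squared_add2)
    qed
    have "\<sigma> * cos ?t \<le> 1" using \<sigma> cos_le_one[of ?t] cos_ge_minus_one[of ?t] by auto
    then have "1 + u\<^sup>2 - 2 * u * (\<sigma> * cos ?t) \<ge> (1 - u)\<^sup>2"
      using u mult_left_mono[of "\<sigma> * cos ?t" 1 "2 * u"] by (simp add: power2_eq_square algebra_simps)
    then have p: "1 + u\<^sup>2 - 2 * u * (\<sigma> * cos ?t) > 0" using u by (smt (verit) zero_less_power)
    have e: "w - \<sigma> * cos ?t = (1 + u\<^sup>2 - 2 * u * (\<sigma> * cos ?t)) / (2 * u)"
      using u by (simp add: w field_simps power2_eq_square)
    have "ln \<bar>w - \<sigma> * cos ?t\<bar> = ln (1 + u\<^sup>2 - 2 * u * (\<sigma> * cos ?t)) - ln (2 * u)"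
      using p u by (simp add: e ln_div)
    moreover have "2 * ln (cmod (1 - complex_of_real u * complex_of_real \<sigma> * cis ?t)) = ln ((cmod (1 - complex_of_real u * complex_of_real \<sigma> * cis ?t))\<^sup>2)"
      using p sq by (subst ln_realpow) auto
    ultimately show "2 * ln (cmod (1 - complex_of_real u * complex_of_real \<sigma> * cis ?t)) + - ln (2 * u) = ln \<bar>w - \<sigma> * cos ?t\<bar>"
      using sq by simp
  qed
qed

lemma finite_cos_level: "finite {x \<in> {0..1::real}. cos (2 * pi * x) = v}"
proof -
  have "{x \<in> {0..1::real}. cos (2 * pi * x) = v} \<subseteq> {arccos v / (2 * pi), 1 - arccos v / (2 * pi)}"
  proof
    fix x :: real assume "x \<in> {x \<in> {0..1::real}. cos (2 * pi * x) = v}"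
    then have x: "x \<in> {0..1}" "v = cos (2 * pi * x)" by auto
    show "x \<in> {arccos v / (2 * pi), 1 - arccos v / (2 * pi)}"
    proof (cases "x \<le> 1 / 2")
      case True
      then have "arccos (cos (2 * pi * x)) = 2 * pi * x"
        using x by (intro arccos_cos) (auto simp: field_simps)
      then show ?thesis using x(2) by simp
    next
      case False
      have "cos (2 * pi * (1 - x)) = cos (2 * pi * x)"
        by (simp add: right_diff_distrib cos_diff)
      moreover have "arccos (cos (2 * pi * (1 - x))) = 2 * pi * (1 - x)"
        using x False by (intro arccos_cos) (auto simp: field_simps)
      ultimately have "arccos (cos (2 * pi * x)) = 2 * pi * (1 - x)" by simp
      then show ?thesis using x(2) by (simp add: field_simps)
    qed
  qed
  then show ?thesis by (rule finite_subset) simp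
qed

text \<open>This factorization reduces logarithms of distances between cosines to logarithms of
  distances on the unit circle.\<close>

lemma dist_cos_factor:
  fixes \<theta> \<alpha> :: real
  shows "cmod (1 - cis \<theta> * cis \<alpha>) * cmod (1 - cis (- \<theta>) * cis \<alpha>) = 2 * \<bar>cos \<theta> - cos \<alpha>\<bar>"
proof -
  have "cmod (1 - cis \<theta> * cis \<alpha>) * cmod (1 - cis (- \<theta>) * cis \<alpha>) = cmod (1 - cis (\<theta> + \<alpha>) - cis (\<alpha> - \<theta>) + cis (2 * \<alpha>))"
    by (simp add: norm_mult[symmetric] algebra_simps cis_mult)
  also have "1 - cis (\<theta> + \<alpha>) - cis (\<alpha> - \<theta>) + cis (2 * \<alpha>) = cis \<alpha> * complex_of_real (2 * (cos \<alpha> - cos \<theta>))"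
  proof -
    have "complex_of_real (2 * (cos \<alpha> - cos \<theta>)) = cis \<alpha> + cis (- \<alpha>) - cis \<theta> - cis (- \<theta>)"
      by (simp add: complex_eq_iff)
    then have "cis \<alpha> * complex_of_real (2 * (cos \<alpha> - cos \<theta>)) =
        cis \<alpha> * cis \<alpha> + cis \<alpha> * cis (- \<alpha>) - cis \<alpha> * cis \<theta> - cis \<alpha> * cis (- \<theta>)"
      by (simp only: right_diff_distrib distrib_left)
    also have "\<dots> = cis (2 * \<alpha>) + 1 - cis (\<theta> + \<alpha>) - cis (\<alpha> - \<theta>)"
      by (simp add: cis_mult add.commute)
    finally show ?thesis by simp
  qed
  also have "cmod \<dots> = 2 * \<bar>cos \<theta> - cos \<alpha>\<bar>"
    by (simp only: norm_mult norm_of_real) (simp add: abs_if)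
  finally show ?thesis .
qed

lemma norm_one_minus_scaled_ge:
  fixes u :: real and c :: complex
  assumes "0 \<le> u" "u \<le> 1" "cmod c = 1"
  shows "u * (cmod (1 - c))\<^sup>2 \<le> (cmod (1 - complex_of_real u * c))\<^sup>2"
proof -
  have c: "(Re c)\<^sup>2 + (Im c)\<^sup>2 = 1" using assms(3) by (metis cmod_power2 one_power2)
  have "(cmod (1 - complex_of_real u * c))\<^sup>2 - u * (cmod (1 - c))\<^sup>2 = (1 - u) * (1 - u * ((Re c)\<^sup>2 + (Im c)\<^sup>2))"
    by (simp add: cmod_power2) (simp add: power2_eq_square algebra_simps)
  also have "\<dots> = (1 - u)\<^sup>2" unfolding c by (simp add: power2_eq_square)
  finally show ?thesis using zero_le_power2[of "1 - u"] by linarith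
qed

text \<open>A minorant that stays valid when the unit circle is replaced by a smaller circle. It
  lets the boundary case \<open>u = 1\<close> of the mean value property be reached as a limit of circles of radius
  \<open>u < 1\<close>, although the logarithm is singular there.\<close>

lemma ln_dist_cos_scaled_ge:
  fixes u \<theta> \<alpha> :: real
  assumes "0 < u" "u < 1" "cos \<theta> \<noteq> cos \<alpha>"
  shows "ln u + ln (2 * \<bar>cos \<theta> - cos \<alpha>\<bar>) \<le>
     ln (cmod (1 - u * cis \<theta> * cis \<alpha>)) + ln (cmod (1 - u * cis (- \<theta>) * cis \<alpha>))"
proof -
  let ?A = "cmod (1 - cis \<theta> * cis \<alpha>)" and ?B = "cmod (1 - cis (- \<theta>) * cis \<alpha>)"
  let ?A' = "cmod (1 - u * (cis \<theta> * cis \<alpha>))" and ?B' = "cmod (1 - u * (cis (- \<theta>) * cis \<alpha>))"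
  have AB: "?A * ?B = 2 * \<bar>cos \<theta> - cos \<alpha>\<bar>" by (rule dist_cos_factor)
  then have "?A * ?B \<noteq> 0" using assms by simp
  then have p: "?A > 0" "?B > 0" by auto
  have h: "(1/2) * ln u + ln (cmod (1 - c)) \<le> ln (cmod (1 - u * c))" if c: "cmod c = 1" "cmod (1 - c) > 0" for c :: complex
  proof -
    have le: "u * (cmod (1 - c))\<^sup>2 \<le> (cmod (1 - complex_of_real u * c))\<^sup>2"
      using norm_one_minus_scaled_ge assms c by simp
    have p0: "0 < u * (cmod (1 - c))\<^sup>2" using assms c by simp
    then have "cmod (1 - complex_of_real u * c) > 0" using le by (smt (verit) zero_less_norm_iff zero_power2 norm_eq_zero)
    then have "ln ((cmod (1 - complex_of_real u * c))\<^sup>2) = 2 * ln (cmod (1 - complex_of_real u * c))"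
      by (simp add: ln_realpow)
    moreover have "ln (u * (cmod (1 - c))\<^sup>2) = ln u + 2 * ln (cmod (1 - c))"
      using assms c by (simp add: ln_mult ln_realpow)
    moreover have "ln (u * (cmod (1 - c))\<^sup>2) \<le> ln ((cmod (1 - complex_of_real u * c))\<^sup>2)"
      using le p0 by (intro ln_mono) auto
    ultimately show ?thesis by simp
  qed
  have "ln u + (ln ?A + ln ?B) \<le> ln ?A' + ln ?B'"
    using h[of "cis \<theta> * cis \<alpha>"] h[of "cis (-\<theta>) * cis \<alpha>"] p by (simp add: norm_mult)
  moreover have "ln (?A * ?B) = ln ?A + ln ?B" using p by (simp add: ln_mult)
  ultimately show ?thesis using AB by (simp add: mult.assoc)
qed

text \<open>On a circle of radius \<open>u < 1\<close> both factors of \<open>dist_cos_factor\<close> have logarithmic mean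
  zero. The passage to the limit \<open>u = 1\<close> is justified by the minorant
  \<open>ln_dist_cos_scaled_ge\<close> and the trivial upper bound.\<close>

lemma ln_dist_cos_mean_inside:
  fixes \<theta> :: real
  shows "((\<lambda>x. ln \<bar>cos \<theta> - cos (2 * pi * x)\<bar>) has_integral - ln 2) {0..1}"
proof -
  define p where "p u x = ln (cmod (1 - u * cis \<theta> * cis (2 * pi * x))) + ln (cmod (1 - u * cis (- \<theta>) * cis (2 * pi * x)))"
    for u x :: real
  define q where "q x = ln (2 * \<bar>cos \<theta> - cos (2 * pi * x)\<bar>)" for x :: real
  define Z where "Z = {x \<in> {0..1::real}. cos (2 * pi * x) = cos \<theta>}"
  have finZ: "finite Z" unfolding Z_def by (rule finite_cos_level)
  define v where "v n = 1 - 1 / real (n + 2)" for n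
  have v: "0 < v n" "v n < 1" for n by (auto simp: v_def)
  have v_lim: "v \<longlonglongrightarrow> 1" unfolding v_def by real_asymp
  have p_int: "((\<lambda>x. p u x) has_integral 0) {0..1}" if "0 < u" "u < 1" for u
    unfolding p_def
    using has_integral_add[OF ln_norm_circle_mean[of u "cis \<theta>"] ln_norm_circle_mean[of u "cis (-\<theta>)"]] that by simp
  have ln_ub: "ln (cmod (1 - complex_of_real u * c)) \<le> ln 2" if "0 \<le> u" "u \<le> 1" "cmod c = 1" "1 - u * c \<noteq> 0" for u :: real and c :: complex
  proof -
    have "cmod (1 - complex_of_real u * c) \<le> 1 + u" using norm_triangle_ineq4[of 1 "u*c"] that by (simp add: norm_mult)
    then have "cmod (1 - complex_of_real u * c) \<le> 2" using that by linarith
    then show ?thesis using that by simp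
  qed
  have nz: "1 - complex_of_real u * c \<noteq> 0" if "0 < u" "u < 1" "cmod c = 1" for u :: real and c :: complex
  proof
    assume "1 - complex_of_real u * c = 0"
    then have "cmod (complex_of_real u * c) = 1" by simp
    then show False using that by (simp add: norm_mult)
  qed
  have p_ub: "p u x \<le> 2 * ln 2" if "0 < u" "u < 1" for u x
  proof -
    have "ln (cmod (1 - complex_of_real u * (cis t * cis (2 * pi * x)))) \<le> ln 2" for t
      by (rule ln_ub) (use nz[of u "cis t * cis (2 * pi * x)"] that in \<open>auto simp: norm_mult\<close>)
    from this[of \<theta>] this[of "- \<theta>"] show ?thesis
      unfolding p_def mult.assoc by linarith
  qed
  define I :: "real \<Rightarrow> real" where "I = indicator {0..1}"
  define F where "F u x = I x * (2 * ln 2 - p u x)" for u x :: real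
  define G where "G x = I x * (2 * ln 2 - q x)" for x :: real
  have meas[measurable]: "F u \<in> borel_measurable borel" "G \<in> borel_measurable borel" for u
  proof -
    have [measurable]: "cis \<in> borel_measurable borel"
      by (intro borel_measurable_continuous_onI continuous_intros)
    show "F u \<in> borel_measurable borel" "G \<in> borel_measurable borel" for u
      unfolding F_def G_def p_def q_def I_def by measurable
  qed
  have F_nn: "0 \<le> F u x" if "0 < u" "u < 1" for u x
    unfolding F_def I_def using p_ub[OF that, of x] by (auto simp: indicator_def)
  have G_nn: "0 \<le> G x" for x
  proof -
    have "2 * \<bar>cos \<theta> - cos (2 * pi * x)\<bar> \<le> 4"
    proof -
      have "2 * \<bar>p - q\<bar> \<le> 4" if "\<bar>p\<bar> \<le> 1" "\<bar>q\<bar> \<le> 1" for p q :: real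
        using that by (auto simp: abs_if split: if_splits)
      then show ?thesis by (simp only: abs_cos_le_one)
    qed
    then have "q x \<le> ln 4" unfolding q_def
      by (cases "cos \<theta> = cos (2*pi*x)") (auto intro!: ln_mono)
    also have "ln 4 = 2 * ln (2::real)" using ln_realpow[of 2 2] by simp
    finally show ?thesis by (auto simp: G_def I_def indicator_def)
  qed
  have F_int: "integral\<^sup>N lborel (\<lambda>x. ennreal (F u x)) = ennreal (2 * ln 2)" if "0 < u" "u < 1" for u
  proof (rule nn_integral_has_integral_lborel)
    have "((\<lambda>x. 2 * ln 2 - p u x) has_integral 2 * ln 2 - 0) {0..1}"
      using has_integral_const_real[of "2 * ln 2" 0 1] by (intro has_integral_diff p_int that) simp
    then have "((\<lambda>x. if x \<in> {0..1} then 2 * ln 2 - p u x else 0) has_integral 2 * ln 2) UNIV"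
      by (simp only: has_integral_restrict_UNIV diff_zero)
    then show "(F u has_integral 2 * ln 2) UNIV"
      by (rule has_integral_eq[rotated]) (auto simp: F_def I_def)
  qed (use F_nn that in auto)
  have aeZ: "AE x in lborel. x \<notin> Z"
    by (intro AE_not_in finite_imp_null_set_lborel finZ)
  have le1: "integral\<^sup>N lborel (\<lambda>x. ennreal (G x)) \<le> ennreal (2 * ln 2)"
  proof -
    have "integral\<^sup>N lborel (\<lambda>x. ennreal (G x)) \<le> integral\<^sup>N lborel (\<lambda>x. liminf (\<lambda>n. ennreal (F (v n) x)))"
    proof (rule nn_integral_mono_AE, rule AE_mp[OF aeZ], rule AE_I2, intro impI)
      fix x :: real assume "x \<notin> Z"
      have "(\<lambda>n. F (v n) x) \<longlonglongrightarrow> G x"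
      proof (cases "x \<in> {0..1}")
        case False
        then show ?thesis by (simp add: F_def G_def I_def)
      next
        case True
        with \<open>x \<notin> Z\<close> have ne: "cos \<theta> \<noteq> cos (2 * pi * x)" by (auto simp: Z_def)
        let ?A = "cmod (1 - cis \<theta> * cis (2*pi*x))" and ?B = "cmod (1 - cis (- \<theta>) * cis (2*pi*x))"
        have AB: "?A * ?B = 2 * \<bar>cos \<theta> - cos (2 * pi * x)\<bar>" by (rule dist_cos_factor)
        then have "?A * ?B \<noteq> 0" using ne by simp
        then have pp: "?A > 0" "?B > 0" by auto
        have "(\<lambda>n. p (v n) x) \<longlonglongrightarrow> ln (cmod (1 - complex_of_real 1 * cis \<theta> * cis (2*pi*x))) + ln (cmod (1 - complex_of_real 1 * cis (-\<theta>) * cis (2*pi*x)))"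
          unfolding p_def using pp by (intro tendsto_intros v_lim) auto
        moreover have "ln (cmod (1 - complex_of_real 1 * cis \<theta> * cis (2*pi*x))) + ln (cmod (1 - complex_of_real 1 * cis (-\<theta>) * cis (2*pi*x))) = q x"
          using pp AB by (simp add: q_def AB[symmetric] ln_mult)
        ultimately have "(\<lambda>n. p (v n) x) \<longlonglongrightarrow> q x" by simp
        then show ?thesis unfolding F_def G_def by (intro tendsto_intros)
      qed
      then have "(\<lambda>n. ennreal (F (v n) x)) \<longlonglongrightarrow> ennreal (G x)" by (rule tendsto_ennrealI)
      then show "ennreal (G x) \<le> liminf (\<lambda>n. ennreal (F (v n) x))"
        by (simp add: lim_imp_Liminf)
    qed
    also have "\<dots> \<le> liminf (\<lambda>n. integral\<^sup>N lborel (\<lambda>x. ennreal (F (v n) x)))"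
      by (rule nn_integral_liminf) measurable
    also have "\<dots> = ennreal (2 * ln 2)" using F_int v by (simp add: Liminf_const)
    finally show ?thesis .
  qed
  have le2: "ennreal (2 * ln 2) \<le> integral\<^sup>N lborel (\<lambda>x. ennreal (G x)) + ennreal (- ln (v n))" for n
  proof -
    have "ennreal (2 * ln 2) = integral\<^sup>N lborel (\<lambda>x. ennreal (F (v n) x))" using F_int v by simp
    also have "\<dots> \<le> integral\<^sup>N lborel (\<lambda>x. ennreal (G x) + ennreal (I x * (- ln (v n))))"
    proof (rule nn_integral_mono_AE, rule AE_mp[OF aeZ], rule AE_I2, intro impI)
      fix x :: real assume xZ: "x \<notin> Z"
      have "F (v n) x \<le> G x + I x * (- ln (v n))"
      proof (cases "x \<in> {0..1}")
        case True
        with xZ have ne: "cos \<theta> \<noteq> cos (2 * pi * x)" by (auto simp: Z_def)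
        have "ln (v n) + q x \<le> p (v n) x" unfolding p_def q_def
          by (rule ln_dist_cos_scaled_ge[OF v ne])
        then show ?thesis using True by (simp add: F_def G_def I_def)
      qed (simp add: F_def G_def I_def)
      then show "ennreal (F (v n) x) \<le> ennreal (G x) + ennreal (I x * (- ln (v n)))"
        using G_nn[of x] v[of n] by (subst ennreal_plus[symmetric]) (auto simp: I_def indicator_def intro!: ennreal_leI)
    qed
    also have "\<dots> = integral\<^sup>N lborel (\<lambda>x. ennreal (G x)) + integral\<^sup>N lborel (\<lambda>x. ennreal (I x * (- ln (v n))))"
      by (rule nn_integral_add) (auto simp: I_def)
    also have "integral\<^sup>N lborel (\<lambda>x. ennreal (I x * (- ln (v n)))) = ennreal (- ln (v n))"
    proof -
      have "integral\<^sup>N lborel (\<lambda>x. ennreal (I x * (- ln (v n)))) = integral\<^sup>N lborel (\<lambda>x. ennreal (- ln (v n)) * indicator {0..1::real} x)"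
        by (intro nn_integral_cong) (auto simp: I_def indicator_def)
      then show ?thesis by (simp add: nn_integral_cmult)
    qed
    finally show ?thesis .
  qed
  obtain r where r: "0 \<le> r" "integral\<^sup>N lborel (\<lambda>x. ennreal (G x)) = ennreal r"
  proof -
    have "integral\<^sup>N lborel (\<lambda>x. ennreal (G x)) \<noteq> top"
      using le1 le_less_trans[OF le1 ennreal_less_top] by simp
    then show thesis using that by (cases "integral\<^sup>N lborel (\<lambda>x. ennreal (G x))") auto
  qed
  have "r \<le> 2 * ln 2" using le1 r by simp
  moreover have "2 * ln 2 \<le> r"
  proof (rule LIMSEQ_le_const)
    show "(\<lambda>n. r + - ln (v n)) \<longlonglongrightarrow> r"
      by (rule tendsto_eq_intros v_lim | simp)+
    have "2 * ln 2 \<le> r + - ln (v n)" for n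
    proof -
      have nn: "0 \<le> - ln (v n)" using v[of n] by simp
      have "ennreal (2 * ln 2) \<le> ennreal (r + - ln (v n))"
        using le2[of n] r nn by (simp only: ennreal_plus)
      then show ?thesis using r nn by (subst (asm) ennreal_le_iff) auto
    qed
    then show "\<exists>N. \<forall>n\<ge>N. 2 * ln 2 \<le> r + - ln (v n)" by blast
  qed
  ultimately have "r = 2 * ln 2" by simp
  then have "(G has_integral 2 * ln 2) UNIV"
    using nn_integral_has_integral[of G r] r G_nn meas by simp
  then have "((\<lambda>x. if x \<in> {0..1} then 2 * ln 2 - q x else 0) has_integral 2 * ln 2) UNIV"
    by (rule has_integral_eq[rotated]) (auto simp: G_def I_def)
  then have "((\<lambda>x. 2 * ln 2 - q x) has_integral 2 * ln 2) {0..1}"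
    by (simp only: has_integral_restrict_UNIV)
  moreover have "((\<lambda>x. ln (2::real)) has_integral ln 2) {0..1::real}"
    using has_integral_const_real[of "ln (2::real)" 0 1] by simp
  ultimately have "((\<lambda>x. ln 2 - (2 * ln 2 - q x)) has_integral ln 2 - 2 * ln 2) {0..1}"
    by (intro has_integral_diff)
  moreover have "ln 2 - (2 * ln 2 - q x) = q x - ln 2" for x by simp
  ultimately have "((\<lambda>x. q x - ln 2) has_integral - ln 2) {0..1}" by simp
  then show ?thesis
  proof (rule has_integral_spike_finite[OF finZ, rotated])
    fix x assume "x \<in> {0..1} - Z"
    then have "cos \<theta> \<noteq> cos (2 * pi * x)" by (auto simp: Z_def)
    then show "ln \<bar>cos \<theta> - cos (2 * pi * x)\<bar> = q x - ln 2"
      by (simp add: q_def ln_mult)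
  qed
qed

text \<open>The arcsine law is the equilibrium measure of \<open>[-1, 1]\<close>: its logarithmic potential is the Green
  function plus the logarithm of the capacity \<open>1/2\<close>. This identity carries both asymptotic bounds and the computation of the capacity.\<close>

lemma ln_dist_cos_mean:
  "((\<lambda>x. ln \<bar>w - cos (2 * pi * x)\<bar>) has_integral green_slit (complex_of_real w) - ln 2) {0..1}"
proof -
  consider "\<bar>w\<bar> \<le> 1" | "1 < w" | "w < -1" by linarith
  then show ?thesis
  proof cases
    case 1
    then show ?thesis using ln_dist_cos_mean_inside[of "arccos w"] by (simp add: green_slit_real max_def cos_arccos_abs)
  next
    case 2
    then show ?thesis using ln_dist_cos_mean_outside[of w 1] by (simp add: green_slit_real max_def)
  next
    case 3
    have "\<bar>- w - (- 1) * cos (2 * pi * x)\<bar> = \<bar>w - cos (2 * pi * x)\<bar>" for x :: real by simp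
    then show ?thesis using 3 ln_dist_cos_mean_outside[of "- w" "- 1"] by (simp add: green_slit_real max_def)
  qed
qed

section \<open>Chebyshev polynomials and their nodes\<close>

fun cheb :: "nat \<Rightarrow> real poly" where
  "cheb 0 = 1"
| "cheb (Suc 0) = [:0, 1:]"
| "cheb (Suc (Suc n)) = smult 2 ([:0, 1:] * cheb (Suc n)) - cheb n"

lemma poly_cheb_cos: "poly (cheb n) (cos t) = cos (n * t)"
proof (induction n rule: cheb.induct)
  case (3 n)
  have "cos (real (Suc (Suc n)) * t) + cos (real n * t) = 2 * cos (real (Suc n) * t) * cos t"
    using cos_add[of "real (Suc n) * t" t] cos_diff[of "real (Suc n) * t" t]
    by (simp add: algebra_simps)
  then show ?case using 3 by (simp add: algebra_simps)
qed auto

lemma poly_cheb_cosh: "poly (cheb n) (cosh t) = cosh (n * t)"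
proof (induction n rule: cheb.induct)
  case (3 n)
  have "cosh (real (Suc n) * t + t) + cosh (real (Suc n) * t - t) = 2 * cosh (real (Suc n) * t) * cosh t"
    by (simp only: cosh_add cosh_diff)
  moreover have "real (Suc (Suc n)) * t = real (Suc n) * t + t" "real n * t = real (Suc n) * t - t"
    by (auto simp: algebra_simps)
  ultimately have "cosh (real (Suc (Suc n)) * t) + cosh (real n * t) = 2 * cosh (real (Suc n) * t) * cosh t"
    by metis
  then show ?case using 3 by (simp add: algebra_simps)
qed auto

lemma poly_cheb_minus: "poly (cheb n) (- x) = (- 1) ^ n * poly (cheb n) x"
  by (induction n rule: cheb.induct) (auto simp: algebra_simps)

lemma abs_poly_cheb_abs: "\<bar>poly (cheb n) \<bar>x\<bar>\<bar> = \<bar>poly (cheb n) x\<bar>"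
proof (cases "0 \<le> x")
  case False
  then have "\<bar>x\<bar> = - x" by simp
  then show ?thesis by (simp only: poly_cheb_minus abs_mult power_abs) simp
qed simp

lemma degree_cheb_aux: "degree (cheb n) \<le> n \<and> coeff (cheb n) n = (if n = 0 then 1 else 2 ^ (n - 1))"
proof (induction n rule: cheb.induct)
  case (3 n)
  have "degree (cheb (Suc (Suc n))) \<le> Suc (Suc n)"
    using 3 by (auto intro!: degree_diff_le order.trans[OF degree_smult_le] order.trans[OF degree_mult_le])
  moreover have "coeff (cheb n) (Suc (Suc n)) = 0"
    using 3 by (intro coeff_eq_0) auto
  ultimately show ?case using 3 by simp
qed auto

lemma poly_eq_prod_roots:
  fixes p :: "'a::field poly"
  assumes "degree p \<le> n" "inj_on z {..<n}" "\<And>i. i < n \<Longrightarrow> poly p (z i) = 0"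
  shows "p = smult (coeff p n) (\<Prod>i<n. [:- z i, 1:])"
proof -
  let ?P = "\<Prod>i<n. [:- z i, 1:]"
  have degP: "degree ?P = n"
    by (subst degree_prod_eq_sum_degree) auto
  have lcP: "coeff ?P n = 1"
    using degP lead_coeff_prod[of "\<lambda>i. [:- z i, 1:]" "{..<n}"] by simp
  define D where "D = p - smult (coeff p n) ?P"
  have "D = 0"
  proof (rule ccontr)
    assume D: "D \<noteq> 0"
    have "degree D \<le> n" unfolding D_def
      using assms(1) degP by (intro degree_diff_le order.trans[OF degree_smult_le]) auto
    moreover have "coeff D n = 0" by (simp add: D_def lcP)
    ultimately have "degree D < n" using D by (metis le_neq_implies_less leading_coeff_0_iff)
    moreover have "card {x. poly D x = 0} \<le> degree D" using D by (rule card_poly_roots_bound)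
    moreover have "card (z ` {..<n}) \<le> card {x. poly D x = 0}"
      using poly_roots_finite[OF D] assms(3)
      by (intro card_mono) (auto simp: D_def poly_prod)
    ultimately show False using card_image[OF assms(2)] by simp
  qed
  then show ?thesis by (simp add: D_def)
qed

text \<open>The zeros of the Chebyshev polynomial of degree \<open>M\<close>.\<close>

definition cheb_node :: "nat \<Rightarrow> nat \<Rightarrow> real" where
  "cheb_node M m = cos (pi * (real (2 * m + 1) / real (2 * M)))"

lemma cheb_node_range: "\<bar>cheb_node M m\<bar> \<le> 1"
  by (simp add: cheb_node_def)

lemma cheb_factor:
  assumes "M > 0"
  shows "cheb M = smult (2 ^ (M - 1)) (\<Prod>m<M. [:- cheb_node M m, 1:])"
proof -
  have inj: "inj_on (cheb_node M) {..<M}"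
  proof (rule inj_onI)
    fix i j assume ij: "i \<in> {..<M}" "j \<in> {..<M}" "cheb_node M i = cheb_node M j"
    have r0: "0 \<le> pi * (real (2 * k + 1) / real (2 * M))" for k :: nat
      by (intro mult_nonneg_nonneg divide_nonneg_nonneg) auto
    have r1: "pi * (real (2 * k + 1) / real (2 * M)) \<le> pi" if "k < M" for k :: nat
    proof -
      have "real (2 * k + 1) \<le> real (2 * M)" using that by (intro of_nat_mono) linarith
      then have "real (2 * k + 1) / real (2 * M) \<le> 1" using assms by (intro divide_le_eq_1_pos[THEN iffD2]) auto
      from mult_left_mono[OF this, of pi] show ?thesis by (simp only: mult_1_right pi_ge_zero)
    qed
    have "pi * (real (2 * i + 1) / real (2 * M)) = pi * (real (2 * j + 1) / real (2 * M))"
    proof (rule cos_inj_pi[OF r0 r1 r0 r1])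
      show "i < M" "j < M" using ij by auto
      show "cos (pi * (real (2 * i + 1) / real (2 * M))) = cos (pi * (real (2 * j + 1) / real (2 * M)))"
        using ij(3) unfolding cheb_node_def .
    qed
    then have "real (2 * i + 1) / real (2 * M) = real (2 * j + 1) / real (2 * M)"
      by (simp only: mult_cancel_left pi_neq_zero simp_thms)
    then have "real (2 * i + 1) = real (2 * j + 1)" using assms by (simp only: divide_cancel_right of_nat_eq_0_iff) simp
    then show "i = j" by (simp only: of_nat_eq_iff)
  qed
  have root: "poly (cheb M) (cheb_node M m) = 0" if "m < M" for m
  proof -
    have "poly (cheb M) (cheb_node M m) = cos (m * pi + pi / 2)"
      unfolding cheb_node_def poly_cheb_cos using assms by (intro arg_cong[of _ _ cos]) (simp add: field_simps)
    moreover have "cos (m * pi + pi / 2) = 0" by (simp add: cos_add)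
    ultimately show ?thesis by simp
  qed
  have "cheb M = smult (coeff (cheb M) M) (\<Prod>m<M. [:- cheb_node M m, 1:])"
    by (rule poly_eq_prod_roots) (use degree_cheb_aux[of M] inj root in auto)
  also have "coeff (cheb M) M = 2 ^ (M - 1)" using degree_cheb_aux[of M] assms by simp
  finally show ?thesis .
qed

lemma prod_dist_cheb_nodes:
  assumes "M > 0"
  shows "(\<Prod>m<M. \<bar>w - cheb_node M m\<bar>) = \<bar>poly (cheb M) w\<bar> / 2 ^ (M - 1)"
  by (subst cheb_factor[OF assms]) (simp add: poly_prod abs_mult abs_prod)


lemma cosh_exp_bounds:
  fixes x :: real
  shows "exp x / 2 \<le> cosh x" "0 \<le> x \<Longrightarrow> cosh x \<le> exp x"
proof -
  have c: "cosh x = (exp x + exp (- x)) / 2" by (simp add: cosh_field_def)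
  show "exp x / 2 \<le> cosh x" unfolding c by (intro divide_right_mono) (auto intro: less_imp_le)
  assume "0 \<le> x"
  then have "exp (- x) \<le> exp x" by simp
  then have "exp x + exp (- x) \<le> exp x + exp x" by (rule add_left_mono)
  then show "cosh x \<le> exp x" unfolding c by (simp only: divide_le_eq_numeral1 mult_2_right)
qed

lemma cheb_le_exp: "\<bar>poly (cheb M) w\<bar> \<le> exp (M * green_slit (complex_of_real w))"
proof (cases "\<bar>w\<bar> \<le> 1")
  case True
  then have "poly (cheb M) w = cos (M * arccos w)"
    using poly_cheb_cos[of M "arccos w"] by (simp add: cos_arccos_abs)
  then have "\<bar>poly (cheb M) w\<bar> \<le> 1" by simp
  also have "1 \<le> exp (M * green_slit (complex_of_real w))" using green_slit_nonneg by simp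
  finally show ?thesis .
next
  case False
  define u where "u = arcosh \<bar>w\<bar>"
  have "poly (cheb M) \<bar>w\<bar> = cosh (M * u)"
    using poly_cheb_cosh[of M u] False by (simp add: u_def)
  then have "\<bar>poly (cheb M) w\<bar> = \<bar>cosh (M * u)\<bar>"
    by (simp only: abs_poly_cheb_abs[of M w, symmetric])
  then have "\<bar>poly (cheb M) w\<bar> = cosh (M * u)" by (simp only: abs_of_pos cosh_real_pos)
  moreover have "0 \<le> u" using False by (simp add: u_def)
  then have "cosh (M * u) \<le> exp (M * u)" by (intro cosh_exp_bounds) simp
  moreover have "green_slit (complex_of_real w) = u" using False by (simp add: green_slit_real u_def max_def)
  ultimately show ?thesis by (simp only:)
qed

lemma cheb_ge_exp:
  assumes "1 \<le> \<bar>w\<bar>"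
  shows "exp (M * green_slit (complex_of_real w)) / 2 \<le> \<bar>poly (cheb M) w\<bar>"
proof -
  define u where "u = arcosh \<bar>w\<bar>"
  have "poly (cheb M) \<bar>w\<bar> = cosh (M * u)"
    using poly_cheb_cosh[of M u] assms by (simp add: u_def)
  then have "\<bar>poly (cheb M) w\<bar> = \<bar>cosh (M * u)\<bar>"
    by (simp only: abs_poly_cheb_abs[of M w, symmetric])
  then have "\<bar>poly (cheb M) w\<bar> = cosh (M * u)" by (simp only: abs_of_pos cosh_real_pos)
  moreover have "green_slit (complex_of_real w) = u" using assms by (simp add: green_slit_real u_def max_def)
  ultimately show ?thesis by (simp only: cosh_exp_bounds)
qed

text \<open>The Chebyshev nodes are a discrete substitute for the arcsine law: the sum over them is
  the logarithm of the Chebyshev polynomial itself, which is controlled by the Green function.\<close>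

lemma sum_ln_dist_cheb_nodes:
  assumes "M > 0" "\<And>m. m < M \<Longrightarrow> w \<noteq> cheb_node M m"
  shows "(\<Sum>m<M. ln \<bar>w - cheb_node M m\<bar>) = ln \<bar>poly (cheb M) w\<bar> - real (M - 1) * ln 2"
    and "poly (cheb M) w \<noteq> 0"
proof -
  have "(\<Prod>m<M. \<bar>w - cheb_node M m\<bar>) > 0"
    using assms(2) by (intro prod_pos) auto
  then have *: "\<bar>poly (cheb M) w\<bar> / 2 ^ (M - 1) > 0"
    by (simp only: prod_dist_cheb_nodes[OF assms(1)])
  then show nz: "poly (cheb M) w \<noteq> 0"
    by (intro notI) (simp only: abs_zero div_0 less_irrefl)
  have "(\<Sum>m<M. ln \<bar>w - cheb_node M m\<bar>) = ln (\<Prod>m<M. \<bar>w - cheb_node M m\<bar>)"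
    using assms(2) by (intro ln_prod[symmetric]) auto
  also have "\<dots> = ln (\<bar>poly (cheb M) w\<bar> / 2 ^ (M - 1))" by (simp only: prod_dist_cheb_nodes[OF assms(1)])
  also have "\<dots> = ln \<bar>poly (cheb M) w\<bar> - real (M - 1) * ln 2"
    using nz by (subst ln_div) (auto simp: ln_realpow)
  finally show "(\<Sum>m<M. ln \<bar>w - cheb_node M m\<bar>) = ln \<bar>poly (cheb M) w\<bar> - real (M - 1) * ln 2" .
qed

text \<open>The error \<open>ln 2\<close> does not depend on \<open>M\<close>, so it disappears after division by \<open>M\<close>.\<close>

lemma sum_ln_dist_cheb_nodes_le:
  assumes "M > 0" "\<And>m. m < M \<Longrightarrow> w \<noteq> cheb_node M m"
  shows "(\<Sum>m<M. ln \<bar>w - cheb_node M m\<bar>) \<le> M * (green_slit (complex_of_real w) - ln 2) + ln 2"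
proof -
  have "ln \<bar>poly (cheb M) w\<bar> \<le> ln (exp (M * green_slit (complex_of_real w)))"
    using sum_ln_dist_cheb_nodes(2)[OF assms] by (intro ln_mono cheb_le_exp) auto
  then have "ln \<bar>poly (cheb M) w\<bar> \<le> M * green_slit (complex_of_real w)" by simp
  moreover have "real (M - 1) = real M - 1" using assms(1) by simp
  ultimately show ?thesis using sum_ln_dist_cheb_nodes(1)[OF assms]
    by (simp only: right_diff_distrib left_diff_distrib mult_1_left)
qed

lemma sum_ln_dist_cheb_nodes_ge:
  assumes "M > 0" "1 < \<bar>w\<bar>"
  shows "M * (green_slit (complex_of_real w) - ln 2) \<le> (\<Sum>m<M. ln \<bar>w - cheb_node M m\<bar>)"
proof -
  have ne: "w \<noteq> cheb_node M m" for m using cheb_node_range[of M m] assms(2) by auto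
  have "ln (exp (M * green_slit (complex_of_real w)) / 2) \<le> ln \<bar>poly (cheb M) w\<bar>"
    using cheb_ge_exp[of w M] assms(2) by (intro ln_mono) auto
  then have "M * green_slit (complex_of_real w) - ln 2 \<le> ln \<bar>poly (cheb M) w\<bar>"
    by (simp add: ln_div)
  moreover have "real (M - 1) = real M - 1" using assms(1) by simp
  ultimately show ?thesis using sum_ln_dist_cheb_nodes(1)[OF assms(1) ne]
    by (simp only: right_diff_distrib left_diff_distrib mult_1_left)
qed

section \<open>Weighted Chebyshev polynomials with an alternation set\<close>

definition node_prod :: "(nat \<Rightarrow> real) \<Rightarrow> nat \<Rightarrow> nat \<Rightarrow> real" where
  "node_prod t n i = (\<Prod>j\<in>{..n} - {i}. t i - t j)"

definition increasing_upto :: "nat \<Rightarrow> (nat \<Rightarrow> real) \<Rightarrow> bool" where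
  "increasing_upto n t \<longleftrightarrow> (\<forall>i j. i < j \<and> j \<le> n \<longrightarrow> t i < t j)"

lemma increasing_upto_inj: "increasing_upto n t \<Longrightarrow> inj_on t {..n}"
  unfolding increasing_upto_def inj_on_def by (metis atMost_iff less_irrefl linorder_neqE_nat)

lemma increasing_uptoI:
  assumes "\<And>i. i < n \<Longrightarrow> t i < t (Suc i)"
  shows "increasing_upto n t"
  unfolding increasing_upto_def
proof (intro allI impI)
  fix i j :: nat assume "i < j \<and> j \<le> n"
  then have "i < j" "j \<le> n" by auto
  then show "t i < t j"
  proof (induction j)
    case (Suc j)
    have "t j < t (Suc j)" using assms Suc.prems by simp
    then show ?case using Suc by (cases "i = j") auto
  qed simp
qed

text \<open>Exactly \<open>n - i\<close> of the factors are negative, one for each node to the right.\<close>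

lemma node_prod_sign:
  assumes "increasing_upto n t" "i \<le> n"
  shows "node_prod t n i = (-1) ^ (n - i) * \<bar>node_prod t n i\<bar>" "node_prod t n i \<noteq> 0"
proof -
  have nz: "t i - t j \<noteq> 0" if "j \<in> {..n} - {i}" for j
    using increasing_upto_inj[OF assms(1)] that assms(2) by (auto simp: inj_on_def)
  then show "node_prod t n i \<noteq> 0" by (simp add: node_prod_def)
  have split: "{..n} - {i} = {..<i} \<union> {i<..n}" using assms(2) by auto
  have "node_prod t n i = (\<Prod>j<i. t i - t j) * (\<Prod>j\<in>{i<..n}. t i - t j)"
    unfolding node_prod_def split by (rule prod.union_disjoint) auto
  also have "(\<Prod>j<i. t i - t j) = (\<Prod>j<i. \<bar>t i - t j\<bar>)"
    using assms unfolding increasing_upto_def by (intro prod.cong) (auto simp: less_imp_le)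
  also have "(\<Prod>j\<in>{i<..n}. t i - t j) = (\<Prod>j\<in>{i<..n}. (-1) * \<bar>t i - t j\<bar>)"
    using assms unfolding increasing_upto_def by (intro prod.cong) (auto simp: abs_if)
  also have "\<dots> = (-1) ^ (n - i) * (\<Prod>j\<in>{i<..n}. \<bar>t i - t j\<bar>)"
    by (subst prod.distrib) simp
  finally have "node_prod t n i = (-1) ^ (n - i) * ((\<Prod>j<i. \<bar>t i - t j\<bar>) * (\<Prod>j\<in>{i<..n}. \<bar>t i - t j\<bar>))"
    by simp
  moreover have "(\<Prod>j<i. \<bar>t i - t j\<bar>) * (\<Prod>j\<in>{i<..n}. \<bar>t i - t j\<bar>) = \<bar>node_prod t n i\<bar>"
    unfolding node_prod_def abs_prod split by (rule prod.union_disjoint[symmetric]) auto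
  ultimately show "node_prod t n i = (-1) ^ (n - i) * \<bar>node_prod t n i\<bar>" by simp
qed

definition lagrange_poly :: "(nat \<Rightarrow> real) \<Rightarrow> nat \<Rightarrow> (nat \<Rightarrow> real) \<Rightarrow> real poly" where
  "lagrange_poly t n v = (\<Sum>i\<le>n. smult (v i / node_prod t n i) (\<Prod>j\<in>{..n} - {i}. [:- t j, 1:]))"

lemma lagrange_basis:
  assumes "i \<le> n"
  shows "degree (\<Prod>j\<in>{..n} - {i}. [:- t j, 1:]) = n" "coeff (\<Prod>j\<in>{..n} - {i}. [:- t j :: real, 1:]) n = 1"
proof -
  show d: "degree (\<Prod>j\<in>{..n} - {i}. [:- t j, 1:]) = n"
    using assms by (subst degree_prod_eq_sum_degree) auto
  have "lead_coeff (\<Prod>j\<in>{..n} - {i}. [:- t j, 1:]) = 1"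
    by (simp add: lead_coeff_prod)
  then show "coeff (\<Prod>j\<in>{..n} - {i}. [:- t j, 1:]) n = 1" by (simp only: d)
qed

lemma lagrange_poly:
  assumes "inj_on t {..n}"
  shows "degree (lagrange_poly t n v) \<le> n"
    and "coeff (lagrange_poly t n v) n = (\<Sum>i\<le>n. v i / node_prod t n i)"
    and "\<And>k. k \<le> n \<Longrightarrow> poly (lagrange_poly t n v) (t k) = v k"
proof -
  show "degree (lagrange_poly t n v) \<le> n"
    unfolding lagrange_poly_def using lagrange_basis(1)
    by (intro degree_sum_le) (auto intro: order.trans[OF degree_smult_le])
  show "coeff (lagrange_poly t n v) n = (\<Sum>i\<le>n. v i / node_prod t n i)"
    unfolding lagrange_poly_def coeff_sum using lagrange_basis(2) by (intro sum.cong) auto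
  fix k assume k: "k \<le> n"
  have nz: "node_prod t n k \<noteq> 0"
    unfolding node_prod_def using assms k by (auto simp: inj_on_def)
  have "poly (lagrange_poly t n v) (t k) = (\<Sum>i\<le>n. if i = k then v k else 0)"
    unfolding lagrange_poly_def poly_sum
  proof (intro sum.cong refl)
    fix i assume "i \<in> {..n}"
    show "poly (smult (v i / node_prod t n i) (\<Prod>j\<in>{..n} - {i}. [:- t j, 1:])) (t k) = (if i = k then v k else 0)"
    proof (cases "i = k")
      case True
      then show ?thesis using nz by (simp add: poly_prod node_prod_def)
    next
      case False
      then show ?thesis using k by (auto simp: poly_prod intro!: bexI[of _ k])
    qed
  qed
  then show "poly (lagrange_poly t n v) (t k) = v k" using k by simp
qed

text \<open>Both sides are the leading coefficient of the interpolating polynomial.\<close>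

lemma divided_difference:
  assumes "inj_on t {..n}" "degree p \<le> n"
  shows "(\<Sum>i\<le>n. poly p (t i) / node_prod t n i) = coeff p n"
proof -
  define D where "D = p - lagrange_poly t n (\<lambda>i. poly p (t i))"
  have "degree D \<le> n" unfolding D_def
    using assms lagrange_poly(1) by (intro degree_diff_le) auto
  have "D = 0"
  proof (rule ccontr)
    assume "D \<noteq> 0"
    then have "card {x. poly D x = 0} \<le> n"
      using card_poly_roots_bound[of D] \<open>degree D \<le> n\<close> by simp
    moreover have "card (t ` {..n}) \<le> card {x. poly D x = 0}"
      using poly_roots_finite[OF \<open>D \<noteq> 0\<close>] lagrange_poly(3)[OF assms(1)] by (intro card_mono) (auto simp: D_def)
    ultimately show False using card_image[OF assms(1)] by simp
  qed
  then have "p = lagrange_poly t n (\<lambda>i. poly p (t i))" by (simp add: D_def)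
  then show ?thesis using lagrange_poly(2)[OF assms(1)] by metis
qed

text \<open>Its reciprocal is the smallest weighted norm of a monic polynomial of degree \<open>n\<close> on the nodes
  alone. The best nodes in a compact set are therefore those that minimize this sum.\<close>

definition node_sum :: "(real \<Rightarrow> real) \<Rightarrow> nat \<Rightarrow> (nat \<Rightarrow> real) \<Rightarrow> real" where
  "node_sum \<kappa> n t = (\<Sum>i\<le>n. \<kappa> (t i) / \<bar>node_prod t n i\<bar>)"

lemma node_sum_cong:
  assumes "\<And>i. i \<le> n \<Longrightarrow> t i = t' i"
  shows "node_sum \<kappa> n t = node_sum \<kappa> n t'"
proof -
  have "node_prod t n i = node_prod t' n i" if "i \<le> n" for i
    unfolding node_prod_def using assms that by (intro prod.cong) auto
  then show ?thesis unfolding node_sum_def using assms by (intro sum.cong) auto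
qed

text \<open>The signs in the divided difference alternate, so the values of a monic polynomial at the
  nodes cannot all be small.\<close>

lemma monic_alternating_sum:
  assumes "increasing_upto n t" "degree p \<le> n" "coeff p n = 1"
  shows "(\<Sum>i\<le>n. (-1) ^ (n - i) * poly p (t i) / \<bar>node_prod t n i\<bar>) = 1"
proof -
  have "(-1) ^ (n - i) * poly p (t i) / \<bar>node_prod t n i\<bar> = poly p (t i) / node_prod t n i" if "i \<le> n" for i
  proof -
    have "(-1) ^ (n - i) * ((-1) ^ (n - i) :: real) = 1"
      by (metis mult.commute power_minus1_even power_add mult_2)
    moreover note node_prod_sign(1)[OF assms(1) that] node_prod_sign(2)[OF assms(1) that]
    ultimately show ?thesis
      by (smt (verit, del_insts) divide_divide_eq_right mult.assoc mult.commute nonzero_divide_mult_cancel_right nonzero_mult_div_cancel_left abs_eq_0 mult_divide_mult_cancel_left no_zero_divisors zero_neq_one)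
  qed
  then have "(\<Sum>i\<le>n. (-1) ^ (n - i) * poly p (t i) / \<bar>node_prod t n i\<bar>) = (\<Sum>i\<le>n. poly p (t i) / node_prod t n i)"
    by (intro sum.cong) auto
  also have "\<dots> = 1" using divided_difference[OF increasing_upto_inj[OF assms(1)] assms(2)] assms(3) by simp
  finally show ?thesis .
qed

lemma compact_function_space:
  fixes X :: "real set"
  assumes "compact X"
  shows "compact {t :: nat \<Rightarrow> real. \<forall>i. t i \<in> X}"
proof -
  have "compactin (product_topology (\<lambda>i. euclidean) UNIV) (PiE UNIV (\<lambda>i::nat. X))"
    unfolding compactin_PiE using assms by (simp add: compactin_euclidean_iff)
  moreover have "PiE UNIV (\<lambda>i::nat. X) = {t. \<forall>i. t i \<in> X}" by (auto simp: PiE_def)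
  ultimately show ?thesis
    by (simp add: euclidean_product_topology compactin_euclidean_iff)
qed

text \<open>The sum grows without bound as two nodes approach each other, so a minimizing sequence of nodes
  stays away from the diagonal and compactness applies.\<close>

lemma node_sum_minimizer:
  fixes X :: "real set"
  assumes "compact X" "infinite X" "continuous_on X \<kappa>" "\<And>x. x \<in> X \<Longrightarrow> 0 < \<kappa> x"
  obtains t where "increasing_upto n t" "\<And>i. i \<le> n \<Longrightarrow> t i \<in> X"
    "\<And>t'. increasing_upto n t' \<Longrightarrow> (\<And>i. i \<le> n \<Longrightarrow> t' i \<in> X) \<Longrightarrow> node_sum \<kappa> n t \<le> node_sum \<kappa> n t'"
proof -
  obtain A where A: "finite A" "card A = Suc n" "A \<subseteq> X"
    using infinite_arbitrarily_large[OF assms(2), of "Suc n"] by auto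
  define t0 where "t0 i = sorted_list_of_set A ! (min i n)" for i
  have lenA: "length (sorted_list_of_set A) = Suc n" using A by simp
  have t0X: "t0 i \<in> X" for i
    unfolding t0_def using A lenA nth_mem[of "min i n" "sorted_list_of_set A"] by auto
  have t0inc: "increasing_upto n t0"
    unfolding increasing_upto_def t0_def
    using A lenA strict_sorted_list_of_set[of A] by (auto simp: sorted_wrt_iff_nth_less min_def)
  define P0 where "P0 = node_sum \<kappa> n t0"
  have termpos: "0 < \<kappa> (t i) / \<bar>node_prod t n i\<bar>" if "increasing_upto n t" "t i \<in> X" "i \<le> n" for t i
    using assms(4)[OF that(2)] node_prod_sign(2)[OF that(1,3)] by simp
  have P0pos: "0 < P0" unfolding P0_def node_sum_def
    using termpos[OF t0inc t0X] by (intro sum_pos) auto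
  obtain x0 where "x0 \<in> X" "\<And>x. x \<in> X \<Longrightarrow> \<kappa> x0 \<le> \<kappa> x"
    using continuous_attains_inf[OF assms(1) _ assms(3)] assms(2) by (metis finite.emptyI)
  then have m: "0 < \<kappa> x0" "\<And>x. x \<in> X \<Longrightarrow> \<kappa> x0 \<le> \<kappa> x" using assms(4) by auto
  define d where "d = \<kappa> x0 / P0"
  have d: "0 < d" using m P0pos by (simp add: d_def)
  define K where "K = {t. \<forall>i. t i \<in> X} \<inter> {t. \<forall>i<n. t i \<le> t (Suc i)} \<inter> {t. \<forall>i\<le>n. d \<le> \<bar>node_prod t n i\<bar>}"
  have coord[continuous_intros]: "continuous_on S (\<lambda>t :: nat \<Rightarrow> real. t i)" for i S
    by (rule continuous_on_subset[OF continuous_on_product_coordinates]) simp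
  have np[continuous_intros]: "continuous_on S (\<lambda>t :: nat \<Rightarrow> real. \<bar>node_prod t n i\<bar>)" for i S
    unfolding node_prod_def by (intro continuous_intros)
  have "compact K"
    unfolding K_def
  proof (intro compact_Int_closed compact_function_space assms(1))
    show "closed {t :: nat \<Rightarrow> real. \<forall>i<n. t i \<le> t (Suc i)}"
      by (intro closed_Collect_all closed_Collect_imp closed_Collect_le continuous_intros) auto
    show "closed {t :: nat \<Rightarrow> real. \<forall>i\<le>n. d \<le> \<bar>node_prod t n i\<bar>}"
      by (intro closed_Collect_all closed_Collect_imp closed_Collect_le continuous_intros) auto
  qed
  have inK: "(\<lambda>i. t (min i n)) \<in> K" if t: "increasing_upto n t" "\<And>i. i \<le> n \<Longrightarrow> t i \<in> X" "node_sum \<kappa> n t \<le> P0" for t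
  proof -
    have "d \<le> \<bar>node_prod (\<lambda>i. t (min i n)) n i\<bar>" if "i \<le> n" for i
    proof -
      have e: "node_prod (\<lambda>i. t (min i n)) n i = node_prod t n i"
        unfolding node_prod_def using that by (intro prod.cong) (auto simp: min_def)
      have "\<kappa> (t i) / \<bar>node_prod t n i\<bar> \<le> node_sum \<kappa> n t"
        unfolding node_sum_def using that less_imp_le[OF termpos[OF t(1) t(2)]]
        by (intro member_le_sum) auto
      then have "\<kappa> (t i) / \<bar>node_prod t n i\<bar> \<le> P0" using t(3) by simp
      then have "\<kappa> (t i) \<le> P0 * \<bar>node_prod t n i\<bar>"
        using node_prod_sign(2)[OF t(1) that] by (simp add: divide_le_eq)
      then have "\<kappa> x0 \<le> P0 * \<bar>node_prod t n i\<bar>" using m(2)[OF t(2)[OF that]] by simp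
      then show ?thesis unfolding e d_def using P0pos by (simp add: divide_le_eq mult.commute)
    qed
    moreover have "t (min i n) \<le> t (min (Suc i) n)" if "i < n" for i
      using t(1) that unfolding increasing_upto_def by (auto simp: min_def less_imp_le)
    ultimately show ?thesis unfolding K_def using t(2) by auto
  qed
  have Kne: "K \<noteq> {}" using inK[OF t0inc t0X] by (auto simp: P0_def)
  have "continuous_on K (node_sum \<kappa> n)"
  proof -
    have "continuous_on K (\<lambda>t. \<kappa> (t i))" for i
      by (rule continuous_on_compose2[OF assms(3)]) (auto intro: coord simp: K_def)
    then show ?thesis unfolding node_sum_def[abs_def]
      by (intro continuous_intros) (use d in \<open>auto simp: K_def\<close>)
  qed
  then obtain t where t: "t \<in> K" "\<And>t'. t' \<in> K \<Longrightarrow> node_sum \<kappa> n t \<le> node_sum \<kappa> n t'"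
    using continuous_attains_inf[OF \<open>compact K\<close> Kne] by metis
  show thesis
  proof (rule that[of t])
    show "increasing_upto n t"
    proof (rule increasing_uptoI)
      fix i assume i: "i < n"
      have "d \<le> \<bar>node_prod t n i\<bar>" using t(1) i by (simp add: K_def)
      then have "node_prod t n i \<noteq> 0" using d by auto
      then have "t i \<noteq> t (Suc i)" using i unfolding node_prod_def by auto
      then show "t i < t (Suc i)" using t(1) i by (auto simp: K_def le_less)
    qed
    show "t i \<in> X" for i using t(1) by (auto simp: K_def)
    fix t' assume t': "increasing_upto n t'" "\<And>i. i \<le> n \<Longrightarrow> t' i \<in> X"
    have le0: "node_sum \<kappa> n t \<le> P0"
      using t(2)[OF inK[OF t0inc t0X]] node_sum_cong[of n "\<lambda>i. t0 (min i n)" t0 \<kappa>] by (auto simp: P0_def)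
    show "node_sum \<kappa> n t \<le> node_sum \<kappa> n t'"
    proof (cases "node_sum \<kappa> n t' \<le> P0")
      case True
      then show ?thesis using t(2)[OF inK[OF t']] node_sum_cong[of n "\<lambda>i. t' (min i n)" t' \<kappa>] by auto
    qed (use le0 in simp)
  qed
qed

text \<open>At minimizing nodes, interpolate the values that alternate in sign and have the size
  of the weight times \<open>L\<close>. If the interpolating polynomial exceeded \<open>L * \<kappa>\<close> somewhere in \<open>X\<close>, exchanging a
  node for that point would decrease the node sum.\<close>

theorem weighted_chebyshev_alternation:
  fixes X :: "real set"
  assumes "compact X" "infinite X" "continuous_on X \<kappa>" "\<And>x. x \<in> X \<Longrightarrow> 0 < \<kappa> x"
  obtains p L t where "degree p = n" "lead_coeff p = 1" "0 < L"
    "\<And>x. x \<in> X \<Longrightarrow> \<bar>poly p x\<bar> \<le> L * \<kappa> x"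
    "increasing_upto n t" "\<And>i. i \<le> n \<Longrightarrow> t i \<in> X"
    "\<And>i. i \<le> n \<Longrightarrow> poly p (t i) = (-1) ^ (n - i) * (L * \<kappa> (t i))"
proof -
  obtain t where t: "increasing_upto n t" "\<And>i. i \<le> n \<Longrightarrow> t i \<in> X"
    and tmin: "\<And>t'. increasing_upto n t' \<Longrightarrow> (\<And>i. i \<le> n \<Longrightarrow> t' i \<in> X) \<Longrightarrow> node_sum \<kappa> n t \<le> node_sum \<kappa> n t'"
    using node_sum_minimizer[OF assms] by blast
  have Ppos: "0 < node_sum \<kappa> n t" unfolding node_sum_def
    using assms(4)[OF t(2)] node_prod_sign(2)[OF t(1)] by (intro sum_pos) auto
  define L where "L = 1 / node_sum \<kappa> n t"
  have L: "0 < L" "L * node_sum \<kappa> n t = 1" using Ppos by (auto simp: L_def)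
  define p where "p = lagrange_poly t n (\<lambda>i. (-1) ^ (n - i) * (L * \<kappa> (t i)))"
  note inj = increasing_upto_inj[OF t(1)]
  have val: "poly p (t i) = (-1) ^ (n - i) * (L * \<kappa> (t i))" if "i \<le> n" for i
    unfolding p_def by (rule lagrange_poly(3)[OF inj that])
  have sq: "(-1) ^ k * ((-1) ^ k * r) = (r :: real)" for k r
    by (cases "even k") auto
  have deg: "degree p \<le> n" unfolding p_def by (rule lagrange_poly(1)[OF inj])
  have "coeff p n = (\<Sum>i\<le>n. (-1) ^ (n - i) * (L * \<kappa> (t i)) / node_prod t n i)"
    unfolding p_def by (rule lagrange_poly(2)[OF inj])
  also have "\<dots> = (\<Sum>i\<le>n. L * (\<kappa> (t i) / \<bar>node_prod t n i\<bar>))"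
  proof (intro sum.cong refl)
    fix i assume "i \<in> {..n}"
    then have "node_prod t n i = (-1) ^ (n - i) * \<bar>node_prod t n i\<bar>"
      using node_prod_sign(1)[OF t(1)] by auto
    then show "(-1) ^ (n - i) * (L * \<kappa> (t i)) / node_prod t n i = L * (\<kappa> (t i) / \<bar>node_prod t n i\<bar>)"
      by (cases "even (n - i)") auto
  qed
  also have "\<dots> = 1" 
    unfolding sum_distrib_left[symmetric] node_sum_def[symmetric] using L by simp
  finally have lc: "coeff p n = 1" .
  then have degn: "degree p = n" using deg by (metis le_antisym le_degree zero_neq_one)
  have no_better: False
    if t': "increasing_upto n t'" "\<And>i. i \<le> n \<Longrightarrow> t' i \<in> X"
      and ge: "\<And>i. i \<le> n \<Longrightarrow> L * \<kappa> (t' i) \<le> (-1) ^ (n - i) * poly p (t' i)"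
      and k: "k \<le> n" "L * \<kappa> (t' k) < (-1) ^ (n - k) * poly p (t' k)" for t' k
  proof -
    have "L * node_sum \<kappa> n t' = (\<Sum>i\<le>n. L * \<kappa> (t' i) / \<bar>node_prod t' n i\<bar>)"
      by (simp add: node_sum_def sum_distrib_left)
    also have "\<dots> < (\<Sum>i\<le>n. (-1) ^ (n - i) * poly p (t' i) / \<bar>node_prod t' n i\<bar>)"
    proof (rule sum_strict_mono_ex1)
      show "\<forall>i\<in>{..n}. L * \<kappa> (t' i) / \<bar>node_prod t' n i\<bar> \<le> (-1) ^ (n - i) * poly p (t' i) / \<bar>node_prod t' n i\<bar>"
        using ge by (intro ballI divide_right_mono) auto
      show "\<exists>i\<in>{..n}. L * \<kappa> (t' i) / \<bar>node_prod t' n i\<bar> < (-1) ^ (n - i) * poly p (t' i) / \<bar>node_prod t' n i\<bar>"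
        using k node_prod_sign(2)[OF t'(1) k(1)] by (intro bexI[of _ k] divide_strict_right_mono) auto
    qed simp
    also have "\<dots> = 1" by (rule monic_alternating_sum[OF t'(1) deg lc])
    also have "\<dots> = L * node_sum \<kappa> n t" using L by simp
    also have "\<dots> \<le> L * node_sum \<kappa> n t'" using tmin[OF t'] L(1) by (intro mult_left_mono) auto
    finally show False by simp
  qed
  have exchange: False
    if x: "x \<in> X" "L * \<kappa> x < (-1) ^ (n - k) * poly p x" "k \<le> n"
      and lr: "\<And>i. i < k \<Longrightarrow> t i < x" "\<And>i. k < i \<Longrightarrow> i \<le> n \<Longrightarrow> x < t i" for x k
  proof (rule no_better[of "t(k := x)" k])
    show "increasing_upto n (t(k := x))"
      using t(1) lr unfolding increasing_upto_def by auto
    show "L * \<kappa> ((t(k := x)) i) \<le> (-1) ^ (n - i) * poly p ((t(k := x)) i)" if "i \<le> n" for i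
      using x val[OF that] by (simp add: sq)
  qed (use x t(2) in auto)
  have no_flip: False
    if t': "increasing_upto n t'" and le: "\<And>i. i \<le> n \<Longrightarrow> (-1) ^ (n - i) * poly p (t' i) \<le> 0" for t'
  proof -
    have "(\<Sum>i\<le>n. (-1) ^ (n - i) * poly p (t' i) / \<bar>node_prod t' n i\<bar>) \<le> 0"
      using le by (intro sum_nonpos divide_nonpos_nonneg) auto
    then show False using monic_alternating_sum[OF t' deg lc] by simp
  qed
  have bound: "\<bar>poly p x\<bar> \<le> L * \<kappa> x" if xX: "x \<in> X" for x
  proof (rule ccontr)
    assume "\<not> \<bar>poly p x\<bar> \<le> L * \<kappa> x"
    then have big: "L * \<kappa> x < \<bar>poly p x\<bar>" by simp
    have Lk: "0 < L * \<kappa> y" if "y \<in> X" for y using L assms(4)[OF that] by simp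
    have inc: "t i < t j" if "i < j" "j \<le> n" for i j
      using t(1) that by (simp add: increasing_upto_def)
    have nt: "x \<noteq> t i" if "i \<le> n" for i
      using big val[OF that] Lk[OF xX] by (auto simp: abs_mult)
    have sgn: "L * \<kappa> x < (-1) ^ (n - k) * poly p x \<or> (-1) ^ (n - k) * poly p x < 0" for k
      using big by (cases "even (n - k)") (auto simp: abs_if split: if_splits)
    consider "x < t 0" | "t n < x" | i where "i < n" "t i < x" "x < t (Suc i)"
    proof (cases "x < t 0 \<or> t n < x")
      case False
      then have ends: "t 0 < x" "x < t n" using nt[of 0] nt[of n] by (auto simp: not_less le_less)
      define i where "i = Max {i. i \<le> n \<and> t i < x}"
      have fin: "finite {i. i \<le> n \<and> t i < x}" by (rule finite_subset[of _ "{..n}"]) auto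
      have i: "i \<le> n" "t i < x"
        using Max_in[OF fin] ends unfolding i_def by blast+
      have "i \<noteq> n" using i ends by auto
      then have "i < n" using i by simp
      have "\<not> t (Suc i) < x"
        using Max_ge[OF fin, of "Suc i"] \<open>i < n\<close> unfolding i_def[symmetric] by auto
      moreover have "x \<noteq> t (Suc i)" using nt[of "Suc i"] \<open>i < n\<close> by auto
      ultimately have "x < t (Suc i)" by auto
      then show thesis using that(3)[OF \<open>i < n\<close> i(2)] by blast
    qed (use that in auto)
    then show False
    proof cases
      case 1
      have lt: "x < t i" if "i \<le> n" for i
        using 1 inc[of 0 i] that by (cases "i = 0") auto
      show False using sgn[of 0]
      proof
        assume "L * \<kappa> x < (-1) ^ (n - 0) * poly p x"
        then show False by (rule exchange[OF xX]) (use lt in auto)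
      next
        assume neg: "(-1) ^ (n - 0) * poly p x < 0"
        define t' where "t' i = (if i = 0 then x else t (i - 1))" for i
        show False
        proof (rule no_flip[of t'])
          show "increasing_upto n t'"
            unfolding increasing_upto_def
          proof (intro allI impI)
            fix i j assume ij: "i < j \<and> j \<le> n"
            then obtain j' where j': "j = Suc j'" by (cases j) auto
            show "t' i < t' j"
              using ij lt[of j'] t(1) unfolding t'_def j' increasing_upto_def by (cases i) auto
          qed
          fix i assume i: "i \<le> n"
          show "(-1) ^ (n - i) * poly p (t' i) \<le> 0"
          proof (cases i)
            case 0
            then show ?thesis using neg by (simp add: t'_def)
          next
            case (Suc j)
            then have "n - j = Suc (n - i)" using i by simp
            then have "(-1) ^ (n - i) * poly p (t' i) = - ((-1) ^ (n - i) * ((-1) ^ (n - i) * (L * \<kappa> (t j))))"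
              using Suc i val[of j] by (simp add: t'_def)
            then show ?thesis using Lk[OF t(2)[of j]] Suc i by (simp add: sq)
          qed
        qed
      qed
    next
      case 2
      have lt: "t i < x" if "i \<le> n" for i
        using 2 inc[of i n] that by (cases "i = n") auto
      show False using sgn[of n]
      proof
        assume "L * \<kappa> x < (-1) ^ (n - n) * poly p x"
        then show False by (rule exchange[OF xX]) (use lt in auto)
      next
        assume neg: "(-1) ^ (n - n) * poly p x < 0"
        define t' where "t' i = (if i = n then x else t (Suc i))" for i
        show False
        proof (rule no_flip[of t'])
          show "increasing_upto n t'"
            unfolding increasing_upto_def
          proof (intro allI impI)
            fix i j assume ij: "i < j \<and> j \<le> n"
            show "t' i < t' j"
            proof (cases "j = n")
              case True
              then show ?thesis using ij lt[of "Suc i"] by (simp add: t'_def)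
            next
              case False
              then show ?thesis using ij t(1) by (simp add: t'_def increasing_upto_def)
            qed
          qed
          fix i assume i: "i \<le> n"
          show "(-1) ^ (n - i) * poly p (t' i) \<le> 0"
          proof (cases "i = n")
            case True
            then show ?thesis using neg by (simp add: t'_def)
          next
            case False
            then have "n - i = Suc (n - Suc i)" using i by simp
            then have "(-1) ^ (n - i) * poly p (t' i) = - ((-1) ^ (n - Suc i) * ((-1) ^ (n - Suc i) * (L * \<kappa> (t (Suc i)))))"
              using False i val[of "Suc i"] by (simp add: t'_def)
            then show ?thesis using Lk[OF t(2)[of "Suc i"]] False i by (simp add: sq)
          qed
        qed
      qed
    next
      case (3 i)
      have lo: "t j < x" if "j \<le> i" for j
        using 3 inc[of j i] that by (cases "j = i") auto
      have hi: "x < t j" if "Suc i \<le> j" "j \<le> n" for j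
        using 3 inc[of "Suc i" j] that by (cases "j = Suc i") auto
      show False using sgn[of i]
      proof
        assume "L * \<kappa> x < (-1) ^ (n - i) * poly p x"
        then show False by (rule exchange[OF xX]) (use lo hi 3 in auto)
      next
        assume "(-1) ^ (n - i) * poly p x < 0"
        moreover have "n - i = Suc (n - Suc i)" using 3 by simp
        ultimately have "0 < (-1) ^ (n - Suc i) * poly p x" by simp
        then have "L * \<kappa> x < (-1) ^ (n - Suc i) * poly p x" using sgn[of "Suc i"] by auto
        then show False by (rule exchange[OF xX]) (use lo hi 3 in auto)
      qed
    qed
  qed
  show thesis
    using that[of p L t] degn lc L(1) bound t val by auto
qed

section \<open>Upper bound from zeros between alternation points\<close>

definition weight_poly :: "real option \<Rightarrow> real poly" where
  "weight_poly r = (case r of None \<Rightarrow> 1 | Some s \<Rightarrow> [:- s, 1:])"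

text \<open>The mean of the logarithm of the weight over the arcsine law, by \<open>ln_dist_cos_mean\<close>.\<close>

definition weight_mean :: "real option \<Rightarrow> real" where
  "weight_mean r = (case r of None \<Rightarrow> 0 | Some s \<Rightarrow> green_slit (complex_of_real s) - ln 2)"

text \<open>The coefficient of degree \<open>n\<close> of the \<open>n\<close>-th power of the weight, for \<open>n > 0\<close>: subtracting a multiple of
  that power from a polynomial of degree \<open>n\<close> changes the leading coefficient in the residual case only.\<close>

definition weight_lead :: "real option \<Rightarrow> real" where
  "weight_lead r = (case r of None \<Rightarrow> 0 | Some s \<Rightarrow> 1)"

text \<open>The mean, over the arcsine law in \<open>c\<close>, of the logarithm of the leading coefficient of
  \<open>p / L - c * q ^ n\<close> for monic \<open>p\<close> of degree \<open>n\<close>.\<close>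

definition lead_mean :: "real option \<Rightarrow> real \<Rightarrow> real" where
  "lead_mean r L = (case r of None \<Rightarrow> - ln L | Some s \<Rightarrow> green_slit (complex_of_real (1 / L)) - ln 2)"

lemma weight_poly_power:
  "degree (weight_poly r ^ n) \<le> n" "0 < n \<Longrightarrow> coeff (weight_poly r ^ n) n = weight_lead r"
proof -
  show "degree (weight_poly r ^ n) \<le> n"
    by (rule order.trans[OF degree_power_le]) (auto simp: weight_poly_def split: option.splits)
  assume "0 < n"
  then show "coeff (weight_poly r ^ n) n = weight_lead r"
  proof (cases r)
    case (Some s)
    have "degree ([:- s, 1:] ^ n) = n" by (simp add: degree_power_eq)
    moreover have "lead_coeff ([:- s, 1:] ^ n) = 1" by (simp add: lead_coeff_power)
    ultimately show ?thesis by (simp add: Some weight_poly_def weight_lead_def)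
  qed (simp add: weight_poly_def weight_lead_def)
qed

lemma lead_mean_integral:
  assumes "0 < L"
  shows "((\<lambda>x. ln \<bar>1 / L - weight_lead r * cos (2 * pi * x)\<bar>) has_integral lead_mean r L) {0..1}"
proof (cases r)
  case None
  have "ln \<bar>1 / L\<bar> = - ln L" using assms by (simp add: ln_div)
  then show ?thesis using None has_integral_const_real[of "- ln L" 0 1]
    by (simp add: weight_lead_def lead_mean_def)
next
  case (Some s)
  then show ?thesis using ln_dist_cos_mean[of "1 / L"] by (simp add: weight_lead_def lead_mean_def)
qed

lemma weight_mean_integral:
  "((\<lambda>x. ln \<bar>poly (weight_poly r) (cos (2 * pi * x))\<bar>) has_integral weight_mean r) {0..1}"
proof (cases r)
  case (Some s)
  have "\<bar>cos (2 * pi * x) - s\<bar> = \<bar>s - cos (2 * pi * x)\<bar>" for x by simp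
  then show ?thesis using ln_dist_cos_mean[of s] Some by (simp add: weight_poly_def weight_mean_def)
qed (simp add: weight_poly_def weight_mean_def)

lemma weight_mean_nodes:
  assumes "M > 0" "\<And>t. \<bar>t\<bar> \<le> 1 \<Longrightarrow> poly (weight_poly r) t \<noteq> 0"
  shows "M * weight_mean r \<le> (\<Sum>m<M. ln \<bar>poly (weight_poly r) (cheb_node M m)\<bar>)"
proof (cases r)
  case (Some s)
  have "1 < \<bar>s\<bar>" using assms(2)[of s] Some by (auto simp: weight_poly_def not_less[symmetric])
  moreover have "\<bar>cheb_node M m - s\<bar> = \<bar>s - cheb_node M m\<bar>" for m by simp
  ultimately show ?thesis using sum_ln_dist_cheb_nodes_ge[OF assms(1), of s] Some
    by (simp add: weight_poly_def weight_mean_def)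
qed (simp add: weight_poly_def weight_mean_def)

text \<open>The discrete averages over Chebyshev nodes have an error that does not grow with the number
  of nodes; this removes it.\<close>

lemma bounded_slope_imp_nonpos:
  assumes "\<And>M :: nat. M > 0 \<Longrightarrow> real M * D \<le> C"
  shows "D \<le> (0 :: real)"
proof (rule ccontr)
  assume "\<not> D \<le> 0"
  then have D: "D > 0" by simp
  obtain M :: nat where M: "C / D < real M" using reals_Archimedean2 by blast
  have "C < real (Suc M) * D" using M D by (simp add: divide_less_eq algebra_simps)
  then show False using assms[of "Suc M"] by simp
qed

lemma cos_strict_bounds:
  assumes "x \<in> {0..1}" "cos (2 * pi * x) \<noteq> 1" "cos (2 * pi * x) \<noteq> -1"
  shows "\<bar>cos (2 * pi * x)\<bar> < (1::real)"
  using assms cos_le_one[of "2*pi*x"] cos_ge_minus_one[of "2*pi*x"] by (auto simp: abs_less_iff le_less)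

text \<open>The Green function increases with the distance from the interval, so its value at \<open>z i\<close> is at
  most its value at whichever of the two adjacent nodes is further out, and different gaps use different
  nodes. Zeros inside the interval contribute nothing.\<close>

lemma sum_green_zeros_le:
  fixes t z :: "nat \<Rightarrow> real"
  assumes t: "increasing_upto n t" and z: "\<And>i. i < n \<Longrightarrow> t i < z i \<and> z i < t (Suc i)"
    and tX: "\<And>i. i \<le> n \<Longrightarrow> t i \<in> X"
    and SG: "\<And>F. finite F \<Longrightarrow> F \<subseteq> X - {-1..1} \<Longrightarrow> (\<Sum>s\<in>F. green_slit (complex_of_real s)) \<le> SG"
  shows "(\<Sum>i<n. green_slit (complex_of_real (z i))) \<le> SG"
proof -
  let ?g = "\<lambda>s. green_slit (complex_of_real s)"
  define A where "A = {i. i < n \<and> z i > 1}"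
  define B where "B = {i. i < n \<and> z i < -1}"
  have fin: "finite A" "finite B" by (auto simp: A_def B_def)
  note inj = increasing_upto_inj[OF t]
  have injA: "inj_on (\<lambda>i. t (Suc i)) A"
    using inj by (fastforce simp: inj_on_def A_def)
  have injB: "inj_on t B" using inj by (auto simp: inj_on_def B_def)
  have big: "t (Suc i) > 1" if "i \<in> A" for i using z[of i] that by (auto simp: A_def)
  have small: "t i < -1" if "i \<in> B" for i using z[of i] that by (auto simp: B_def)
  have "(\<Sum>i<n. ?g (z i)) = (\<Sum>i\<in>A \<union> B. ?g (z i))"
    by (rule sum.mono_neutral_right) (auto simp: A_def B_def green_slit_real max_def)
  also have "\<dots> = (\<Sum>i\<in>A. ?g (z i)) + (\<Sum>i\<in>B. ?g (z i))"
    by (rule sum.union_disjoint) (use fin in \<open>auto simp: A_def B_def\<close>)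
  also have "\<dots> \<le> (\<Sum>i\<in>A. ?g (t (Suc i))) + (\<Sum>i\<in>B. ?g (t i))"
  proof (intro add_mono sum_mono)
    fix i assume "i \<in> A"
    then show "?g (z i) \<le> ?g (t (Suc i))" using z[of i] by (intro green_slit_mono) (auto simp: A_def)
  next
    fix i assume "i \<in> B"
    then show "?g (z i) \<le> ?g (t i)" using z[of i] by (intro green_slit_mono) (auto simp: B_def)
  qed
  also have "\<dots> = sum ?g ((\<lambda>i. t (Suc i)) ` A) + sum ?g (t ` B)"
    by (simp add: sum.reindex[OF injA] sum.reindex[OF injB])
  also have "\<dots> = sum ?g ((\<lambda>i. t (Suc i)) ` A \<union> t ` B)"
    by (rule sum.union_disjoint[symmetric]) (use fin big small in \<open>fastforce+\<close>)
  also have "\<dots> \<le> SG"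
  proof (rule SG)
    show "(\<lambda>i. t (Suc i)) ` A \<union> t ` B \<subseteq> X - {-1..1}"
      using big small tX by (auto simp: A_def B_def) fastforce+
  qed (use fin in auto)
  finally show ?thesis .
qed

text \<open>For \<open>|c| < 1\<close> the alternation forces all \<open>n\<close> zeros of \<open>R = p / L - c * q ^ n\<close> to lie in the gaps between
  the alternation points. Average \<open>ln |R|\<close> at the Chebyshev nodes in two ways. As a function of \<open>c\<close> it is
  \<open>n * ln |q|\<close> plus \<open>ln |v - c|\<close> with \<open>|v| \<le> 1\<close>, whose mean is \<open>- ln 2\<close>. As a product over the zeros it is bounded
  by the Green function at the zeros, hence by \<open>SG\<close>.\<close>

lemma extremal_upper:
  fixes p :: "real poly" and t :: "nat \<Rightarrow> real"
  assumes n: "0 < n" and X: "{-1..1} \<subseteq> X"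
    and nz: "\<And>s. s \<in> X \<Longrightarrow> poly (weight_poly r) s \<noteq> 0"
    and p: "degree p = n" "lead_coeff p = 1" and L: "0 < L" "r \<noteq> None \<Longrightarrow> L \<le> 1"
    and bound: "\<And>s. s \<in> X \<Longrightarrow> \<bar>poly p s\<bar> \<le> L * \<bar>poly (weight_poly r) s\<bar> ^ n"
    and t: "increasing_upto n t" "\<And>i. i \<le> n \<Longrightarrow> t i \<in> X"
    and alt: "\<And>i. i \<le> n \<Longrightarrow> poly p (t i) = (-1) ^ (n - i) * (L * \<bar>poly (weight_poly r) (t i)\<bar> ^ n)"
    and SG: "\<And>F. finite F \<Longrightarrow> F \<subseteq> X - {-1..1} \<Longrightarrow> (\<Sum>s\<in>F. green_slit (complex_of_real s)) \<le> SG"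
  shows "n * weight_mean r - ln 2 \<le> lead_mean r L + SG - n * ln 2"
proof -
  define q where "q = weight_poly r"
  define e where "e = weight_lead r"
  have e01: "e = 0 \<or> e = 1" by (auto simp: e_def weight_lead_def split: option.splits)
  have eL: "\<bar>e * c\<bar> < 1 / L" if "\<bar>c\<bar> < 1" for c
  proof (cases r)
    case (Some s)
    then have "1 \<le> 1 / L" using L by simp
    then show ?thesis using that Some by (simp add: e_def weight_lead_def)
  qed (use L in \<open>simp add: e_def weight_lead_def\<close>)
  \<comment> \<open>the error is bounded independently of \<open>M\<close>\<close>
  have main: "real M * (n * weight_mean r - ln 2 - (lead_mean r L + SG - n * ln 2)) \<le> n * ln 2" if M: "M > 0" for M :: nat
  proof -
    let ?\<tau> = "cheb_node M"
    have \<tau>X: "?\<tau> m \<in> X" for m using cheb_node_range[of M m] X by (auto simp: abs_le_iff)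
    define v where "v m = poly p (?\<tau> m) / (L * poly q (?\<tau> m) ^ n)" for m
    have v1: "\<bar>v m\<bar> \<le> 1" for m
      using bound[OF \<tau>X[of m]] nz[OF \<tau>X[of m]] L
      by (simp add: v_def q_def abs_mult power_abs divide_le_eq)
    define S where "S = (\<Union>c\<in>{1, -1} \<union> v ` {..<M}. {x \<in> {0..1::real}. cos (2 * pi * x) = c})"
    have finS: "finite S" unfolding S_def by (intro finite_UN_I finite_cos_level) auto
    define f where "f x = (\<Sum>m<M. n * ln \<bar>poly q (?\<tau> m)\<bar> + ln \<bar>v m - cos (2 * pi * x)\<bar>)" for x :: real
    define h where "h x = M * ln \<bar>1 / L - e * cos (2 * pi * x)\<bar> + (M * SG - n * M * ln 2 + n * ln 2)" for x :: real
    have fint: "(f has_integral (\<Sum>m<M. n * ln \<bar>poly q (?\<tau> m)\<bar> + (0 - ln 2))) {0..1}"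
      unfolding f_def
    proof (intro has_integral_sum has_integral_add)
      fix m
      show "((\<lambda>x. n * ln \<bar>poly q (?\<tau> m)\<bar>) has_integral n * ln \<bar>poly q (?\<tau> m)\<bar>) {0..1::real}"
        using has_integral_const_real[of "n * ln \<bar>poly q (?\<tau> m)\<bar>" 0 1] by simp
      have "green_slit (complex_of_real (v m)) = 0" using v1[of m] by (simp add: green_slit_real max_def)
      then show "((\<lambda>x. ln \<bar>v m - cos (2 * pi * x)\<bar>) has_integral 0 - ln 2) {0..1}"
        using ln_dist_cos_mean[of "v m"] by simp
    qed simp
    have hint: "(h has_integral M * lead_mean r L + (M * SG - n * M * ln 2 + n * ln 2)) {0..1}"
    proof -
      define C where "C = M * SG - n * M * ln 2 + n * ln 2"
      have "((\<lambda>x. C) has_integral C) {0..1::real}"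
        using has_integral_const_real[of C 0 1] by simp
      then show ?thesis
        unfolding h_def e_def C_def[symmetric]
        by (intro has_integral_add has_integral_mult_right lead_mean_integral L)
    qed
    have le: "f x \<le> h x" if x: "x \<in> {0..1} - S" for x
    proof -
      define c where "c = cos (2 * pi * x)"
      have c: "\<bar>c\<bar> < 1" unfolding c_def by (rule cos_strict_bounds) (use x in \<open>auto simp: S_def\<close>)
      have cv: "v m \<noteq> c" if "m < M" for m
      proof
        assume "v m = c"
        then have "x \<in> {x \<in> {0..1::real}. cos (2 * pi * x) = v m}" using x by (simp add: c_def)
        moreover have "v m \<in> {1, -1} \<union> v ` {..<M}" using that by simp
        ultimately have "x \<in> S" unfolding S_def by blast
        then show False using x by simp
      qed
      \<comment> \<open>since \<open>|c| < 1\<close>, subtracting \<open>c * q ^ n\<close> does not change the signs at the alternation points\<close>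
      define R where "R = smult (1 / L) p - smult c (q ^ n)"
      have degR: "degree R \<le> n" unfolding R_def q_def using p weight_poly_power(1)[of r n]
        by (intro degree_diff_le order.trans[OF degree_smult_le]) auto
      have lcR: "coeff R n = 1 / L - e * c" unfolding R_def q_def e_def using p weight_poly_power(2)[OF n, of r] by (simp add: mult.commute)
      have lcpos: "coeff R n > 0" using eL[OF c] unfolding lcR by (simp add: abs_less_iff)
      have sgnR: "0 < (-1) ^ (n - i) * poly R (t i)" if i: "i \<le> n" for i
      proof -
        define Q where "Q = poly q (t i) ^ n"
        have Q: "\<bar>Q\<bar> > 0" using nz[OF t(2)[OF i]] by (simp add: Q_def q_def)
        have "(-1) ^ (n - i) * poly R (t i) = \<bar>Q\<bar> - (-1) ^ (n - i) * (c * Q)"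
          using L alt[OF i] by (cases "even (n - i)") (auto simp: R_def Q_def q_def power_abs algebra_simps)
        moreover have "\<bar>(-1) ^ (n - i) * (c * Q)\<bar> < \<bar>Q\<bar>"
          using c Q by (simp add: abs_mult power_abs)
        ultimately show ?thesis by (simp add: abs_less_iff)
      qed
      have "\<exists>z. t i < z \<and> z < t (Suc i) \<and> poly R z = 0" if i: "i < n" for i
      proof -
        have "n - i = Suc (n - Suc i)" using i by simp
        then have "poly R (t i) * poly R (t (Suc i)) < 0"
          using sgnR[of i] sgnR[of "Suc i"] i
          by (cases "even (n - Suc i)") (auto simp: mult_less_0_iff)
        moreover have "t i < t (Suc i)" using t(1) i by (auto simp: increasing_upto_def)
        ultimately show ?thesis using poly_IVT[of "t i" "t (Suc i)" R] by auto
      qed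
      then obtain z where z: "\<And>i. i < n \<Longrightarrow> t i < z i \<and> z i < t (Suc i)" "\<And>i. i < n \<Longrightarrow> poly R (z i) = 0"
        by metis
      have zinc: "z i < z j" if "i < j" "j < n" for i j
      proof -
        have "t (Suc i) \<le> t j"
          using t(1) that unfolding increasing_upto_def by (cases "Suc i = j") (auto intro: less_imp_le)
        then show ?thesis using z(1)[of i] z(1)[of j] that by auto
      qed
      have zinj: "inj_on z {..<n}"
        using zinc by (intro inj_onI) (metis lessThan_iff less_irrefl linorder_neqE_nat)
      have Rfac: "R = smult (coeff R n) (\<Prod>i<n. [:- z i, 1:])"
        by (rule poly_eq_prod_roots[OF degR zinj z(2)])
      have R\<tau>: "poly R (?\<tau> m) = poly q (?\<tau> m) ^ n * (v m - c)" for m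
        using nz[OF \<tau>X[of m]] L by (simp add: R_def v_def q_def field_simps)
      have R\<tau>nz: "poly R (?\<tau> m) \<noteq> 0" if "m < M" for m
        using R\<tau>[of m] cv[OF that] nz[OF \<tau>X[of m]] by (simp add: q_def)
      have z\<tau>: "z i \<noteq> ?\<tau> m" if "m < M" "i < n" for i m
        using R\<tau>nz[OF that(1)] z(2)[OF that(2)] by auto
      have lnR: "ln \<bar>poly R (?\<tau> m)\<bar> = ln (1 / L - e * c) + (\<Sum>i<n. ln \<bar>z i - ?\<tau> m\<bar>)" if m: "m < M" for m
      proof -
        have "poly R (?\<tau> m) = coeff R n * (\<Prod>i<n. ?\<tau> m - z i)"
          by (subst Rfac) (simp add: poly_prod)
        then have "\<bar>poly R (?\<tau> m)\<bar> = coeff R n * (\<Prod>i<n. \<bar>z i - ?\<tau> m\<bar>)"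
          using lcpos by (simp add: abs_mult abs_prod abs_minus_commute)
        moreover have pos: "(\<Prod>i<n. \<bar>z i - ?\<tau> m\<bar>) > 0" using z\<tau>[OF m] by (intro prod_pos) auto
        have "ln (coeff R n * (\<Prod>i<n. \<bar>z i - ?\<tau> m\<bar>)) = ln (coeff R n) + ln (\<Prod>i<n. \<bar>z i - ?\<tau> m\<bar>)"
          by (rule ln_mult_pos[OF lcpos pos])
        moreover have "ln (\<Prod>i<n. \<bar>z i - ?\<tau> m\<bar>) = (\<Sum>i<n. ln \<bar>z i - ?\<tau> m\<bar>)"
          using z\<tau>[OF m] by (intro ln_prod) auto
        ultimately show ?thesis unfolding lcR by simp
      qed
      have "f x = (\<Sum>m<M. ln \<bar>poly R (?\<tau> m)\<bar>)"
        unfolding f_def c_def[symmetric]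
      proof (intro sum.cong refl)
        fix m assume "m \<in> {..<M}"
        then show "n * ln \<bar>poly q (?\<tau> m)\<bar> + ln \<bar>v m - c\<bar> = ln \<bar>poly R (?\<tau> m)\<bar>"
          unfolding R\<tau> using cv[of m] nz[OF \<tau>X[of m]]
          by (simp add: abs_mult ln_mult power_abs ln_realpow q_def)
      qed
      also have "\<dots> = (\<Sum>m<M. ln (1 / L - e * c)) + (\<Sum>m<M. \<Sum>i<n. ln \<bar>z i - ?\<tau> m\<bar>)"
        by (simp add: lnR sum.distrib)
      also have "(\<Sum>m<M. \<Sum>i<n. ln \<bar>z i - ?\<tau> m\<bar>) = (\<Sum>i<n. \<Sum>m<M. ln \<bar>z i - ?\<tau> m\<bar>)"
        by (rule sum.swap)
      also have "\<dots> \<le> (\<Sum>i<n. M * (green_slit (complex_of_real (z i)) - ln 2) + ln 2)"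
        using z\<tau> by (intro sum_mono sum_ln_dist_cheb_nodes_le M) auto
      also have "\<dots> = M * (\<Sum>i<n. green_slit (complex_of_real (z i))) - n * M * ln 2 + n * ln 2"
        by (simp add: sum.distrib sum_distrib_left[symmetric] sum_subtractf algebra_simps)
      also have "M * (\<Sum>i<n. green_slit (complex_of_real (z i))) - n * M * ln 2 + n * ln 2
          \<le> M * SG - n * M * ln 2 + n * ln 2"
        by (intro add_right_mono diff_right_mono mult_left_mono sum_green_zeros_le[OF t(1) z(1) t(2) SG]) auto
      also have "(\<Sum>m<M. ln (1 / L - e * c)) = M * ln (1 / L - e * c)" by simp
      finally have "f x \<le> M * ln (1 / L - e * c) + (M * SG - n * M * ln 2 + n * ln 2)"
        by simp
      then show ?thesis using lcpos lcR by (simp add: h_def c_def)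
    qed
    define f' where "f' x = (if x \<in> S then h x else f x)" for x
    have "(f' has_integral (\<Sum>m<M. n * ln \<bar>poly q (?\<tau> m)\<bar> + (0 - ln 2))) {0..1}"
      by (rule has_integral_spike_finite[OF finS _ fint]) (auto simp: f'_def)
    then have "(\<Sum>m<M. n * ln \<bar>poly q (?\<tau> m)\<bar> + (0 - ln 2)) \<le> M * lead_mean r L + (M * SG - n * M * ln 2 + n * ln 2)"
      by (rule has_integral_le[OF _ hint]) (use le in \<open>auto simp: f'_def\<close>)
    moreover have "(\<Sum>m<M. n * ln \<bar>poly q (?\<tau> m)\<bar> + (0 - ln 2)) = n * (\<Sum>m<M. ln \<bar>poly q (?\<tau> m)\<bar>) - M * ln 2"
      by (simp add: sum_subtractf sum_distrib_left)
    moreover have "n * (M * weight_mean r) \<le> n * (\<Sum>m<M. ln \<bar>poly q (?\<tau> m)\<bar>)"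
    proof (unfold q_def, intro mult_left_mono weight_mean_nodes M)
      fix t :: real assume "\<bar>t\<bar> \<le> 1"
      then have "t \<in> X" using X by (auto simp: abs_le_iff)
      then show "poly (weight_poly r) t \<noteq> 0" by (rule nz)
    qed simp
    ultimately show ?thesis by (simp add: algebra_simps)
  qed
  have "n * weight_mean r - ln 2 - (lead_mean r L + SG - n * ln 2) \<le> 0"
    by (rule bounded_slope_imp_nonpos[OF main])
  then show ?thesis by simp
qed

section \<open>Logarithmic minorants and small interpolating polynomials\<close>

text \<open>Replacing each complex zero by its real part only decreases the distances to real points.\<close>

lemma poly_abs_ge_prod_real:
  fixes p :: "real poly"
  assumes "p \<noteq> 0"
  obtains ys :: "real list" where "length ys = degree p"
    "\<And>t. \<bar>lead_coeff p\<bar> * (\<Prod>y\<leftarrow>ys. \<bar>t - y\<bar>) \<le> \<bar>poly p t\<bar>"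
proof -
  have "\<exists>zs :: complex list. length zs = degree P \<and> P = smult (lead_coeff P) (\<Prod>z\<leftarrow>zs. [:- z, 1:])"
    if "P \<noteq> 0" for P :: "complex poly"
    using that
  proof (induction "degree P" arbitrary: P)
    case 0
    then obtain c where "P = [:c:]" by (metis degree_eq_zeroE)
    then show ?case by (intro exI[of _ "[]"]) simp
  next
    case (Suc d)
    have "\<not> constant (poly P)" using Suc.hyps(2) constant_degree[of P] by simp
    then obtain z where z: "poly P z = 0" using fundamental_theorem_of_algebra by blast
    then obtain Q where Q: "P = [:- z, 1:] * Q" unfolding poly_eq_0_iff_dvd by (rule dvdE)
    have Q0: "Q \<noteq> 0" using Suc.prems Q by auto
    have degQ: "degree P = Suc (degree Q)" unfolding Q using Q0 by (subst degree_mult_eq) auto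
    then obtain zs where zs: "length zs = degree Q" "Q = smult (lead_coeff Q) (\<Prod>z\<leftarrow>zs. [:- z, 1:])"
      using Suc.hyps(1)[of Q] Suc.hyps(2) Q0 by auto
    have lc: "lead_coeff P = lead_coeff Q" unfolding Q by (subst lead_coeff_mult) simp
    have "P = [:- z, 1:] * smult (lead_coeff Q) (\<Prod>z\<leftarrow>zs. [:- z, 1:])"
      using Q zs(2) by metis
    also have "\<dots> = smult (lead_coeff Q) (\<Prod>z\<leftarrow>z # zs. [:- z, 1:])"
      by (simp only: list.map prod_list.Cons mult_smult_right)
    also have "lead_coeff Q = lead_coeff P" using lc by (rule sym)
    finally have "P = smult (lead_coeff P) (\<Prod>z\<leftarrow>z # zs. [:- z, 1:])" .
    then show ?case using zs(1) degQ by (intro exI[of _ "z # zs"]) auto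
  qed
  moreover define P where "P = map_poly complex_of_real p"
  moreover have "P \<noteq> 0" using assms by (simp add: P_def map_poly_eq_0_iff)
  ultimately obtain zs where zs: "length zs = degree P" "P = smult (lead_coeff P) (\<Prod>z\<leftarrow>zs. [:- z, 1:])"
    by blast
  have degP: "degree P = degree p" by (simp add: P_def degree_map_poly)
  have lcP: "lead_coeff P = complex_of_real (lead_coeff p)" by (simp add: P_def coeff_map_poly degree_map_poly)
  show thesis
  proof (rule that[of "map Re zs"])
    show "length (map Re zs) = degree p" using zs(1) degP by simp
    fix t
    have val: "poly P (complex_of_real t) = complex_of_real (poly p t)"
      unfolding P_def by (induction p) (auto simp: map_poly_pCons)
    have "cmod (poly P (complex_of_real t)) = \<bar>lead_coeff p\<bar> * (\<Prod>z\<leftarrow>zs. cmod (complex_of_real t - z))"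
    proof -
      have "poly (\<Prod>z\<leftarrow>zs. [:- z, 1:]) w = (\<Prod>z\<leftarrow>zs. w - z)" for w :: complex and zs
        by (induction zs) (auto simp: algebra_simps)
      moreover have "cmod (\<Prod>z\<leftarrow>zs. f z) = (\<Prod>z\<leftarrow>zs. cmod (f z))" for zs and f :: "complex \<Rightarrow> complex"
        by (induction zs) (auto simp: norm_mult)
      ultimately show ?thesis by (subst zs(2)) (simp add: norm_mult lcP)
    qed
    moreover have "(\<Prod>y\<leftarrow>map Re zs. \<bar>t - y\<bar>) \<le> (\<Prod>z\<leftarrow>zs. cmod (complex_of_real t - z))" for zs
    proof (induction zs)
      case (Cons z zs)
      have "\<bar>t - Re z\<bar> \<le> cmod (complex_of_real t - z)" using abs_Re_le_cmod[of "complex_of_real t - z"] by simp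
      moreover have "0 \<le> (\<Prod>y\<leftarrow>map Re zs. \<bar>t - y\<bar>)" by (induction zs) auto
      ultimately show ?case using Cons by (auto intro!: mult_mono)
    qed simp
    ultimately show "\<bar>lead_coeff p\<bar> * (\<Prod>y\<leftarrow>map Re zs. \<bar>t - y\<bar>) \<le> \<bar>poly p t\<bar>"
      using val by (simp add: mult_left_mono del: list.map_comp map_map)
  qed
qed

lemma prod_roots_dvd:
  fixes p :: "'a::field poly"
  assumes "finite Q" "\<And>s. s \<in> Q \<Longrightarrow> poly p s = 0"
  shows "(\<Prod>s\<in>Q. [:- s, 1:]) dvd p"
  using assms
proof (induction Q arbitrary: p rule: finite_induct)
  case (insert s Q)
  obtain p' where p': "p = [:- s, 1:] * p'" using insert.prems by (metis insertI1 poly_eq_0_iff_dvd dvdE)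
  have "poly p' u = 0" if "u \<in> Q" for u
  proof -
    have "poly p u = 0" "u \<noteq> s" using insert that by auto
    then show ?thesis by (simp add: p')
  qed
  then have "(\<Prod>s\<in>Q. [:- s, 1:]) dvd p'" by (rule insert.IH)
  then show ?case unfolding p' prod.insert[OF insert(1,2)] by (rule mult_dvd_mono[OF dvd_refl])
qed simp

lemma cos_avoid_finite: "finite C \<Longrightarrow> finite {x \<in> {0..1::real}. cos (2 * pi * x) \<in> C}"
proof -
  assume "finite C"
  moreover have "{x \<in> {0..1::real}. cos (2 * pi * x) \<in> C} = (\<Union>c\<in>C. {x \<in> {0..1::real}. cos (2 * pi * x) = c})" by auto
  ultimately show ?thesis using finite_cos_level by auto
qed

text \<open>The zeros in \<open>Q\<close> contribute their Green functions to the logarithmic mean of \<open>R\<close>, and every other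
  zero contributes at least \<open>- ln 2\<close>. Working with a minorant having real zeros keeps all integrals within the
  reach of \<open>ln_dist_cos_mean\<close>.\<close>

lemma log_minorant:
  fixes R :: "real poly"
  assumes R: "R \<noteq> 0" and Q: "finite Q" "\<And>s. s \<in> Q \<Longrightarrow> poly R s = 0"
  obtains f J S where "finite S" "(f has_integral J) {0..1}"
    "ln \<bar>lead_coeff R\<bar> + (\<Sum>s\<in>Q. green_slit (complex_of_real s)) - degree R * ln 2 \<le> J"
    "\<And>x. x \<in> {0..1} - S \<Longrightarrow> f x \<le> ln \<bar>poly R (cos (2 * pi * x))\<bar> \<and> poly R (cos (2 * pi * x)) \<noteq> 0"
proof -
  obtain T where T: "R = (\<Prod>s\<in>Q. [:- s, 1:]) * T" using prod_roots_dvd[OF Q] by (metis dvdE)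
  have T0: "T \<noteq> 0" using R T by auto
  obtain ys where ys: "length ys = degree T"
    "\<And>t. \<bar>lead_coeff T\<bar> * (\<Prod>y\<leftarrow>ys. \<bar>t - y\<bar>) \<le> \<bar>poly T t\<bar>"
    using poly_abs_ge_prod_real[OF T0] by blast
  have degQ: "degree (\<Prod>s\<in>Q. [:- s, 1:]) = card Q"
    by (subst degree_prod_eq_sum_degree) auto
  have P0: "(\<Prod>s\<in>Q. [:- s, 1:]) \<noteq> 0" using Q by (simp add: prod_zero_iff)
  have degR: "degree R = card Q + length ys"
    unfolding T using degQ ys(1) T0 P0 by (subst degree_mult_eq) auto
  have lcR: "lead_coeff R = lead_coeff T"
    unfolding T lead_coeff_mult by (simp add: lead_coeff_prod)
  define f where "f x = ln \<bar>lead_coeff R\<bar> + (\<Sum>s\<in>Q. ln \<bar>s - cos (2 * pi * x)\<bar>) + (\<Sum>y\<leftarrow>ys. ln \<bar>y - cos (2 * pi * x)\<bar>)" for x :: real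
  define J where "J = ln \<bar>lead_coeff R\<bar> + (\<Sum>s\<in>Q. green_slit (complex_of_real s) - ln 2) + (\<Sum>y\<leftarrow>ys. green_slit (complex_of_real y) - ln 2)"
  define S where "S = {x \<in> {0..1::real}. cos (2 * pi * x) \<in> {t. poly R t = 0} \<union> Q \<union> set ys}"
  have "finite S" unfolding S_def using Q poly_roots_finite[OF R] by (intro cos_avoid_finite) auto
  moreover have "(f has_integral J) {0..1}"
    unfolding f_def J_def
  proof (intro has_integral_add has_integral_sum Q ln_dist_cos_mean)
    show "((\<lambda>x. ln \<bar>lead_coeff R\<bar>) has_integral ln \<bar>lead_coeff R\<bar>) {0..1::real}"
      using has_integral_const_real[of "ln \<bar>lead_coeff R\<bar>" 0 1] by simp
    show "((\<lambda>x. \<Sum>y\<leftarrow>ys. ln \<bar>y - cos (2 * pi * x)\<bar>) has_integral (\<Sum>y\<leftarrow>ys. green_slit (complex_of_real y) - ln 2)) {0..1}"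
      by (induction ys) (auto intro!: has_integral_add ln_dist_cos_mean)
  qed
  moreover have "ln \<bar>lead_coeff R\<bar> + (\<Sum>s\<in>Q. green_slit (complex_of_real s)) - degree R * ln 2 \<le> J"
  proof -
    have "- (length ys * ln 2) \<le> (\<Sum>y\<leftarrow>ys. green_slit (complex_of_real y) - ln 2)"
    proof (induction ys)
      case (Cons y ys)
      then show ?case using green_slit_nonneg[of "complex_of_real y"] by (simp add: algebra_simps)
    qed simp
    then show ?thesis unfolding J_def degR by (simp add: sum_subtractf algebra_simps)
  qed
  moreover have "f x \<le> ln \<bar>poly R (cos (2 * pi * x))\<bar> \<and> poly R (cos (2 * pi * x)) \<noteq> 0" if x: "x \<in> {0..1} - S" for x
  proof -
    define t where "t = cos (2 * pi * x)"
    have t: "poly R t \<noteq> 0" "t \<notin> Q" "t \<notin> set ys" using x by (auto simp: S_def t_def)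
    have lc: "\<bar>lead_coeff R\<bar> > 0" using R by simp
    have p1: "(\<Prod>s\<in>Q. \<bar>s - t\<bar>) > 0" using t by (intro prod_pos) auto
    have p2: "(\<Prod>y\<leftarrow>ys. \<bar>y - t\<bar>) > 0" using t(3) by (induction ys) auto
    have l1: "ln (\<Prod>s\<in>Q. \<bar>s - t\<bar>) = (\<Sum>s\<in>Q. ln \<bar>s - t\<bar>)"
      using t Q by (intro ln_prod) auto
    have l2: "ln (\<Prod>y\<leftarrow>ys. \<bar>y - t\<bar>) = (\<Sum>y\<leftarrow>ys. ln \<bar>y - t\<bar>)"
      using t(3)
    proof (induction ys)
      case (Cons y ys)
      have "(\<Prod>y\<leftarrow>ys. \<bar>y - t\<bar>) > 0" using Cons.prems by (induction ys) auto
      then show ?case using Cons by (auto simp: ln_mult)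
    qed simp
    have "\<bar>poly R t\<bar> = (\<Prod>s\<in>Q. \<bar>s - t\<bar>) * \<bar>poly T t\<bar>"
      unfolding T by (simp add: abs_mult poly_prod abs_prod abs_minus_commute)
    also have "\<dots> \<ge> (\<Prod>s\<in>Q. \<bar>s - t\<bar>) * (\<bar>lead_coeff R\<bar> * (\<Prod>y\<leftarrow>ys. \<bar>y - t\<bar>))"
      using ys(2)[of t] p1 unfolding lcR by (intro mult_left_mono) (auto simp: abs_minus_commute)
    finally have "ln ((\<Prod>s\<in>Q. \<bar>s - t\<bar>) * (\<bar>lead_coeff R\<bar> * (\<Prod>y\<leftarrow>ys. \<bar>y - t\<bar>))) \<le> ln \<bar>poly R t\<bar>"
      using p1 p2 lc by (intro ln_mono) auto
    moreover have "ln ((\<Prod>s\<in>Q. \<bar>s - t\<bar>) * (\<bar>lead_coeff R\<bar> * (\<Prod>y\<leftarrow>ys. \<bar>y - t\<bar>))) =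
       (\<Sum>s\<in>Q. ln \<bar>s - t\<bar>) + (ln \<bar>lead_coeff R\<bar> + (\<Sum>y\<leftarrow>ys. ln \<bar>y - t\<bar>))"
      using p1 p2 lc by (simp add: ln_mult l1 l2)
    ultimately show ?thesis using t(1) by (simp add: f_def t_def)
  qed
  ultimately show thesis using that by blast
qed

text \<open>A power of a quadratic polynomial that equals the square of the weight at \<open>s\<close>, but is smaller than it by a
  constant factor on the interval, has the right value at \<open>s\<close> and decays geometrically relative to the weight.
  A fixed Lagrange factor takes care of the remaining points of \<open>Q\<close>.\<close>

lemma small_interpolants:
  assumes r: "\<And>t. \<bar>t\<bar> \<le> 1 \<Longrightarrow> poly (weight_poly r) t \<noteq> 0"
    and Q: "finite Q" "\<And>s. s \<in> Q \<Longrightarrow> 1 < \<bar>s\<bar>" "\<And>s. s \<in> Q \<Longrightarrow> poly (weight_poly r) s \<noteq> 0"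
    and s: "s \<in> Q" and \<delta>: "0 < \<delta>"
  shows "\<exists>n0. \<forall>n\<ge>n0. \<exists>l :: real poly. degree l < n \<and>
     (\<forall>u\<in>Q. poly l u = (if u = s then poly (weight_poly r) s ^ n else 0)) \<and>
     (\<forall>t. \<bar>t\<bar> \<le> 1 \<longrightarrow> \<bar>poly l t\<bar> \<le> \<delta> * \<bar>poly (weight_poly r) t\<bar> ^ n)"
proof -
  define q where "q = weight_poly r"
  have q: "\<And>t. \<bar>t\<bar> \<le> 1 \<Longrightarrow> poly q t \<noteq> 0" "poly q s \<noteq> 0" using r Q s by (auto simp: q_def)
  have degq: "degree q \<le> 1" by (auto simp: q_def weight_poly_def split: option.splits)
  have I: "compact {-1..1::real}" "{-1..1::real} \<noteq> {}" by auto
  have cq: "continuous_on {-1..1} (\<lambda>t. \<bar>poly q t\<bar>)" by (intro continuous_intros)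
  obtain tm where tm: "tm \<in> {-1..1}" "\<And>t. t \<in> {-1..1} \<Longrightarrow> \<bar>poly q tm\<bar> \<le> \<bar>poly q t\<bar>"
    using continuous_attains_inf[OF I cq] by blast
  obtain tM where tM: "tM \<in> {-1..1}" "\<And>t. t \<in> {-1..1} \<Longrightarrow> \<bar>poly q t\<bar> \<le> \<bar>poly q tM\<bar>"
    using continuous_attains_sup[OF I cq] by blast
  define m where "m = \<bar>poly q tm\<bar>"
  define Mx where "Mx = \<bar>poly q tM\<bar>"
  have m: "0 < m" using q(1)[of tm] tm(1) by (auto simp: m_def abs_le_iff)
  have mb: "m \<le> \<bar>poly q t\<bar>" "\<bar>poly q t\<bar> \<le> Mx" if "\<bar>t\<bar> \<le> 1" for t
    using tm(2)[of t] tM(2)[of t] that by (auto simp: m_def Mx_def abs_le_iff)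
  have Mx: "0 < Mx" using mb[of 0] m by simp
  define a where "a = \<bar>s\<bar> + 1"
  define b where "b = \<bar>s\<bar> - 1"
  have ab: "0 < a" "0 < b" using Q(2)[OF s] by (auto simp: a_def b_def)
  have dist: "b \<le> \<bar>t - s\<bar>" "\<bar>t - s\<bar> \<le> a" if "\<bar>t\<bar> \<le> 1" for t
    using that by (auto simp: a_def b_def)
  define \<eta> where "\<eta> = (m / a)\<^sup>2"
  have \<eta>: "0 < \<eta>" using m ab by (simp add: \<eta>_def)
  define \<theta> where "\<theta> = max 0 (1 - \<eta> * (b / Mx)\<^sup>2)"
  have \<theta>: "0 \<le> \<theta>" "\<theta> < 1" using \<eta> ab Mx by (auto simp: \<theta>_def)
  \<comment> \<open>for suitable \<open>\<eta>\<close> this is between \<open>0\<close> and a fixed multiple \<open>\<theta> < 1\<close> of the squared weight on the interval\<close>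
  define k where "k = q\<^sup>2 - smult \<eta> ([:- s, 1:]\<^sup>2)"
  have kv: "poly k t = (poly q t)\<^sup>2 - \<eta> * (t - s)\<^sup>2" for t by (simp add: k_def poly_power)
  have degk: "degree k \<le> 2" unfolding k_def
  proof (intro degree_diff_le order.trans[OF degree_smult_le])
    show "degree (q\<^sup>2) \<le> 2" using degq degree_power_le[of q 2] by linarith
    show "degree ([:- s, 1:]\<^sup>2) \<le> 2" using degree_power_le[of "[:- s, 1:]" 2] by simp
  qed
  have kb: "\<bar>poly k t\<bar> \<le> \<theta> * (poly q t)\<^sup>2" if t: "\<bar>t\<bar> \<le> 1" for t
  proof -
    have "\<eta> * (t - s)\<^sup>2 \<le> (poly q t)\<^sup>2"
    proof -
      have "\<eta> * (t - s)\<^sup>2 = (m / a * \<bar>t - s\<bar>)\<^sup>2" by (simp add: \<eta>_def power_mult_distrib power_divide)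
      also have "\<dots> \<le> (m / a * a)\<^sup>2" using dist(2)[OF t] m ab by (intro power_mono mult_left_mono) auto
      also have "\<dots> = m\<^sup>2" using ab by simp
      also have "\<dots> \<le> \<bar>poly q t\<bar>\<^sup>2" using mb(1)[OF t] m by (intro power_mono) auto
      finally show ?thesis by simp
    qed
    then have "0 \<le> poly k t" by (simp add: kv)
    moreover have "(1 - \<eta> * (b / Mx)\<^sup>2) * (poly q t)\<^sup>2 \<ge> poly k t"
    proof -
      have "\<eta> * ((b / Mx)\<^sup>2 * (poly q t)\<^sup>2) \<le> \<eta> * (t - s)\<^sup>2"
      proof (intro mult_left_mono)
        have "(b / Mx)\<^sup>2 * (poly q t)\<^sup>2 = (b * (\<bar>poly q t\<bar> / Mx))\<^sup>2" by (simp add: power_mult_distrib power_divide)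
        also have "\<dots> \<le> (\<bar>t - s\<bar> * 1)\<^sup>2"
          using mb(2)[OF t] dist(1)[OF t] Mx ab by (intro power_mono mult_mono) auto
        finally show "(b / Mx)\<^sup>2 * (poly q t)\<^sup>2 \<le> (t - s)\<^sup>2" by simp
      qed (use \<eta> in simp)
      then show ?thesis by (simp add: kv algebra_simps)
    qed
    moreover have "(1 - \<eta> * (b / Mx)\<^sup>2) * (poly q t)\<^sup>2 \<le> \<theta> * (poly q t)\<^sup>2"
      by (intro mult_right_mono) (auto simp: \<theta>_def)
    ultimately show ?thesis by linarith
  qed
  define N where "N = card Q"
  have N: "0 < N" using s Q(1) by (auto simp: N_def card_gt_0_iff)
  define P where "P = (\<Prod>u\<in>Q - {s}. [:- u, 1:])"
  have degP: "degree P = N - 1" unfolding P_def using s Q(1)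
    by (subst degree_prod_eq_sum_degree) (auto simp: N_def)
  have Ps: "poly P s \<noteq> 0" unfolding P_def using Q(1) by (simp add: poly_prod)
  have "continuous_on {-1..1} (\<lambda>t. \<bar>poly P t\<bar>)" by (intro continuous_intros)
  then obtain tB where tB: "\<And>t. t \<in> {-1..1} \<Longrightarrow> \<bar>poly P t\<bar> \<le> \<bar>poly P tB\<bar>"
    using continuous_attains_sup[OF I] by metis
  define B where "B = \<bar>poly P tB\<bar>"
  have B: "\<bar>poly P t\<bar> \<le> B" if "\<bar>t\<bar> \<le> 1" for t using tB[of t] that by (auto simp: B_def abs_le_iff)
  define c where "c = poly q s ^ N / poly P s"
  have "(\<lambda>j. \<bar>c\<bar> * B / m ^ N * \<theta> ^ j) \<longlonglongrightarrow> \<bar>c\<bar> * B / m ^ N * 0"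
    using \<theta> by (intro tendsto_intros LIMSEQ_realpow_zero) auto
  then have "eventually (\<lambda>j. \<bar>c\<bar> * B / m ^ N * \<theta> ^ j < \<delta>) sequentially"
    using \<delta> by (intro order_tendstoD(2)) auto
  then obtain j0 where j0: "\<And>j. j \<ge> j0 \<Longrightarrow> \<bar>c\<bar> * B / m ^ N * \<theta> ^ j < \<delta>"
    by (auto simp: eventually_sequentially)
  show ?thesis unfolding q_def[symmetric]
  proof (intro exI[of _ "2 * j0 + N"] allI impI)
    fix n assume n: "2 * j0 + N \<le> n"
    define j where "j = (n - N) div 2"
    define i where "i = (n - N) mod 2"
    have nij: "n = 2 * j + i + N" "j \<ge> j0" using n by (auto simp: i_def j_def)
    define l where "l = smult c (k ^ j * q ^ i * P)"
    have lv: "poly l t = c * (poly k t ^ j * poly q t ^ i * poly P t)" for t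
      by (simp add: l_def poly_power)
    have "degree l < n"
    proof -
      have "degree l \<le> degree (k ^ j) + degree (q ^ i) + degree P"
        unfolding l_def by (meson degree_smult_le degree_mult_le order.trans add_mono order_refl)
      also have "\<dots> \<le> 2 * j + i + (N - 1)"
      proof (intro add_mono)
        show "degree (k ^ j) \<le> 2 * j" using degree_power_le[of k j] mult_right_mono[OF degk, of j] by linarith
        show "degree (q ^ i) \<le> i" using degree_power_le[of q i] mult_right_mono[OF degq, of i] by linarith
      qed (simp add: degP)
      also have "\<dots> < n" using nij N by simp
      finally show ?thesis .
    qed
    moreover have "poly l u = (if u = s then poly q s ^ n else 0)" if u: "u \<in> Q" for u
    proof (cases "u = s")
      case True
      have "poly l s = c * (((poly q s)\<^sup>2) ^ j * poly q s ^ i * poly P s)" by (simp add: lv kv)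
      also have "\<dots> = poly q s ^ N * (poly q s ^ (2 * j) * poly q s ^ i)"
        using Ps by (simp add: c_def power_mult)
      also have "\<dots> = poly q s ^ n" by (simp add: nij(1) power_add)
      finally show ?thesis using True by simp
    next
      case False
      then have "poly P u = 0" using u Q(1) by (auto simp: P_def poly_prod)
      then show ?thesis using False by (simp add: lv)
    qed
    moreover have "\<bar>poly l t\<bar> \<le> \<delta> * \<bar>poly q t\<bar> ^ n" if t: "\<bar>t\<bar> \<le> 1" for t
    proof -
      define y where "y = \<bar>poly q t\<bar>"
      have y: "m \<le> y" "0 < y" using mb(1)[OF t] m by (auto simp: y_def)
      have "\<bar>poly l t\<bar> = \<bar>c\<bar> * (\<bar>poly k t\<bar> ^ j * y ^ i * \<bar>poly P t\<bar>)"
        by (simp add: lv abs_mult power_abs y_def)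
      also have "\<dots> \<le> \<bar>c\<bar> * ((\<theta> * y\<^sup>2) ^ j * y ^ i * B)"
        using kb[OF t] B[OF t] \<theta> y by (intro mult_left_mono mult_mono power_mono) (auto simp: y_def)
      also have "\<dots> = \<bar>c\<bar> * B * \<theta> ^ j * y ^ (2 * j + i)"
        by (simp add: power_mult_distrib power_add power_mult)
      also have "\<dots> = \<bar>c\<bar> * B / m ^ N * \<theta> ^ j * (y ^ (2 * j + i) * m ^ N)"
        using m by simp
      also have "\<dots> \<le> \<bar>c\<bar> * B / m ^ N * \<theta> ^ j * (y ^ (2 * j + i) * y ^ N)"
        using y m \<theta> B[OF t] by (intro mult_left_mono power_mono mult_nonneg_nonneg divide_nonneg_nonneg) auto
      also have "y ^ (2 * j + i) * y ^ N = y ^ n" by (simp add: nij(1) power_add)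
      also have "\<bar>c\<bar> * B / m ^ N * \<theta> ^ j * y ^ n \<le> \<delta> * y ^ n"
        using j0[OF nij(2)] y by (intro mult_right_mono) auto
      finally show ?thesis by (simp add: y_def)
    qed
    ultimately show "\<exists>l. degree l < n \<and> (\<forall>u\<in>Q. poly l u = (if u = s then poly q s ^ n else 0)) \<and>
        (\<forall>t. \<bar>t\<bar> \<le> 1 \<longrightarrow> \<bar>poly l t\<bar> \<le> \<delta> * \<bar>poly q t\<bar> ^ n)" by blast
  qed
qed

section \<open>Lower bound from finitely many points\<close>

text \<open>For \<open>|c| \<le> 1\<close>, correct \<open>p / L - c * q ^ n\<close> by small interpolants so that it vanishes on \<open>Q\<close>. Its
  logarithmic mean over the interval then contains the Green functions at \<open>Q\<close>. On the interval it
  equals \<open>q ^ n * (V - c * U)\<close> with \<open>U\<close> close to \<open>1\<close> and \<open>|V|\<close> at most slightly above \<open>1\<close>, so averaging over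
  \<open>c\<close> first gives nearly \<open>- ln 2\<close> plus the mean of the weight.\<close>

lemma widom_lower_bound_finite:
  assumes r: "\<And>t. \<bar>t\<bar> \<le> 1 \<Longrightarrow> poly (weight_poly r) t \<noteq> 0"
    and Q: "finite Q" "\<And>s. s \<in> Q \<Longrightarrow> 1 < \<bar>s\<bar>" "\<And>s. s \<in> Q \<Longrightarrow> poly (weight_poly r) s \<noteq> 0"
    and \<epsilon>: "0 < \<epsilon>"
  shows "\<exists>n0. \<forall>n\<ge>n0. \<forall>p L. degree p = n \<and> lead_coeff p = 1 \<and> 0 < L \<and> (r \<noteq> None \<longrightarrow> L < 1) \<and>
      (\<forall>s\<in>{-1..1} \<union> Q. \<bar>poly p s\<bar> \<le> L * \<bar>poly (weight_poly r) s\<bar> ^ n) \<longrightarrow>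
      lead_mean r L + (\<Sum>s\<in>Q. green_slit (complex_of_real s)) \<le> n * ln 2 + n * weight_mean r - ln 2 + \<epsilon>"
proof -
  define q where "q = weight_poly r"
  define e where "e = weight_lead r"
  let ?g = "\<lambda>s. green_slit (complex_of_real s)"
  \<comment> \<open>the mean of \<open>ln |V - c * U|\<close> over \<open>c\<close> exceeds \<open>- ln 2\<close> by at most \<open>\<phi> \<eta>\<close>\<close>
  define \<phi> where "\<phi> \<eta> = ln (1 + \<eta>) + ?g ((1 + \<eta>) / (1 - \<eta>))" for \<eta> :: real
  have "isCont green_slit 1"
    using continuous_on_green_slit[of UNIV] by (simp add: continuous_on_eq_continuous_at)
  then have "(\<phi> \<longlongrightarrow> \<phi> 0) (at 0)"
    unfolding \<phi>_def
    by (intro tendsto_intros isCont_tendsto_compose[of _ green_slit]) (auto intro!: tendsto_eq_intros)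
  moreover have "\<phi> 0 = 0" by (simp add: \<phi>_def green_slit_def)
  ultimately have "eventually (\<lambda>\<eta>. \<phi> \<eta> < \<epsilon>) (at 0)"
    using \<epsilon> by (intro order_tendstoD(2)[of \<phi> 0]) auto
  then obtain d where d: "d > 0" "\<And>\<eta>. \<eta> \<noteq> 0 \<Longrightarrow> \<bar>\<eta>\<bar> < d \<Longrightarrow> \<phi> \<eta> < \<epsilon>"
    unfolding eventually_at by (auto simp: dist_real_def)
  define \<eta> where "\<eta> = min (d / 2) (1 / 2)"
  have \<eta>: "0 < \<eta>" "\<eta> < 1" "\<phi> \<eta> < \<epsilon>"
    using d(1) d(2)[of \<eta>] by (auto simp: \<eta>_def)
  define \<delta> where "\<delta> = \<eta> / (card Q + 1)"
  have \<delta>: "0 < \<delta>" "card Q * \<delta> \<le> \<eta>"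
    using \<eta> by (auto simp: \<delta>_def field_simps)
  have "\<forall>s\<in>Q. eventually (\<lambda>n. \<exists>l :: real poly. degree l < n \<and>
     (\<forall>u\<in>Q. poly l u = (if u = s then poly q s ^ n else 0)) \<and>
     (\<forall>t. \<bar>t\<bar> \<le> 1 \<longrightarrow> \<bar>poly l t\<bar> \<le> \<delta> * \<bar>poly q t\<bar> ^ n)) sequentially"
    unfolding eventually_sequentially q_def using small_interpolants[OF r Q _ \<delta>(1)] by blast
  then have "eventually (\<lambda>n. \<forall>s\<in>Q. \<exists>l :: real poly. degree l < n \<and>
     (\<forall>u\<in>Q. poly l u = (if u = s then poly q s ^ n else 0)) \<and>
     (\<forall>t. \<bar>t\<bar> \<le> 1 \<longrightarrow> \<bar>poly l t\<bar> \<le> \<delta> * \<bar>poly q t\<bar> ^ n)) sequentially"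
    using Q(1) by (simp add: eventually_ball_finite_distrib)
  then obtain n0 where n0: "\<And>n. n \<ge> n0 \<Longrightarrow> \<forall>s\<in>Q. \<exists>l :: real poly. degree l < n \<and>
     (\<forall>u\<in>Q. poly l u = (if u = s then poly q s ^ n else 0)) \<and>
     (\<forall>t. \<bar>t\<bar> \<le> 1 \<longrightarrow> \<bar>poly l t\<bar> \<le> \<delta> * \<bar>poly q t\<bar> ^ n)"
    by (auto simp: eventually_sequentially)
  show ?thesis
  proof (intro exI[of _ "max n0 1"] allI impI)
    fix n p L
    assume n: "max n0 1 \<le> n"
    assume "degree p = n \<and> lead_coeff p = 1 \<and> 0 < L \<and> (r \<noteq> None \<longrightarrow> L < 1) \<and>
      (\<forall>s\<in>{-1..1} \<union> Q. \<bar>poly p s\<bar> \<le> L * \<bar>poly (weight_poly r) s\<bar> ^ n)"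
    then have p: "degree p = n" "coeff p n = 1" and L: "0 < L" "r \<noteq> None \<longrightarrow> L < 1"
      and bound: "\<And>s. s \<in> {-1..1} \<union> Q \<Longrightarrow> \<bar>poly p s\<bar> \<le> L * \<bar>poly q s\<bar> ^ n"
      by (auto simp: q_def)
    obtain l :: "real \<Rightarrow> real poly" where l: "\<And>s. s \<in> Q \<Longrightarrow> degree (l s) < n"
      "\<And>s u. s \<in> Q \<Longrightarrow> u \<in> Q \<Longrightarrow> poly (l s) u = (if u = s then poly q s ^ n else 0)"
      "\<And>s t. s \<in> Q \<Longrightarrow> \<bar>t\<bar> \<le> 1 \<Longrightarrow> \<bar>poly (l s) t\<bar> \<le> \<delta> * \<bar>poly q t\<bar> ^ n"
      using bchoice[OF n0[of n]] n by (auto simp del: One_nat_def)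
    have eL: "e * c < 1 / L" if "\<bar>c\<bar> \<le> 1" for c
    proof (cases r)
      case (Some s)
      then have "1 < 1 / L" using L by simp
      then show ?thesis using that Some by (simp add: e_def weight_lead_def)
    qed (use L in \<open>simp add: e_def weight_lead_def\<close>)
    define \<beta> where "\<beta> s = poly p s / (L * poly q s ^ n)" for s
    have \<beta>: "\<bar>\<beta> s\<bar> \<le> 1" if "s \<in> {-1..1} \<union> Q" for s
    proof -
      have "poly q s \<noteq> 0" using that r[of s] Q(3)[of s] by (auto simp: q_def abs_le_iff)
      then show ?thesis using bound[OF that] L
        by (simp add: \<beta>_def abs_mult power_abs divide_le_eq)
    qed
    \<comment> \<open>the interpolants have degree less than \<open>n\<close>, so they leave the leading coefficient unchanged\<close>
    define R where "R c = smult (1 / L) p - smult c (q ^ n) - (\<Sum>s\<in>Q. smult (\<beta> s - c) (l s))" for c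
    have degR: "degree (R c) \<le> n" for c
      unfolding R_def q_def using p weight_poly_power(1)[of r n] l(1)
      by (intro degree_diff_le degree_sum_le Q(1) order.trans[OF degree_smult_le]) (auto intro: less_imp_le)
    have lcR: "coeff (R c) n = 1 / L - e * c" for c
    proof -
      have "coeff (\<Sum>s\<in>Q. smult (\<beta> s - c) (l s)) n = 0"
        unfolding coeff_sum using l(1) by (intro sum.neutral) (auto simp: coeff_eq_0)
      then show ?thesis using p(2) weight_poly_power(2)[of n r] n by (simp add: R_def q_def e_def mult.commute)
    qed
    have Rlead: "degree (R c) = n" "lead_coeff (R c) = 1 / L - e * c" "R c \<noteq> 0" if "\<bar>c\<bar> \<le> 1" for c
    proof -
      have "coeff (R c) n \<noteq> 0" unfolding lcR using eL[OF that] by simp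
      then show "degree (R c) = n" "R c \<noteq> 0" using degR[of c] by (auto intro: le_antisym le_degree)
      then show "lead_coeff (R c) = 1 / L - e * c" using lcR[of c] by simp
    qed
    have Rroot: "poly (R c) u = 0" if u: "u \<in> Q" for c u
    proof -
      have "poly q u \<noteq> 0" using Q(3)[OF u] by (simp add: q_def)
      have "poly (\<Sum>s\<in>Q. smult (\<beta> s - c) (l s)) u = (\<Sum>s\<in>Q. if s = u then (\<beta> u - c) * poly q u ^ n else 0)"
        unfolding poly_sum using l(2)[OF _ u] by (intro sum.cong) auto
      also have "\<dots> = (\<beta> u - c) * poly q u ^ n" using Q(1) u by simp
      finally have "poly (R c) u = poly p u / L - c * poly q u ^ n - (\<beta> u - c) * poly q u ^ n"
        unfolding R_def by simp
      also have "poly p u / L = \<beta> u * poly q u ^ n" using \<open>poly q u \<noteq> 0\<close> L by (simp add: \<beta>_def)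
      finally show ?thesis by (simp add: algebra_simps)
    qed
    define \<rho> where "\<rho> s t = poly (l s) t / poly q t ^ n" for s t
    define V where "V t = \<beta> t - (\<Sum>s\<in>Q. \<beta> s * \<rho> s t)" for t
    define U where "U t = 1 - (\<Sum>s\<in>Q. \<rho> s t)" for t
    have \<rho>: "\<bar>\<rho> s t\<bar> \<le> \<delta>" if "s \<in> Q" "\<bar>t\<bar> \<le> 1" for s t
      using l(3)[OF that] r[OF that(2)] by (simp add: \<rho>_def power_abs divide_le_eq q_def)
    have U: "\<bar>U t - 1\<bar> \<le> \<eta>" if t: "\<bar>t\<bar> \<le> 1" for t
    proof -
      have "\<bar>\<Sum>s\<in>Q. \<rho> s t\<bar> \<le> (\<Sum>s\<in>Q. \<delta>)"
        by (rule order.trans[OF sum_abs sum_mono]) (use \<rho> t in auto)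
      then show ?thesis using \<delta>(2) by (simp add: U_def)
    qed
    have V: "\<bar>V t\<bar> \<le> 1 + \<eta>" if t: "\<bar>t\<bar> \<le> 1" for t
    proof -
      have "\<bar>\<Sum>s\<in>Q. \<beta> s * \<rho> s t\<bar> \<le> (\<Sum>s\<in>Q. \<delta>)"
      proof (rule order.trans[OF sum_abs sum_mono])
        fix s assume s: "s \<in> Q"
        have "\<bar>\<beta> s\<bar> * \<bar>\<rho> s t\<bar> \<le> 1 * \<delta>" using \<beta>[of s] \<rho>[OF s t] s by (intro mult_mono) auto
        then show "\<bar>\<beta> s * \<rho> s t\<bar> \<le> \<delta>" by (simp add: abs_mult)
      qed
      moreover have "\<bar>\<beta> t\<bar> \<le> 1" using \<beta>[of t] t by (auto simp: abs_le_iff)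
      ultimately show ?thesis using \<delta>(2) unfolding V_def by (simp add: abs_le_iff)
    qed
    have Rval: "poly (R c) t = poly q t ^ n * (V t - c * U t)" if t: "\<bar>t\<bar> \<le> 1" for c t
    proof -
      have q0: "poly q t ^ n \<noteq> 0" using r[OF t] by (simp add: q_def)
      have "poly q t ^ n * (\<beta> s * \<rho> s t) - poly q t ^ n * (c * \<rho> s t) = (\<beta> s - c) * poly (l s) t" for s
        using q0 by (simp add: \<rho>_def left_diff_distrib)
      then have "(\<Sum>s\<in>Q. (\<beta> s - c) * poly (l s) t) = poly q t ^ n * ((\<Sum>s\<in>Q. \<beta> s * \<rho> s t) - c * (\<Sum>s\<in>Q. \<rho> s t))"
        by (simp add: sum_distrib_left right_diff_distrib sum_subtractf[symmetric])
      moreover have "poly p t / L = poly q t ^ n * \<beta> t" using q0 L by (simp add: \<beta>_def)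
      ultimately show ?thesis by (simp add: R_def poly_sum V_def U_def algebra_simps)
    qed
    define G where "G = ?g ((1 + \<eta>) / (1 - \<eta>))"
    let ?C = "\<lambda>M. M * ln (1 + \<eta>) + (M * (G - ln 2) + ln 2)"
    have main: "M * (lead_mean r L + (\<Sum>s\<in>Q. ?g s) - (n * ln 2 + n * weight_mean r - ln 2 + \<phi> \<eta>)) \<le> ln 2"
      if M: "M > 0" for M :: nat
    proof -
      let ?\<tau> = "cheb_node M"
      have "\<exists>f J S. finite S \<and> (f has_integral J) {0..1} \<and>
          ln \<bar>lead_coeff (R (?\<tau> m))\<bar> + (\<Sum>s\<in>Q. ?g s) - degree (R (?\<tau> m)) * ln 2 \<le> J \<and>
          (\<forall>x\<in>{0..1} - S. f x \<le> ln \<bar>poly (R (?\<tau> m)) (cos (2 * pi * x))\<bar> \<and> poly (R (?\<tau> m)) (cos (2 * pi * x)) \<noteq> 0)" for m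
        by (rule log_minorant[OF Rlead(3)[OF cheb_node_range] Q(1) Rroot]) blast+
      then obtain f J S where fJS: "\<And>m. finite (S m)" "\<And>m. (f m has_integral J m) {0..1}"
         "\<And>m. ln \<bar>lead_coeff (R (?\<tau> m))\<bar> + (\<Sum>s\<in>Q. ?g s) - degree (R (?\<tau> m)) * ln 2 \<le> J m"
         "\<And>m x. x \<in> {0..1} - S m \<Longrightarrow> f m x \<le> ln \<bar>poly (R (?\<tau> m)) (cos (2 * pi * x))\<bar> \<and> poly (R (?\<tau> m)) (cos (2 * pi * x)) \<noteq> 0"
        by metis
      define SS where "SS = (\<Union>m<M. S m)"
      have finSS: "finite SS" unfolding SS_def using fJS(1) by auto
      define h where "h x = M * n * ln \<bar>poly q (cos (2 * pi * x))\<bar> + ?C M" for x :: real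
      have hint: "(h has_integral M * n * weight_mean r + ?C M) {0..1}"
      proof -
        have "((\<lambda>x. ?C M) has_integral ?C M) {0..1::real}"
          using has_integral_const_real[of "?C M" 0 1] by simp
        moreover have "((\<lambda>x. M * n * ln \<bar>poly q (cos (2 * pi * x))\<bar>) has_integral M * n * weight_mean r) {0..1}"
          unfolding q_def by (intro has_integral_mult_right weight_mean_integral)
        ultimately show ?thesis unfolding h_def by (rule has_integral_add[rotated])
      qed
      define F where "F x = (\<Sum>m<M. f m x)" for x
      have Fint: "(F has_integral (\<Sum>m<M. J m)) {0..1}"
        unfolding F_def by (intro has_integral_sum fJS(2)) auto
      have le: "F x \<le> h x" if x: "x \<in> {0..1} - SS" for x
      proof -
        define t where "t = cos (2 * pi * x)"
        have t: "\<bar>t\<bar> \<le> 1" by (simp add: t_def)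
        have xS: "x \<in> {0..1} - S m" if "m < M" for m using x that by (auto simp: SS_def)
        have Rnz: "poly (R (?\<tau> m)) t \<noteq> 0" if "m < M" for m using fJS(4)[OF xS[OF that]] by (simp add: t_def)
        have Ub: "1 - \<eta> \<le> U t" "U t \<le> 1 + \<eta>" using U[OF t] by (auto simp: abs_le_iff)
        have Upos: "0 < U t" using Ub(1) \<eta>(2) by simp
        define w where "w = V t / U t"
        have qpos: "0 < \<bar>poly q t\<bar> ^ n" using r[OF t] by (simp add: q_def)
        have Rw: "\<bar>poly (R c) t\<bar> = \<bar>poly q t\<bar> ^ n * (U t * \<bar>w - c\<bar>)" for c
        proof -
          have "V t - c * U t = U t * (w - c)" using Upos by (simp add: w_def field_simps)
          then show ?thesis using Upos unfolding Rval[OF t] by (simp add: abs_mult power_abs)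
        qed
        have wne: "w \<noteq> ?\<tau> m" if "m < M" for m using Rnz[OF that] Rw[of "?\<tau> m"] by auto
        have w: "\<bar>w\<bar> \<le> (1 + \<eta>) / (1 - \<eta>)"
          unfolding w_def abs_divide using V[OF t] Ub \<eta> Upos by (intro frac_le) auto
        have "F x \<le> (\<Sum>m<M. ln \<bar>poly (R (?\<tau> m)) t\<bar>)"
          unfolding F_def t_def using fJS(4)[OF xS] by (intro sum_mono) auto
        also have "\<dots> = (\<Sum>m<M. (n * ln \<bar>poly q t\<bar> + ln (U t)) + ln \<bar>w - ?\<tau> m\<bar>)"
        proof (intro sum.cong refl)
          fix m assume "m \<in> {..<M}"
          then have "0 < \<bar>w - ?\<tau> m\<bar>" using wne by simp
          then have "ln (\<bar>poly q t\<bar> ^ n * (U t * \<bar>w - ?\<tau> m\<bar>)) = ln (\<bar>poly q t\<bar> ^ n) + (ln (U t) + ln \<bar>w - ?\<tau> m\<bar>)"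
            using qpos Upos by (subst ln_mult_pos, simp, simp, subst ln_mult_pos) simp_all
          moreover have "ln (\<bar>poly q t\<bar> ^ n) = n * ln \<bar>poly q t\<bar>"
            using r[OF t] by (simp add: ln_realpow q_def)
          ultimately show "ln \<bar>poly (R (?\<tau> m)) t\<bar> = (n * ln \<bar>poly q t\<bar> + ln (U t)) + ln \<bar>w - ?\<tau> m\<bar>"
            unfolding Rw by simp
        qed
        also have "\<dots> = M * (n * ln \<bar>poly q t\<bar> + ln (U t)) + (\<Sum>m<M. ln \<bar>w - ?\<tau> m\<bar>)"
          by (simp add: sum.distrib distrib_left)
        also have "\<dots> \<le> M * (n * ln \<bar>poly q t\<bar> + ln (1 + \<eta>)) + (M * (G - ln 2) + ln 2)"
        proof (intro add_mono mult_left_mono)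
          show "ln (U t) \<le> ln (1 + \<eta>)" using Upos Ub by (intro ln_mono) auto
          have "(\<Sum>m<M. ln \<bar>w - ?\<tau> m\<bar>) \<le> M * (?g w - ln 2) + ln 2"
            by (rule sum_ln_dist_cheb_nodes_le[OF M wne])
          also have "?g w \<le> G" unfolding G_def using w \<eta> by (intro green_slit_mono) auto
          then have "M * (?g w - ln 2) + ln 2 \<le> M * (G - ln 2) + ln 2"
            by (intro add_right_mono mult_left_mono diff_right_mono) auto
          finally show "(\<Sum>m<M. ln \<bar>w - ?\<tau> m\<bar>) \<le> M * (G - ln 2) + ln 2" .
        qed auto
        also have "\<dots> = h x" by (simp add: h_def t_def algebra_simps)
        finally show ?thesis .
      qed
      define F' where "F' x = (if x \<in> SS then h x else F x)" for x
      have "(F' has_integral (\<Sum>m<M. J m)) {0..1}"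
        by (rule has_integral_spike_finite[OF finSS _ Fint]) (auto simp: F'_def)
      then have "(\<Sum>m<M. J m) \<le> M * n * weight_mean r + ?C M"
        by (rule has_integral_le[OF _ hint]) (use le in \<open>auto simp: F'_def\<close>)
      moreover have "(\<Sum>m<M. ln \<bar>1 / L - e * ?\<tau> m\<bar> + (\<Sum>s\<in>Q. ?g s) - n * ln 2) \<le> (\<Sum>m<M. J m)"
      proof (rule sum_mono)
        fix m
        show "ln \<bar>1 / L - e * ?\<tau> m\<bar> + (\<Sum>s\<in>Q. ?g s) - n * ln 2 \<le> J m"
          using fJS(3)[of m] unfolding Rlead(1)[OF cheb_node_range] lcR .
      qed
      moreover have "(\<Sum>m<M. ln \<bar>1 / L - e * ?\<tau> m\<bar> + (\<Sum>s\<in>Q. ?g s) - n * ln 2) =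
          (\<Sum>m<M. ln \<bar>1 / L - e * ?\<tau> m\<bar>) + M * ((\<Sum>s\<in>Q. ?g s) - n * ln 2)"
        by (simp add: sum.distrib sum_subtractf algebra_simps)
      moreover have "M * lead_mean r L \<le> (\<Sum>m<M. ln \<bar>1 / L - e * ?\<tau> m\<bar>)"
      proof (cases r)
        case None
        then show ?thesis using L by (simp add: lead_mean_def e_def weight_lead_def ln_divide_pos)
      next
        case (Some s)
        then have "1 < \<bar>1 / L\<bar>" using L by simp
        from sum_ln_dist_cheb_nodes_ge[OF M this] show ?thesis
          using Some by (simp add: lead_mean_def e_def weight_lead_def)
      qed
      ultimately have "M * lead_mean r L + M * ((\<Sum>s\<in>Q. ?g s) - n * ln 2) \<le> M * n * weight_mean r + ?C M"
        by linarith
      moreover have "\<phi> \<eta> = ln (1 + \<eta>) + G" by (simp only: \<phi>_def G_def)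
      ultimately show ?thesis by (simp add: algebra_simps)
    qed
    have "lead_mean r L + (\<Sum>s\<in>Q. ?g s) - (n * ln 2 + n * weight_mean r - ln 2 + \<phi> \<eta>) \<le> 0"
      by (rule bounded_slope_imp_nonpos[OF main])
    then show "lead_mean r L + (\<Sum>s\<in>Q. ?g s) \<le> n * ln 2 + n * weight_mean r - ln 2 + \<epsilon>"
      using \<eta>(3) by simp
  qed
qed

section \<open>Limit of the normalized weighted minima\<close>

text \<open>A possibly infinite sum of nonnegative terms is the supremum of its finite partial sums, so bounds of these
  two kinds determine the limit also when it is infinite.\<close>

lemma limit_of_sum_bounds:
  fixes W :: "nat \<Rightarrow> real" and g :: "'a \<Rightarrow> real"
  assumes g: "\<And>s. 0 \<le> g s"
    and low: "\<And>F c. finite F \<Longrightarrow> F \<subseteq> D \<Longrightarrow> c < sum g F \<Longrightarrow> eventually (\<lambda>n. 2 * exp c \<le> W n) sequentially"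
    and up: "\<And>S \<delta>. (\<And>F. finite F \<Longrightarrow> F \<subseteq> D \<Longrightarrow> sum g F \<le> S) \<Longrightarrow> 0 < \<delta> \<Longrightarrow> eventually (\<lambda>n. W n \<le> 2 * exp S + \<delta>) sequentially"
  shows "(\<lambda>n. ereal (W n)) \<longlonglongrightarrow> 2 * exp_ereal (\<Sum>\<^sub>\<infinity>s\<in>D. ereal (g s))"
proof -
  define I where "I = (\<Sum>\<^sub>\<infinity>s\<in>D. ereal (g s))"
  have I: "I = (SUP F\<in>{F. finite F \<and> F \<subseteq> D}. ereal (sum g F))"
  proof -
    have "I = (SUP F\<in>{F. finite F \<and> F \<subseteq> D}. (\<Sum>s\<in>F. ereal (g s)))"
      unfolding I_def by (rule nonneg_infsum_complete) (use g in auto)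
    then show ?thesis by (simp only: sum_ereal)
  qed
  have I0: "0 \<le> I" unfolding I by (rule SUP_upper2[of "{}"]) auto
  have ex: "\<exists>F. finite F \<and> F \<subseteq> D \<and> c < sum g F" if "ereal c < I" for c
    using that unfolding I less_SUP_iff by auto
  have low': "eventually (\<lambda>n. ereal a < ereal (W n)) sequentially" if a: "a < 2 * exp c" "ereal c < I" for a c
  proof -
    obtain F where "finite F" "F \<subseteq> D" "c < sum g F" using ex[OF a(2)] by blast
    from low[OF this] show ?thesis by (rule eventually_mono) (use a in auto)
  qed
  show ?thesis unfolding I_def[symmetric]
  proof (cases I)
    case PInf
    have "exp_ereal \<infinity> = \<infinity>" using exp_ereal.simps(2) by (simp only: infinity_ereal_def)
    then have lim: "2 * exp_ereal I = \<infinity>" using PInf by simp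
    show "(\<lambda>n. ereal (W n)) \<longlonglongrightarrow> 2 * exp_ereal I"
      unfolding lim tendsto_PInfty
    proof
      fix a :: real
      define c where "c = ln (\<bar>a\<bar> + 1)"
      have "a < 2 * exp c" by (simp add: c_def)
      then show "eventually (\<lambda>n. ereal a < ereal (W n)) sequentially"
        by (rule low') (simp add: PInf)
    qed
  next
    case MInf
    then show "(\<lambda>n. ereal (W n)) \<longlonglongrightarrow> 2 * exp_ereal I" using I0 by simp
  next
    case (real S)
    have S: "sum g F \<le> S" if "finite F" "F \<subseteq> D" for F
    proof -
      have "ereal (sum g F) \<le> I" unfolding I by (rule SUP_upper) (use that in auto)
      then show ?thesis using real by simp
    qed
    have "W \<longlonglongrightarrow> 2 * exp S"
    proof (rule order_tendstoI)
      fix a assume a: "a < 2 * exp S"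
      define c where "c = (if a \<le> 0 then S - 1 else (ln (a / 2) + S) / 2)"
      have "c < S \<and> a < 2 * exp c"
      proof (cases "a \<le> 0")
        case True
        then show ?thesis using exp_gt_zero[of c] by (auto simp: c_def intro: le_less_trans)
      next
        case False
        then have "ln (a / 2) < ln (exp S)" using a by (subst ln_less_cancel_iff) auto
        then have "ln (a / 2) < S" by simp
        then have "c < S" "ln (a / 2) < c" using False by (auto simp: c_def)
        then have "exp (ln (a / 2)) < exp c" by simp
        then show ?thesis using False \<open>c < S\<close> by simp
      qed
      then show "eventually (\<lambda>n. a < W n) sequentially" using low'[of a c] real by simp
    next
      fix a assume a: "2 * exp S < a"
      define \<delta> where "\<delta> = (a - 2 * exp S) / 2"
      have \<delta>: "0 < \<delta>" "2 * exp S + \<delta> < a" using a by (auto simp: \<delta>_def field_simps)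
      have "eventually (\<lambda>n. W n \<le> 2 * exp S + \<delta>) sequentially" by (rule up[OF S \<delta>(1)])
      then show "eventually (\<lambda>n. W n < a) sequentially" by (rule eventually_mono) (use \<delta> in auto)
    qed
    then have "(\<lambda>n. ereal (W n)) \<longlonglongrightarrow> ereal (2 * exp S)" by simp
    moreover have "2 * exp_ereal I = ereal (2 * exp S)" using real by (simp add: numeral_eq_ereal)
    ultimately show "(\<lambda>n. ereal (W n)) \<longlonglongrightarrow> 2 * exp_ereal I" by simp
  qed
qed

text \<open>Summing the values of both polynomials with the alternating divided difference weights
  compares their norms on the alternation set.\<close>

lemma alternation_minimal:
  fixes p :: "real poly"
  assumes t: "increasing_upto n t" and p: "degree p \<le> n" "coeff p n = 1"
    and alt: "\<And>i. i \<le> n \<Longrightarrow> poly p (t i) = (-1) ^ (n - i) * (L * \<kappa> (t i))" and \<kappa>: "\<And>i. i \<le> n \<Longrightarrow> 0 < \<kappa> (t i)"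
    and q: "degree q \<le> n" "coeff q n = 1" "\<And>i. i \<le> n \<Longrightarrow> \<bar>poly q (t i)\<bar> \<le> L' * \<kappa> (t i)"
  shows "L \<le> L'"
proof -
  define N where "N = (\<Sum>i\<le>n. \<kappa> (t i) / \<bar>node_prod t n i\<bar>)"
  have N: "0 < N" unfolding N_def using \<kappa> node_prod_sign(2)[OF t] by (intro sum_pos) auto
  have sq: "(-1) ^ k * ((-1) ^ k * r) = (r :: real)" for k r by (cases "even k") auto
  have "1 = (\<Sum>i\<le>n. (-1) ^ (n - i) * poly p (t i) / \<bar>node_prod t n i\<bar>)"
    by (rule monic_alternating_sum[OF t p, symmetric])
  also have "\<dots> = (\<Sum>i\<le>n. L * (\<kappa> (t i) / \<bar>node_prod t n i\<bar>))"
    using alt by (intro sum.cong) (auto simp: sq)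
  finally have "1 = L * N" by (simp only: N_def sum_distrib_left)
  have "1 = (\<Sum>i\<le>n. (-1) ^ (n - i) * poly q (t i) / \<bar>node_prod t n i\<bar>)"
    by (rule monic_alternating_sum[OF t q(1,2), symmetric])
  also have "\<dots> \<le> (\<Sum>i\<le>n. L' * (\<kappa> (t i) / \<bar>node_prod t n i\<bar>))"
  proof (rule sum_mono)
    fix i assume "i \<in> {..n}"
    then have "(-1) ^ (n - i) * poly q (t i) \<le> L' * \<kappa> (t i)"
      using q(3)[of i] by (cases "even (n - i)") (auto simp: abs_le_iff)
    then have "(-1) ^ (n - i) * poly q (t i) / \<bar>node_prod t n i\<bar> \<le> L' * \<kappa> (t i) / \<bar>node_prod t n i\<bar>"
      by (rule divide_right_mono) simp
    then show "(-1) ^ (n - i) * poly q (t i) / \<bar>node_prod t n i\<bar> \<le> L' * (\<kappa> (t i) / \<bar>node_prod t n i\<bar>)" by simp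
  qed
  also have "\<dots> = L' * N" by (simp only: N_def sum_distrib_left)
  finally have "L * N \<le> L' * N" using \<open>1 = L * N\<close> by simp
  then show ?thesis using N by simp
qed

text \<open>A monic polynomial of least weighted norm on \<open>X\<close>, certified by an alternation set; here \<open>L\<close>
  is the norm.\<close>

definition alternating_extremal :: "real option \<Rightarrow> real set \<Rightarrow> nat \<Rightarrow> real poly \<Rightarrow> real \<Rightarrow> bool" where
  "alternating_extremal r X n p L \<longleftrightarrow> degree p = n \<and> lead_coeff p = 1 \<and> 0 < L \<and>
     (\<forall>s\<in>X. \<bar>poly p s\<bar> \<le> L * \<bar>poly (weight_poly r) s\<bar> ^ n) \<and>
     (\<exists>t. increasing_upto n t \<and> (\<forall>i\<le>n. t i \<in> X \<and> poly p (t i) = (-1) ^ (n - i) * (L * \<bar>poly (weight_poly r) (t i)\<bar> ^ n)))"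

text \<open>The factor between the weighted minimum and the Widom factor: a power of the reciprocal of the capacity
  \<open>1/2\<close>, and the sum of the two powers of the residual capacity \<open>exp (- g s)\<close>.\<close>

definition widom_scale :: "real option \<Rightarrow> nat \<Rightarrow> real" where
  "widom_scale r n = (case r of None \<Rightarrow> 2 ^ n | Some s \<Rightarrow> 2 * cosh (n * green_slit (complex_of_real s)))"

lemma green_slit_ge_1: "1 \<le> x \<Longrightarrow> green_slit (complex_of_real x) = arcosh x"
  by (simp add: green_slit_real max_absorb2)

text \<open>In the residual case the bounds for \<open>L\<close> appear as bounds for the argument of a hyperbolic
  cosine; this and the next lemma turn them into bounds for the Widom factor with an error that tends to \<open>0\<close> as \<open>x\<close> grows.\<close>

lemma cosh_ratio_upper: "cosh x / cosh (x - S) \<le> exp S * (1 + exp (- (2 * x)))" for x S :: real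
proof -
  have "exp (x - S) / 2 \<le> cosh (x - S)" by (rule cosh_exp_bounds)
  then have "cosh x / cosh (x - S) \<le> cosh x / (exp (x - S) / 2)"
    by (intro divide_left_mono) (auto intro!: mult_pos_pos cosh_real_pos less_imp_le[OF cosh_real_pos])
  also have "\<dots> = exp S * (1 + exp (- (2 * x)))"
  proof -
    have "exp (- (2 * x)) = exp (- x) / exp x" by (simp add: exp_diff[symmetric])
    then show ?thesis by (simp add: cosh_field_def exp_diff field_simps)
  qed
  finally show ?thesis .
qed

lemma cosh_ratio_lower: "exp c / (1 + exp (2 * c - 2 * x)) \<le> cosh x / cosh (x - c)" for x c :: real
proof -
  have A: "cosh (x - c) = exp (- c) * exp x * (1 + exp (2 * c - 2 * x)) / 2"
  proof -
    have "exp (- (x - c)) = exp (- c) * exp x * exp (2 * c - 2 * x)"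
      by (simp add: exp_add[symmetric])
    moreover have "exp (x - c) = exp (- c) * exp x" by (simp add: exp_add[symmetric])
    ultimately show ?thesis by (simp add: cosh_field_def algebra_simps)
  qed
  have "exp x / 2 \<le> cosh x" by (rule cosh_exp_bounds)
  then have B: "(exp x / 2) / cosh (x - c) \<le> cosh x / cosh (x - c)"
    by (intro divide_right_mono) (auto intro: less_imp_le[OF cosh_real_pos])
  have "(exp x / 2) / (exp (- c) * exp x * (1 + exp (2 * c - 2 * x)) / 2) = exp c / (1 + exp (2 * c - 2 * x))"
  proof -
    have "(p / 2) / (inverse q * p * y / 2) = q / y" if "0 < p" "0 < q" for p q y :: real
      using that by (simp add: field_simps)
    then show ?thesis by (simp only: exp_minus exp_gt_zero)
  qed
  then have "(exp x / 2) / cosh (x - c) = exp c / (1 + exp (2 * c - 2 * x))" by (simp only: A)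
  then show ?thesis using B by (simp only:)
qed

text \<open>The bounds from \<open>extremal_upper\<close> and \<open>widom_lower_bound_finite\<close> control \<open>lead_mean r (L n)\<close>. In
  the unweighted case this is \<open>- ln (L n)\<close>; in the weighted case it is the Green function at \<open>1 / L n\<close>, and the
  bounds become bounds for \<open>L n\<close> times a hyperbolic cosine.\<close>

theorem normalized_widom_limit:
  fixes L :: "nat \<Rightarrow> real"
  assumes X: "{-1..1} \<subseteq> X" and nz: "\<And>s. s \<in> X \<Longrightarrow> poly (weight_poly r) s \<noteq> 0"
    and L: "\<And>n. 0 < n \<Longrightarrow> \<exists>p. alternating_extremal r X n p (L n)"
  shows "(\<lambda>n. ereal (L n * widom_scale r n)) \<longlonglongrightarrow>
     2 * exp_ereal (\<Sum>\<^sub>\<infinity>s\<in>X - {-1..1}. ereal (green_slit (complex_of_real s)))"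
proof (rule limit_of_sum_bounds)
  let ?g = "\<lambda>s. green_slit (complex_of_real s)"
  show "0 \<le> ?g s" for s by (rule green_slit_nonneg)
  obtain p where ex: "\<And>n. 0 < n \<Longrightarrow> alternating_extremal r X n (p n) (L n)" using L by metis
  have p: "degree (p n) = n" "lead_coeff (p n) = 1" and Lpos: "0 < L n"
    and bound: "\<And>s. s \<in> X \<Longrightarrow> \<bar>poly (p n) s\<bar> \<le> L n * \<bar>poly (weight_poly r) s\<bar> ^ n" if "0 < n" for n
    using ex[OF that, unfolded alternating_extremal_def] by blast+
  have "\<forall>n. \<exists>t. 0 < n \<longrightarrow> increasing_upto n t \<and>
      (\<forall>i\<le>n. t i \<in> X \<and> poly (p n) (t i) = (-1) ^ (n - i) * (L n * \<bar>poly (weight_poly r) (t i)\<bar> ^ n))"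
    using ex unfolding alternating_extremal_def by blast
  then obtain t where T: "\<forall>n. 0 < n \<longrightarrow> increasing_upto n (t n) \<and>
      (\<forall>i\<le>n. t n i \<in> X \<and> poly (p n) (t n i) = (-1) ^ (n - i) * (L n * \<bar>poly (weight_poly r) (t n i)\<bar> ^ n))"
    by (rule choice[THEN exE])
  have t: "\<And>n. 0 < n \<Longrightarrow> increasing_upto n (t n)" "\<And>n i. 0 < n \<Longrightarrow> i \<le> n \<Longrightarrow> t n i \<in> X"
    and alt: "\<And>n i. 0 < n \<Longrightarrow> i \<le> n \<Longrightarrow> poly (p n) (t n i) = (-1) ^ (n - i) * (L n * \<bar>poly (weight_poly r) (t n i)\<bar> ^ n)"
    using T by auto
  have L1: "L n \<le> 1" if n: "0 < n" and r: "r \<noteq> None" for n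
  proof (rule alternation_minimal[OF t(1)[OF n] _ _ alt[OF n]])
    show "degree (p n) \<le> n" "coeff (p n) n = 1" using p[OF n] by auto
    show "0 < \<bar>poly (weight_poly r) (t n i)\<bar> ^ n" if "i \<le> n" for i using nz[OF t(2)[OF n that]] by simp
    show "degree (weight_poly r ^ n) \<le> n" by (rule weight_poly_power)
    show "coeff (weight_poly r ^ n) n = 1" using weight_poly_power(2)[OF n, of r] r by (auto simp: weight_lead_def)
    show "\<bar>poly (weight_poly r ^ n) (t n i)\<bar> \<le> 1 * \<bar>poly (weight_poly r) (t n i)\<bar> ^ n" for i
      by (simp add: poly_power power_abs)
  qed auto
  have I: "poly (weight_poly r) s \<noteq> 0" if "\<bar>s\<bar> \<le> 1" for s
    by (rule nz) (use that X in \<open>auto simp: abs_le_iff\<close>)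
  have gs0: "0 < ?g s0" if "r = Some s0" for s0
  proof -
    have "1 < \<bar>s0\<bar>" using I[of s0] that by (auto simp: weight_poly_def not_less[symmetric])
    then show ?thesis by (simp add: green_slit_real max_absorb2)
  qed
  have n_lim: "filterlim (\<lambda>n. real n * ?g s0) at_top sequentially" if "r = Some s0" for s0
    using gs0[OF that] by (intro filterlim_at_top_mult_tendsto_pos[OF tendsto_const] filterlim_real_sequentially)
  show "eventually (\<lambda>n. L n * widom_scale r n \<le> 2 * exp S + \<delta>) sequentially"
    if S: "\<And>F. finite F \<Longrightarrow> F \<subseteq> X - {-1..1} \<Longrightarrow> sum ?g F \<le> S" and \<delta>: "0 < \<delta>" for S \<delta>
  proof -
    have up: "n * weight_mean r - ln 2 \<le> lead_mean r (L n) + S - n * ln 2" if n: "0 < n" for n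
      by (rule extremal_upper[OF n X nz p(1)[OF n] p(2)[OF n] Lpos[OF n] L1[OF n] bound[OF n] t(1)[OF n] t(2)[OF n] alt[OF n] S])
    show ?thesis
    proof (cases r)
      case None
      have "L n * widom_scale r n \<le> 2 * exp S + \<delta>" if n: "0 < n" for n
      proof -
        have "ln (L n) + n * ln 2 \<le> ln 2 + S"
          using up[OF n] None by (simp add: weight_mean_def lead_mean_def)
        then have "exp (ln (L n) + n * ln 2) \<le> exp (ln 2 + S)" by simp
        then have "L n * 2 ^ n \<le> 2 * exp S"
          using Lpos[OF n] by (simp add: exp_add exp_of_nat_mult)
        then show ?thesis using None \<delta> by (simp add: widom_scale_def)
      qed
      then show ?thesis by (auto simp: eventually_sequentially intro!: exI[of _ 1])
    next
      case (Some s0)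
      have "((\<lambda>x. 2 * exp S * (1 + exp (- (2 * x)))) \<longlongrightarrow> 2 * exp S) at_top" by real_asymp
      then have "eventually (\<lambda>x. 2 * exp S * (1 + exp (- (2 * x))) < 2 * exp S + \<delta>) at_top"
        using \<delta> by (intro order_tendstoD(2)) auto
      then have e1: "eventually (\<lambda>n. 2 * exp S * (1 + exp (- (2 * (real n * ?g s0)))) < 2 * exp S + \<delta>) sequentially"
        using n_lim[OF Some] by (rule eventually_compose_filterlim)
      have e2: "eventually (\<lambda>n. S \<le> real n * ?g s0) sequentially"
        using n_lim[OF Some] by (simp add: filterlim_at_top)
      from e1 e2 eventually_gt_at_top[of 0] show ?thesis
      proof eventually_elim
        case (elim n)
        define x where "x = real n * ?g s0"
        have Ln: "1 \<le> 1 / L n" using L1[OF elim(3)] Lpos[OF elim(3)] Some by simp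
        have "x - S \<le> arcosh (1 / L n)"
          using up[OF elim(3)] Some green_slit_ge_1[OF Ln] by (simp add: weight_mean_def lead_mean_def x_def right_diff_distrib)
        moreover have "0 \<le> x - S" using elim(2) by (simp add: x_def)
        ultimately have "cosh (x - S) \<le> cosh (arcosh (1 / L n))" using Ln by (intro cosh_real_nonneg_le_iff[THEN iffD2]) auto
        then have "cosh (x - S) \<le> 1 / L n" using Ln by simp
        then have "L n \<le> 1 / cosh (x - S)" using Lpos[OF elim(3)] cosh_real_pos[of "x - S"] by (simp add: field_simps)
        then have "L n * (2 * cosh x) \<le> 1 / cosh (x - S) * (2 * cosh x)"
          by (intro mult_right_mono) (auto intro: less_imp_le[OF cosh_real_pos])
        also have "\<dots> = 2 * (cosh x / cosh (x - S))" by simp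
        also have "\<dots> \<le> 2 * (exp S * (1 + exp (- (2 * x))))" by (intro mult_left_mono cosh_ratio_upper) auto
        finally show ?case using elim(1) Some by (simp add: widom_scale_def x_def)
      qed
    qed
  qed
  show "eventually (\<lambda>n. 2 * exp c \<le> L n * widom_scale r n) sequentially"
    if F: "finite F" "F \<subseteq> X - {-1..1}" and c: "c < sum ?g F" for F c
  proof -
    define \<epsilon> where "\<epsilon> = (sum ?g F - c) / 2"
    define c' where "c' = sum ?g F - \<epsilon>"
    have \<epsilon>: "0 < \<epsilon>" "c < c'" using c by (auto simp: \<epsilon>_def c'_def field_simps)
    have "\<exists>n0. \<forall>n\<ge>n0. \<forall>p L. degree p = n \<and> lead_coeff p = 1 \<and> 0 < L \<and> (r \<noteq> None \<longrightarrow> L < 1) \<and>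
      (\<forall>s\<in>{-1..1} \<union> F. \<bar>poly p s\<bar> \<le> L * \<bar>poly (weight_poly r) s\<bar> ^ n) \<longrightarrow>
      lead_mean r L + sum ?g F \<le> n * ln 2 + n * weight_mean r - ln 2 + \<epsilon>"
    proof (rule widom_lower_bound_finite[OF I F(1) _ _ \<epsilon>(1)])
      fix s assume "s \<in> F"
      then have s: "s \<in> X" "s \<notin> {-1..1}" using F(2) by auto
      then show "1 < \<bar>s\<bar>" by (auto simp: abs_if)
      show "poly (weight_poly r) s \<noteq> 0" by (rule nz[OF s(1)])
    qed
    then obtain n0 where n0: "\<And>n p L. n \<ge> n0 \<Longrightarrow> degree p = n \<Longrightarrow> lead_coeff p = 1 \<Longrightarrow> 0 < L \<Longrightarrow> (r \<noteq> None \<longrightarrow> L < 1) \<Longrightarrow>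
      (\<forall>s\<in>{-1..1} \<union> F. \<bar>poly p s\<bar> \<le> L * \<bar>poly (weight_poly r) s\<bar> ^ n) \<Longrightarrow>
      lead_mean r L + sum ?g F \<le> n * ln 2 + n * weight_mean r - ln 2 + \<epsilon>"
      by metis
    have lowb: "lead_mean r (L n) \<le> n * ln 2 + n * weight_mean r - ln 2 - c'"
      if n: "n0 \<le> n" "0 < n" "r \<noteq> None \<longrightarrow> L n < 1" for n
    proof -
      have "lead_mean r (L n) + sum ?g F \<le> n * ln 2 + n * weight_mean r - ln 2 + \<epsilon>"
        by (rule n0[OF n(1) p(1)[OF n(2)] p(2)[OF n(2)] Lpos[OF n(2)] n(3)]) (use bound[OF n(2)] X F(2) in auto)
      then show ?thesis by (simp add: c'_def)
    qed
    show ?thesis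
    proof (cases r)
      case None
      have "2 * exp c \<le> L n * widom_scale r n" if n: "max n0 1 \<le> n" for n
      proof -
        have "ln 2 + c' \<le> ln (L n) + n * ln 2"
          using lowb[of n] n None by (simp add: weight_mean_def lead_mean_def)
        then have "exp (ln 2 + c') \<le> exp (ln (L n) + n * ln 2)" by simp
        then have "2 * exp c' \<le> L n * 2 ^ n"
          using Lpos[of n] n by (simp add: exp_add exp_of_nat_mult)
        have "2 * exp c \<le> 2 * exp c'" using \<epsilon> by simp
        also note \<open>2 * exp c' \<le> L n * 2 ^ n\<close>
        finally show ?thesis using None by (simp add: widom_scale_def)
      qed
      then show ?thesis unfolding eventually_sequentially by blast
    next
      case (Some s0)
      have "((\<lambda>x. exp c' / (1 + exp (2 * c' - 2 * x))) \<longlongrightarrow> exp c') at_top" by real_asymp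
      then have "eventually (\<lambda>x. exp c < exp c' / (1 + exp (2 * c' - 2 * x))) at_top"
        using \<epsilon> by (intro order_tendstoD(1)) auto
      then have e1: "eventually (\<lambda>n. exp c < exp c' / (1 + exp (2 * c' - 2 * (real n * ?g s0)))) sequentially"
        using n_lim[OF Some] by (rule eventually_compose_filterlim)
      have e2: "eventually (\<lambda>n. ln (2 * exp c) + \<bar>c'\<bar> \<le> real n * ?g s0) sequentially"
        using n_lim[OF Some] by (simp add: filterlim_at_top)
      from e1 e2 eventually_ge_at_top[of "max n0 1"] show ?thesis
      proof eventually_elim
        case (elim n)
        then have n: "n0 \<le> n" "0 < n" by auto
        define x where "x = real n * ?g s0"
        show ?case
        proof (cases "L n < 1")
          case False
          then have Ln: "L n = 1" using L1[OF n(2)] Some by simp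
          have "ln (2 * exp c) \<le> x" using elim(2) by (simp add: x_def)
          then have "exp (ln (2 * exp c)) \<le> exp x" by (simp only: exp_le_cancel_iff)
          then have "2 * exp c \<le> exp x" by (simp only: exp_ln mult_pos_pos zero_less_numeral exp_gt_zero)
          also have "exp x / 2 \<le> cosh x" by (rule cosh_exp_bounds)
          then have "exp x \<le> 2 * cosh x" by simp
          finally show ?thesis using Ln Some by (simp add: widom_scale_def x_def)
        next
          case True
          then have L1': "1 \<le> 1 / L n" using Lpos[OF n(2)] by simp
          have "arcosh (1 / L n) \<le> x - c'"
            using lowb[OF n] True Some green_slit_ge_1[OF L1'] by (simp add: weight_mean_def lead_mean_def x_def right_diff_distrib)
          moreover have "0 \<le> arcosh (1 / L n)" using L1' by simp
          ultimately have "cosh (arcosh (1 / L n)) \<le> cosh (x - c')" by (intro cosh_real_nonneg_le_iff[THEN iffD2]) auto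
          then have "1 / L n \<le> cosh (x - c')" using L1' by simp
          then have "1 / cosh (x - c') \<le> L n" using Lpos[OF n(2)] cosh_real_pos[of "x - c'"] by (simp add: field_simps)
          then have "1 / cosh (x - c') * (2 * cosh x) \<le> L n * (2 * cosh x)"
            by (intro mult_right_mono) (auto intro: less_imp_le[OF cosh_real_pos])
          moreover have "exp c \<le> cosh x / cosh (x - c')"
            using elim(1) cosh_ratio_lower[of c' x] unfolding x_def by (rule order.trans[OF less_imp_le])
          ultimately show ?thesis using Some by (simp add: widom_scale_def x_def)
        qed
      qed
    qed
  qed
qed

section \<open>Capacity of an interval with countably many points\<close>

text \<open>The kernel \<open>log_kernel\<close> plus a constant that makes it nonnegative on a bounded set, so
  that a single nonnegative integral replaces the difference of two.\<close>

definition shifted_kernel :: "real \<Rightarrow> real \<Rightarrow> real \<Rightarrow> ennreal" where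
  "shifted_kernel C s t = (if s = t then \<infinity> else ennreal (C - ln \<bar>s - t\<bar>))"

lemma measurable_kernels:
  "(\<lambda>p. e2ennreal (log_kernel (fst p) (snd p))) \<in> borel_measurable (borel \<Otimes>\<^sub>M borel)"
  "(\<lambda>p. e2ennreal (- log_kernel (fst p) (snd p))) \<in> borel_measurable (borel \<Otimes>\<^sub>M borel)"
  "(\<lambda>p. shifted_kernel C (fst p) (snd p)) \<in> borel_measurable (borel \<Otimes>\<^sub>M borel)"
  unfolding log_kernel_def shifted_kernel_def by measurable

text \<open>On a bounded set the negative part of the kernel is at most \<open>C\<close>, so its integral is finite and
  adding the constant \<open>C\<close> to the kernel adds \<open>C\<close> to the energy of a probability measure.\<close>

lemma log_energy_shifted:
  assumes \<mu>: "\<mu> \<in> prob_measures_on K" "K \<in> sets borel" and C: "0 \<le> C"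
    and K: "\<And>s t. s \<in> K \<Longrightarrow> t \<in> K \<Longrightarrow> \<bar>s - t\<bar> \<le> exp C"
  shows "log_energy \<mu> = enn2ereal (\<integral>\<^sup>+ s. (\<integral>\<^sup>+ t. shifted_kernel C s t \<partial>\<mu>) \<partial>\<mu>) - ereal C"
proof -
  interpret prob_space \<mu> using \<mu> by (simp add: prob_measures_on_def)
  have sets[measurable_cong]: "sets \<mu> = sets borel" using \<mu> by (simp add: prob_measures_on_def)
  have AEK: "AE t in \<mu>. t \<in> K"
  proof -
    have "- K \<in> null_sets \<mu>"
      using \<mu> by (intro null_setsI) (auto simp: prob_measures_on_def)
    then have "AE t in \<mu>. t \<notin> - K" by (rule AE_not_in)
    then show ?thesis by simp
  qed
  note [measurable] = measurable_kernels
  have m1[measurable]: "(\<lambda>p. e2ennreal (log_kernel (fst p) (snd p))) \<in> borel_measurable (\<mu> \<Otimes>\<^sub>M \<mu>)"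
    and m2[measurable]: "(\<lambda>p. e2ennreal (- log_kernel (fst p) (snd p))) \<in> borel_measurable (\<mu> \<Otimes>\<^sub>M \<mu>)"
    and m3[measurable]: "(\<lambda>p. shifted_kernel C (fst p) (snd p)) \<in> borel_measurable (\<mu> \<Otimes>\<^sub>M \<mu>)"
    by measurable
  have i1: "(\<lambda>t. e2ennreal (log_kernel s t)) \<in> borel_measurable \<mu>"
    and i2: "(\<lambda>t. e2ennreal (- log_kernel s t)) \<in> borel_measurable \<mu>"
    and i3: "(\<lambda>t. shifted_kernel C s t) \<in> borel_measurable \<mu>" for s
    unfolding log_kernel_def shifted_kernel_def by measurable
  have o1: "(\<lambda>s. \<integral>\<^sup>+ t. e2ennreal (log_kernel s t) \<partial>\<mu>) \<in> borel_measurable \<mu>"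
    using borel_measurable_nn_integral_fst[OF m1] by simp
  have o2: "(\<lambda>s. \<integral>\<^sup>+ t. e2ennreal (- log_kernel s t) \<partial>\<mu>) \<in> borel_measurable \<mu>"
    using borel_measurable_nn_integral_fst[OF m2] by simp
  have o3: "(\<lambda>s. \<integral>\<^sup>+ t. shifted_kernel C s t \<partial>\<mu>) \<in> borel_measurable \<mu>"
    using borel_measurable_nn_integral_fst[OF m3] by simp
  have pt: "e2ennreal (log_kernel s t) + ennreal C = shifted_kernel C s t + e2ennreal (- log_kernel s t)"
    and le: "e2ennreal (- log_kernel s t) \<le> ennreal C" if "s \<in> K" "t \<in> K" for s t
  proof -
    have "ln \<bar>s - t\<bar> \<le> C" if "s \<noteq> t"
    proof -
      have "ln \<bar>s - t\<bar> \<le> ln (exp C)" using that K[OF \<open>s \<in> K\<close> \<open>t \<in> K\<close>] by (intro ln_mono) auto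
      then show ?thesis by simp
    qed
    note lnC = this
    show "e2ennreal (- log_kernel s t) \<le> ennreal C"
      using lnC C by (auto simp: log_kernel_def e2ennreal_neg intro!: ennreal_leI)
    show "e2ennreal (log_kernel s t) + ennreal C = shifted_kernel C s t + e2ennreal (- log_kernel s t)"
    proof (cases "s = t")
      case False
      note lnC = lnC[OF False]
      show ?thesis
      proof (cases "0 \<le> ln \<bar>s - t\<bar>")
        case True
        then show ?thesis using False lnC C
          by (simp add: log_kernel_def shifted_kernel_def ennreal_neg ennreal_plus[symmetric] del: ennreal_plus)
      next
        case neg: False
        then show ?thesis using False lnC C
          by (simp add: log_kernel_def shifted_kernel_def ennreal_neg ennreal_plus[symmetric] del: ennreal_plus)
      qed
    qed (simp add: log_kernel_def shifted_kernel_def)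
  qed
  define P where "P = (\<integral>\<^sup>+ s. (\<integral>\<^sup>+ t. e2ennreal (log_kernel s t) \<partial>\<mu>) \<partial>\<mu>)"
  define N where "N = (\<integral>\<^sup>+ s. (\<integral>\<^sup>+ t. e2ennreal (- log_kernel s t) \<partial>\<mu>) \<partial>\<mu>)"
  define S where "S = (\<integral>\<^sup>+ s. (\<integral>\<^sup>+ t. shifted_kernel C s t \<partial>\<mu>) \<partial>\<mu>)"
  have "P + ennreal C = (\<integral>\<^sup>+ s. (\<integral>\<^sup>+ t. e2ennreal (log_kernel s t) + ennreal C \<partial>\<mu>) \<partial>\<mu>)"
    unfolding P_def by (subst nn_integral_add) (simp_all add: i1 o1 nn_integral_add emeasure_space_1)
  also have "\<dots> = (\<integral>\<^sup>+ s. (\<integral>\<^sup>+ t. shifted_kernel C s t + e2ennreal (- log_kernel s t) \<partial>\<mu>) \<partial>\<mu>)"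
  proof (rule nn_integral_cong_AE, rule AE_mp[OF AEK], rule AE_I2, intro impI)
    fix s assume "s \<in> K"
    show "(\<integral>\<^sup>+ t. e2ennreal (log_kernel s t) + ennreal C \<partial>\<mu>) = (\<integral>\<^sup>+ t. shifted_kernel C s t + e2ennreal (- log_kernel s t) \<partial>\<mu>)"
      by (rule nn_integral_cong_AE, rule AE_mp[OF AEK], rule AE_I2) (use pt[OF \<open>s \<in> K\<close>] in auto)
  qed
  also have "\<dots> = S + N"
    unfolding S_def N_def by (simp add: i2 i3 o2 o3 nn_integral_add)
  finally have PS: "P + ennreal C = S + N" .
  have "N \<le> (\<integral>\<^sup>+ s. (\<integral>\<^sup>+ t. ennreal C \<partial>\<mu>) \<partial>\<mu>)"
    unfolding N_def
  proof (rule nn_integral_mono_AE, rule AE_mp[OF AEK], rule AE_I2, intro impI)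
    fix s assume "s \<in> K"
    show "(\<integral>\<^sup>+ t. e2ennreal (- log_kernel s t) \<partial>\<mu>) \<le> (\<integral>\<^sup>+ t. ennreal C \<partial>\<mu>)"
      by (rule nn_integral_mono_AE, rule AE_mp[OF AEK], rule AE_I2) (use le[OF \<open>s \<in> K\<close>] in auto)
  qed
  then have "N \<le> ennreal C" by (simp add: emeasure_space_1)
  then obtain n where n: "N = ennreal n" "0 \<le> n"
    by (cases N) (auto simp: top_unique)
  have "log_energy \<mu> = enn2ereal P - enn2ereal N"
    by (simp add: log_energy_def P_def N_def)
  also have "\<dots> = enn2ereal S - ereal C"
  proof (cases P)
    case (real p)
    then have "S + N \<noteq> top" using PS by (metis ennreal_add_eq_top ennreal_neq_top)
    then obtain s where s: "S = ennreal s" "0 \<le> s" by (cases S) auto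
    have "p + C = s + n" using PS real s n C
      by (simp add: ennreal_plus[symmetric] del: ennreal_plus)
    then show ?thesis using real s n by (simp add: enn2ereal_ennreal)
  next
    case top
    then have "S = top" using PS n by (metis ennreal_add_eq_top ennreal_neq_top)
    then show ?thesis using top n by (simp add: enn2ereal_ennreal)
  qed
  finally show ?thesis by (simp add: S_def)
qed

text \<open>The kernel is infinite on the diagonal, to which an atom gives positive mass.\<close>

lemma log_energy_atom:
  assumes \<mu>: "\<mu> \<in> prob_measures_on K" "K \<in> sets borel" and C: "0 \<le> C"
    and K: "\<And>s t. s \<in> K \<Longrightarrow> t \<in> K \<Longrightarrow> \<bar>s - t\<bar> \<le> exp C" and atom: "emeasure \<mu> {x} \<noteq> 0"
  shows "log_energy \<mu> = \<infinity>"
proof -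
  have sets[measurable_cong]: "sets \<mu> = sets borel" using \<mu> by (simp add: prob_measures_on_def)
  have "(\<integral>\<^sup>+ s. (\<integral>\<^sup>+ t. shifted_kernel C s t \<partial>\<mu>) \<partial>\<mu>) \<ge> (\<integral>\<^sup>+ s. (\<integral>\<^sup>+ t. \<infinity> * indicator {x} s * indicator {x} t \<partial>\<mu>) \<partial>\<mu>)"
    by (intro nn_integral_mono) (auto simp: shifted_kernel_def indicator_def)
  also have "(\<integral>\<^sup>+ s. (\<integral>\<^sup>+ t. \<infinity> * indicator {x} s * indicator {x} t \<partial>\<mu>) \<partial>\<mu>) = \<infinity> * emeasure \<mu> {x} * emeasure \<mu> {x}"
    by (simp add: nn_integral_cmult nn_integral_multc)
  also have "\<dots> = \<infinity>" using atom by (simp add: ennreal_top_mult)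
  finally have "(\<integral>\<^sup>+ s. (\<integral>\<^sup>+ t. shifted_kernel C s t \<partial>\<mu>) \<partial>\<mu>) = \<infinity>" by (simp add: top_unique)
  then show ?thesis using log_energy_shifted[OF \<mu> C K] by simp
qed

lemma countable_imp_atom:
  assumes \<mu>: "\<mu> \<in> prob_measures_on K" and D: "countable D" "\<And>x. x \<in> D \<Longrightarrow> emeasure \<mu> {x} = 0"
  shows "emeasure \<mu> D = 0" "D \<in> sets \<mu>"
proof -
  have sets: "sets \<mu> = sets borel" using \<mu> by (simp add: prob_measures_on_def)
  show D': "D \<in> sets \<mu>" using D(1) by (simp add: sets sets.countable)
  have "emeasure \<mu> (\<Union>x\<in>D. {x}) = (\<integral>\<^sup>+x. emeasure \<mu> {x} \<partial>count_space D)"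
    by (rule emeasure_UN_countable) (use D sets in \<open>auto simp: disjoint_family_on_def\<close>)
  also have "\<dots> = 0" using D by (subst nn_integral_0_iff_AE) (auto simp: AE_count_space)
  finally show "emeasure \<mu> D = 0" by simp
qed

lemma bounded_imp_diff_bounded:
  fixes K :: "real set"
  assumes "bounded K"
  shows "\<exists>C. \<forall>s\<in>K. \<forall>t\<in>K. \<bar>s - t\<bar> \<le> C"
  using diameter_bounded_bound[OF assms] unfolding dist_real_def by blast

text \<open>A probability measure on a countable set has an atom, and hence infinite energy.\<close>

lemma Cap_countable:
  assumes "countable K" "bounded K"
  shows "Cap K = 0"
proof -
  obtain C0 where C0: "\<And>s t. s \<in> K \<Longrightarrow> t \<in> K \<Longrightarrow> \<bar>s - t\<bar> \<le> C0"
    using bounded_imp_diff_bounded[OF assms(2)] by blast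
  have Kb: "K \<in> sets borel" by (rule sets.countable[OF _ assms(1)]) simp
  have "log_energy \<mu> = \<infinity>" if \<mu>: "\<mu> \<in> prob_measures_on K" for \<mu>
  proof -
    interpret prob_space \<mu> using \<mu> by (simp add: prob_measures_on_def)
    have sets: "sets \<mu> = sets borel" using \<mu> by (simp add: prob_measures_on_def)
    then have sp: "space \<mu> = UNIV" by (metis sets_eq_imp_space_eq space_borel)
    have "\<exists>x. emeasure \<mu> {x} \<noteq> 0"
    proof (rule ccontr)
      assume "\<not> ?thesis"
      then have "emeasure \<mu> K = 0" "K \<in> sets \<mu>" using countable_imp_atom[OF \<mu> assms(1)] by auto
      moreover have "emeasure \<mu> (- K) = 0" using \<mu> by (simp add: prob_measures_on_def)
      moreover have "emeasure \<mu> (K \<union> - K) \<le> emeasure \<mu> K + emeasure \<mu> (- K)"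
        by (rule emeasure_subadditive) (use Kb sets in auto)
      moreover have "emeasure \<mu> (K \<union> - K) = 1" using emeasure_space_1 by (simp add: sp)
      ultimately show False by simp
    qed
    then obtain x where x: "emeasure \<mu> {x} \<noteq> 0" by blast
    show ?thesis
    proof (rule log_energy_atom[OF \<mu> Kb _ _ x])
      show "0 \<le> \<bar>C0\<bar>" by simp
      fix s t assume "s \<in> K" "t \<in> K"
      then have "\<bar>s - t\<bar> \<le> \<bar>C0\<bar>" using C0 by fastforce
      also have "\<dots> \<le> exp \<bar>C0\<bar>" by (rule order.trans[OF _ exp_ge_add_one_self]) simp
      finally show "\<bar>s - t\<bar> \<le> exp \<bar>C0\<bar>" .
    qed
  qed
  then have "\<infinity> \<le> (INF \<mu>\<in>prob_measures_on K. log_energy \<mu>)" by (intro INF_greatest) simp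
  then have "(INF \<mu>\<in>prob_measures_on K. log_energy \<mu>) = \<infinity>" by simp
  moreover have "exp_ereal (- \<infinity>) = 0"
    using exp_ereal.simps(3) by (simp only: MInfty_eq_minfinity)
  ultimately show ?thesis by (simp add: Cap_def)
qed

lemma ennreal_integral_le_nn_integral:
  fixes f :: "'a \<Rightarrow> real"
  assumes "integrable M f"
  shows "ennreal (\<integral>x. f x \<partial>M) \<le> (\<integral>\<^sup>+x. ennreal (f x) \<partial>M)"
proof -
  have "(\<integral>x. f x \<partial>M) \<le> (\<integral>x. max 0 (f x) \<partial>M)"
    using assms by (intro integral_mono) auto
  moreover have "(\<integral>\<^sup>+x. ennreal (max 0 (f x)) \<partial>M) = ennreal (\<integral>x. max 0 (f x) \<partial>M)"
    using assms by (intro nn_integral_eq_integral) auto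
  moreover have "ennreal (max 0 y) = ennreal y" for y by (simp add: max_def ennreal_neg)
  ultimately show ?thesis by (simp add: ennreal_leI)
qed

lemma ln_one_minus_series:
  assumes "0 < r" "r < 1"
  shows "\<bar>- ln (cmod (1 - complex_of_real r * cis \<alpha>)) - (\<Sum>n<N. r ^ n / n * cos (n * \<alpha>))\<bar> \<le> r ^ N / (1 - r)"
proof -
  define z where "z = complex_of_real r * cis \<alpha>"
  have z: "cmod z = r" using assms by (simp add: z_def norm_mult)
  have "(\<lambda>n. - ((- (- z)) ^ n) / of_nat n) sums ln (1 + (- z))"
    by (rule Ln_series') (use z assms in simp)
  then have "(\<lambda>n. - (- (z ^ n) / of_nat n)) sums - ln (1 - z)"
    by (intro sums_minus) simp
  then have "(\<lambda>n. z ^ n / of_nat n) sums - ln (1 - z)" by simp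
  then have *: "(\<lambda>n. Re (z ^ n / of_nat n)) sums Re (- ln (1 - z))" by (rule sums_Re)
  have trm: "Re (z ^ n / of_nat n) = r ^ n / n * cos (n * \<alpha>)" for n
  proof -
    have "z ^ n / of_nat n = complex_of_real (r ^ n / n) * cis (n * \<alpha>)"
      by (simp add: z_def power_mult_distrib Complex.DeMoivre)
    then show ?thesis by (simp del: of_real_divide)
  qed
  have "1 - z \<noteq> 0" using z assms by auto
  then have "Re (- ln (1 - z)) = - ln (cmod (1 - z))" by simp
  moreover have "(\<lambda>n. Re (z ^ n / of_nat n)) = (\<lambda>n. r ^ n / n * cos (n * \<alpha>))" using trm by (rule ext)
  ultimately have S: "(\<lambda>n. r ^ n / n * cos (n * \<alpha>)) sums - ln (cmod (1 - z))" using * by (simp only:)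
  have geo: "(\<lambda>k. r ^ (k + N)) sums (r ^ N / (1 - r))"
  proof -
    have g: "(\<lambda>k. r ^ N * r ^ k) sums (r ^ N * (1 / (1 - r)))"
      by (rule sums_mult, rule geometric_sums) (use assms in simp)
    have "r ^ N * r ^ k = r ^ (k + N)" for k by (metis power_add add.commute)
    then show ?thesis using g by (simp only: times_divide_eq_right mult_1_right)
  qed
  have bnd: "norm (r ^ (k + N) / real (k + N) * cos (real (k + N) * \<alpha>)) \<le> r ^ (k + N)" for k
  proof (cases "k + N = 0")
    case False
    then have "1 \<le> k + N" by linarith
    then have "real 1 \<le> real (k + N)" by (rule of_nat_mono)
    then have "r ^ (k + N) / real (k + N) \<le> r ^ (k + N) / 1"
      using assms by (intro divide_left_mono) auto
    then have "r ^ (k + N) / real (k + N) \<le> r ^ (k + N)" by simp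
    moreover have "r ^ (k + N) / real (k + N) * \<bar>cos (real (k + N) * \<alpha>)\<bar> \<le> r ^ (k + N) / real (k + N) * 1"
      using assms by (intro mult_left_mono) auto
    ultimately show ?thesis using assms by (simp add: abs_mult power_abs)
  qed auto
  have tail: "(\<lambda>k. r ^ (k + N) / real (k + N) * cos (real (k + N) * \<alpha>)) sums
      (- ln (cmod (1 - z)) - (\<Sum>n<N. r ^ n / n * cos (n * \<alpha>)))"
    using S by (subst sums_iff_shift) simp
  have "norm (suminf (\<lambda>k. r ^ (k + N) / real (k + N) * cos (real (k + N) * \<alpha>))) \<le> suminf (\<lambda>k. r ^ (k + N))"
    by (rule norm_suminf_le) (use bnd geo in \<open>auto simp: sums_iff\<close>)
  then show ?thesis using tail geo by (simp add: sums_iff z_def)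
qed

text \<open>The expansion of the logarithmic kernel in Chebyshev polynomials, damped by powers of \<open>r\<close> and
  truncated after \<open>N\<close> terms. The finite sum is a positive definite kernel.\<close>

lemma log_kernel_minorant:
  assumes "0 < r" "r < 1" "\<bar>s\<bar> \<le> 1" "\<bar>t\<bar> \<le> 1" "s \<noteq> t"
  shows "ln 2 + ln r - 2 * (r ^ N / (1 - r)) + (\<Sum>n<N. 2 * r ^ n / n * (poly (cheb n) s * poly (cheb n) t)) \<le> - ln \<bar>s - t\<bar>"
proof -
  define \<theta> where "\<theta> = arccos s"
  define \<phi> where "\<phi> = arccos t"
  have st: "s = cos \<theta>" "t = cos \<phi>" using assms by (simp_all add: \<theta>_def \<phi>_def cos_arccos_abs)
  have prod: "cos (n * (\<theta> + \<phi>)) + cos (n * (- \<theta> + \<phi>)) = 2 * (poly (cheb n) s * poly (cheb n) t)" for n :: nat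
    unfolding st poly_cheb_cos by (simp add: distrib_left right_diff_distrib cos_add cos_diff)
  have cis: "cis \<theta> * cis \<phi> = cis (\<theta> + \<phi>)" "cis (- \<theta>) * cis \<phi> = cis (- \<theta> + \<phi>)"
    by (simp_all add: cis_mult)
  have "ln r + ln (2 * \<bar>cos \<theta> - cos \<phi>\<bar>) \<le>
     ln (cmod (1 - r * cis \<theta> * cis \<phi>)) + ln (cmod (1 - r * cis (- \<theta>) * cis \<phi>))"
    by (rule ln_dist_cos_scaled_ge) (use assms st in auto)
  then have 1: "ln r + ln (2 * \<bar>s - t\<bar>) \<le> ln (cmod (1 - r * cis (\<theta> + \<phi>))) + ln (cmod (1 - r * cis (- \<theta> + \<phi>)))"
    by (simp add: st cis mult.assoc)
  have 2: "ln (2 * \<bar>s - t\<bar>) = ln 2 + ln \<bar>s - t\<bar>" using assms by (intro ln_mult_pos) auto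
  have arith: "l2 + lr - 2 * e + (S1 + S2) \<le> - d"
    if "lr + (l2 + d) \<le> A + B" "\<bar>- A - S1\<bar> \<le> e" "\<bar>- B - S2\<bar> \<le> e" for l2 lr e S1 S2 d A B :: real
    using that by (simp add: abs_le_iff)
  have sum_eq: "(\<Sum>n<N. 2 * r ^ n / n * (poly (cheb n) s * poly (cheb n) t)) =
     (\<Sum>n<N. r ^ n / n * cos (n * (\<theta> + \<phi>))) + (\<Sum>n<N. r ^ n / n * cos (n * (- \<theta> + \<phi>)))"
    unfolding sum.distrib[symmetric]
  proof (rule sum.cong[OF refl])
    fix n
    have "2 * r ^ n / n * (poly (cheb n) s * poly (cheb n) t) = r ^ n / n * (2 * (poly (cheb n) s * poly (cheb n) t))"
      by simp
    then show "2 * r ^ n / n * (poly (cheb n) s * poly (cheb n) t) =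
        r ^ n / n * cos (n * (\<theta> + \<phi>)) + r ^ n / n * cos (n * (- \<theta> + \<phi>))"
      unfolding prod[symmetric] distrib_left[of "r ^ n / n"] .
  qed
  show ?thesis
    unfolding sum_eq
    by (rule arith[OF 1[unfolded 2] ln_one_minus_series[OF assms(1,2)] ln_one_minus_series[OF assms(1,2)]])
qed

text \<open>Integrating the minorant, the Chebyshev terms give squares of moments of the measure and can be
  dropped; what remains tends to the energy of the arcsine law.\<close>

lemma log_energy_ge_interval:
  assumes H: "0 < H" and \<mu>: "prob_space \<mu>" "sets \<mu> = sets borel" "AE t in \<mu>. \<bar>(t - c) / H\<bar> \<le> 1"
    and C: "0 \<le> C"
  shows "ereal (ln 2 - ln H + C) \<le> enn2ereal (\<integral>\<^sup>+ s. (\<integral>\<^sup>+ t. shifted_kernel C s t \<partial>\<mu>) \<partial>\<mu>)"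
proof -
  interpret prob_space \<mu> by fact
  note [measurable_cong] = \<mu>(2)
  define T where "T n t = poly (cheb n) ((t - c) / H)" for n t
  have T_meas[measurable]: "T n \<in> borel_measurable borel" for n
    unfolding T_def by (intro borel_measurable_continuous_onI continuous_intros) (use H in auto)
  have T_bd: "\<bar>T n t\<bar> \<le> 1" if "\<bar>(t - c) / H\<bar> \<le> 1" for n t
    using poly_cheb_cos[of n "arccos ((t - c) / H)"] that abs_cos_le_one[of "n * arccos ((t - c) / H)"]
    by (simp add: T_def cos_arccos_abs)
  have T_int[simp, intro]: "integrable \<mu> (T n)" for n
    by (rule integrable_const_bound[of _ 1]) (use AE_mp[OF \<mu>(3)] T_bd in \<open>auto intro!: AE_mp[OF \<mu>(3)]\<close>)
  define a where "a n = (\<integral>t. T n t \<partial>\<mu>)" for n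
  have bound: "ereal (ln 2 - ln H + C + (ln r - 2 * (r ^ N / (1 - r)))) \<le> enn2ereal (\<integral>\<^sup>+ s. (\<integral>\<^sup>+ t. shifted_kernel C s t \<partial>\<mu>) \<partial>\<mu>)"
    if r: "0 < r" "r < 1" for r :: real and N
  proof -
    define D where "D = ln 2 - ln H + C + (ln r - 2 * (r ^ N / (1 - r)))"
    have pt: "ennreal (D + (\<Sum>n<N. 2 * r ^ n / n * (T n s * T n t))) \<le> shifted_kernel C s t"
      if "\<bar>(s - c) / H\<bar> \<le> 1" "\<bar>(t - c) / H\<bar> \<le> 1" for s t
    proof (cases "s = t")
      case False
      have e: "(s - c) / H - (t - c) / H = (s - t) / H" using H by (simp add: diff_divide_distrib)
      have "ln 2 + ln r - 2 * (r ^ N / (1 - r)) + (\<Sum>n<N. 2 * r ^ n / n * (T n s * T n t)) \<le> - ln \<bar>(s - t) / H\<bar>"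
        unfolding T_def using log_kernel_minorant[OF r that, of N] H False by (simp add: e)
      also have "ln \<bar>(s - t) / H\<bar> = ln \<bar>s - t\<bar> - ln H"
        using H False by (simp add: ln_divide_pos)
      finally show ?thesis using False by (simp add: shifted_kernel_def D_def ennreal_leI)
    qed (simp add: shifted_kernel_def)
    have inner: "ennreal (D + (\<Sum>n<N. 2 * r ^ n / n * (T n s * a n))) \<le> (\<integral>\<^sup>+ t. shifted_kernel C s t \<partial>\<mu>)"
      if s: "\<bar>(s - c) / H\<bar> \<le> 1" for s
    proof -
      have "(\<integral>t. D + (\<Sum>n<N. 2 * r ^ n / n * (T n s * T n t)) \<partial>\<mu>) = D + (\<Sum>n<N. 2 * r ^ n / n * (T n s * a n))"
        by (subst Bochner_Integration.integral_add) (auto simp: a_def prob_space)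
      then have "ennreal (D + (\<Sum>n<N. 2 * r ^ n / n * (T n s * a n))) \<le> (\<integral>\<^sup>+ t. ennreal (D + (\<Sum>n<N. 2 * r ^ n / n * (T n s * T n t))) \<partial>\<mu>)"
        using ennreal_integral_le_nn_integral[of \<mu> "\<lambda>t. D + (\<Sum>n<N. 2 * r ^ n / n * (T n s * T n t))"] by simp
      also have "\<dots> \<le> (\<integral>\<^sup>+ t. shifted_kernel C s t \<partial>\<mu>)"
        by (rule nn_integral_mono_AE, rule AE_mp[OF \<mu>(3)], rule AE_I2) (use pt[OF s] in auto)
      finally show ?thesis .
    qed
    have "(\<integral>s. D + (\<Sum>n<N. 2 * r ^ n / n * (T n s * a n)) \<partial>\<mu>) = D + (\<Sum>n<N. 2 * r ^ n / n * (a n * a n))"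
      by (subst Bochner_Integration.integral_add) (auto simp: a_def prob_space)
    moreover have "0 \<le> (\<Sum>n<N. 2 * r ^ n / n * (a n * a n))"
      using r by (intro sum_nonneg mult_nonneg_nonneg[OF _ zero_le_square]) auto
    ultimately have "ennreal D \<le> ennreal (\<integral>s. D + (\<Sum>n<N. 2 * r ^ n / n * (T n s * a n)) \<partial>\<mu>)"
      by (intro ennreal_leI) simp
    also have "\<dots> \<le> (\<integral>\<^sup>+ s. ennreal (D + (\<Sum>n<N. 2 * r ^ n / n * (T n s * a n))) \<partial>\<mu>)"
      by (rule ennreal_integral_le_nn_integral) auto
    also have "\<dots> \<le> (\<integral>\<^sup>+ s. (\<integral>\<^sup>+ t. shifted_kernel C s t \<partial>\<mu>) \<partial>\<mu>)"
      by (rule nn_integral_mono_AE, rule AE_mp[OF \<mu>(3)], rule AE_I2) (use inner in auto)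
    finally have "enn2ereal (ennreal D) \<le> enn2ereal (\<integral>\<^sup>+ s. (\<integral>\<^sup>+ t. shifted_kernel C s t \<partial>\<mu>) \<partial>\<mu>)"
      by (simp add: less_eq_ennreal.rep_eq)
    moreover have "ereal D \<le> enn2ereal (ennreal D)"
      by (cases "0 \<le> D") (auto simp: enn2ereal_ennreal ennreal_neg zero_ennreal.rep_eq)
    ultimately show ?thesis unfolding D_def by (rule order.trans[rotated])
  qed
  have bound': "ereal (ln 2 - ln H + C + ln r) \<le> enn2ereal (\<integral>\<^sup>+ s. (\<integral>\<^sup>+ t. shifted_kernel C s t \<partial>\<mu>) \<partial>\<mu>)"
    if r: "0 < r" "r < 1" for r :: real
  proof (rule LIMSEQ_le_const2)
    have "(\<lambda>N. ln 2 - ln H + C + (ln r - 2 * (r ^ N / (1 - r)))) \<longlonglongrightarrow> ln 2 - ln H + C + (ln r - 2 * (0 / (1 - r)))"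
      using r by (intro tendsto_intros LIMSEQ_realpow_zero) auto
    then show "(\<lambda>N. ereal (ln 2 - ln H + C + (ln r - 2 * (r ^ N / (1 - r))))) \<longlonglongrightarrow> ereal (ln 2 - ln H + C + ln r)"
      by simp
    show "\<exists>N. \<forall>n\<ge>N. ereal (ln 2 - ln H + C + (ln r - 2 * (r ^ n / (1 - r)))) \<le> enn2ereal (\<integral>\<^sup>+ s. (\<integral>\<^sup>+ t. shifted_kernel C s t \<partial>\<mu>) \<partial>\<mu>)"
      using bound[OF r] by blast
  qed
  show ?thesis
  proof (rule LIMSEQ_le_const2)
    have "(\<lambda>k. ln (1 - 1 / real (k + 2))) \<longlonglongrightarrow> 0" by real_asymp
    then have "(\<lambda>k. ln 2 - ln H + C + ln (1 - 1 / real (k + 2))) \<longlonglongrightarrow> ln 2 - ln H + C + 0"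
      by (intro tendsto_add tendsto_const)
    then show "(\<lambda>k. ereal (ln 2 - ln H + C + ln (1 - 1 / real (k + 2)))) \<longlonglongrightarrow> ereal (ln 2 - ln H + C)"
      by simp
    show "\<exists>N. \<forall>k\<ge>N. ereal (ln 2 - ln H + C + ln (1 - 1 / real (k + 2))) \<le> enn2ereal (\<integral>\<^sup>+ s. (\<integral>\<^sup>+ t. shifted_kernel C s t \<partial>\<mu>) \<partial>\<mu>)"
      using bound' by auto
  qed
qed

definition arcsine_measure :: "real \<Rightarrow> real \<Rightarrow> real measure" where
  "arcsine_measure c H = distr (restrict_space lborel {0..1}) borel (\<lambda>x. c + H * cos (2 * pi * x))"

text \<open>By \<open>ln_dist_cos_mean\<close> the potential of the arcsine law is constant on the interval.\<close>

lemma arcsine_measure_energy: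
  assumes H: "0 < H" and C: "0 \<le> C" "2 * H \<le> exp C"
  shows "(\<integral>\<^sup>+ s. (\<integral>\<^sup>+ t. shifted_kernel C s t \<partial>arcsine_measure c H) \<partial>arcsine_measure c H) = ennreal (ln 2 - ln H + C)"
proof -
  let ?u = "\<lambda>x. c + H * cos (2 * pi * x)"
  have meas_s: "(\<lambda>t. shifted_kernel C s t) \<in> borel_measurable borel" for s
    unfolding shifted_kernel_def by measurable
  have nn_distr: "(\<integral>\<^sup>+ t. f t \<partial>arcsine_measure c H) = (\<integral>\<^sup>+ x\<in>{0..1}. f (?u x) \<partial>lborel)"
    if "f \<in> borel_measurable borel" for f
    unfolding arcsine_measure_def using that
    by (subst nn_integral_distr) (auto simp: nn_integral_restrict_space intro!: measurable_restrict_space1)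
  have inner: "(\<integral>\<^sup>+ t. shifted_kernel C (?u y) t \<partial>arcsine_measure c H) = ennreal (ln 2 - ln H + C)" for y
  proof -
    define Z where "Z = {x \<in> {0..1::real}. cos (2 * pi * x) = cos (2 * pi * y)}"
    have "finite Z" unfolding Z_def by (rule finite_cos_level)
    define f where "f x = (if x \<in> {0..1} then (if cos (2 * pi * x) = cos (2 * pi * y) then 0 else C - ln H - ln \<bar>cos (2 * pi * y) - cos (2 * pi * x)\<bar>) else 0)" for x :: real
    have fm: "f \<in> borel_measurable borel" unfolding f_def by measurable
    have kern: "C - ln \<bar>?u y - ?u x\<bar> = C - ln H - ln \<bar>cos (2 * pi * y) - cos (2 * pi * x)\<bar>"
       "0 \<le> C - ln \<bar>?u y - ?u x\<bar>" if "cos (2 * pi * x) \<noteq> cos (2 * pi * y)" for x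
    proof -
      have e: "\<bar>?u y - ?u x\<bar> = H * \<bar>cos (2 * pi * y) - cos (2 * pi * x)\<bar>"
        using H by (simp add: abs_mult[symmetric] right_diff_distrib[symmetric] abs_mult)
      show "C - ln \<bar>?u y - ?u x\<bar> = C - ln H - ln \<bar>cos (2 * pi * y) - cos (2 * pi * x)\<bar>"
        unfolding e using H that by (subst ln_mult_pos) auto
      have "\<bar>p - q\<bar> \<le> 2" if "\<bar>p\<bar> \<le> 1" "\<bar>q\<bar> \<le> 1" for p q :: real using that by (auto simp: abs_if split: if_splits)
      then have "\<bar>cos (2 * pi * y) - cos (2 * pi * x)\<bar> \<le> 2" by (simp only: abs_cos_le_one)
      then have "\<bar>?u y - ?u x\<bar> \<le> H * 2" unfolding e using H by (intro mult_left_mono) auto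
      also have "\<dots> \<le> exp C" using C(2) by simp
      finally have "ln \<bar>?u y - ?u x\<bar> \<le> ln (exp C)" using H that by (intro ln_mono) auto
      then show "0 \<le> C - ln \<bar>?u y - ?u x\<bar>" by simp
    qed
    have fnn: "0 \<le> f x" for x using kern[of x] by (auto simp: f_def)
    have "((\<lambda>x. (C - ln H) - ln \<bar>cos (2 * pi * y) - cos (2 * pi * x)\<bar>) has_integral ((C - ln H) - (green_slit (complex_of_real (cos (2 * pi * y))) - ln 2))) {0..1}"
    proof (rule has_integral_diff[OF _ ln_dist_cos_mean])
      show "((\<lambda>x. C - ln H) has_integral C - ln H) {0..1::real}"
        using has_integral_const_real[of "C - ln H" 0 1] by simp
    qed
    moreover have "green_slit (complex_of_real (cos (2 * pi * y))) = 0"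
      by (simp add: green_slit_real max_absorb1)
    then have "(C - ln H) - (green_slit (complex_of_real (cos (2 * pi * y))) - ln 2) = ln 2 - ln H + C"
      by simp
    ultimately have "((\<lambda>x. (C - ln H) - ln \<bar>cos (2 * pi * y) - cos (2 * pi * x)\<bar>) has_integral (ln 2 - ln H + C)) {0..1}"
      by (simp only:)
    then have "(f has_integral (ln 2 - ln H + C)) {0..1}"
      by (rule has_integral_spike_finite[OF \<open>finite Z\<close>, rotated]) (auto simp: f_def Z_def)
    then have "((\<lambda>x. if x \<in> {0..1} then f x else 0) has_integral (ln 2 - ln H + C)) UNIV"
      by (simp only: has_integral_restrict_UNIV)
    then have "(f has_integral (ln 2 - ln H + C)) UNIV"
      by (rule has_integral_eq[rotated]) (auto simp: f_def)
    then have F: "(\<integral>\<^sup>+x. ennreal (f x) \<partial>lborel) = ennreal (ln 2 - ln H + C)"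
      by (rule nn_integral_has_integral_lborel[OF fm fnn])
    have "(\<integral>\<^sup>+ t. shifted_kernel C (?u y) t \<partial>arcsine_measure c H) = (\<integral>\<^sup>+ x\<in>{0..1}. shifted_kernel C (?u y) (?u x) \<partial>lborel)"
      by (rule nn_distr[OF meas_s])
    also have "\<dots> = (\<integral>\<^sup>+x. ennreal (f x) \<partial>lborel)"
    proof (rule nn_integral_cong_AE)
      have "AE x in lborel. x \<notin> Z" by (intro AE_not_in finite_imp_null_set_lborel \<open>finite Z\<close>)
      then show "AE x in lborel. shifted_kernel C (?u y) (?u x) * indicator {0..1} x = ennreal (f x)"
      proof (rule AE_mp, intro AE_I2 impI)
        fix x :: real assume "x \<notin> Z"
        show "shifted_kernel C (?u y) (?u x) * indicator {0..1} x = ennreal (f x)"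
        proof (cases "x \<in> {0..1}")
          case True
          with \<open>x \<notin> Z\<close> have ne: "cos (2 * pi * x) \<noteq> cos (2 * pi * y)" by (auto simp: Z_def)
          then have "?u y \<noteq> ?u x" using H by auto
          then have "shifted_kernel C (?u y) (?u x) = ennreal (C - ln \<bar>?u y - ?u x\<bar>)"
            by (simp only: shifted_kernel_def if_False)
          then show ?thesis using True ne unfolding kern(1)[OF ne] by (simp add: f_def)
        next
          case False
          then have "f x = 0" "indicator {0..1} x = (0 :: ennreal)" by (auto simp: f_def)
          then show ?thesis by simp
        qed
      qed
    qed
    finally show ?thesis using F by simp
  qed
  have "(\<lambda>p. shifted_kernel C (fst p) (snd p)) \<in> borel_measurable (borel \<Otimes>\<^sub>M arcsine_measure c H)"
    unfolding arcsine_measure_def shifted_kernel_def by measurable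
  moreover have sf: "sigma_finite_measure (arcsine_measure c H)"
  proof -
    have "emeasure (arcsine_measure c H) (space (arcsine_measure c H)) = 1"
      unfolding arcsine_measure_def
      by (subst emeasure_distr) (auto simp: emeasure_restrict_space space_restrict_space intro!: measurable_restrict_space1)
    then have "prob_space (arcsine_measure c H)" by (rule prob_spaceI)
    then show ?thesis by (simp add: prob_space_imp_sigma_finite)
  qed
  ultimately have "(\<lambda>s. \<integral>\<^sup>+ t. shifted_kernel C s t \<partial>arcsine_measure c H) \<in> borel_measurable borel"
    using sigma_finite_measure.borel_measurable_nn_integral_fst[OF sf, of "\<lambda>p. shifted_kernel C (fst p) (snd p)" borel]
    by (simp only: fst_conv snd_conv)
  then have "(\<integral>\<^sup>+ s. (\<integral>\<^sup>+ t. shifted_kernel C s t \<partial>arcsine_measure c H) \<partial>arcsine_measure c H) = (\<integral>\<^sup>+ x\<in>{0..1::real}. ennreal (ln 2 - ln H + C) \<partial>lborel)"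
    by (subst nn_distr) (auto simp: inner)
  also have "\<dots> = ennreal (ln 2 - ln H + C)" by (simp add: nn_integral_cmult)
  finally show ?thesis .
qed

lemma arcsine_measure_prob:
  assumes "0 < H" "{c - H..c + H} \<subseteq> K" "K \<in> sets borel"
  shows "arcsine_measure c H \<in> prob_measures_on K"
proof -
  have m: "(\<lambda>x. c + H * cos (2 * pi * x)) \<in> measurable (restrict_space lborel {0..1}) borel"
    by (intro measurable_restrict_space1) measurable
  have "emeasure (arcsine_measure c H) (space (arcsine_measure c H)) = 1"
    unfolding arcsine_measure_def
    by (subst emeasure_distr) (auto simp: emeasure_restrict_space space_restrict_space intro!: measurable_restrict_space1)
  then have "prob_space (arcsine_measure c H)" by (rule prob_spaceI)
  moreover have "emeasure (arcsine_measure c H) (- K) = 0"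
  proof -
    have "c + H * cos (2 * pi * x) \<in> K" for x
    proof -
      have "\<bar>H * cos (2 * pi * x)\<bar> \<le> H * 1" using assms(1) unfolding abs_mult by (intro mult_mono) auto
      then have "c + H * cos (2 * pi * x) \<in> {c - H..c + H}" by (auto simp: abs_le_iff)
      then show ?thesis using assms(2) by blast
    qed
    then have "(\<lambda>x. c + H * cos (2 * pi * x)) -` (- K) \<inter> space (restrict_space lborel {0..1}) = {}" by auto
    then show ?thesis unfolding arcsine_measure_def using assms(3) by (subst emeasure_distr[OF m]) auto
  qed
  ultimately show ?thesis by (simp add: prob_measures_on_def arcsine_measure_def)
qed

text \<open>A measure of finite energy has no atoms and so lives on the interval, where the arcsine law has the
  least energy.\<close>

theorem Cap_interval_countable:
  assumes ab: "a < b" and E: "E = {a..b} \<union> D" "countable D" "compact E"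
  shows "Cap E = (b - a) / 4"
proof -
  define H where "H = (b - a) / 2"
  define c where "c = (a + b) / 2"
  have H: "0 < H" using ab by (simp add: H_def)
  have I: "{c - H..c + H} = {a..b}" by (auto simp: c_def H_def field_simps)
  have Eb: "E \<in> sets borel" using E(3) by (simp add: borel_closed compact_imp_closed)
  obtain C0 where C0: "\<And>s t. s \<in> E \<Longrightarrow> t \<in> E \<Longrightarrow> \<bar>s - t\<bar> \<le> C0"
    using bounded_imp_diff_bounded[OF compact_imp_bounded[OF E(3)]] by blast
  define C where "C = \<bar>C0\<bar> + 2 * H"
  have C: "0 \<le> C" "2 * H \<le> exp C" "\<bar>C0\<bar> \<le> exp C"
  proof -
    have "C \<le> exp C" by (rule order.trans[OF _ exp_ge_add_one_self]) simp
    moreover have "0 \<le> C" "2 * H \<le> C" "\<bar>C0\<bar> \<le> C" using H by (auto simp: C_def)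
    ultimately show "0 \<le> C" "2 * H \<le> exp C" "\<bar>C0\<bar> \<le> exp C" by (auto intro: order.trans)
  qed
  have K: "\<bar>s - t\<bar> \<le> exp C" if "s \<in> E" "t \<in> E" for s t
    using C0[OF that] C(3) by linarith
  have low: "ereal (ln 2 - ln H) \<le> log_energy \<mu>" if \<mu>: "\<mu> \<in> prob_measures_on E" for \<mu>
  proof (cases "\<exists>x. emeasure \<mu> {x} \<noteq> 0")
    case True
    then show ?thesis using log_energy_atom[OF \<mu> Eb C(1) K] by auto
  next
    case False
    have sets: "sets \<mu> = sets borel" using \<mu> by (simp add: prob_measures_on_def)
    have "D \<in> null_sets \<mu>" using countable_imp_atom[OF \<mu> E(2)] False by (intro null_setsI) auto
    moreover have "- E \<in> null_sets \<mu>"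
      using \<mu> Eb by (intro null_setsI) (auto simp: prob_measures_on_def)
    ultimately have "AE t in \<mu>. t \<notin> D \<and> t \<notin> - E" by (intro AE_conjI AE_not_in)
    then have AE: "AE t in \<mu>. \<bar>(t - c) / H\<bar> \<le> 1"
    proof (rule AE_mp, intro AE_I2 impI)
      fix t assume "t \<notin> D \<and> t \<notin> - E"
      then have "t \<in> {c - H..c + H}" using E(1) I by auto
      then have "\<bar>t - c\<bar> \<le> H" by (auto simp: abs_le_iff)
      then show "\<bar>(t - c) / H\<bar> \<le> 1" using H by (simp add: divide_le_eq)
    qed
    have "ereal (ln 2 - ln H + C) \<le> enn2ereal (\<integral>\<^sup>+ s. (\<integral>\<^sup>+ t. shifted_kernel C s t \<partial>\<mu>) \<partial>\<mu>)"
      by (rule log_energy_ge_interval[OF H _ sets AE C(1)]) (use \<mu> in \<open>simp add: prob_measures_on_def\<close>)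
    then have "ereal (ln 2 - ln H + C) - ereal C \<le> enn2ereal (\<integral>\<^sup>+ s. (\<integral>\<^sup>+ t. shifted_kernel C s t \<partial>\<mu>) \<partial>\<mu>) - ereal C"
      by (intro ereal_minus_mono) auto
    then show ?thesis using log_energy_shifted[OF \<mu> Eb C(1) K] by simp
  qed
  have arc: "arcsine_measure c H \<in> prob_measures_on E"
    by (rule arcsine_measure_prob[OF H _ Eb]) (use I E(1) in auto)
  have "ln H \<le> C"
  proof -
    have "ln H \<le> ln (exp C)" using H C(2) by (intro ln_mono) auto
    then show ?thesis by simp
  qed
  moreover have "0 \<le> ln (2 :: real)" by simp
  ultimately have "0 \<le> ln 2 - ln H + C" by linarith
  then have "log_energy (arcsine_measure c H) = ereal (ln 2 - ln H)"
    using log_energy_shifted[OF arc Eb C(1) K] arcsine_measure_energy[OF H C(1,2), of c]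
    by (simp add: enn2ereal_ennreal)
  then have "(INF \<mu>\<in>prob_measures_on E. log_energy \<mu>) = ereal (ln 2 - ln H)"
    using low arc by (intro antisym INF_greatest) (auto intro: INF_lower2)
  then have "Cap E = exp (ln H - ln 2)" by (simp add: Cap_def)
  also have "\<dots> = H / 2" using H by (simp add: exp_diff)
  finally show ?thesis by (simp add: H_def)
qed

text \<open>The uniform measure on a set of positive length has finite energy, since \<open>- ln u\<close> is bounded by a
  multiple of the integrable function \<open>u powr (-1/2)\<close>.\<close>

lemma Cap_zero_imp_null:
  assumes F: "compact F" "Cap F = 0"
  shows "emeasure lborel F = 0"
proof (rule ccontr)
  assume pos: "emeasure lborel F \<noteq> 0"
  have Fb: "F \<in> sets borel" using F(1) by (simp add: borel_closed compact_imp_closed)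
  have fin: "emeasure lborel F < \<infinity>" using F(1) by (rule emeasure_compact_finite)
  define m where "m = measure lborel F"
  have m: "emeasure lborel F = ennreal m" "0 < m"
    using pos fin by (auto simp: m_def emeasure_eq_ennreal_measure zero_less_measure_iff)
  define \<mu> where "\<mu> = uniform_measure lborel F"
  have \<mu>: "\<mu> \<in> prob_measures_on F"
  proof -
    have "prob_space \<mu>" unfolding \<mu>_def by (rule prob_space_uniform_measure) (use pos fin in auto)
    moreover have "emeasure \<mu> (- F) = 0" unfolding \<mu>_def using Fb by (subst emeasure_uniform_measure) auto
    ultimately show ?thesis by (simp add: prob_measures_on_def \<mu>_def)
  qed
  obtain C0 where C0: "\<And>s t. s \<in> F \<Longrightarrow> t \<in> F \<Longrightarrow> \<bar>s - t\<bar> \<le> C0"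
    using bounded_imp_diff_bounded[OF compact_imp_bounded[OF F(1)]] by blast
  define C where "C = \<bar>C0\<bar>"
  have C: "0 \<le> C" by (simp add: C_def)
  have dC: "\<bar>s - t\<bar> \<le> C" if "s \<in> F" "t \<in> F" for s t
    using C0[OF that] by (simp add: C_def)
  have K: "\<bar>s - t\<bar> \<le> exp C" if "s \<in> F" "t \<in> F" for s t
    using dC[OF that] exp_ge_add_one_self[of C] by linarith
  define \<psi> where "\<psi> u = (if u \<in> {-C..C} then 2 * \<bar>u\<bar> powr (-1/2) else 0)" for u :: real
  have \<psi>m: "\<psi> \<in> borel_measurable borel" unfolding \<psi>_def by measurable
  have \<psi>fin: "(\<integral>\<^sup>+u. ennreal (\<psi> u) \<partial>lborel) < \<infinity>"
  proof -
    have h: "((\<lambda>u. 2 * u powr (-1/2)) has_integral 2 * (C powr (-1/2 + 1) / (-1/2 + 1))) {0..C}"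
      using C by (intro has_integral_mult_right has_integral_powr_from_0) auto
    then have p: "((\<lambda>u. 2 * \<bar>u\<bar> powr (-1/2)) has_integral 2 * (C powr (-1/2 + 1) / (-1/2 + 1))) {0..C}"
      by (rule has_integral_eq[rotated]) auto
    have n: "((\<lambda>u. 2 * \<bar>u\<bar> powr (-1/2)) has_integral 2 * (C powr (-1/2 + 1) / (-1/2 + 1))) {-C..0}"
      using has_integral_reflect_real[of "\<lambda>u. 2 * \<bar>u\<bar> powr (-1/2)" _ C 0] p by simp
    obtain J where "((\<lambda>u. 2 * \<bar>u\<bar> powr (-1/2)) has_integral J) {-C..C}"
      using has_integral_combine[OF _ _ n p] C by auto
    then have "((\<lambda>u. if u \<in> {-C..C} then 2 * \<bar>u\<bar> powr (-1/2) else 0) has_integral J) UNIV"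
      by (simp only: has_integral_restrict_UNIV)
    then have "(\<psi> has_integral J) UNIV" by (rule has_integral_eq[rotated]) (auto simp: \<psi>_def)
    then have "(\<integral>\<^sup>+u. ennreal (\<psi> u) \<partial>lborel) = ennreal J"
      by (rule nn_integral_has_integral_lborel[OF \<psi>m, rotated]) (simp add: \<psi>_def)
    then show ?thesis by simp
  qed
  have kern: "shifted_kernel C s t \<le> ennreal C + ennreal (\<psi> (t - s))" if "s \<in> F" "t \<in> F" "s \<noteq> t" for s t
  proof -
    define u where "u = \<bar>s - t\<bar>"
    have u: "0 < u" "u \<le> C" using that dC by (auto simp: u_def)
    have "- ln u = 2 * ln (u powr (-1/2))" using u by (simp add: ln_powr)
    also have "\<dots> \<le> 2 * (u powr (-1/2) - 1)" using u by (intro mult_left_mono ln_le_minus_one) auto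
    also have "\<dots> \<le> \<psi> (t - s)" using u by (auto simp: \<psi>_def u_def abs_minus_commute abs_le_iff)
    finally have "C - ln u \<le> C + \<psi> (t - s)" by simp
    then have "ennreal (C - ln u) \<le> ennreal (C + \<psi> (t - s))" by (rule ennreal_leI)
    also have "\<dots> = ennreal C + ennreal (\<psi> (t - s))" using C by (intro ennreal_plus) (auto simp: \<psi>_def)
    finally show ?thesis using that by (simp add: shifted_kernel_def u_def)
  qed
  define B where "B = ennreal C + (\<integral>\<^sup>+u. ennreal (\<psi> u) \<partial>lborel) / ennreal m"
  have inner: "(\<integral>\<^sup>+ t. shifted_kernel C s t \<partial>\<mu>) \<le> B" if s: "s \<in> F" for s
  proof -
    have "(\<integral>\<^sup>+ t. shifted_kernel C s t \<partial>\<mu>) = (\<integral>\<^sup>+ t\<in>F. shifted_kernel C s t \<partial>lborel) / ennreal m"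
      unfolding \<mu>_def m(1)[symmetric] by (rule nn_integral_uniform_measure) (auto simp: shifted_kernel_def Fb)
    also have "(\<integral>\<^sup>+ t\<in>F. shifted_kernel C s t \<partial>lborel) \<le> (\<integral>\<^sup>+ t. ennreal C * indicator F t + ennreal (\<psi> (- s + 1 * t)) \<partial>lborel)"
    proof (rule nn_integral_mono_AE)
      have "AE t in lborel. t \<notin> {s}" by (intro AE_not_in finite_imp_null_set_lborel) auto
      then show "AE t in lborel. shifted_kernel C s t * indicator F t \<le> ennreal C * indicator F t + ennreal (\<psi> (- s + 1 * t))"
        by (rule AE_mp, intro AE_I2) (use kern[OF s] in \<open>auto simp: indicator_def\<close>)
    qed
    also have "\<dots> = ennreal C * ennreal m + (\<integral>\<^sup>+ t. ennreal (\<psi> (- s + 1 * t)) \<partial>lborel)"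
      using \<psi>m Fb by (subst nn_integral_add) (auto simp: nn_integral_cmult m(1))
    also have "(\<integral>\<^sup>+ t. ennreal (\<psi> (- s + 1 * t)) \<partial>lborel) = (\<integral>\<^sup>+u. ennreal (\<psi> u) \<partial>lborel)"
      using nn_integral_real_affine[of "\<lambda>u. ennreal (\<psi> u)" 1 "- s"] \<psi>m by simp
    finally have "(\<integral>\<^sup>+ t. shifted_kernel C s t \<partial>\<mu>) \<le> (ennreal C * ennreal m + (\<integral>\<^sup>+u. ennreal (\<psi> u) \<partial>lborel)) / ennreal m"
      by (simp add: divide_right_mono_ennreal)
    also have "\<dots> = B" unfolding B_def using m(2)
      by (simp add: add_divide_distrib_ennreal ennreal_mult_divide_eq) 
    finally show ?thesis .
  qed
  have Bfin: "B < \<infinity>" unfolding B_def using \<psi>fin m(2)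
    by (auto simp: ennreal_divide_eq_top_iff less_top[symmetric])
  have "(\<integral>\<^sup>+ s. (\<integral>\<^sup>+ t. shifted_kernel C s t \<partial>\<mu>) \<partial>\<mu>) \<le> (\<integral>\<^sup>+ s. B \<partial>\<mu>)"
  proof (rule nn_integral_mono_AE)
    have "- F \<in> null_sets \<mu>" using \<mu> Fb by (intro null_setsI) (auto simp: prob_measures_on_def)
    then have "AE t in \<mu>. t \<notin> - F" by (rule AE_not_in)
    then show "AE s in \<mu>. (\<integral>\<^sup>+ t. shifted_kernel C s t \<partial>\<mu>) \<le> B"
      by (rule AE_mp, intro AE_I2) (use inner in auto)
  qed
  also have "\<dots> = B" using \<mu> by (simp add: prob_measures_on_def prob_space.emeasure_space_1)
  finally have le: "(\<integral>\<^sup>+ s. (\<integral>\<^sup>+ t. shifted_kernel C s t \<partial>\<mu>) \<partial>\<mu>) \<le> B" .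
  then obtain e where e: "(\<integral>\<^sup>+ s. (\<integral>\<^sup>+ t. shifted_kernel C s t \<partial>\<mu>) \<partial>\<mu>) = ennreal e" "0 \<le> e"
    using Bfin by (cases "\<integral>\<^sup>+ s. (\<integral>\<^sup>+ t. shifted_kernel C s t \<partial>\<mu>) \<partial>\<mu>") (auto simp: top_unique)
  have "log_energy \<mu> = ereal (e - C)"
    using log_energy_shifted[OF \<mu> Fb C K] e by (simp add: enn2ereal_ennreal)
  then have up: "(INF \<mu>\<in>prob_measures_on F. log_energy \<mu>) \<le> ereal (e - C)"
    using \<mu> by (auto intro: INF_lower2)
  have lo: "ereal (- C) \<le> (INF \<mu>\<in>prob_measures_on F. log_energy \<mu>)"
  proof (rule INF_greatest)
    fix \<nu> assume \<nu>: "\<nu> \<in> prob_measures_on F"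
    have "0 - ereal C \<le> enn2ereal (\<integral>\<^sup>+ s. (\<integral>\<^sup>+ t. shifted_kernel C s t \<partial>\<nu>) \<partial>\<nu>) - ereal C"
      by (intro ereal_minus_mono) auto
    then show "ereal (- C) \<le> log_energy \<nu>" using log_energy_shifted[OF \<nu> Fb C K] by simp
  qed
  obtain I where "(INF \<mu>\<in>prob_measures_on F. log_energy \<mu>) = ereal I"
    using up lo by (cases "INF \<mu>\<in>prob_measures_on F. log_energy \<mu>") auto
  then have "Cap F = exp (- I)" by (simp add: Cap_def)
  then show False using F(2) by simp
qed

section \<open>Harmonic functions off a slit\<close>

text \<open>By the Cauchy-Riemann equations, a real function whose gradient is the conjugate of a
  holomorphic function is harmonic. This covers real parts and logarithms of moduli alike, without a choice of
  branch.\<close>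

lemma harmonic_on_holomorphic_gradient:
  assumes U: "open U" and q: "q holomorphic_on U"
    and u: "\<And>z. z \<in> U \<Longrightarrow> (u has_derivative (\<lambda>h. Re (q z * h))) (at z)"
  shows "harmonic_on U u"
proof -
  have dq: "(q has_derivative (\<lambda>h. deriv q z * h)) (at z)" if "z \<in> U" for z
    using holomorphic_derivI[OF q U that] by (simp add: has_field_derivative_def)
  have dhol: "deriv q holomorphic_on U" by (rule holomorphic_deriv[OF q U])
  have c: "continuous_on U (deriv q)" by (rule holomorphic_on_imp_continuous_on[OF dhol])
  show ?thesis
    unfolding harmonic_on_def
  proof (intro conjI exI ballI)
    show "open U" by (rule U)
    show "continuous_on U (\<lambda>z. Re (deriv q z))" "continuous_on U (\<lambda>z. - Im (deriv q z))"
      "continuous_on U (\<lambda>z. - Im (deriv q z))" "continuous_on U (\<lambda>z. - Re (deriv q z))"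
      by (intro continuous_intros c)+
    fix z assume z: "z \<in> U"
    show "(u has_derivative (\<lambda>h. Re (q z) * Re h + - Im (q z) * Im h)) (at z)"
      using u[OF z] by (simp add: algebra_simps)
    have "((\<lambda>z. Re (q z)) has_derivative (\<lambda>h. Re (deriv q z * h))) (at z)"
      by (intro bounded_linear.has_derivative[OF bounded_linear_Re] dq z)
    then show "((\<lambda>z. Re (q z)) has_derivative (\<lambda>h. Re (deriv q z) * Re h + - Im (deriv q z) * Im h)) (at z)"
      by (simp add: algebra_simps)
    have "((\<lambda>z. - Im (q z)) has_derivative (\<lambda>h. - Im (deriv q z * h))) (at z)"
      by (intro has_derivative_minus bounded_linear.has_derivative[OF bounded_linear_Im] dq z)
    then show "((\<lambda>z. - Im (q z)) has_derivative (\<lambda>h. - Im (deriv q z) * Re h + - Re (deriv q z) * Im h)) (at z)"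
      by (simp add: algebra_simps)
    show "Re (deriv q z) + - Re (deriv q z) = 0" by simp
  qed
qed

lemma harmonic_on_Re:
  assumes "open U" "f holomorphic_on U"
  shows "harmonic_on U (\<lambda>z. Re (f z))"
proof (rule harmonic_on_holomorphic_gradient[OF assms(1)])
  show "deriv f holomorphic_on U" by (rule holomorphic_deriv[OF assms(2,1)])
  fix z assume "z \<in> U"
  then have "(f has_derivative (\<lambda>h. deriv f z * h)) (at z)"
    using holomorphic_derivI[OF assms(2,1)] by (simp add: has_field_derivative_def)
  then show "((\<lambda>z. Re (f z)) has_derivative (\<lambda>h. Re (deriv f z * h))) (at z)"
    by (rule bounded_linear.has_derivative[OF bounded_linear_Re])
qed

lemma harmonic_on_ln_cmod:
  assumes U: "open U" and f: "f holomorphic_on U" and nz: "\<And>z. z \<in> U \<Longrightarrow> f z \<noteq> 0"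
  shows "harmonic_on U (\<lambda>z. ln (cmod (f z)))"
proof (rule harmonic_on_holomorphic_gradient[OF U])
  show "(\<lambda>z. deriv f z / f z) holomorphic_on U"
    by (intro holomorphic_intros holomorphic_deriv[OF f U] f) (use nz in auto)
  fix z assume z: "z \<in> U"
  define w where "w = f z"
  have w: "w \<noteq> 0" using nz[OF z] by (simp add: w_def)
  have "(f has_field_derivative deriv f z) (at z)" by (rule holomorphic_derivI[OF f U z])
  then have "((\<lambda>\<zeta>. f \<zeta> / w) has_field_derivative deriv f z / w) (at z)" by (rule DERIV_cdivide)
  moreover have "(Ln has_field_derivative inverse (f z / w)) (at (f z / w))"
    by (rule has_field_derivative_Ln) (use w in \<open>simp add: w_def\<close>)
  ultimately have "((\<lambda>\<zeta>. Ln (f \<zeta> / w)) has_field_derivative inverse (f z / w) * (deriv f z / w)) (at z)"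
    by (rule DERIV_chain2[rotated])
  moreover have "inverse (f z / w) * (deriv f z / w) = deriv f z / f z" using w by (simp add: w_def)
  ultimately have "((\<lambda>\<zeta>. Ln (f \<zeta> / w)) has_field_derivative deriv f z / f z) (at z)" by (simp only:)
  then have "((\<lambda>\<zeta>. Ln (f \<zeta> / w)) has_derivative (\<lambda>h. (deriv f z / f z) * h)) (at z)"
    by (simp only: has_field_derivative_def)
  then have "((\<lambda>\<zeta>. Re (Ln (f \<zeta> / w)) + ln (cmod w)) has_derivative (\<lambda>h. Re ((deriv f z / f z) * h) + 0)) (at z)"
    by (intro has_derivative_add has_derivative_const bounded_linear.has_derivative[OF bounded_linear_Re])
  then have *: "((\<lambda>\<zeta>. Re (Ln (f \<zeta> / w)) + ln (cmod w)) has_derivative (\<lambda>h. Re ((deriv f z / f z) * h))) (at z)"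
    by simp
  show "((\<lambda>z. ln (cmod (f z))) has_derivative (\<lambda>h. Re (deriv f z / f z * h))) (at z)"
  proof (rule has_derivative_transform_within_open[OF * U z])
    fix \<zeta> assume "\<zeta> \<in> U"
    then have "f \<zeta> \<noteq> 0" by (rule nz)
    then show "Re (Ln (f \<zeta> / w)) + ln (cmod w) = ln (cmod (f \<zeta>))"
      using w by (simp add: norm_divide ln_divide_pos)
  qed
qed

lemma harmonic_onE:
  assumes "harmonic_on U u"
  obtains ux uy uxx uxy uyx uyy where
    "open U" "continuous_on U uxx" "continuous_on U uxy" "continuous_on U uyx" "continuous_on U uyy"
    "\<And>z. z \<in> U \<Longrightarrow> (u has_derivative (\<lambda>h. ux z * Re h + uy z * Im h)) (at z)"
    "\<And>z. z \<in> U \<Longrightarrow> (ux has_derivative (\<lambda>h. uxx z * Re h + uxy z * Im h)) (at z)"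
    "\<And>z. z \<in> U \<Longrightarrow> (uy has_derivative (\<lambda>h. uyx z * Re h + uyy z * Im h)) (at z)"
    "\<And>z. z \<in> U \<Longrightarrow> uxx z + uyy z = 0"
proof -
  from conjunct2[OF assms[unfolded harmonic_on_def]] obtain ux uy uxx uxy uyx uyy where H: "continuous_on U uxx \<and> continuous_on U uxy \<and> continuous_on U uyx \<and> continuous_on U uyy \<and>
        (\<forall>z\<in>U.
           (u has_derivative (\<lambda>h. ux z * Re h + uy z * Im h)) (at z) \<and>
           (ux has_derivative (\<lambda>h. uxx z * Re h + uxy z * Im h)) (at z) \<and>
           (uy has_derivative (\<lambda>h. uyx z * Re h + uyy z * Im h)) (at z) \<and>
           uxx z + uyy z = 0)"
    by (elim exE)
  note c = H[THEN conjunct1] H[THEN conjunct2, THEN conjunct1] H[THEN conjunct2, THEN conjunct2, THEN conjunct1]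
    H[THEN conjunct2, THEN conjunct2, THEN conjunct2, THEN conjunct1]
  note d = H[THEN conjunct2, THEN conjunct2, THEN conjunct2, THEN conjunct2, THEN bspec]
  show thesis
    by (rule that[OF conjunct1[OF assms[unfolded harmonic_on_def]] c d[THEN conjunct1] d[THEN conjunct2, THEN conjunct1]
      d[THEN conjunct2, THEN conjunct2, THEN conjunct1] d[THEN conjunct2, THEN conjunct2, THEN conjunct2]])
qed

lemma harmonic_on_cong:
  assumes "harmonic_on U u" "\<And>z. z \<in> U \<Longrightarrow> u z = v z"
  shows "harmonic_on U v"
proof -
  have "(u has_derivative D) (at z) \<Longrightarrow> (v has_derivative D) (at z)" if "open U" "z \<in> U" for D z
    using has_derivative_transform_within_open[of u D z UNIV U v] that assms(2) by simp
  note transfer = this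
  obtain ux uy uxx uxy uyx uyy where u: "open U" "continuous_on U uxx" "continuous_on U uxy" "continuous_on U uyx" "continuous_on U uyy"
    "\<And>z. z \<in> U \<Longrightarrow> (u has_derivative (\<lambda>h. ux z * Re h + uy z * Im h)) (at z)"
    "\<And>z. z \<in> U \<Longrightarrow> (ux has_derivative (\<lambda>h. uxx z * Re h + uxy z * Im h)) (at z)"
    "\<And>z. z \<in> U \<Longrightarrow> (uy has_derivative (\<lambda>h. uyx z * Re h + uyy z * Im h)) (at z)"
    "\<And>z. z \<in> U \<Longrightarrow> uxx z + uyy z = 0"
    by (rule harmonic_onE[OF assms(1)]) (rule that)
  show ?thesis
    unfolding harmonic_on_def
  proof (intro conjI exI ballI)
    fix z assume "z \<in> U"
    then show "(v has_derivative (\<lambda>h. ux z * Re h + uy z * Im h)) (at z)"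
      by (intro transfer u)
  qed (fact u)+
qed

lemma harmonic_on_lincomb:
  assumes "harmonic_on U u" "harmonic_on U v"
  shows "harmonic_on U (\<lambda>z. c * u z + d * v z)"
proof -
  obtain ux uy uxx uxy uyx uyy where u: "open U" "continuous_on U uxx" "continuous_on U uxy" "continuous_on U uyx" "continuous_on U uyy"
    "\<And>z. z \<in> U \<Longrightarrow> (u has_derivative (\<lambda>h. ux z * Re h + uy z * Im h)) (at z)"
    "\<And>z. z \<in> U \<Longrightarrow> (ux has_derivative (\<lambda>h. uxx z * Re h + uxy z * Im h)) (at z)"
    "\<And>z. z \<in> U \<Longrightarrow> (uy has_derivative (\<lambda>h. uyx z * Re h + uyy z * Im h)) (at z)"
    "\<And>z. z \<in> U \<Longrightarrow> uxx z + uyy z = 0"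
    by (rule harmonic_onE[OF assms(1)]) (rule that)
  obtain vx vy vxx vxy vyx vyy where v: "open U" "continuous_on U vxx" "continuous_on U vxy" "continuous_on U vyx" "continuous_on U vyy"
    "\<And>z. z \<in> U \<Longrightarrow> (v has_derivative (\<lambda>h. vx z * Re h + vy z * Im h)) (at z)"
    "\<And>z. z \<in> U \<Longrightarrow> (vx has_derivative (\<lambda>h. vxx z * Re h + vxy z * Im h)) (at z)"
    "\<And>z. z \<in> U \<Longrightarrow> (vy has_derivative (\<lambda>h. vyx z * Re h + vyy z * Im h)) (at z)"
    "\<And>z. z \<in> U \<Longrightarrow> vxx z + vyy z = 0"
    by (rule harmonic_onE[OF assms(2)]) (rule that)
  have lin: "((\<lambda>z. c * f z + d * g z) has_derivative (\<lambda>h. (c * p + d * p') * Re h + (c * r + d * r') * Im h)) (at z)"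
    if "(f has_derivative (\<lambda>h. p * Re h + r * Im h)) (at z)" "(g has_derivative (\<lambda>h. p' * Re h + r' * Im h)) (at z)"
    for f g :: "complex \<Rightarrow> real" and p r p' r' z
  proof -
    have "((\<lambda>z. c * f z + d * g z) has_derivative (\<lambda>h. c * (p * Re h + r * Im h) + d * (p' * Re h + r' * Im h))) (at z)"
      by (intro has_derivative_add has_derivative_mult_right that)
    moreover have "(\<lambda>h. c * (p * Re h + r * Im h) + d * (p' * Re h + r' * Im h)) = (\<lambda>h. (c * p + d * p') * Re h + (c * r + d * r') * Im h)"
      by (simp add: fun_eq_iff algebra_simps)
    ultimately show ?thesis by metis
  qed
  show ?thesis
    unfolding harmonic_on_def
  proof (intro conjI exI ballI)
    show "open U" by fact
    show "continuous_on U (\<lambda>z. c * uxx z + d * vxx z)" "continuous_on U (\<lambda>z. c * uxy z + d * vxy z)"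
      "continuous_on U (\<lambda>z. c * uyx z + d * vyx z)" "continuous_on U (\<lambda>z. c * uyy z + d * vyy z)"
      by (intro continuous_intros u v)+
    fix z assume z: "z \<in> U"
    show "((\<lambda>z. c * u z + d * v z) has_derivative (\<lambda>h. (c * ux z + d * vx z) * Re h + (c * uy z + d * vy z) * Im h)) (at z)"
      "((\<lambda>z. c * ux z + d * vx z) has_derivative (\<lambda>h. (c * uxx z + d * vxx z) * Re h + (c * uxy z + d * vxy z) * Im h)) (at z)"
      "((\<lambda>z. c * uy z + d * vy z) has_derivative (\<lambda>h. (c * uyx z + d * vyx z) * Re h + (c * uyy z + d * vyy z) * Im h)) (at z)"
      by (intro lin u v z)+
    have "c * uxx z + d * vxx z + (c * uyy z + d * vyy z) = c * (uxx z + uyy z) + d * (vxx z + vyy z)"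
      by (simp add: algebra_simps)
    then show "c * uxx z + d * vxx z + (c * uyy z + d * vyy z) = 0" using u(9)[OF z] v(9)[OF z] by simp
  qed
qed

lemma harmonic_on_const: "open U \<Longrightarrow> harmonic_on U (\<lambda>z. c)"
  using harmonic_on_Re[of U "\<lambda>z. complex_of_real c"] by simp

lemma harmonic_on_sum:
  assumes "finite A" "open U" "\<And>i. i \<in> A \<Longrightarrow> harmonic_on U (f i)"
  shows "harmonic_on U (\<lambda>z. \<Sum>i\<in>A. f i z)"
  using assms(1,3)
proof (induction A rule: finite_induct)
  case empty
  then show ?case using harmonic_on_const[OF assms(2), of 0] by simp
next
  case (insert i A)
  then show ?case using harmonic_on_lincomb[of U "f i" "\<lambda>z. \<Sum>i\<in>A. f i z" 1 1] by simp
qed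

lemma second_derivative_nonpos_at_max:
  fixes f :: "real \<Rightarrow> real"
  assumes d: "0 < d" and f: "\<And>t. \<bar>t\<bar> < d \<Longrightarrow> (f has_real_derivative f' t) (at t)"
    and f': "(f' has_real_derivative c) (at 0)" and max: "\<And>t. \<bar>t\<bar> < d \<Longrightarrow> f t \<le> f 0"
  shows "c \<le> 0"
proof (rule ccontr)
  assume "\<not> c \<le> 0"
  then have "0 < c" by simp
  have f0: "f' 0 = 0"
    by (rule DERIV_local_max[OF f[of 0] d]) (use d max in auto)
  obtain e where e: "e > 0" "\<And>h. 0 < h \<Longrightarrow> h < e \<Longrightarrow> f' 0 < f' (0 + h)"
    using DERIV_pos_inc_right[OF f' \<open>0 < c\<close>] by blast
  define t where "t = min d e / 2"
  have t: "0 < t" "t < d" "t < e" using d e(1) by (auto simp: t_def min_def)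
  have "\<exists>z. z > 0 \<and> z < t \<and> f t - f 0 = (t - 0) * f' z"
    by (rule MVT2) (use t f in auto)
  then obtain z where z: "0 < z" "z < t" "f t - f 0 = (t - 0) * f' z" by blast
  have "0 < f' z" using e(2)[of z] z t f0 by simp
  then have "f 0 < f t" using z t by (metis diff_0_right diff_gt_0_iff_gt mult_pos_pos)
  then show False using max[of t] t by simp
qed

lemma directional_derivative:
  fixes u :: "complex \<Rightarrow> real"
  assumes "(u has_derivative (\<lambda>h. p * Re h + r * Im h)) (at (z + complex_of_real t * e))"
  shows "((\<lambda>s. u (z + complex_of_real s * e)) has_real_derivative (p * Re e + r * Im e)) (at t)"
proof -
  have "((\<lambda>s. z + complex_of_real s * e) has_derivative (\<lambda>s. complex_of_real s * e)) (at t)"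
    by (auto intro!: derivative_eq_intros)
  from has_derivative_compose[OF this assms] have "((\<lambda>s. u (z + complex_of_real s * e)) has_derivative
      (\<lambda>s. p * Re (complex_of_real s * e) + r * Im (complex_of_real s * e))) (at t)" .
  moreover have "(\<lambda>s. p * Re (complex_of_real s * e) + r * Im (complex_of_real s * e)) = (*) (p * Re e + r * Im e)"
    by (auto simp: fun_eq_iff algebra_simps)
  ultimately show ?thesis by (simp only: has_field_derivative_def)
qed

text \<open>Adding a small multiple of \<open>|z| ^ 2\<close> makes the Laplacian positive, which rules out an interior
  maximum.\<close>

theorem harmonic_maximum_principle:
  assumes u: "harmonic_on U u" and K: "compact K" "K \<subseteq> U" and out: "\<And>z. z \<in> U - K \<Longrightarrow> u z \<le> 0"
    and z: "z \<in> U"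
  shows "u z \<le> 0"
proof (rule ccontr)
  assume "\<not> u z \<le> 0"
  then have pos: "0 < u z" by simp
  then have zK: "z \<in> K" using out[of z] z by force
  obtain ux uy uxx uxy uyx uyy where h': "open U" "continuous_on U uxx" "continuous_on U uxy" "continuous_on U uyx" "continuous_on U uyy"
    "\<And>z. z \<in> U \<Longrightarrow> (u has_derivative (\<lambda>h. ux z * Re h + uy z * Im h)) (at z)"
    "\<And>z. z \<in> U \<Longrightarrow> (ux has_derivative (\<lambda>h. uxx z * Re h + uxy z * Im h)) (at z)"
    "\<And>z. z \<in> U \<Longrightarrow> (uy has_derivative (\<lambda>h. uyx z * Re h + uyy z * Im h)) (at z)"
    "\<And>z. z \<in> U \<Longrightarrow> uxx z + uyy z = 0"
    by (rule harmonic_onE[OF u]) (rule that)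
  note h = h'(1,6,7,8,9)
  obtain R where R: "0 < R" "\<And>z. z \<in> K \<Longrightarrow> cmod z \<le> R"
    using compact_imp_bounded[OF K(1)] unfolding bounded_pos by auto
  define \<delta> where "\<delta> = u z / (2 * (R + 1)\<^sup>2)"
  have \<delta>: "0 < \<delta>" using pos R by (simp add: \<delta>_def)
  have \<delta>R: "\<delta> * (R + 1)\<^sup>2 < u z" using pos R by (simp add: \<delta>_def)
  define v where "v z = u z + \<delta> * (cmod z)\<^sup>2" for z
  have cu: "continuous_on K u"
  proof (rule continuous_at_imp_continuous_on, rule ballI)
    fix z assume "z \<in> K"
    then show "isCont u z" using has_derivative_continuous[OF h(2)[of z]] K(2) by auto
  qed
  have "continuous_on K v" unfolding v_def by (intro continuous_intros cu)
  then obtain m where m: "m \<in> K" "\<And>y. y \<in> K \<Longrightarrow> v y \<le> v m"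
    using continuous_attains_sup[OF K(1)] zK by blast
  have mU: "m \<in> U" using m(1) K(2) by auto
  have "0 \<le> \<delta> * (cmod z)\<^sup>2" using \<delta> by simp
  then have vm: "u z \<le> v m" using m(2)[OF zK] unfolding v_def by linarith
  obtain d0 where d0: "0 < d0" "ball m d0 \<subseteq> U" using h(1) mU openE by blast
  define d where "d = min d0 1"
  have d: "0 < d" "d \<le> 1" "ball m d \<subseteq> U" using d0 by (auto simp: d_def)
  have loc: "v y \<le> v m" if y: "cmod (y - m) < d" for y
  proof (cases "y \<in> K")
    case False
    have "y \<in> U" using y d(3) by (auto simp: dist_norm norm_minus_commute)
    then have "u y \<le> 0" using out False by auto
    have "cmod y \<le> cmod m + cmod (y - m)" using norm_triangle_ineq[of m "y - m"] by simp
    then have "cmod y \<le> R + 1" using R(2)[OF m(1)] y d by linarith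
    then have "\<delta> * (cmod y)\<^sup>2 \<le> \<delta> * (R + 1)\<^sup>2" using \<delta> by (intro mult_left_mono power_mono) auto
    then show ?thesis using \<open>u y \<le> 0\<close> \<delta>R vm by (simp add: v_def)
  qed (use m in auto)
  have line: "ux' + 2 * \<delta> \<le> 0"
    if e: "cmod e = 1" and d1: "\<And>z. z \<in> U \<Longrightarrow> (u has_derivative (\<lambda>h. ux z * Re h + uy z * Im h)) (at z)"
      and w: "\<And>t. \<bar>t\<bar> < d \<Longrightarrow> ux (m + complex_of_real t * e) * Re e + uy (m + complex_of_real t * e) * Im e = f' t"
      and f': "(f' has_real_derivative ux') (at 0)" for e f' ux'
  proof (rule second_derivative_nonpos_at_max[OF d(1)])
    fix t :: real assume t: "\<bar>t\<bar> < d"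
    have inU: "m + complex_of_real t * e \<in> U" using t d(3) e by (auto simp: dist_norm norm_mult)
    have sq: "(cmod (m + complex_of_real s * e))\<^sup>2 = (cmod m)\<^sup>2 + 2 * s * (Re m * Re e + Im m * Im e) + s\<^sup>2" for s
    proof -
      have "(Re e)\<^sup>2 + (Im e)\<^sup>2 = 1" using e by (metis cmod_power2 one_power2)
      moreover have "(cmod (m + complex_of_real s * e))\<^sup>2 =
          (cmod m)\<^sup>2 + 2 * s * (Re m * Re e + Im m * Im e) + s\<^sup>2 * ((Re e)\<^sup>2 + (Im e)\<^sup>2)"
        by (simp add: cmod_power2) (simp add: power2_eq_square algebra_simps)
      ultimately show ?thesis by simp
    qed
    have "((\<lambda>s. u (m + complex_of_real s * e) + \<delta> * ((cmod m)\<^sup>2 + 2 * s * (Re m * Re e + Im m * Im e) + s\<^sup>2)) has_real_derivative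
       f' t + \<delta> * (2 * (Re m * Re e + Im m * Im e) + 2 * t)) (at t)"
      using directional_derivative[OF d1[OF inU]] unfolding w[OF t]
      by (auto intro!: derivative_eq_intros)
    then show "((\<lambda>s. v (m + complex_of_real s * e)) has_real_derivative f' t + \<delta> * (2 * (Re m * Re e + Im m * Im e) + 2 * t)) (at t)"
      unfolding v_def sq .
    show "v (m + complex_of_real t * e) \<le> v (m + complex_of_real 0 * e)"
      using loc[of "m + complex_of_real t * e"] t e by (simp add: norm_mult)
  next
    show "((\<lambda>t. f' t + \<delta> * (2 * (Re m * Re e + Im m * Im e) + 2 * t)) has_real_derivative ux' + 2 * \<delta>) (at 0)"
      using f' by (auto intro!: derivative_eq_intros)
  qed
  have "uxx m + 2 * \<delta> \<le> 0"
  proof (rule line[of 1 "\<lambda>t. ux (m + complex_of_real t * 1)"])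
    show "((\<lambda>t. ux (m + complex_of_real t * 1)) has_real_derivative uxx m) (at 0)"
      using directional_derivative[of ux "uxx m" "uxy m" m 0 1] h(3)[OF mU] by simp
  qed (use h(2) in auto)
  moreover have "uyy m + 2 * \<delta> \<le> 0"
  proof (rule line[of \<i> "\<lambda>t. uy (m + complex_of_real t * \<i>)"])
    show "((\<lambda>t. uy (m + complex_of_real t * \<i>)) has_real_derivative uyy m) (at 0)"
      using directional_derivative[of uy "uyx m" "uyy m" m 0 \<i>] h(4)[OF mU] by simp
  qed (use h(2) in auto)
  ultimately show False using h(5)[OF mU] \<delta> by simp
qed

text \<open>A holomorphic square root off the slit: the quotient \<open>(w + 1) / (w - 1)\<close> avoids the nonpositive
  reals there. It maps the complement of the slit into the right half plane, and the slit to the imaginary axis.\<close>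

definition slit_root :: "complex \<Rightarrow> complex" where
  "slit_root w = csqrt ((w + 1) / (w - 1))"

lemma off_slit_quotient:
  assumes "w \<notin> complex_of_real ` {-1..1}"
  shows "(w + 1) / (w - 1) \<notin> \<real>\<^sub>\<le>\<^sub>0" "w \<noteq> 1" "w \<noteq> -1"
proof -
  show w1: "w \<noteq> 1" "w \<noteq> -1" using assms 
  proof -
    have "complex_of_real 1 \<in> complex_of_real ` {-1..1}" "complex_of_real (-1) \<in> complex_of_real ` {-1..1}" by (rule imageI, simp)+
    then show "w \<noteq> 1" "w \<noteq> -1" using assms by auto
  qed
  show "(w + 1) / (w - 1) \<notin> \<real>\<^sub>\<le>\<^sub>0"
  proof
    assume "(w + 1) / (w - 1) \<in> \<real>\<^sub>\<le>\<^sub>0"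
    then obtain r where r: "(w + 1) / (w - 1) = complex_of_real r" "r \<le> 0" by (auto elim!: nonpos_Reals_cases)
    then have "w + 1 = complex_of_real r * (w - 1)" using w1 by (simp add: divide_eq_eq)
    then have "w * (1 - complex_of_real r) = - complex_of_real r - 1" by (simp add: algebra_simps)
    moreover have "1 - complex_of_real r \<noteq> 0" 
    proof
      assume "1 - complex_of_real r = 0"
      then have "complex_of_real r = complex_of_real 1" by simp
      then have "r = 1" by (simp only: of_real_eq_iff)
      then show False using r(2) by simp
    qed
    ultimately have "w = (- complex_of_real r - 1) / (1 - complex_of_real r)" by (simp add: eq_divide_eq)
    also have "\<dots> = complex_of_real ((- r - 1) / (1 - r))" by simp
    finally have "w = complex_of_real ((- r - 1) / (1 - r))" .
    moreover have "(- r - 1) / (1 - r) \<in> {-1..1}" using r(2) by (auto simp: field_simps)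
    ultimately show False using assms by blast
  qed
qed

lemma slit_root_sq: "(slit_root w)\<^sup>2 = (w + 1) / (w - 1)"
  by (simp add: slit_root_def)

lemma Re_slit_root_pos:
  assumes "w \<notin> complex_of_real ` {-1..1}"
  shows "0 < Re (slit_root w)"
proof -
  have "csqrt ((w + 1) / (w - 1)) \<noteq> 0" using off_slit_quotient[OF assms] by auto
  moreover have "Re (csqrt z) \<noteq> 0" if "z \<notin> \<real>\<^sub>\<le>\<^sub>0" for z
  proof
    assume "Re (csqrt z) = 0"
    then have "csqrt z = \<i> * Im (csqrt z)" by (simp add: complex_eq_iff)
    then have "(csqrt z)\<^sup>2 = (\<i> * complex_of_real (Im (csqrt z)))\<^sup>2" by (rule arg_cong)
    then have "z = complex_of_real (- (Im (csqrt z))\<^sup>2)" by (simp add: power_mult_distrib)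
    moreover have "complex_of_real (- (Im (csqrt z))\<^sup>2) \<in> \<real>\<^sub>\<le>\<^sub>0"
      by (subst nonpos_Reals_of_real_iff) simp
    ultimately have "z \<in> \<real>\<^sub>\<le>\<^sub>0" by (rule ssubst)
    then show False using that by simp
  qed
  ultimately show ?thesis using Re_csqrt off_slit_quotient(1)[OF assms] unfolding slit_root_def
    by (metis less_eq_real_def)
qed

lemma holomorphic_slit_root: "slit_root holomorphic_on - complex_of_real ` {-1..1}"
  unfolding slit_root_def using off_slit_quotient
  by (intro holomorphic_intros) auto

text \<open>With \<open>r = slit_root w\<close>, the Green function is the logarithm of the modulus of \<open>(r + 1) / (r - 1)\<close>, which makes it
  harmonic.\<close>

lemma green_slit_ln:
  assumes "w \<notin> complex_of_real ` {-1..1}"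
  shows "green_slit w = ln (cmod ((slit_root w + 1) / (slit_root w - 1)))"
    and "1 < cmod ((slit_root w + 1) / (slit_root w - 1))" "slit_root w \<noteq> 1"
proof -
  define W where "W = slit_root w"
  have W2: "W\<^sup>2 = (w + 1) / (w - 1)" by (simp add: W_def slit_root_sq)
  have Wpos: "0 < Re W" unfolding W_def by (rule Re_slit_root_pos[OF assms])
  note w = off_slit_quotient[OF assms]
  show W1: "slit_root w \<noteq> 1"
  proof
    assume "slit_root w = 1"
    then have "(w + 1) / (w - 1) = 1" using W2 by (simp add: W_def)
    then show False using w by (simp add: divide_eq_eq)
  qed
  define \<zeta> where "\<zeta> = (W + 1) / (W - 1)"
  have "(cmod (W + 1))\<^sup>2 - (cmod (W - 1))\<^sup>2 = 4 * Re W"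
    by (simp add: cmod_power2) (simp add: power2_eq_square algebra_simps)
  then have "(cmod (W - 1))\<^sup>2 < (cmod (W + 1))\<^sup>2" using Wpos by linarith
  then have lt: "cmod (W - 1) < cmod (W + 1)" by (rule power_less_imp_less_base) simp
  moreover have "0 < cmod (W - 1)" using W1 by (simp add: W_def)
  ultimately have \<zeta>1: "1 < cmod \<zeta>" by (simp add: \<zeta>_def norm_divide)
  then show "1 < cmod ((slit_root w + 1) / (slit_root w - 1))" by (simp add: \<zeta>_def W_def)
  have \<zeta>0: "\<zeta> \<noteq> 0" using \<zeta>1 by auto
  have Wne: "W - 1 \<noteq> 0" "W + 1 \<noteq> 0" using W1 lt by (auto simp: W_def)
  have "W\<^sup>2 - 1 = (W + 1) * (W - 1)" by (simp add: power2_eq_square algebra_simps)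
  then have W2ne: "W\<^sup>2 - 1 \<noteq> 0" using Wne by (simp only: mult_eq_0_iff simp_thms)
  have wW: "w = (W\<^sup>2 + 1) / (W\<^sup>2 - 1)"
  proof -
    have "W\<^sup>2 * (w - 1) = w + 1" using W2 w(2) by simp
    then have "w * (W\<^sup>2 - 1) = W\<^sup>2 + 1" by (simp add: algebra_simps)
    then show ?thesis using W2ne by (simp add: eq_divide_eq)
  qed
  have w\<zeta>: "w = (\<zeta>\<^sup>2 + 1) / (2 * \<zeta>)"
  proof -
    have "(\<zeta>\<^sup>2 + 1) / (2 * \<zeta>) = ((W + 1)\<^sup>2 + (W - 1)\<^sup>2) / (2 * (W + 1) * (W - 1))"
    proof -
      have "((p / q)\<^sup>2 + 1) / (2 * (p / q)) = (p\<^sup>2 + q\<^sup>2) / (2 * p * q)" if "p \<noteq> 0" "q \<noteq> 0" for p q :: complex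
        using that by (simp add: field_simps power2_eq_square)
      from this[OF Wne(2,1)] show ?thesis unfolding \<zeta>_def .
    qed
    also have "(W + 1)\<^sup>2 + (W - 1)\<^sup>2 = 2 * (W\<^sup>2 + 1)" by (simp add: power2_eq_square algebra_simps)
    also have "2 * (W + 1) * (W - 1) = 2 * (W\<^sup>2 - 1)" by (simp add: power2_eq_square algebra_simps)
    also have "2 * (W\<^sup>2 + 1) / (2 * (W\<^sup>2 - 1)) = w"
      unfolding wW by (rule mult_divide_mult_cancel_left) simp
    finally show ?thesis by (rule sym)
  qed
  have p1: "w + 1 = (\<zeta> + 1)\<^sup>2 / (2 * \<zeta>)" and m1: "w - 1 = (\<zeta> - 1)\<^sup>2 / (2 * \<zeta>)"
    unfolding w\<zeta> using \<zeta>0 by (simp_all add: field_simps power2_eq_square)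
  have "cmod (w - 1) + cmod (w + 1) = ((cmod (\<zeta> - 1))\<^sup>2 + (cmod (\<zeta> + 1))\<^sup>2) / (2 * cmod \<zeta>)"
    unfolding p1 m1 by (simp add: norm_divide norm_mult norm_power add_divide_distrib)
  also have "(cmod (\<zeta> - 1))\<^sup>2 + (cmod (\<zeta> + 1))\<^sup>2 = 2 * (cmod \<zeta>)\<^sup>2 + 2"
    by (simp add: cmod_power2) (simp add: power2_eq_square algebra_simps)
  also have "(2 * (cmod \<zeta>)\<^sup>2 + 2) / (2 * cmod \<zeta>) = cmod \<zeta> + inverse (cmod \<zeta>)"
    using \<zeta>0 by (simp add: field_simps power2_eq_square)
  finally have "(cmod (w - 1) + cmod (w + 1)) / 2 = cosh (ln (cmod \<zeta>))"
    using cosh_ln_real[of "cmod \<zeta>"] \<zeta>0 by simp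
  then have "green_slit w = arcosh (cosh (ln (cmod \<zeta>)))" by (simp add: green_slit_def)
  also have "\<dots> = ln (cmod \<zeta>)" using \<zeta>1 by (intro arcosh_cosh_real) simp
  finally show "green_slit w = ln (cmod ((slit_root w + 1) / (slit_root w - 1)))"
    by (simp add: \<zeta>_def W_def)
qed

lemma harmonic_green_slit:
  assumes V: "open V" and m: "m holomorphic_on V" "\<And>z. z \<in> V \<Longrightarrow> m z \<notin> complex_of_real ` {-1..1}"
  shows "harmonic_on V (\<lambda>z. green_slit (m z))"
proof -
  have "slit_root \<circ> m holomorphic_on V"
    by (rule holomorphic_on_compose_gen[OF m(1) holomorphic_slit_root]) (use m(2) in auto)
  then have h: "(\<lambda>z. slit_root (m z)) holomorphic_on V" by (simp add: o_def)
  have "harmonic_on V (\<lambda>z. ln (cmod ((slit_root (m z) + 1) / (slit_root (m z) - 1))))"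
  proof (rule harmonic_on_ln_cmod[OF V])
    show "(\<lambda>z. (slit_root (m z) + 1) / (slit_root (m z) - 1)) holomorphic_on V"
      by (intro holomorphic_intros h) (use green_slit_ln(3) m(2) in auto)
    fix z assume "z \<in> V"
    from green_slit_ln(2)[OF m(2)[OF this]] show "(slit_root (m z) + 1) / (slit_root (m z) - 1) \<noteq> 0" by auto
  qed
  then show ?thesis
    by (rule harmonic_on_cong) (use green_slit_ln(1) m(2) in auto)
qed

text \<open>Outer regularity gives an open cover of small measure; if the mesh of a grid is below the distance from \<open>K\<close> to
  the complement of the cover, every cell that meets \<open>K\<close> lies in the cover.\<close>

lemma null_compact_grid_cover:
  fixes K :: "real set"
  assumes K: "compact K" "emeasure lborel K = 0" and \<eta>: "0 < \<eta>"
  obtains d :: real and J :: "int set" where "0 < d" "finite J" "card J * d \<le> \<eta>"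
    "\<And>t. t \<in> K \<Longrightarrow> \<exists>j\<in>J. real_of_int j * d \<le> t \<and> t < (real_of_int j + 1) * d"
proof -
  have Kb: "K \<in> sets borel" using K(1) by (simp add: borel_closed compact_imp_closed)
  obtain O' where O': "open O'" "K \<subseteq> O'" "emeasure lborel O' < ennreal \<eta>"
  proof -
    have "K \<in> sets lebesgue" using Kb by (simp add: sets_completionI_sets)
    then obtain T where T: "open T" "K \<subseteq> T" "(T - K) \<in> lmeasurable" "emeasure lebesgue (T - K) < ennreal \<eta>"
      using sets_lebesgue_outer_open[OF _ \<eta>, of K] by metis
    have "emeasure lborel T = emeasure lebesgue T" using T(1) by (simp add: borel_open)
    also have "emeasure lebesgue T = emeasure lebesgue ((T - K) \<union> K)" using T(2) by (simp add: Un_absorb2)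
    also have "\<dots> \<le> emeasure lebesgue (T - K) + emeasure lebesgue K"
      using T(3) \<open>K \<in> sets lebesgue\<close> by (intro emeasure_subadditive) auto
    also have "emeasure lebesgue K = 0" using K(2) Kb by simp
    finally show thesis using that[OF T(1,2)] T(4) by simp
  qed
  obtain \<delta> where \<delta>: "0 < \<delta>" "\<And>t y. t \<in> K \<Longrightarrow> \<bar>y - t\<bar> < \<delta> \<Longrightarrow> y \<in> O'"
  proof (cases "- O' = {}")
    case True
    then show thesis using that[of 1] by auto
  next
    case False
    obtain d where "0 < d" "\<And>x y. x \<in> K \<Longrightarrow> y \<in> - O' \<Longrightarrow> d \<le> dist x y"
    proof -
      have "closed (- O')" "K \<inter> - O' = {}" using O' by auto
      from separate_compact_closed[OF K(1) this] show thesis using that by blast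
    qed
    then show thesis using that[of d] by (force simp: dist_real_def abs_minus_commute)
  qed
  define d where "d = \<delta> / 2"
  have d: "0 < d" "d < \<delta>" using \<delta>(1) by (auto simp: d_def)
  define J where "J = (\<lambda>t. \<lfloor>t / d\<rfloor>) ` K"
  have cell: "\<lfloor>t / d\<rfloor> * d \<le> t" "t < (\<lfloor>t / d\<rfloor> + 1) * d" for t
  proof -
    have "\<lfloor>t / d\<rfloor> \<le> t / d" "t / d < \<lfloor>t / d\<rfloor> + 1" by linarith+
    then show "\<lfloor>t / d\<rfloor> * d \<le> t" "t < (\<lfloor>t / d\<rfloor> + 1) * d" 
      using pos_le_divide_eq[OF d(1)] pos_divide_less_eq[OF d(1)] by blast+
  qed
  have "finite J"
  proof -
    obtain B where B: "\<And>t. t \<in> K \<Longrightarrow> \<bar>t\<bar> \<le> B" using compact_imp_bounded[OF K(1)] by (auto simp: bounded_real)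
    have "J \<subseteq> {\<lfloor>- B / d\<rfloor>..\<lfloor>B / d\<rfloor>}"
    proof
      fix j assume "j \<in> J"
      then obtain t where t: "t \<in> K" "j = \<lfloor>t / d\<rfloor>" by (auto simp: J_def)
      have "- B \<le> t" "t \<le> B" using B[OF t(1)] by (auto simp: abs_le_iff)
      then have "- B / d \<le> t / d" "t / d \<le> B / d" using d by (intro divide_right_mono; simp)+
      then show "j \<in> {\<lfloor>- B / d\<rfloor>..\<lfloor>B / d\<rfloor>}" unfolding t(2) by (auto intro!: floor_mono)
    qed
    then show ?thesis by (rule finite_subset) simp
  qed
  define C where "C j = {real_of_int j * d..<(real_of_int j + 1) * d}" for j :: int
  have disj: "disjoint_family_on C J"
    unfolding disjoint_family_on_def
  proof (intro ballI impI)
    fix i j :: int assume "i \<noteq> j"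
    show "C i \<inter> C j = {}"
    proof (rule ccontr)
      assume "C i \<inter> C j \<noteq> {}"
      then obtain x where x: "real_of_int i * d \<le> x" "x < (real_of_int i + 1) * d" "real_of_int j * d \<le> x" "x < (real_of_int j + 1) * d"
        unfolding C_def by (metis IntE all_not_in_conv atLeastLessThan_iff)
      then have "real_of_int i * d < (real_of_int j + 1) * d" "real_of_int j * d < (real_of_int i + 1) * d" by linarith+
      then have "real_of_int i < real_of_int j + 1" "real_of_int j < real_of_int i + 1" using d by simp_all
      then show False using \<open>i \<noteq> j\<close> by linarith
    qed
  qed
  have sub: "(\<Union>j\<in>J. C j) \<subseteq> O'"
  proof
    fix y assume "y \<in> (\<Union>j\<in>J. C j)"
    then obtain t where t: "t \<in> K" "y \<in> C \<lfloor>t / d\<rfloor>" by (auto simp: J_def)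
    have "\<bar>y - t\<bar> \<le> d" using t(2) cell[of t] by (auto simp: C_def abs_le_iff algebra_simps)
    then show "y \<in> O'" using \<delta>(2)[OF t(1)] d by auto
  qed
  have "ennreal (card J * d) = (\<Sum>j\<in>J. emeasure lborel (C j))"
  proof -
    have "emeasure lborel (C j) = ennreal d" for j
      using d by (simp add: C_def algebra_simps)
    then show ?thesis using d by (simp add: ennreal_mult ennreal_of_nat_eq_real_of_nat)
  qed
  also have "\<dots> = emeasure lborel (\<Union>j\<in>J. C j)"
    by (rule sum_emeasure[OF _ disj \<open>finite J\<close>]) (auto simp: C_def)
  also have "\<dots> \<le> emeasure lborel O'" using sub O'(1) by (intro emeasure_mono) auto
  also have "\<dots> < ennreal \<eta>" by fact
  finally have "card J * d \<le> \<eta>" using \<eta> d by (simp add: ennreal_less_iff)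
  then show thesis
    using that[OF d(1) \<open>finite J\<close>] cell by (auto simp: J_def)
qed

section \<open>A maximum principle with exceptional boundary sets\<close>

definition unit_slit_map :: "real \<Rightarrow> real \<Rightarrow> complex \<Rightarrow> complex" where
  "unit_slit_map a b z = (2 * z - complex_of_real (a + b)) / complex_of_real (b - a)"

lemma unit_slit_map_off:
  assumes "a < b" "z \<notin> complex_of_real ` {a..b}"
  shows "unit_slit_map a b z \<notin> complex_of_real ` {-1..1}"
proof
  assume "unit_slit_map a b z \<in> complex_of_real ` {-1..1}"
  then obtain s where s: "s \<in> {-1..1}" "(2 * z - complex_of_real (a + b)) / complex_of_real (b - a) = complex_of_real s"
    by (auto simp: unit_slit_map_def)
  define t where "t = (s * (b - a) + (a + b)) / 2"
  have "2 * z - complex_of_real (a + b) = complex_of_real s * complex_of_real (b - a)"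
    using s(2) assms(1) by (simp add: divide_eq_eq)
  then have "z = complex_of_real t" by (simp add: t_def field_simps)
  moreover have "t \<in> {a..b}"
  proof -
    have "s * (b - a) \<le> 1 * (b - a)" "- 1 * (b - a) \<le> s * (b - a)"
      using s(1) assms(1) by (intro mult_right_mono; simp)+
    then show ?thesis by (auto simp: t_def field_simps)
  qed
  ultimately show False using assms(2) by blast
qed

lemma unit_slit_map_quotient:
  assumes "a < b"
  shows "(unit_slit_map a b z + 1) / (unit_slit_map a b z - 1) = (z - complex_of_real a) / (z - complex_of_real b)"
proof -
  define h where "h = complex_of_real (b - a)"
  have h: "h \<noteq> 0" using assms by (simp add: h_def)
  have "unit_slit_map a b z + 1 = 2 * (z - complex_of_real a) / h" "unit_slit_map a b z - 1 = 2 * (z - complex_of_real b) / h"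
    unfolding unit_slit_map_def h_def[symmetric] using h by (simp_all add: field_simps) (simp_all add: h_def)
  moreover have "(2 * p / h) / (2 * r / h) = p / r" for p r using h by simp
  ultimately show ?thesis by (simp only:)
qed

lemma exp_green_slit_ge: "cmod w \<le> exp (green_slit w)"
proof -
  define g where "g = green_slit w"
  have "cosh g = (cmod (w - 1) + cmod (w + 1)) / 2"
    unfolding g_def green_slit_def using foci_sum_ge[of w] by (rule cosh_arcosh_real)
  moreover have "cosh g \<le> exp g" using green_slit_nonneg[of w] by (intro cosh_exp_bounds) (simp add: g_def)
  ultimately show ?thesis using foci_sum_ge_cmod[of w] by (simp add: g_def)
qed

text \<open>Near infinity both sides grow like \<open>ln |z|\<close>, so the Green function minus the logarithmic
  kernel of a point is bounded below. The difference is a nonnegative harmonic function that is infinite at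
  that point.\<close>

lemma point_barrier_const:
  assumes "a < b"
  obtains C where "\<And>z. z \<noteq> complex_of_real q \<Longrightarrow> ln (cmod (z - complex_of_real q)) \<le> green_slit (unit_slit_map a b z) + C"
proof -
  define H where "H = (b - a) / 2"
  define m where "m = (a + b) / 2"
  have H: "0 < H" using assms by (simp add: H_def)
  have "ln (cmod (z - complex_of_real q)) \<le> green_slit (unit_slit_map a b z) + ln (H + \<bar>m - q\<bar>)"
    if z: "z \<noteq> complex_of_real q" for z
  proof -
    let ?g = "green_slit (unit_slit_map a b z)"
    have "z - complex_of_real q = complex_of_real H * unit_slit_map a b z + complex_of_real (m - q)"
      using assms by (simp add: unit_slit_map_def H_def m_def field_simps)
    then have "cmod (z - complex_of_real q) \<le> H * cmod (unit_slit_map a b z) + \<bar>m - q\<bar>"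
      using norm_triangle_ineq[of "complex_of_real H * unit_slit_map a b z" "complex_of_real (m - q)"] H
      by (simp only: norm_mult norm_of_real abs_of_pos)
    also have "\<dots> \<le> H * exp ?g + \<bar>m - q\<bar> * exp ?g"
    proof (intro add_mono mult_left_mono exp_green_slit_ge)
      have "\<bar>m - q\<bar> * 1 \<le> \<bar>m - q\<bar> * exp ?g" using green_slit_nonneg by (intro mult_left_mono) auto
      then show "\<bar>m - q\<bar> \<le> \<bar>m - q\<bar> * exp ?g" by simp
    qed (use H in simp)
    also have "\<dots> = exp ?g * (H + \<bar>m - q\<bar>)" by (simp add: algebra_simps)
    finally have "ln (cmod (z - complex_of_real q)) \<le> ln (exp ?g * (H + \<bar>m - q\<bar>))"
      using z by (intro ln_mono) auto
    also have "\<dots> = ?g + ln (H + \<bar>m - q\<bar>)" using H by (subst ln_mult_pos) auto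
    finally show ?thesis .
  qed
  then show thesis by (rule that)
qed

text \<open>The angle under which the segment from \<open>\<i> s\<close> to \<open>\<i> t\<close> is seen from \<open>w\<close>; up to a factor \<open>pi\<close> it is the harmonic measure
  of that segment for the right half plane.\<close>

definition sector_angle :: "real \<Rightarrow> real \<Rightarrow> complex \<Rightarrow> real" where
  "sector_angle s t w = Im (Ln (w - \<i> * complex_of_real s)) - Im (Ln (w - \<i> * complex_of_real t))"

lemma sector_angle_arctan:
  assumes "0 < Re w"
  shows "sector_angle s t w = arctan ((Im w - s) / Re w) - arctan ((Im w - t) / Re w)"
proof -
  have "Im (Ln (w - \<i> * complex_of_real r)) = arctan ((Im w - r) / Re w)" for r
  proof -
    have "w - \<i> * complex_of_real r \<noteq> 0" using assms by (auto simp: complex_eq_iff)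
    then show ?thesis using assms by (subst Im_Ln_eq) auto
  qed
  then show ?thesis by (simp add: sector_angle_def)
qed

lemma arctan_diff_le:
  assumes "y \<le> x"
  shows "arctan x - arctan y \<le> x - y"
proof (cases "y = x")
  case False
  then have "y < x" using assms by simp
  then obtain z where z: "arctan x - arctan y = (x - y) * inverse (1 + z\<^sup>2)"
    using MVT2[of y x arctan "\<lambda>z. inverse (1 + z\<^sup>2)"] DERIV_arctan by auto
  have "inverse (1 + z\<^sup>2) \<le> 1" by (rule inverse_le_1_iff[THEN iffD2]) simp
  then have "(x - y) * inverse (1 + z\<^sup>2) \<le> (x - y) * 1" using \<open>y < x\<close> by (intro mult_left_mono) auto
  then show ?thesis using z by simp
qed simp

lemma sector_angle_bounds:
  assumes w: "0 < Re w" and st: "s \<le> t"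
  shows "0 \<le> sector_angle s t w" "sector_angle s t w \<le> (t - s) / Re w"
proof -
  have le: "(Im w - t) / Re w \<le> (Im w - s) / Re w" using assms by (intro divide_right_mono) auto
  then show "0 \<le> sector_angle s t w" using w by (simp add: sector_angle_arctan arctan_monotone')
  have "sector_angle s t w \<le> (Im w - s) / Re w - (Im w - t) / Re w"
    using arctan_diff_le[OF le] w by (simp add: sector_angle_arctan)
  also have "\<dots> = (t - s) / Re w" by (simp add: diff_divide_distrib)
  finally show "sector_angle s t w \<le> (t - s) / Re w" .
qed

lemma sector_angle_ge_1:
  assumes w: "0 < Re w" "Re w \<le> d" and st: "s + d \<le> Im w" "Im w \<le> t - d"
  shows "1 \<le> sector_angle s t w"
proof -
  have "1 \<le> (Im w - s) / Re w" "(Im w - t) / Re w \<le> -1"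
    using assms by (auto simp: le_divide_eq divide_le_eq)
  then have "arctan 1 \<le> arctan ((Im w - s) / Re w)" "arctan ((Im w - t) / Re w) \<le> arctan (-1)"
    by (simp_all only: arctan_le_iff)
  then have "pi / 4 - (- (pi / 4)) \<le> sector_angle s t w"
    using w(1) by (simp add: sector_angle_arctan arctan_one arctan_minus)
  then show ?thesis using pi_ge_two by simp
qed

lemma harmonic_sector_angle:
  assumes "open V" "W holomorphic_on V" "\<And>z. z \<in> V \<Longrightarrow> 0 < Re (W z)"
  shows "harmonic_on V (\<lambda>z. sector_angle s t (W z))"
proof -
  have "harmonic_on V (\<lambda>z. Re (- \<i> * (Ln (W z - \<i> * complex_of_real s) - Ln (W z - \<i> * complex_of_real t))))"
  proof (rule harmonic_on_Re[OF assms(1)], intro holomorphic_intros assms(2))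
    fix z assume "z \<in> V"
    then have "0 < Re (W z)" by (rule assms(3))
    then show "W z - \<i> * complex_of_real s \<notin> \<real>\<^sub>\<le>\<^sub>0" "W z - \<i> * complex_of_real t \<notin> \<real>\<^sub>\<le>\<^sub>0"
      by (auto simp: complex_nonpos_Reals_iff)
  qed
  then show ?thesis by (simp add: sector_angle_def)
qed

lemma sum_half_powers_le:
  assumes "countable Q" "finite T" "T \<subseteq> Q"
  shows "(\<Sum>q\<in>T. (1/2 :: real) ^ Suc (to_nat_on Q q)) \<le> 1"
proof -
  have inj: "inj_on (to_nat_on Q) T" using inj_on_to_nat_on[OF assms(1)] assms(3) by (rule inj_on_subset)
  have "(\<Sum>q\<in>T. (1/2 :: real) ^ Suc (to_nat_on Q q)) = (\<Sum>k\<in>to_nat_on Q ` T. (1/2) ^ Suc k)"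
    by (simp add: sum.reindex[OF inj])
  also have "\<dots> \<le> (\<Sum>k. (1/2) ^ Suc k)"
    by (rule sum_le_suminf) (use power_half_series assms(2) in \<open>auto simp: sums_iff\<close>)
  also have "\<dots> = 1" using power_half_series by (simp add: sums_iff)
  finally show ?thesis .
qed

text \<open>The boundary values are only known to vanish outside a countable set and a set \<open>P\<close> with null compact
  parts. Logarithmic barriers with summable weights handle the countable set. The points of the interval where
  \<open>h\<close> does not stay below a small bound form a closed subset of \<open>P\<close>. Under the slit root this set goes to a null set on
  the imaginary axis, which is covered by finitely many segments of small total length; the angles
  subtended by these segments are harmonic, at least \<open>1\<close> near the set and small at \<open>z0\<close>. The
  maximum principle compares \<open>h\<close> with the sum of all these barriers.\<close>

theorem bounded_harmonic_nonpos:
  fixes h :: "complex \<Rightarrow> real"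
  assumes ab: "a < b" and E: "compact E" "{a..b} \<subseteq> E" "countable (E - {a..b})"
    and h: "harmonic_on (- complex_of_real ` E) h" "\<And>z. z \<in> - complex_of_real ` E \<Longrightarrow> h z \<le> M"
    and P: "\<And>t. t \<in> {a..b} - P \<Longrightarrow> (h \<longlongrightarrow> 0) (at (complex_of_real t) within - complex_of_real ` E)"
      "\<And>F. compact F \<Longrightarrow> F \<subseteq> P \<Longrightarrow> emeasure lborel F = 0"
    and z0: "z0 \<in> - complex_of_real ` E"
  shows "h z0 \<le> 0"
proof (rule field_le_epsilon)
  fix \<epsilon>' :: real assume "0 < \<epsilon>'"
  define \<epsilon> where "\<epsilon> = \<epsilon>' / 4"
  have \<epsilon>: "0 < \<epsilon>" using \<open>0 < \<epsilon>'\<close> by (simp add: \<epsilon>_def)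
  define U where "U = - complex_of_real ` E"
  have cE: "compact (complex_of_real ` E)"
    by (intro compact_continuous_image continuous_intros E)
  have U: "open U" unfolding U_def using cE by (simp add: open_Compl compact_imp_closed)
  have z0U: "z0 \<in> U" using z0 by (simp add: U_def)
  have UI: "U \<subseteq> - complex_of_real ` {a..b}" using E(2) by (auto simp: U_def)
  define N where "N = max M 0 + 1"
  have N: "0 < N" "\<And>z. z \<in> U \<Longrightarrow> h z \<le> N" using h(2) by (force simp: N_def U_def)+
  define G where "G z = green_slit (unit_slit_map a b z)" for z
  have Gnn: "0 \<le> G z" for z by (simp add: G_def green_slit_nonneg)
  have uhol: "unit_slit_map a b holomorphic_on S" for S
    unfolding unit_slit_map_def using ab by (intro holomorphic_intros) auto
  have off: "unit_slit_map a b z \<notin> complex_of_real ` {-1..1}" if "z \<in> U" for z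
    by (rule unit_slit_map_off[OF ab]) (use that UI in auto)
  have Gharm: "harmonic_on U G"
    unfolding G_def by (rule harmonic_green_slit[OF U uhol off])
  define W where "W z = slit_root (unit_slit_map a b z)" for z
  have Wpos: "0 < Re (W z)" if "z \<in> U" for z
    unfolding W_def by (rule Re_slit_root_pos[OF off[OF that]])
  have Whol: "W holomorphic_on U"
  proof -
    have "slit_root \<circ> unit_slit_map a b holomorphic_on U"
      by (rule holomorphic_on_compose_gen[OF uhol holomorphic_slit_root], intro image_subsetI ComplI) (use off in auto)
    then show ?thesis by (simp add: o_def W_def[abs_def])
  qed
  have Wsq: "(W z)\<^sup>2 = (z - complex_of_real a) / (z - complex_of_real b)" for z
    unfolding W_def slit_root_sq unit_slit_map_quotient[OF ab] ..
  \<comment> \<open>logarithmic barriers at the points of a countable set\<close>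
  define Q where "Q = (E - {a..b}) \<union> {a, b}"
  have Q: "countable Q" "Q \<subseteq> E" "a \<in> Q" "b \<in> Q" using E ab by (auto simp: Q_def)
  have "\<exists>C. \<forall>z. z \<noteq> complex_of_real q \<longrightarrow> ln (cmod (z - complex_of_real q)) \<le> G z + C" for q
    unfolding G_def by (rule point_barrier_const[OF ab, of q]) blast
  then obtain C where C: "\<And>q z. z \<noteq> complex_of_real q \<Longrightarrow> ln (cmod (z - complex_of_real q)) \<le> G z + C q"
    by metis
  define B where "B q z = G z + C q - ln (cmod (z - complex_of_real q))" for q z
  have Bnn: "0 \<le> B q z" if "q \<in> Q" "z \<in> U" for q z
  proof -
    have "z \<noteq> complex_of_real q" using that Q(2) by (auto simp: U_def)
    then show ?thesis using C[of z q] by (simp add: B_def)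
  qed
  have Bharm: "harmonic_on U (B q)" if "q \<in> Q" for q
  proof -
    have "harmonic_on U (\<lambda>z. ln (cmod (z - complex_of_real q)))"
      by (rule harmonic_on_ln_cmod[OF U]) (use that Q(2) in \<open>auto intro!: holomorphic_intros simp: U_def\<close>)
    from harmonic_on_lincomb[OF Gharm this, of 1 "-1"] harmonic_on_const[OF U, of "C q"]
    have "harmonic_on U (\<lambda>z. 1 * (1 * G z + (-1) * ln (cmod (z - complex_of_real q))) + 1 * C q)"
      by (rule harmonic_on_lincomb)
    then show ?thesis by (rule harmonic_on_cong) (simp add: B_def)
  qed
  \<comment> \<open>all barriers together contribute at most \<open>\<epsilon>\<close> at \<open>z0\<close>\<close>
  define c where "c q = \<epsilon> * (1/2) ^ Suc (to_nat_on Q q) / (B q z0 + 1)" for q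
  have cpos: "0 < c q" if "q \<in> Q" for q
    using Bnn[OF that z0U] \<epsilon> by (simp add: c_def)
  have csum: "(\<Sum>q\<in>T. c q * B q z0) \<le> \<epsilon>" if T: "finite T" "T \<subseteq> Q" for T
  proof -
    have "(\<Sum>q\<in>T. c q * B q z0) \<le> (\<Sum>q\<in>T. \<epsilon> * (1/2) ^ Suc (to_nat_on Q q))"
    proof (rule sum_mono)
      fix q assume "q \<in> T"
      then have Bq: "0 \<le> B q z0" using Bnn[OF _ z0U] T by auto
      have "c q * B q z0 = \<epsilon> * (1/2) ^ Suc (to_nat_on Q q) * (B q z0 / (B q z0 + 1))"
        by (simp add: c_def)
      also have "\<dots> \<le> \<epsilon> * (1/2) ^ Suc (to_nat_on Q q) * 1"
        using Bq \<epsilon> by (intro mult_left_mono) auto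
      finally show "c q * B q z0 \<le> \<epsilon> * (1/2) ^ Suc (to_nat_on Q q)" by simp
    qed
    also have "\<dots> \<le> \<epsilon> * 1" unfolding sum_distrib_left[symmetric]
      using sum_half_powers_le[OF Q(1) T] \<epsilon> by (intro mult_left_mono) auto
    finally show ?thesis by simp
  qed
  define \<rho> where "\<rho> q = exp (C q - N / c q)" for q
  have \<rho>: "N \<le> c q * B q z" if "q \<in> Q" "z \<in> U" "cmod (z - complex_of_real q) < \<rho> q" for q z
  proof -
    have "z \<noteq> complex_of_real q" using that Q(2) by (auto simp: U_def)
    then have "ln (cmod (z - complex_of_real q)) \<le> ln (\<rho> q)" using that(3) by (intro ln_mono) auto
    then have "N / c q \<le> B q z" using Gnn[of z] by (simp add: B_def \<rho>_def)
    then show ?thesis using cpos[OF that(1)] by (simp add: divide_le_eq mult.commute)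
  qed
  \<comment> \<open>the boundary points at which \<open>h\<close> does not stay below \<open>\<epsilon>\<close>\<close>
  define F where "F = {t \<in> {a..b}. \<forall>r>0. \<exists>z\<in>U. cmod (z - complex_of_real t) < r \<and> \<epsilon> \<le> h z}"
  have FP: "F \<subseteq> P"
  proof
    fix t assume t: "t \<in> F"
    show "t \<in> P"
    proof (rule ccontr)
      assume "t \<notin> P"
      then have "(h \<longlongrightarrow> 0) (at (complex_of_real t) within U)" using P(1) t by (auto simp: F_def U_def)
      then have "eventually (\<lambda>z. h z < \<epsilon>) (at (complex_of_real t) within U)"
        using \<epsilon> by (rule order_tendstoD(2))
      then obtain r where r: "0 < r" "\<And>z. z \<in> U \<Longrightarrow> z \<noteq> complex_of_real t \<Longrightarrow> dist z (complex_of_real t) < r \<Longrightarrow> h z < \<epsilon>"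
        by (auto simp: eventually_at)
      obtain z where z: "z \<in> U" "cmod (z - complex_of_real t) < r" "\<epsilon> \<le> h z" using t r(1) by (auto simp: F_def)
      have "z \<noteq> complex_of_real t" using z(1) t E(2) by (auto simp: U_def F_def)
      then show False using r(2)[OF z(1)] z by (auto simp: dist_norm)
    qed
  qed
  have Fclosed: "closed F"
    unfolding closed_sequential_limits
  proof (intro allI impI)
    fix x l assume xl: "(\<forall>n. x n \<in> F) \<and> x \<longlonglongrightarrow> l"
    then have "l \<in> {a..b}" using closed_sequentially[of "{a..b}" x l] by (auto simp: F_def)
    moreover have "\<exists>z\<in>U. cmod (z - complex_of_real l) < r \<and> \<epsilon> \<le> h z" if r: "0 < r" for r
    proof -
      obtain n where n: "\<bar>x n - l\<bar> < r / 2"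
        using xl r unfolding LIMSEQ_iff by (metis half_gt_zero order_refl real_norm_def)
      obtain z where z: "z \<in> U" "cmod (z - complex_of_real (x n)) < r / 2" "\<epsilon> \<le> h z"
        using xl r half_gt_zero[OF r] unfolding F_def by blast
      have "cmod (z - complex_of_real l) \<le> cmod (z - complex_of_real (x n)) + cmod (complex_of_real (x n) - complex_of_real l)"
        using norm_triangle_ineq[of "z - complex_of_real (x n)" "complex_of_real (x n) - complex_of_real l"] by simp
      also have "cmod (complex_of_real (x n) - complex_of_real l) = \<bar>x n - l\<bar>"
        by (simp only: of_real_diff[symmetric] norm_of_real)
      finally have "cmod (z - complex_of_real l) < r" using n z(2) by simp
      then show ?thesis using z by blast
    qed
    ultimately show "l \<in> F" by (simp add: F_def)
  qed
  define F1 where "F1 = F \<inter> {a + \<rho> a..b - \<rho> b}"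
  have F1: "compact F1" "F1 \<subseteq> P" "F1 \<subseteq> {a<..<b}"
  proof -
    show "compact F1" unfolding F1_def using Fclosed by (simp add: closed_Int_compact)
    show "F1 \<subseteq> P" using FP by (auto simp: F1_def)
    have "0 < \<rho> a" "0 < \<rho> b" by (auto simp: \<rho>_def)
    then show "F1 \<subseteq> {a<..<b}" by (auto simp: F1_def)
  qed
  \<comment> \<open>the two sides of the slit at \<open>t\<close> correspond to \<open>\<i> * \<tau> t\<close> and \<open>- \<i> * \<tau> t\<close>\<close>
  define \<tau> where "\<tau> t = sqrt ((t - a) / (b - t))" for t
  have \<tau>pos: "0 < (t - a) / (b - t)" "0 < \<tau> t" if "t \<in> F1" for t
    using F1(3) that by (auto simp: \<tau>_def)
  have "emeasure lborel F1 = 0" by (rule P(2)[OF F1(1,2)])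
  then have "negligible F1"
    using F1(1) by (simp add: negligible_iff_null_sets null_sets_def borel_closed compact_imp_closed)
  moreover have \<tau>diff: "\<tau> differentiable_on F1"
    unfolding \<tau>_def differentiable_on_def
  proof
    fix t assume t: "t \<in> F1"
    have "((\<lambda>t. sqrt ((t - a) / (b - t))) has_real_derivative
        ((1 * (b - t) - (t - a) * (0 - 1)) / ((b - t) * (b - t))) * (inverse (sqrt ((t - a) / (b - t))) / 2)) (at t within F1)"
      using \<tau>pos(1)[OF t] F1(3) t by (auto intro!: derivative_eq_intros simp: mult.commute)
    then show "(\<lambda>t. sqrt ((t - a) / (b - t))) differentiable at t within F1"
      unfolding differentiable_def has_field_derivative_def by blast
  qed
  ultimately have "negligible (\<tau> ` F1)" by (intro negligible_differentiable_image_negligible) auto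
  moreover have K: "compact (\<tau> ` F1)"
    by (rule compact_continuous_image[OF differentiable_imp_continuous_on[OF \<tau>diff] F1(1)])
  ultimately have K0: "emeasure lborel (\<tau> ` F1) = 0"
    by (simp add: negligible_iff_null_sets null_sets_def borel_closed compact_imp_closed)
  define \<eta> where "\<eta> = \<epsilon> * Re (W z0) / (10 * N)"
  have \<eta>: "0 < \<eta>" using \<epsilon> N Wpos[OF z0U] by (simp add: \<eta>_def)
  obtain d :: real and J :: "int set" where dJ: "0 < d" "finite J" "card J * d \<le> \<eta>"
    "\<And>t. t \<in> \<tau> ` F1 \<Longrightarrow> \<exists>j\<in>J. real_of_int j * d \<le> t \<and> t < (real_of_int j + 1) * d"
    by (rule null_compact_grid_cover[OF K K0 \<eta>]) (rule that)
  define S where "S j z = sector_angle ((real_of_int j - 2) * d) ((real_of_int j + 3) * d) (W z)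
      + sector_angle (- ((real_of_int j + 3) * d)) (- ((real_of_int j - 2) * d)) (W z)" for j :: int and z
  have le: "(real_of_int j - 2) * d \<le> (real_of_int j + 3) * d" for j :: int using dJ(1) by (intro mult_right_mono) auto
  have Snn: "0 \<le> S j z" if "z \<in> U" for j z
    unfolding S_def using sector_angle_bounds(1)[OF Wpos[OF that]] le[of j] by (intro add_nonneg_nonneg) auto
  have Sharm: "harmonic_on U (S j)" for j
  proof -
    note h = harmonic_sector_angle[OF U Whol Wpos]
    have "harmonic_on U (\<lambda>z. 1 * sector_angle ((real_of_int j - 2) * d) ((real_of_int j + 3) * d) (W z)
      + 1 * sector_angle (- ((real_of_int j + 3) * d)) (- ((real_of_int j - 2) * d)) (W z))"
      by (rule harmonic_on_lincomb[OF h h])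
    then show ?thesis by (rule harmonic_on_cong) (simp add: S_def)
  qed
  have Ssum: "(\<Sum>j\<in>J. N * S j z0) \<le> \<epsilon>"
  proof -
    have "S j z0 \<le> 10 * d / Re (W z0)" for j
    proof -
      have "S j z0 \<le> ((real_of_int j + 3) * d - (real_of_int j - 2) * d) / Re (W z0)
         + (- ((real_of_int j - 2) * d) - - ((real_of_int j + 3) * d)) / Re (W z0)"
        unfolding S_def by (intro add_mono sector_angle_bounds(2) Wpos z0U) (use le[of j] in auto)
      also have "\<dots> = 10 * d / Re (W z0)" by (simp add: add_divide_distrib[symmetric] algebra_simps)
      finally show ?thesis .
    qed
    then have "(\<Sum>j\<in>J. N * S j z0) \<le> (\<Sum>j\<in>J. N * (10 * d / Re (W z0)))"
      using N by (intro sum_mono mult_left_mono) auto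
    also have "\<dots> = (card J * d) * (10 * N / Re (W z0))" by simp
    also have "\<dots> \<le> \<eta> * (10 * N / Re (W z0))" using dJ(3) N Wpos[OF z0U] by (intro mult_right_mono) auto
    also have "\<dots> = \<epsilon>" using N Wpos[OF z0U] by (simp add: \<eta>_def)
    finally show ?thesis .
  qed
  have Snear: "\<exists>r>0. \<forall>z\<in>U. cmod (z - complex_of_real t) < r \<longrightarrow> N \<le> (\<Sum>j\<in>J. N * S j z)" if t: "t \<in> F1" for t
  proof -
    obtain j where j: "j \<in> J" "real_of_int j * d \<le> \<tau> t" "\<tau> t < (real_of_int j + 1) * d" using dJ(4)[of "\<tau> t"] t by auto
    define f where "f z = (z - complex_of_real a) / (z - complex_of_real b)" for z
    have tb: "t \<noteq> b" using F1(3) t by auto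
    have "isCont f (complex_of_real t)" unfolding f_def using tb by (intro continuous_intros) auto
    moreover have "f (complex_of_real t) = - (complex_of_real (\<tau> t))\<^sup>2"
    proof -
      have "(\<tau> t)\<^sup>2 = (t - a) / (b - t)" unfolding \<tau>_def using \<tau>pos(1)[OF t] by simp
      then have "- ((\<tau> t)\<^sup>2) = (t - a) / (t - b)" using tb by (simp add: minus_divide_right)
      then have "complex_of_real (- ((\<tau> t)\<^sup>2)) = complex_of_real ((t - a) / (t - b))" by (rule arg_cong)
      then show ?thesis by (simp add: f_def)
    qed
    ultimately have "(f \<longlongrightarrow> - (complex_of_real (\<tau> t))\<^sup>2) (at (complex_of_real t))" by (simp add: isCont_def)
    moreover have "0 < d\<^sup>2" using dJ(1) by simp
    ultimately obtain r where r: "0 < r" "\<And>z. z \<noteq> complex_of_real t \<Longrightarrow> cmod (z - complex_of_real t) < r \<Longrightarrow> cmod (f z - - (complex_of_real (\<tau> t))\<^sup>2) < d\<^sup>2"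
      unfolding LIM_eq by metis
    show ?thesis
    proof (intro exI[of _ r] conjI ballI impI r(1))
      fix z assume z: "z \<in> U" "cmod (z - complex_of_real t) < r"
      have "t \<in> {a<..<b}" using t F1(3) by blast
      then have "t \<in> {a..b}" by simp
      then have "t \<in> E" using E(2) by blast
      then have "z \<noteq> complex_of_real t" using z(1) by (auto simp: U_def)
      define v where "v = \<i> * complex_of_real (\<tau> t)"
      have "(W z - v) * (W z + v) = (W z)\<^sup>2 + (complex_of_real (\<tau> t))\<^sup>2"
        by (simp add: v_def power2_eq_square algebra_simps)
      then have "cmod ((W z - v) * (W z + v)) < d\<^sup>2" using r(2)[OF \<open>z \<noteq> complex_of_real t\<close> z(2)] by (simp add: Wsq f_def)
      then have "cmod (W z - v) * cmod (W z + v) < d * d" by (simp add: norm_mult power2_eq_square)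
      then have "cmod (W z - v) < d \<or> cmod (W z + v) < d"
        using mult_mono[of d "cmod (W z - v)" d "cmod (W z + v)"] dJ(1) by (metis norm_ge_zero not_less order_less_imp_le)
      then have "1 \<le> S j z"
      proof
        assume lt: "cmod (W z - v) < d"
        have "Re (W z) \<le> d" using complex_Re_le_cmod[of "W z - v"] lt by (simp add: v_def)
        moreover have "\<bar>Im (W z) - \<tau> t\<bar> < d" using abs_Im_le_cmod[of "W z - v"] lt by (simp add: v_def)
        ultimately have "1 \<le> sector_angle ((real_of_int j - 2) * d) ((real_of_int j + 3) * d) (W z)"
          using j Wpos[OF z(1)] by (intro sector_angle_ge_1[of _ d]) (auto simp: algebra_simps abs_less_iff)
        moreover have "0 \<le> sector_angle (- ((real_of_int j + 3) * d)) (- ((real_of_int j - 2) * d)) (W z)"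
          using sector_angle_bounds(1)[OF Wpos[OF z(1)]] le[of j] by auto
        ultimately show ?thesis by (simp add: S_def)
      next
        assume lt: "cmod (W z + v) < d"
        have "Re (W z) \<le> d" using complex_Re_le_cmod[of "W z + v"] lt by (simp add: v_def)
        moreover have "\<bar>Im (W z) + \<tau> t\<bar> < d" using abs_Im_le_cmod[of "W z + v"] lt by (simp add: v_def)
        ultimately have "1 \<le> sector_angle (- ((real_of_int j + 3) * d)) (- ((real_of_int j - 2) * d)) (W z)"
          using j Wpos[OF z(1)] by (intro sector_angle_ge_1[of _ d]) (auto simp: algebra_simps abs_less_iff)
        moreover have "0 \<le> sector_angle ((real_of_int j - 2) * d) ((real_of_int j + 3) * d) (W z)"
          using sector_angle_bounds(1)[OF Wpos[OF z(1)]] le[of j] by auto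
        ultimately show ?thesis by (simp add: S_def)
      qed
      then have "N * 1 \<le> N * S j z" using N by (intro mult_left_mono) auto
      also have "\<dots> \<le> (\<Sum>j\<in>J. N * S j z)"
        using j(1) dJ(2) N Snn[OF z(1)] by (intro member_le_sum) auto
      finally show "N \<le> (\<Sum>j\<in>J. N * S j z)" by simp
    qed
  qed
  \<comment> \<open>near every point of \<open>E\<close> finitely many barriers suffice\<close>
  have SJnn: "0 \<le> (\<Sum>j\<in>J. N * S j z)" if "z \<in> U" for z
    using N Snn[OF that] by (intro sum_nonneg) auto
  define Loc where "Loc p r T \<longleftrightarrow> 0 < r \<and> finite T \<and> T \<subseteq> Q \<and>
      (\<forall>z\<in>U. cmod (z - complex_of_real p) < r \<longrightarrow> h z \<le> \<epsilon> + (\<Sum>q\<in>T. c q * B q z) + (\<Sum>j\<in>J. N * S j z))" for p r T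
  have local: "\<exists>r T. 0 < r \<and> finite T \<and> T \<subseteq> Q \<and>
      (\<forall>z\<in>U. cmod (z - complex_of_real p) < r \<longrightarrow> h z \<le> \<epsilon> + (\<Sum>q\<in>T. c q * B q z) + (\<Sum>j\<in>J. N * S j z))"
    if p: "p \<in> E" for p
  proof -
    have nearQ: ?thesis if q: "q \<in> Q" "\<bar>p - q\<bar> < \<rho> q" for q
    proof (intro exI[of _ "\<rho> q - \<bar>p - q\<bar>"] exI[of _ "{q}"] conjI ballI impI)
      fix z assume z: "z \<in> U" "cmod (z - complex_of_real p) < \<rho> q - \<bar>p - q\<bar>"
      have "cmod (z - complex_of_real q) \<le> cmod (z - complex_of_real p) + cmod (complex_of_real p - complex_of_real q)"
        using norm_triangle_ineq[of "z - complex_of_real p" "complex_of_real p - complex_of_real q"] by simp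
      also have "cmod (complex_of_real p - complex_of_real q) = \<bar>p - q\<bar>"
        by (simp only: of_real_diff[symmetric] norm_of_real)
      finally have "cmod (z - complex_of_real q) < \<rho> q" using z(2) by simp
      then have "N \<le> c q * B q z" by (rule \<rho>[OF q(1) z(1)])
      then show "h z \<le> \<epsilon> + (\<Sum>q\<in>{q}. c q * B q z) + (\<Sum>j\<in>J. N * S j z)"
        using N(2)[OF z(1)] SJnn[OF z(1)] \<epsilon> by simp
    qed (use q in auto)
    consider "p \<in> Q" | "\<bar>p - a\<bar> < \<rho> a" | "\<bar>p - b\<bar> < \<rho> b" | "p \<in> F1" | "p \<in> {a..b}" "p \<notin> F"
    proof (cases "p \<in> Q \<or> \<bar>p - a\<bar> < \<rho> a \<or> \<bar>p - b\<bar> < \<rho> b \<or> p \<notin> F")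
      case True
      then show thesis
      proof (elim disjE)
        assume pF: "p \<notin> F"
        show thesis
        proof (cases "p \<in> {a..b}")
          case True
          then show thesis using pF by (rule that(5))
        next
          case False
          then have "p \<in> Q" using p by (simp add: Q_def)
          then show thesis by (rule that(1))
        qed
      qed (rule that, assumption)+
    next
      case False
      then have "p \<in> {a..b}" by (auto simp: F_def)
      then have "p \<in> F1" using False by (auto simp: F1_def)
      then show thesis by (rule that(4))
    qed
    then show ?thesis
    proof cases
      case 1
      then show ?thesis by (rule nearQ) (simp add: \<rho>_def)
    next
      case 2
      then show ?thesis by (rule nearQ[OF Q(3)])
    next
      case 3
      then show ?thesis by (rule nearQ[OF Q(4)])
    next
      case 4
      then obtain r where r: "0 < r" "\<And>z. z \<in> U \<Longrightarrow> cmod (z - complex_of_real p) < r \<Longrightarrow> N \<le> (\<Sum>j\<in>J. N * S j z)"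
        using Snear by blast
      show ?thesis
      proof (intro exI[of _ r] exI[of _ "{}"] conjI ballI impI r(1))
        fix z assume z: "z \<in> U" "cmod (z - complex_of_real p) < r"
        show "h z \<le> \<epsilon> + (\<Sum>q\<in>{}. c q * B q z) + (\<Sum>j\<in>J. N * S j z)"
          using r(2)[OF z] N(2)[OF z(1)] \<epsilon> by simp
      qed auto
    next
      case 5
      then obtain r where r: "0 < r" "\<And>z. z \<in> U \<Longrightarrow> cmod (z - complex_of_real p) < r \<Longrightarrow> h z < \<epsilon>"
        by (auto simp: F_def not_le)
      show ?thesis
      proof (intro exI[of _ r] exI[of _ "{}"] conjI ballI impI r(1))
        fix z assume z: "z \<in> U" "cmod (z - complex_of_real p) < r"
        show "h z \<le> \<epsilon> + (\<Sum>q\<in>{}. c q * B q z) + (\<Sum>j\<in>J. N * S j z)"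
          using r(2)[OF z] SJnn[OF z(1)] by simp
      qed auto
    qed
  qed
  then have "\<exists>r T. Loc p r T" if "p \<in> E" for p using that unfolding Loc_def by blast
  then obtain r T where Loc: "\<And>p. p \<in> E \<Longrightarrow> Loc p (r p) (T p)" by metis
  have rT: "\<And>p. p \<in> E \<Longrightarrow> 0 < r p" "\<And>p. p \<in> E \<Longrightarrow> finite (T p)" "\<And>p. p \<in> E \<Longrightarrow> T p \<subseteq> Q"
    "\<And>p z. p \<in> E \<Longrightarrow> z \<in> U \<Longrightarrow> cmod (z - complex_of_real p) < r p \<Longrightarrow> h z \<le> \<epsilon> + (\<Sum>q\<in>T p. c q * B q z) + (\<Sum>j\<in>J. N * S j z)"
    using Loc unfolding Loc_def by blast+
  obtain E0 where E0: "E0 \<subseteq> E" "finite E0" "complex_of_real ` E \<subseteq> (\<Union>p\<in>E0. ball (complex_of_real p) (r p))"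
  proof (rule compactE_image[OF cE, of E "\<lambda>p. ball (complex_of_real p) (r p)"])
    show "complex_of_real ` E \<subseteq> (\<Union>p\<in>E. ball (complex_of_real p) (r p))" using rT(1) by force
  qed auto
  define TT where "TT = (\<Union>p\<in>E0. T p)"
  have TT: "finite TT" "TT \<subseteq> Q" unfolding TT_def using E0 rT(2,3) by blast+
  have sumTT: "(\<Sum>q\<in>T p. c q * B q z) \<le> (\<Sum>q\<in>TT. c q * B q z)" if "p \<in> E0" "z \<in> U" for p z
    using TT that cpos Bnn by (intro sum_mono2) (auto simp: TT_def less_imp_le)
  define g where "g = \<epsilon> / (G z0 + 1)"
  have g: "0 < g" "g * G z0 \<le> \<epsilon>" using \<epsilon> Gnn[of z0] by (auto simp: g_def divide_le_eq mult_le_cancel_left1)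
  define R where "R = (exp (N / g) * (b - a) + \<bar>a + b\<bar>) / 2"
  have far: "N \<le> g * G z" if z: "R < cmod z" for z
  proof -
    have "2 * cmod z \<le> cmod (2 * z - complex_of_real (a + b)) + \<bar>a + b\<bar>"
      using norm_triangle_ineq[of "2 * z - complex_of_real (a + b)" "complex_of_real (a + b)"]
      by (simp only: diff_add_cancel norm_of_real norm_mult norm_numeral)
    then have "exp (N / g) * (b - a) < cmod (2 * z - complex_of_real (a + b))"
      using z by (simp add: R_def)
    then have "exp (N / g) < cmod (unit_slit_map a b z)"
      unfolding unit_slit_map_def norm_divide norm_of_real using ab by (simp add: less_divide_eq)
    also have "\<dots> \<le> exp (G z)" unfolding G_def by (rule exp_green_slit_ge)
    finally have "N / g < G z" by simp
    then show ?thesis using g by (simp add: divide_less_eq mult.commute)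
  qed
  define v where "v z = 1 * (1 * h z + (- g) * G z) + (-1) * (1 * (\<Sum>q\<in>TT. c q * B q z + 0 * G z) + 1 * ((\<Sum>j\<in>J. N * S j z + 0 * G z) + \<epsilon>))" for z
  have v_eq: "v z = h z - g * G z - (\<Sum>q\<in>TT. c q * B q z) - (\<Sum>j\<in>J. N * S j z) - \<epsilon>" for z
    by (simp add: v_def)
  have "harmonic_on U v"
  proof -
    have s1: "harmonic_on U (\<lambda>z. \<Sum>q\<in>TT. c q * B q z + 0 * G z)"
      using TT Bharm Gharm by (intro harmonic_on_sum U harmonic_on_lincomb) auto
    have s2: "harmonic_on U (\<lambda>z. \<Sum>j\<in>J. N * S j z + 0 * G z)"
      by (intro harmonic_on_sum U harmonic_on_lincomb Sharm Gharm dJ)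
    from harmonic_on_lincomb[OF s2 harmonic_on_const[OF U, of \<epsilon>], of 1 1]
    have s3: "harmonic_on U (\<lambda>z. (\<Sum>j\<in>J. N * S j z + 0 * G z) + \<epsilon>)" by simp
    have hU: "harmonic_on U h" using h(1) by (simp add: U_def)
    show ?thesis unfolding v_def
      by (rule harmonic_on_lincomb[OF harmonic_on_lincomb[OF hU Gharm] harmonic_on_lincomb[OF s1 s3]])
  qed
  moreover have "compact (cball 0 R - (\<Union>p\<in>E0. ball (complex_of_real p) (r p)))"
    by (intro compact_diff compact_cball) auto
  moreover have "cball 0 R - (\<Union>p\<in>E0. ball (complex_of_real p) (r p)) \<subseteq> U"
    using E0(3) by (auto simp: U_def)
  moreover have "v z \<le> 0" if z: "z \<in> U - (cball 0 R - (\<Union>p\<in>E0. ball (complex_of_real p) (r p)))" for z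
  proof -
    have zU: "z \<in> U" using z by simp
    have nn: "0 \<le> (\<Sum>q\<in>TT. c q * B q z)" "0 \<le> g * G z"
      using TT cpos Bnn[OF _ zU] g Gnn by (auto intro!: sum_nonneg mult_nonneg_nonneg simp: less_imp_le subset_iff)
    consider "R < cmod z" | p where "p \<in> E0" "cmod (z - complex_of_real p) < r p"
      using z by (auto simp: dist_norm norm_minus_commute not_le)
    then show ?thesis
    proof cases
      case 1
      then show ?thesis using far[OF 1] N(2)[OF zU] nn SJnn[OF zU] \<epsilon> by (simp add: v_eq)
    next
      case 2
      then have "p \<in> E" using E0 by auto
      from rT(4)[OF this zU 2(2)] sumTT[OF 2(1) zU] nn show ?thesis by (simp add: v_eq)
    qed
  qed
  ultimately have "v z0 \<le> 0" using z0U by (rule harmonic_maximum_principle)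
  then have "h z0 \<le> 4 * \<epsilon>" using g(2) csum[OF TT] Ssum by (simp add: v_eq)
  then show "h z0 \<le> 0 + \<epsilon>'" by (simp add: \<epsilon>_def)
qed

section \<open>The Green function of an interval with countably many points\<close>

lemma arcosh_mono:
  fixes u v :: real
  assumes "1 \<le> u" "u \<le> v"
  shows "arcosh u \<le> arcosh v"
proof (cases "u = v")
  case False
  then have "arcosh u < arcosh v" using assms by (subst arcosh_less_iff_real) auto
  then show ?thesis by simp
qed simp

text \<open>The Moebius map that sends the pole \<open>w\<close> to infinity and \<open>[a, b]\<close> onto \<open>[-1, 1]\<close>.\<close>

definition pole_map :: "real \<Rightarrow> real \<Rightarrow> real option \<Rightarrow> complex \<Rightarrow> complex" where
  "pole_map a b w z = (case w of None \<Rightarrow> unit_slit_map a b z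
     | Some y \<Rightarrow> (complex_of_real (2 * (a - y) * (b - y)) / (z - complex_of_real y) - complex_of_real (a + b - 2 * y))
         / complex_of_real (b - a))"

definition pole_map_real :: "real \<Rightarrow> real \<Rightarrow> real option \<Rightarrow> real \<Rightarrow> real" where
  "pole_map_real a b w t = (case w of None \<Rightarrow> (2 * t - (a + b)) / (b - a)
     | Some y \<Rightarrow> (2 * (a - y) * (b - y) / (t - y) - (a + b - 2 * y)) / (b - a))"

lemma pole_map_of_real: "pole_map a b w (complex_of_real t) = complex_of_real (pole_map_real a b w t)"
  by (simp add: pole_map_def pole_map_real_def unit_slit_map_def split: option.splits)

text \<open>The inverse of \<open>pole_map\<close> on the unit interval is, up to a shift, a weighted harmonic mean of the shifted end
  points \<open>\<alpha>\<close> and \<open>\<beta>\<close>, which have the same sign.\<close>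

lemma harmonic_mean_between:
  fixes \<alpha> \<beta> D :: real
  assumes "\<alpha> < \<beta>" "0 < \<alpha> * \<beta>" "2 * \<alpha> \<le> D" "D \<le> 2 * \<beta>"
  shows "D \<noteq> 0" "\<alpha> \<le> 2 * \<alpha> * \<beta> / D" "2 * \<alpha> * \<beta> / D \<le> \<beta>"
proof -
  consider "0 < \<alpha>" "0 < \<beta>" | "\<alpha> < 0" "\<beta> < 0" using assms(2) by (auto simp: zero_less_mult_iff)
  then have "D \<noteq> 0 \<and> \<alpha> \<le> 2 * \<alpha> * \<beta> / D \<and> 2 * \<alpha> * \<beta> / D \<le> \<beta>"
  proof cases
    case 1
    then have D: "0 < D" using assms by linarith
    have "\<alpha> * D \<le> \<alpha> * (2 * \<beta>)" "(2 * \<alpha>) * \<beta> \<le> D * \<beta>" using 1 assms by (intro mult_left_mono mult_right_mono; simp)+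
    then show ?thesis using D by (simp add: le_divide_eq divide_le_eq algebra_simps)
  next
    case 2
    then have D: "D < 0" using assms by linarith
    have "\<alpha> * (2 * \<beta>) \<le> \<alpha> * D" "D * \<beta> \<le> (2 * \<alpha>) * \<beta>" using 2 assms by (intro mult_left_mono_neg mult_right_mono_neg; simp)+
    then show ?thesis using D by (simp add: le_divide_eq divide_le_eq algebra_simps)
  qed
  then show "D \<noteq> 0" "\<alpha> \<le> 2 * \<alpha> * \<beta> / D" "2 * \<alpha> * \<beta> / D \<le> \<beta>" by auto
qed

lemma pole_outside_product_pos: "a < b \<Longrightarrow> y \<notin> {a..b} \<Longrightarrow> 0 < (a - y) * (b - y)"
  for a b y :: real
  by (auto simp: zero_less_mult_iff)

lemma pole_map_off:
  assumes ab: "a < b" and w: "\<And>y. w = Some y \<Longrightarrow> y \<notin> {a..b}"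
    and z: "z \<notin> complex_of_real ` {a..b}" "\<And>y. w = Some y \<Longrightarrow> z \<noteq> complex_of_real y"
  shows "pole_map a b w z \<notin> complex_of_real ` {-1..1}"
proof (cases w)
  case None
  then show ?thesis using unit_slit_map_off[OF ab z(1)] by (simp add: pole_map_def)
next
  case (Some y)
  show ?thesis
  proof
    assume "pole_map a b w z \<in> complex_of_real ` {-1..1}"
    then obtain s where s: "-1 \<le> s" "s \<le> 1" "pole_map a b w z = complex_of_real s" by auto
    define \<alpha> where "\<alpha> = a - y"
    define \<beta> where "\<beta> = b - y"
    have \<alpha>\<beta>: "\<alpha> < \<beta>" "0 < \<alpha> * \<beta>" using ab pole_outside_product_pos[OF ab w[OF Some]] by (auto simp: \<alpha>_def \<beta>_def)
    define D where "D = s * (\<beta> - \<alpha>) + (\<alpha> + \<beta>)"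
    have "s * (\<beta> - \<alpha>) \<le> 1 * (\<beta> - \<alpha>)" "- 1 * (\<beta> - \<alpha>) \<le> s * (\<beta> - \<alpha>)"
      using s \<alpha>\<beta> by (intro mult_right_mono; simp)+
    then have D: "2 * \<alpha> \<le> D" "D \<le> 2 * \<beta>" by (auto simp: D_def)
    note m = harmonic_mean_between[OF \<alpha>\<beta> D]
    define u where "u = z - complex_of_real y"
    have u: "u \<noteq> 0" using z(2)[OF Some] by (simp add: u_def)
    have "complex_of_real (2 * \<alpha> * \<beta>) / u - complex_of_real (\<alpha> + \<beta>) = complex_of_real s * complex_of_real (\<beta> - \<alpha>)"
    proof -
      have "(complex_of_real (2 * \<alpha> * \<beta>) / u - complex_of_real (\<alpha> + \<beta>)) / complex_of_real (\<beta> - \<alpha>) = complex_of_real s"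
        using s(3) Some by (simp add: pole_map_def \<alpha>_def \<beta>_def u_def)
      moreover have "complex_of_real (\<beta> - \<alpha>) \<noteq> 0" using \<alpha>\<beta> by simp
      ultimately show ?thesis by (metis nonzero_divide_eq_eq)
    qed
    then have "complex_of_real (2 * \<alpha> * \<beta>) / u = complex_of_real D" by (simp add: D_def algebra_simps)
    then have "complex_of_real (2 * \<alpha> * \<beta>) = complex_of_real D * u" using u by (metis nonzero_divide_eq_eq)
    then have "u = complex_of_real (2 * \<alpha> * \<beta>) / complex_of_real D" using m(1) by (simp add: eq_divide_eq mult.commute)
    then have "z = complex_of_real (y + 2 * \<alpha> * \<beta> / D)" by (simp add: u_def algebra_simps)
    moreover have "y + 2 * \<alpha> * \<beta> / D \<in> {a..b}" using m(2,3) by (auto simp: \<alpha>_def \<beta>_def)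
    ultimately show False using z(1) by blast
  qed
qed

lemma pole_map_real_interval:
  assumes ab: "a < b" and w: "\<And>y. w = Some y \<Longrightarrow> y \<notin> {a..b}" and t: "t \<in> {a..b}"
  shows "pole_map_real a b w t \<in> {-1..1}"
proof (cases w)
  case None
  then show ?thesis using ab t by (simp add: pole_map_real_def divide_le_eq le_divide_eq)
next
  case (Some y)
  define \<alpha> where "\<alpha> = a - y"
  define \<beta> where "\<beta> = b - y"
  have \<alpha>\<beta>: "\<alpha> < \<beta>" "0 < \<alpha> * \<beta>" using ab pole_outside_product_pos[OF ab w[OF Some]] by (auto simp: \<alpha>_def \<beta>_def)
  have "2 * \<alpha> \<le> 2 * (t - y)" "2 * (t - y) \<le> 2 * \<beta>" using t by (auto simp: \<alpha>_def \<beta>_def)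
  note m = harmonic_mean_between[OF \<alpha>\<beta> this]
  have "p / d = 2 * (p / (2 * d))" for p d :: real by simp
  then have "2 * \<alpha> * \<beta> / (t - y) = 2 * (2 * \<alpha> * \<beta> / (2 * (t - y)))" .
  then have "\<bar>2 * \<alpha> * \<beta> / (t - y) - (\<alpha> + \<beta>)\<bar> \<le> \<beta> - \<alpha>" using m(2,3) by (simp only: abs_le_iff) auto
  then show ?thesis using \<alpha>\<beta> Some by (simp add: pole_map_real_def \<alpha>_def \<beta>_def abs_le_iff divide_le_eq le_divide_eq)
qed

lemma pole_map_real_outside:
  assumes "a < b" "\<And>y. w = Some y \<Longrightarrow> y \<notin> {a..b}" "t \<notin> {a..b}" "w \<noteq> Some t"
  shows "1 < \<bar>pole_map_real a b w t\<bar>"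
proof -
  have "complex_of_real (pole_map_real a b w t) \<notin> complex_of_real ` {-1..1}"
    unfolding pole_map_of_real[symmetric] by (rule pole_map_off) (use assms in auto)
  then have "pole_map_real a b w t \<notin> {-1..1}" by blast
  then show ?thesis by (auto simp: abs_if)
qed

definition pole_green :: "real \<Rightarrow> real \<Rightarrow> real option \<Rightarrow> complex \<Rightarrow> real" where
  "pole_green a b w z = green_slit (pole_map a b w z)"

text \<open>Near infinity the Green function is \<open>ln |w|\<close> up to a bounded error; the hypothesis says that \<open>|w|\<close> is
  comparable to \<open>1 / \<rho>\<close>.\<close>

lemma green_slit_near_log:
  assumes "1 \<le> cmod w" "0 < \<rho>" "0 < k1" "k1 \<le> cmod w * \<rho>" "cmod w * \<rho> \<le> k2"
  shows "\<bar>green_slit w + ln \<rho>\<bar> \<le> ln 4 + \<bar>ln k1\<bar> + \<bar>ln k2\<bar>"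
proof -
  define c where "c = (cmod (w - 1) + cmod (w + 1)) / 2"
  have c: "1 \<le> c" "c \<le> cmod w + 1" unfolding c_def by (rule foci_sum_ge, rule foci_sum_le)
  have w0: "0 < cmod w" using assms(1) by linarith
  have "ln (cmod w) \<le> ln (exp (green_slit w))" using w0 exp_green_slit_ge[of w] by (intro ln_mono) auto
  then have lo: "ln (cmod w) \<le> green_slit w" by simp
  have "exp (green_slit w) / 2 \<le> cosh (green_slit w)" by (rule cosh_exp_bounds)
  also have "cosh (green_slit w) = c" unfolding green_slit_def c_def[symmetric] using c(1) by (rule cosh_arcosh_real)
  finally have "exp (green_slit w) \<le> 4 * cmod w" using c(2) assms(1) by simp
  then have "ln (exp (green_slit w)) \<le> ln (4 * cmod w)" by (intro ln_mono) auto
  also have "\<dots> = ln 4 + ln (cmod w)" using w0 by (intro ln_mult_pos) auto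
  finally have hi: "green_slit w \<le> ln 4 + ln (cmod w)" by simp
  have e: "ln (cmod w * \<rho>) = ln (cmod w) + ln \<rho>" using w0 assms(2) by (intro ln_mult_pos) auto
  have "ln k1 \<le> ln (cmod w * \<rho>)" "ln (cmod w * \<rho>) \<le> ln k2"
    using assms(3-5) w0 assms(2) by (auto intro!: ln_mono mult_pos_pos)
  moreover have "0 \<le> ln (4::real)" by simp
  ultimately show ?thesis using lo hi unfolding e by (simp only: abs_le_iff) auto
qed

locale interval_with_points =
  fixes a b :: real and E :: "real set" and w :: "real option"
  assumes ab: "a < b" and E_compact: "compact E" and E_interval: "{a..b} \<subseteq> E"
    and E_countable: "countable (E - {a..b})" and w_notin: "w \<notin> Some ` E"
begin

abbreviation "G \<equiv> pole_green a b w"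

text \<open>At infinity, the value for a finite pole is the Green function of the slit at the image of infinity.\<close>

definition sphere_green :: "complex option \<Rightarrow> ereal" where
  "sphere_green p = (if p = sphere_pt w then \<infinity> else case p of Some z \<Rightarrow> ereal (G z)
     | None \<Rightarrow> ereal (green_slit (complex_of_real (- (a + b - 2 * the w) / (b - a)))))"

text \<open>The complement of this set is the finite part of the domain on which the Green function is harmonic.\<close>

definition E' where "E' = E \<union> (case w of None \<Rightarrow> {} | Some y \<Rightarrow> {y})"

lemma pole_outside: "w = Some y \<Longrightarrow> y \<notin> {a..b}" "w = Some y \<Longrightarrow> y \<notin> E"
  using E_interval w_notin by auto

lemma E'_props: "compact E'" "{a..b} \<subseteq> E'" "countable (E' - {a..b})" "E \<subseteq> E'"
  using E_compact E_interval E_countable by (auto simp: E'_def Un_Diff split: option.splits intro: countable_subset)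

lemma compact_E': "compact (complex_of_real ` E')"
  by (intro compact_continuous_image continuous_intros E'_props)

lemma open_U: "open (- complex_of_real ` E')"
  using compact_E' by (simp add: open_Compl compact_imp_closed)

lemma U_iff: "z \<in> - complex_of_real ` E' \<longleftrightarrow> z \<notin> complex_of_real ` E \<and> (\<forall>y. w = Some y \<longrightarrow> z \<noteq> complex_of_real y)"
  by (auto simp: E'_def split: option.splits)

lemma Omega_U: "{z. Some z \<in> Omega E - {sphere_pt w}} = - complex_of_real ` E'"
  by (auto simp: Omega_def E'_def split: option.splits)

lemma map_off: "z \<in> - complex_of_real ` E' \<Longrightarrow> pole_map a b w z \<notin> complex_of_real ` {-1..1}"
  unfolding U_iff using E_interval by (intro pole_map_off[OF ab pole_outside(1)]) blast+

lemma map_holomorphic: "pole_map a b w holomorphic_on {z. \<forall>y. w = Some y \<longrightarrow> z \<noteq> complex_of_real y}"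
  unfolding pole_map_def[abs_def] unit_slit_map_def using ab
  by (cases w) (auto intro!: holomorphic_intros)

lemma G_harmonic: "harmonic_on (- complex_of_real ` E') G"
  unfolding pole_green_def[abs_def]
proof (rule harmonic_green_slit[OF open_U _ map_off])
  show "pole_map a b w holomorphic_on - complex_of_real ` E'"
    by (rule holomorphic_on_subset[OF map_holomorphic]) (auto simp: E'_def)
qed

lemma G_nonneg: "0 \<le> G z"
  by (simp add: pole_green_def green_slit_nonneg)

lemma G_continuous: "isCont G z" if "\<And>y. w = Some y \<Longrightarrow> z \<noteq> complex_of_real y"
proof -
  have "isCont (pole_map a b w) z"
    unfolding pole_map_def[abs_def] unit_slit_map_def using ab that
    by (cases w) (auto intro!: continuous_intros)
  moreover have "isCont green_slit (pole_map a b w z)"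
    using continuous_on_green_slit[of UNIV] by (simp add: continuous_on_eq_continuous_at)
  ultimately show ?thesis unfolding pole_green_def[abs_def] by (rule isCont_o2)
qed

lemma G_real: "G (complex_of_real t) = green_slit (complex_of_real (pole_map_real a b w t))"
  by (simp add: pole_green_def pole_map_of_real)

lemma G_interval: "t \<in> {a..b} \<Longrightarrow> G (complex_of_real t) = 0"
proof -
  assume "t \<in> {a..b}"
  then have "\<bar>pole_map_real a b w t\<bar> \<le> 1"
    using pole_map_real_interval[where w = w and t = t, OF ab pole_outside(1)] by (simp add: abs_le_iff)
  then have "max 1 \<bar>pole_map_real a b w t\<bar> = 1" by simp
  then show "G (complex_of_real t) = 0" by (simp add: G_real green_slit_real)
qed

lemma G_outside: "t \<notin> {a..b} \<Longrightarrow> w \<noteq> Some t \<Longrightarrow> 0 < G (complex_of_real t)"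
  using pole_map_real_outside[where w = w and t = t, OF ab pole_outside(1)] by (simp add: G_real green_slit_real max_def)

lemma G_near_pole:
  shows "w = None \<Longrightarrow> \<exists>R B. \<forall>z. R < cmod z \<longrightarrow> \<bar>G z - ln (cmod z)\<bar> \<le> B"
    and "w = Some y \<Longrightarrow> \<exists>r>0. \<exists>B. \<forall>z. 0 < cmod (z - complex_of_real y) \<and> cmod (z - complex_of_real y) < r \<longrightarrow>
       \<bar>G z + ln (cmod (z - complex_of_real y))\<bar> \<le> B"
proof -
  assume w: "w = None"
  define R where "R = \<bar>a + b\<bar> + (b - a)"
  have "\<bar>G z - ln (cmod z)\<bar> \<le> ln 4 + \<bar>ln (1 / (b - a))\<bar> + \<bar>ln (3 / (b - a))\<bar>" if z: "R < cmod z" for z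
  proof -
    have z0: "0 < cmod z" "\<bar>a + b\<bar> < cmod z" "b - a < cmod z - \<bar>a + b\<bar>" using z ab by (auto simp: R_def)
    have m: "cmod (unit_slit_map a b z) = cmod (2 * z - complex_of_real (a + b)) / (b - a)"
      unfolding unit_slit_map_def norm_divide norm_of_real using ab by simp
    have n2: "cmod (2 * z) = 2 * cmod z" by (simp add: norm_mult)
    have "cmod (2 * z) - cmod (complex_of_real (a + b)) \<le> cmod (2 * z - complex_of_real (a + b))" by (rule norm_triangle_ineq2)
    then have lo: "2 * cmod z - \<bar>a + b\<bar> \<le> cmod (2 * z - complex_of_real (a + b))" unfolding n2 norm_of_real .
    have "cmod (2 * z - complex_of_real (a + b)) \<le> cmod (2 * z) + cmod (complex_of_real (a + b))" by (rule norm_triangle_ineq4)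
    then have hi: "cmod (2 * z - complex_of_real (a + b)) \<le> 2 * cmod z + \<bar>a + b\<bar>" unfolding n2 norm_of_real .
    have "\<bar>green_slit (unit_slit_map a b z) + ln (1 / cmod z)\<bar> \<le> ln 4 + \<bar>ln (1 / (b - a))\<bar> + \<bar>ln (3 / (b - a))\<bar>"
    proof (rule green_slit_near_log)
      show "1 \<le> cmod (unit_slit_map a b z)" unfolding m using lo z0 ab by (simp add: le_divide_eq)
      show "1 / (b - a) \<le> cmod (unit_slit_map a b z) * (1 / cmod z)" 
        unfolding m using divide_right_mono[of "cmod z" "cmod (2 * z - complex_of_real (a + b))" "(b - a) * cmod z"] lo z0 ab by simp
      show "cmod (unit_slit_map a b z) * (1 / cmod z) \<le> 3 / (b - a)" 
        unfolding m using divide_right_mono[of "cmod (2 * z - complex_of_real (a + b))" "3 * cmod z" "(b - a) * cmod z"] hi z0 ab by simp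
    qed (use z0 ab in auto)
    then show ?thesis using w z0 by (simp add: pole_green_def pole_map_def ln_divide_pos)
  qed
  then show "\<exists>R B. \<forall>z. R < cmod z \<longrightarrow> \<bar>G z - ln (cmod z)\<bar> \<le> B" by blast
next
  assume w: "w = Some y"
  \<comment> \<open>positive because \<open>y\<close> lies on one side of the interval\<close>
  define \<gamma> where "\<gamma> = (a - y) * (b - y)"
  define \<sigma> where "\<sigma> = a + b - 2 * y"
  have \<gamma>: "0 < \<gamma>" unfolding \<gamma>_def by (rule pole_outside_product_pos[OF ab pole_outside(1)[OF w]])
  define r where "r = min (\<gamma> / (\<bar>\<sigma>\<bar> + 1)) (\<gamma> / (b - a))"
  have r: "0 < r" using \<gamma> ab by (auto simp: r_def)
  have "\<bar>G z + ln (cmod (z - complex_of_real y))\<bar> \<le> ln 4 + \<bar>ln (\<gamma> / (b - a))\<bar> + \<bar>ln (3 * \<gamma> / (b - a))\<bar>"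
    if z: "0 < cmod (z - complex_of_real y)" "cmod (z - complex_of_real y) < r" for z
  proof -
    define u where "u = z - complex_of_real y"
    define \<rho> where "\<rho> = cmod u"
    have \<rho>: "0 < \<rho>" "\<rho> * (\<bar>\<sigma>\<bar> + 1) < \<gamma>" "\<rho> * (b - a) < \<gamma>" "u \<noteq> 0"
      using z ab by (auto simp: u_def \<rho>_def r_def less_divide_eq)
    have "pole_map a b w z * u = (complex_of_real (2 * \<gamma>) - complex_of_real \<sigma> * u) / complex_of_real (b - a)"
    proof -
      have "(p / u - q) / k * u = (p - q * u) / k" for p q k :: complex using \<rho>(4) by (simp add: left_diff_distrib)
      then show ?thesis using w by (simp only: pole_map_def option.case u_def[symmetric] \<sigma>_def[symmetric] \<gamma>_def mult.assoc)
    qed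
    then have "cmod (pole_map a b w z * u) = cmod ((complex_of_real (2 * \<gamma>) - complex_of_real \<sigma> * u) / complex_of_real (b - a))" by (rule arg_cong)
    then have m: "cmod (pole_map a b w z) * \<rho> = cmod (complex_of_real (2 * \<gamma>) - complex_of_real \<sigma> * u) / (b - a)"
      unfolding norm_mult norm_divide norm_of_real \<rho>_def using ab by simp
    have s: "cmod (complex_of_real \<sigma> * u) \<le> \<gamma>" 
    proof -
      have "\<rho> * (\<bar>\<sigma>\<bar> + 1) = \<bar>\<sigma>\<bar> * \<rho> + \<rho>" by (simp add: algebra_simps)
      then have "\<bar>\<sigma>\<bar> * \<rho> \<le> \<gamma>" using \<rho>(1,2) by linarith
      then show ?thesis by (simp add: norm_mult \<rho>_def)
    qed
    have "cmod (complex_of_real (2 * \<gamma>)) - cmod (complex_of_real \<sigma> * u) \<le> cmod (complex_of_real (2 * \<gamma>) - complex_of_real \<sigma> * u)" by (rule norm_triangle_ineq2)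
    then have lo: "\<gamma> \<le> cmod (complex_of_real (2 * \<gamma>) - complex_of_real \<sigma> * u)" using s \<gamma> unfolding norm_of_real by simp
    have "cmod (complex_of_real (2 * \<gamma>) - complex_of_real \<sigma> * u) \<le> cmod (complex_of_real (2 * \<gamma>)) + cmod (complex_of_real \<sigma> * u)" by (rule norm_triangle_ineq4)
    then have hi: "cmod (complex_of_real (2 * \<gamma>) - complex_of_real \<sigma> * u) \<le> 3 * \<gamma>" using s \<gamma> unfolding norm_of_real by simp
    have "\<bar>green_slit (pole_map a b w z) + ln \<rho>\<bar> \<le> ln 4 + \<bar>ln (\<gamma> / (b - a))\<bar> + \<bar>ln (3 * \<gamma> / (b - a))\<bar>"
    proof (rule green_slit_near_log)
      show 1: "\<gamma> / (b - a) \<le> cmod (pole_map a b w z) * \<rho>" unfolding m using lo ab by (intro divide_right_mono) auto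
      show "cmod (pole_map a b w z) * \<rho> \<le> 3 * \<gamma> / (b - a)" unfolding m using hi ab by (intro divide_right_mono) auto
      have "1 * \<rho> \<le> \<gamma> / (b - a)" using \<rho>(3) ab by (simp add: le_divide_eq)
      also note 1
      finally show "1 \<le> cmod (pole_map a b w z)" using \<rho>(1) by (simp only: mult_le_cancel_right_pos)
    qed (use \<rho> \<gamma> ab in auto)
    then show ?thesis by (simp add: pole_green_def \<rho>_def u_def)
  qed
  then show "\<exists>r>0. \<exists>B. \<forall>z. 0 < cmod (z - complex_of_real y) \<and> cmod (z - complex_of_real y) < r \<longrightarrow>
       \<bar>G z + ln (cmod (z - complex_of_real y))\<bar> \<le> B" using r by blast
qed

lemma sphere_green_Some: "sphere_green (Some z) = ereal (G z)" if "\<And>y. w = Some y \<Longrightarrow> z \<noteq> complex_of_real y"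
  unfolding sphere_green_def using that by (cases w) auto

lemma sphere_green_U: "z \<in> - complex_of_real ` E' \<Longrightarrow> sphere_green (Some z) = ereal (G z)"
  unfolding U_iff by (intro sphere_green_Some) blast

lemma openin_sphere_Some: "openin riemann_sphere (Some ` V)" if "open V"
  unfolding openin_Alexandroff_compactification using that by (intro disjI1) auto

lemma openin_sphere_None: "openin riemann_sphere (insert None (Some ` (- cball 0 R)))"
  unfolding openin_Alexandroff_compactification
  by (intro disjI2 exI[of _ "cball 0 R"]) (auto simp: compactin_euclidean_iff Compl_eq_Diff_UNIV)

lemma G_bounded_off_pole:
  assumes V: "openin riemann_sphere V" "sphere_pt w \<in> V"
  shows "\<exists>B. \<forall>z\<in>Omega E - V. \<bar>sphere_green z\<bar> \<le> ereal B"
proof (cases w)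
  case None
  then obtain C where C: "compact C" "V = insert None (Some ` (UNIV - C))"
    using V by (auto simp: openin_Alexandroff_compactification compactin_euclidean_iff)
  have "continuous_on C G" using G_continuous None by (intro continuous_at_imp_continuous_on) auto
  then have "bounded (G ` C)" using C(1) by (intro compact_imp_bounded compact_continuous_image)
  then obtain B where B: "\<And>z. z \<in> C \<Longrightarrow> \<bar>G z\<bar> \<le> B" by (auto simp: bounded_real)
  have "\<bar>sphere_green p\<bar> \<le> ereal B" if p: "p \<in> Omega E - V" for p
  proof -
    obtain z where z: "p = Some z" "z \<in> C" using p unfolding C(2) by (cases p) auto
    have "sphere_green (Some z) = ereal (G z)" by (rule sphere_green_Some) (simp add: None)
    then show ?thesis using B[of z] z by simp
  qed
  then show ?thesis by blast
next
  case (Some y)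
  have "open {z. Some z \<in> V}"
  proof -
    from V(1) consider T where "open T" "V = Some ` T" | C where "compact C" "V = insert None (Some ` (UNIV - C))"
      by (auto simp: openin_Alexandroff_compactification compactin_euclidean_iff)
    then show ?thesis
    proof cases
      case 1
      then have "{z. Some z \<in> V} = T" by auto
      then show ?thesis using 1 by simp
    next
      case 2
      then have "{z. Some z \<in> V} = - C" by auto
      then show ?thesis using 2 by (simp add: open_Compl compact_imp_closed)
    qed
  qed
  moreover have "complex_of_real y \<in> {z. Some z \<in> V}" using V(2) Some by simp
  ultimately obtain \<delta> where \<delta>: "0 < \<delta>" "ball (complex_of_real y) \<delta> \<subseteq> {z. Some z \<in> V}" by (rule openE)
  define k where "k = 2 * (a - y) * (b - y)"
  define \<sigma> where "\<sigma> = a + b - 2 * y"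
  define R where "R = (\<bar>k\<bar> / \<delta> + \<bar>\<sigma>\<bar>) / (b - a)"
  define B where "B = arcosh (R + 1)"
  have R: "0 \<le> R" using \<delta> ab by (simp add: R_def)
  have le: "green_slit W \<le> B" if "cmod W \<le> R" for W
  proof -
    have "1 \<le> (cmod (W - 1) + cmod (W + 1)) / 2" "(cmod (W - 1) + cmod (W + 1)) / 2 \<le> R + 1"
      using foci_sum_ge[of W] foci_sum_le[of W] that by auto
    then show ?thesis unfolding green_slit_def B_def
      by (rule arcosh_mono)
  qed
  have "\<bar>sphere_green p\<bar> \<le> ereal B" if p: "p \<in> Omega E - V" for p
  proof (cases p)
    case None
    have "cmod (complex_of_real (- \<sigma> / (b - a))) \<le> R"
      unfolding norm_of_real using ab \<delta> by (auto simp: R_def intro!: divide_right_mono)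
    from le[OF this] have le': "green_slit (complex_of_real (- \<sigma> / (b - a))) \<le> B" .
    have "sphere_green None = ereal (green_slit (complex_of_real (- \<sigma> / (b - a))))"
      unfolding sphere_green_def \<sigma>_def using Some by simp
    then show ?thesis using None le' green_slit_nonneg[of "complex_of_real (- \<sigma> / (b - a))"] by (simp only: abs_ereal.simps abs_of_nonneg ereal_less_eq)
  next
    case (Some z)
    then have "z \<notin> ball (complex_of_real y) \<delta>" using p \<delta>(2) by auto
    then have d: "\<delta> \<le> cmod (z - complex_of_real y)" by (simp add: dist_norm norm_minus_commute)
    then have zy: "z \<noteq> complex_of_real y" using \<delta>(1) by auto
    have "cmod (complex_of_real k / (z - complex_of_real y) - complex_of_real \<sigma>) \<le>
        cmod (complex_of_real k / (z - complex_of_real y)) + cmod (complex_of_real \<sigma>)" by (rule norm_triangle_ineq4)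
    also have "\<dots> \<le> \<bar>k\<bar> / \<delta> + \<bar>\<sigma>\<bar>"
      unfolding norm_divide norm_of_real using d \<delta>(1) by (intro add_mono divide_left_mono mult_pos_pos) auto
    finally have "cmod ((complex_of_real k / (z - complex_of_real y) - complex_of_real \<sigma>) / complex_of_real (b - a)) \<le> R"
      unfolding R_def norm_divide[of _ "complex_of_real (b - a)"] norm_of_real using ab by (simp add: divide_right_mono)
    then have "cmod (pole_map a b w z) \<le> R"
      using \<open>w = Some y\<close> by (simp only: pole_map_def option.case k_def \<sigma>_def)
    from le[OF this] show ?thesis using Some sphere_green_Some[of z] zy \<open>w = Some y\<close> green_slit_nonneg
      by (simp add: pole_green_def)
  qed
  then show ?thesis by blast
qed

lemma tendsto_G_interval:
  assumes "t \<in> {a..b}"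
  shows "((\<lambda>z. sphere_green (Some z)) \<longlongrightarrow> 0) (at (complex_of_real t) within S)"
proof -
  have ne: "w = Some y \<Longrightarrow> complex_of_real t \<noteq> complex_of_real y" for y using pole_outside(1) assms by auto
  have "(G \<longlongrightarrow> G (complex_of_real t)) (at (complex_of_real t) within S)"
    using G_continuous[OF ne] by (simp add: isCont_def tendsto_within_subset[of _ _ _ UNIV])
  then have "(G \<longlongrightarrow> 0) (at (complex_of_real t) within S)" using G_interval[OF assms] by simp
  then have "((\<lambda>z. ereal (G z)) \<longlongrightarrow> ereal 0) (at (complex_of_real t) within S)" by (rule tendsto_ereal)
  moreover have "eventually (\<lambda>z. \<forall>y. w = Some y \<longrightarrow> z \<noteq> complex_of_real y) (at (complex_of_real t) within S)"
  proof (cases w)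
    case (Some y)
    have "eventually (\<lambda>z. z \<noteq> complex_of_real y) (nhds (complex_of_real t))"
      by (rule t1_space_nhds) (use ne Some in auto)
    then show ?thesis using Some by (auto simp: eventually_at_filter elim: eventually_mono)
  qed auto
  then have "eventually (\<lambda>z. ereal (G z) = sphere_green (Some z)) (at (complex_of_real t) within S)"
    by (rule eventually_mono) (use sphere_green_Some in auto)
  ultimately show ?thesis unfolding zero_ereal_def by (rule Lim_transform_eventually)
qed

lemma polar_countable: "countable S \<Longrightarrow> polar S"
  unfolding polar_def using Cap_countable compact_imp_bounded countable_subset by blast

lemma open_inversion_chart: "open {z. inversion_chart z \<in> Omega E - {sphere_pt w}}"
proof -
  obtain B where B0: "0 < B \<and> (\<forall>z\<in>complex_of_real ` E'. cmod z \<le> B)"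
    using compact_imp_bounded[OF compact_E'] unfolding bounded_pos by blast
  then have B: "0 < B" "\<And>z. z \<in> complex_of_real ` E' \<Longrightarrow> cmod z \<le> B" by blast+
  define C where "C = {z. 1 / B \<le> cmod z} \<inter> inverse -` (complex_of_real ` E')"
  have "closed {z :: complex. 1 / B \<le> cmod z}" by (intro closed_Collect_le continuous_intros)
  moreover have "continuous_on {z :: complex. 1 / B \<le> cmod z} inverse"
    using B(1) by (intro continuous_intros) (auto simp: divide_le_0_iff)
  ultimately have "closed C" unfolding C_def
    by (intro continuous_closed_preimage compact_imp_closed[OF compact_E'])
      (auto simp: vimage_def Int_def intro: continuous_closed_preimage compact_imp_closed[OF compact_E'])
  have C: "z \<in> C \<longleftrightarrow> z \<noteq> 0 \<and> inverse z \<in> complex_of_real ` E'" for z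
  proof
    assume "z \<noteq> 0 \<and> inverse z \<in> complex_of_real ` E'"
    then have "inverse (cmod z) \<le> B" "z \<noteq> 0" using B(2)[of "inverse z"] by (auto simp: norm_inverse)
    then have "1 / B \<le> cmod z" using B(1) by (simp add: field_simps)
    then show "z \<in> C" using \<open>z \<noteq> 0 \<and> _\<close> by (simp add: C_def)
  qed (use B(1) in \<open>auto simp: C_def divide_le_0_iff\<close>)
  have iff: "inverse z \<in> complex_of_real ` E' \<longleftrightarrow> \<not> (Some (inverse z) \<in> Omega E - {sphere_pt w})" for z
    using Omega_U by blast
  have None_iff: "None \<in> Omega E - {sphere_pt w} \<longleftrightarrow> w \<noteq> None" by (auto simp: Omega_def)
  have member: "z \<in> {z. inversion_chart z \<in> Omega E - {sphere_pt w}} \<longleftrightarrow> (if z = 0 then w \<noteq> None else z \<notin> C)" for z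
  proof (cases "z = 0")
    case False
    then have "inversion_chart z = Some (inverse z)" by (simp add: inversion_chart_def)
    then have "inversion_chart z \<in> Omega E - {sphere_pt w} \<longleftrightarrow> inverse z \<notin> complex_of_real ` E'" using iff[of z] by simp
    then show ?thesis using False C[of z] by simp
  qed (use None_iff in \<open>simp add: inversion_chart_def\<close>)
  show ?thesis
  proof (cases w)
    case None
    then have "{z. inversion_chart z \<in> Omega E - {sphere_pt w}} = - (insert 0 C)"
      using member None by (intro set_eqI) simp
    then show ?thesis using \<open>closed C\<close> by (simp add: open_Compl)
  next
    case (Some y)
    then have "{z. inversion_chart z \<in> Omega E - {sphere_pt w}} = - C"
      using member C[of 0] Some by (intro set_eqI) auto
    then show ?thesis using \<open>closed C\<close> by (simp add: open_Compl)
  qed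
qed

lemma harmonic_inversion_chart:
  "harmonic_on {z. inversion_chart z \<in> Omega E - {sphere_pt w}} (\<lambda>z. real_of_ereal (sphere_green (inversion_chart z)))"
proof -
  let ?V = "{z. inversion_chart z \<in> Omega E - {sphere_pt w}}"
  have inU: "inverse z \<in> - complex_of_real ` E'" if "z \<in> ?V" "z \<noteq> 0" for z
    using that Omega_U by (auto simp: inversion_chart_def)
  have ne: "w = Some y \<Longrightarrow> inverse z \<noteq> complex_of_real y" if "z \<in> ?V" "z \<noteq> 0" for z y
    using inU[OF that] unfolding U_iff by blast
  show ?thesis
  proof (cases w)
    case None
    have z0: "z \<noteq> 0" if "z \<in> ?V" for z using that None by (auto simp: inversion_chart_def)
    have "harmonic_on ?V (\<lambda>z. green_slit (pole_map a b w (inverse z)))"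
    proof (rule harmonic_green_slit[OF open_inversion_chart])
      show "(\<lambda>z. pole_map a b w (inverse z)) holomorphic_on ?V"
        unfolding pole_map_def unit_slit_map_def using None z0 ab by (auto intro!: holomorphic_intros)
      show "pole_map a b w (inverse z) \<notin> complex_of_real ` {-1..1}" if "z \<in> ?V" for z
        by (rule map_off[OF inU[OF that z0[OF that]]])
    qed
    then show ?thesis
    proof (rule harmonic_on_cong)
      fix z assume z: "z \<in> ?V"
      show "green_slit (pole_map a b w (inverse z)) = real_of_ereal (sphere_green (inversion_chart z))"
        using sphere_green_U[OF inU[OF z z0[OF z]]] z0[OF z] unfolding inversion_chart_def pole_green_def by simp
    qed
  next
    case (Some y)
    define k where "k = 2 * (a - y) * (b - y)"
    define \<sigma> where "\<sigma> = a + b - 2 * y"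
    define m where "m z = (complex_of_real k * z / (1 - complex_of_real y * z) - complex_of_real \<sigma>) / complex_of_real (b - a)" for z
    have den: "1 - complex_of_real y * z \<noteq> 0" if "z \<in> ?V" for z
    proof (cases "z = 0")
      case False
      then show ?thesis using ne[OF that False Some] by (auto simp: field_simps)
    qed simp
    have m_eq: "m z = pole_map a b w (inverse z)" if "z \<in> ?V" "z \<noteq> 0" for z
    proof -
      have "complex_of_real k * z / (1 - complex_of_real y * z) = complex_of_real k / (inverse z - complex_of_real y)"
      proof -
        have "inverse z - complex_of_real y = (1 - complex_of_real y * z) / z" using that(2) by (simp add: field_simps)
        then show ?thesis by simp
      qed
      then show ?thesis using Some by (simp add: m_def pole_map_def k_def \<sigma>_def)
    qed
    have "harmonic_on ?V (\<lambda>z. green_slit (m z))"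
    proof (rule harmonic_green_slit[OF open_inversion_chart])
      show "m holomorphic_on ?V" unfolding m_def[abs_def] using den ab by (intro holomorphic_intros) auto
      show "m z \<notin> complex_of_real ` {-1..1}" if "z \<in> ?V" for z
      proof (cases "z = 0")
        case False
        then show ?thesis using map_off[OF inU[OF that False]] m_eq[OF that False] by simp
      next
        case True
        have "1 < \<bar>\<sigma> / (b - a)\<bar>" using pole_outside(1)[OF Some] ab
          by (auto simp: \<sigma>_def abs_if less_divide_eq divide_less_eq split: if_splits)
        then have "- \<sigma> / (b - a) \<notin> {-1..1}" by (auto simp: abs_if split: if_splits)
        moreover have "m z = complex_of_real (- \<sigma> / (b - a))" using True by (simp add: m_def)
        moreover have "complex_of_real u \<notin> complex_of_real ` V" if "u \<notin> V" for u V using that by auto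
        ultimately show ?thesis by metis
      qed
    qed
    then show ?thesis
    proof (rule harmonic_on_cong)
      fix z assume z: "z \<in> ?V"
      show "green_slit (m z) = real_of_ereal (sphere_green (inversion_chart z))"
      proof (cases "z = 0")
        case True
        have "sphere_green None = ereal (green_slit (complex_of_real (- \<sigma> / (b - a))))"
          unfolding sphere_green_def \<sigma>_def using Some by simp
        then show ?thesis using True unfolding inversion_chart_def m_def by simp
      next
        case False
        then show ?thesis using sphere_green_U[OF inU[OF z False]] m_eq[OF z False]
          unfolding inversion_chart_def pole_green_def by simp
      qed
    qed
  qed
qed

theorem is_green_sphere_green: "is_green_function E (sphere_pt w) sphere_green"
  unfolding is_green_function_def
proof (intro conjI ballI allI impI)
  show "\<bar>sphere_green p\<bar> \<noteq> \<infinity>" if "p \<in> Omega E - {sphere_pt w}" for p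
    unfolding sphere_green_def using that by (cases p) auto
  show "sphere_harmonic_on (Omega E - {sphere_pt w}) (\<lambda>z. real_of_ereal (sphere_green z))"
    unfolding sphere_harmonic_on_def
  proof (intro conjI harmonic_inversion_chart)
    show "harmonic_on {z. Some z \<in> Omega E - {sphere_pt w}} (\<lambda>z. real_of_ereal (sphere_green (Some z)))"
      unfolding Omega_U by (rule harmonic_on_cong[OF G_harmonic]) (simp add: sphere_green_U)
  qed
  show "\<exists>B. \<forall>z\<in>Omega E - V. \<bar>sphere_green z\<bar> \<le> ereal B" if "openin riemann_sphere V \<and> sphere_pt w \<in> V" for V
    using G_bounded_off_pole that by blast
  show "sphere_green (sphere_pt w) = \<infinity>" by (simp add: sphere_green_def)
  show "log_pole (sphere_pt w) sphere_green"
  proof (cases w)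
    case None
    then show ?thesis using G_near_pole(1) sphere_green_Some by (simp add: log_pole_def)
  next
    case (Some y)
    obtain r B where r: "r > 0" "\<And>z. 0 < cmod (z - complex_of_real y) \<Longrightarrow> cmod (z - complex_of_real y) < r \<Longrightarrow>
       \<bar>G z + ln (cmod (z - complex_of_real y))\<bar> \<le> B"
      using G_near_pole(2)[OF Some] by blast
    have "\<bar>sphere_green (Some z) + ereal (ln (cmod (z - complex_of_real y)))\<bar> \<le> ereal B"
      if "0 < cmod (z - complex_of_real y)" "cmod (z - complex_of_real y) < r" for z
      using r(2)[OF that] sphere_green_Some[of z] that Some by auto
    then show ?thesis unfolding log_pole_def using Some r(1) by auto
  qed
  show "polar {t \<in> E. \<not> ((\<lambda>z. sphere_green (Some z)) \<longlongrightarrow> 0) (at (complex_of_real t) within - complex_of_real ` E)}"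
  proof (rule polar_countable, rule countable_subset[OF _ E_countable], rule subsetI)
    fix t assume "t \<in> {t \<in> E. \<not> ((\<lambda>z. sphere_green (Some z)) \<longlongrightarrow> 0) (at (complex_of_real t) within - complex_of_real ` E)}"
    then show "t \<in> E - {a..b}" using tendsto_G_interval by blast
  qed
qed

text \<open>The difference of two Green functions is harmonic and bounded, since the logarithmic
  poles cancel up to bounded terms and both are bounded off the pole. It tends to \<open>0\<close> on the interval outside
  a polar set, so \<open>bounded_harmonic_nonpos\<close> applies to it and to its negative.\<close>

theorem green_function_unique:
  assumes g: "is_green_function E (sphere_pt w) g" and z: "z \<in> - complex_of_real ` E'"
  shows "g (Some z) = ereal (G z)"
proof -
  let ?U = "- complex_of_real ` E'"
  note g_props = g[unfolded is_green_function_def]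
  have g1: "\<forall>p\<in>Omega E - {sphere_pt w}. \<bar>g p\<bar> \<noteq> \<infinity>" using g_props by (elim conjE)
  have g2: "sphere_harmonic_on (Omega E - {sphere_pt w}) (\<lambda>p. real_of_ereal (g p))" using g_props by (elim conjE)
  have g3: "\<forall>U. openin riemann_sphere U \<and> sphere_pt w \<in> U \<longrightarrow> (\<exists>B. \<forall>p\<in>Omega E - U. \<bar>g p\<bar> \<le> ereal B)"
    using g_props by (elim conjE)
  have g4: "log_pole (sphere_pt w) g" using g_props by (elim conjE)
  have g5: "polar {t \<in> E. \<not> ((\<lambda>z. g (Some z)) \<longlongrightarrow> 0) (at (complex_of_real t) within - complex_of_real ` E)}"
    using g_props by (elim conjE)
  have mem: "Some z \<in> Omega E - {sphere_pt w}" if "z \<in> ?U" for z using that Omega_U by blast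
  have fin: "\<bar>g (Some z)\<bar> \<noteq> \<infinity>" if "z \<in> ?U" for z by (rule bspec[OF g1 mem[OF that]])
  have gh: "harmonic_on ?U (\<lambda>z. real_of_ereal (g (Some z)))"
    using g2 unfolding sphere_harmonic_on_def Omega_U by (rule conjunct1)
  define h where "h z = real_of_ereal (g (Some z)) - G z" for z
  have gr: "\<bar>real_of_ereal (g (Some z))\<bar> \<le> B" if "z \<in> ?U" "\<bar>g (Some z)\<bar> \<le> ereal B" for z B
    using fin[OF that(1)] that(2) by (cases "g (Some z)") auto
  have bounded: "\<exists>M. \<forall>z\<in>?U. \<bar>h z\<bar> \<le> M"
  proof -
    have "\<exists>V B. openin riemann_sphere V \<and> sphere_pt w \<in> V \<and> (\<forall>z\<in>?U. Some z \<in> V \<longrightarrow> \<bar>h z\<bar> \<le> B)"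
    proof (cases w)
      case None
      obtain R B where RB: "\<And>z. R < cmod z \<Longrightarrow> \<bar>G z - ln (cmod z)\<bar> \<le> B" using G_near_pole(1)[OF None] by blast
      obtain R' B' where RB': "\<And>z. R' < cmod z \<Longrightarrow> \<bar>g (Some z) - ereal (ln (cmod z))\<bar> \<le> ereal B'"
        using g4 None unfolding log_pole_def by auto
      have "\<bar>h z\<bar> \<le> B + B'" if z: "z \<in> ?U" "max R R' < cmod z" for z
      proof -
        have "\<bar>real_of_ereal (g (Some z)) - ln (cmod z)\<bar> \<le> B'"
          using RB'[of z] fin[OF z(1)] z(2) by (cases "g (Some z)") auto
        then show ?thesis using RB[of z] z(2) by (simp add: h_def abs_le_iff)
      qed
      then have "\<bar>h z\<bar> \<le> B + B'" if "z \<in> ?U" "Some z \<in> insert None (Some ` (- cball 0 (max R R')))" for z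
        using that by (intro \<open>\<And>z. z \<in> ?U \<Longrightarrow> max R R' < cmod z \<Longrightarrow> \<bar>h z\<bar> \<le> B + B'\<close>) (auto simp del: max_less_iff_conj)
      moreover have "sphere_pt w \<in> insert None (Some ` (- cball 0 (max R R')))" by (simp add: None)
      ultimately show ?thesis using openin_sphere_None by blast
    next
      case (Some y)
      obtain r B where r: "r > 0" "\<And>z. 0 < cmod (z - complex_of_real y) \<Longrightarrow> cmod (z - complex_of_real y) < r \<Longrightarrow>
         \<bar>G z + ln (cmod (z - complex_of_real y))\<bar> \<le> B"
        using G_near_pole(2)[OF Some] by blast
      obtain r' B' where r': "r' > 0" "\<And>z. 0 < cmod (z - complex_of_real y) \<Longrightarrow> cmod (z - complex_of_real y) < r' \<Longrightarrow>
         \<bar>g (Some z) + ereal (ln (cmod (z - complex_of_real y)))\<bar> \<le> ereal B'"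
        using g4 Some unfolding log_pole_def by auto
      have "\<bar>h z\<bar> \<le> B + B'" if z: "z \<in> ?U" "cmod (z - complex_of_real y) < min r r'" for z
      proof -
        have "z \<noteq> complex_of_real y" using z(1) Some unfolding U_iff by blast
        then have p: "0 < cmod (z - complex_of_real y)" by simp
        have "\<bar>real_of_ereal (g (Some z)) + ln (cmod (z - complex_of_real y))\<bar> \<le> B'"
          using r'(2)[OF p] fin[OF z(1)] z(2) by (cases "g (Some z)") auto
        then show ?thesis using r(2)[OF p] z(2) by (simp add: h_def abs_le_iff)
      qed
      then have "\<bar>h z\<bar> \<le> B + B'" if "z \<in> ?U" "Some z \<in> Some ` ball (complex_of_real y) (min r r')" for z
        using that by (intro \<open>\<And>z. z \<in> ?U \<Longrightarrow> cmod (z - complex_of_real y) < min r r' \<Longrightarrow> \<bar>h z\<bar> \<le> B + B'\<close>)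
          (auto simp: dist_norm norm_minus_commute simp del: min_less_iff_conj)
      moreover have "sphere_pt w \<in> Some ` ball (complex_of_real y) (min r r')" using Some r(1) r'(1) by simp
      ultimately show ?thesis using openin_sphere_Some[OF open_ball] by blast
    qed
    then obtain V B where V: "openin riemann_sphere V" "sphere_pt w \<in> V" "\<And>z. z \<in> ?U \<Longrightarrow> Some z \<in> V \<Longrightarrow> \<bar>h z\<bar> \<le> B"
      by blast
    have "\<exists>B. \<forall>p\<in>Omega E - V. \<bar>g p\<bar> \<le> ereal B" by (rule g3[rule_format, OF conjI[OF V(1,2)]])
    then obtain B1 where B1: "\<And>p. p \<in> Omega E - V \<Longrightarrow> \<bar>g p\<bar> \<le> ereal B1" by blast
    obtain B2 where B2: "\<And>p. p \<in> Omega E - V \<Longrightarrow> \<bar>sphere_green p\<bar> \<le> ereal B2" using G_bounded_off_pole[OF V(1,2)] by blast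
    have "\<bar>h z\<bar> \<le> \<bar>B\<bar> + \<bar>B1\<bar> + \<bar>B2\<bar>" if z: "z \<in> ?U" for z
    proof (cases "Some z \<in> V")
      case True
      then show ?thesis using V(3)[OF z] by linarith
    next
      case False
      then have p: "Some z \<in> Omega E - V" using mem[OF z] by blast
      have "\<bar>G z\<bar> \<le> B2" using B2[OF p] sphere_green_U[OF z] by simp
      moreover have "\<bar>real_of_ereal (g (Some z))\<bar> \<le> B1" by (rule gr[OF z B1[OF p]])
      ultimately show ?thesis unfolding h_def by linarith
    qed
    then show ?thesis by blast
  qed
  then obtain M where M: "\<And>z. z \<in> ?U \<Longrightarrow> \<bar>h z\<bar> \<le> M" by blast
  define P where "P = {t \<in> E. \<not> ((\<lambda>z. g (Some z)) \<longlongrightarrow> 0) (at (complex_of_real t) within - complex_of_real ` E)}"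
  have polar: "polar P" using g5 unfolding P_def .
  have null: "emeasure lborel F = 0" if "compact F" "F \<subseteq> P" for F
    using polar that unfolding polar_def by (intro Cap_zero_imp_null) auto
  have h0: "(h \<longlongrightarrow> 0) (at (complex_of_real t) within ?U)" if t: "t \<in> {a..b} - P" for t
  proof -
    have "((\<lambda>z. g (Some z)) \<longlongrightarrow> ereal 0) (at (complex_of_real t) within - complex_of_real ` E)"
      using t E_interval by (auto simp: P_def zero_ereal_def)
    then have "((\<lambda>z. g (Some z)) \<longlongrightarrow> ereal 0) (at (complex_of_real t) within ?U)"
      by (rule tendsto_within_subset) (use E'_props(4) in auto)
    then have 1: "((\<lambda>z. real_of_ereal (g (Some z))) \<longlongrightarrow> 0) (at (complex_of_real t) within ?U)"
      by (rule lim_real_of_ereal)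
    have ne: "w = Some y \<Longrightarrow> complex_of_real t \<noteq> complex_of_real y" for y using pole_outside(1) t by auto
    have "(G \<longlongrightarrow> G (complex_of_real t)) (at (complex_of_real t) within ?U)"
      using G_continuous[OF ne] by (simp add: isCont_def tendsto_within_subset[of _ _ _ UNIV])
    then have "(G \<longlongrightarrow> 0) (at (complex_of_real t) within ?U)" using G_interval[of t] t by simp
    from tendsto_diff[OF 1 this] show ?thesis by (simp add: h_def[abs_def])
  qed
  have hh: "harmonic_on ?U h"
    using harmonic_on_lincomb[OF gh G_harmonic, of 1 "-1"] by (simp add: h_def[abs_def])
  have "h z \<le> 0"
    by (rule bounded_harmonic_nonpos[OF ab E'_props(1-3) hh _ h0 null z]) (use M in \<open>auto simp: abs_le_iff\<close>)
  moreover have "- h z \<le> 0"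
  proof (rule bounded_harmonic_nonpos[OF ab E'_props(1-3) _ _ _ null z])
    show "harmonic_on ?U (\<lambda>z. - h z)" using harmonic_on_lincomb[OF hh hh, of "-1" 0] by simp
    show "- h z \<le> M" if "z \<in> ?U" for z using M[OF that] by (simp add: abs_le_iff)
    show "((\<lambda>z. - h z) \<longlongrightarrow> 0) (at (complex_of_real t) within ?U)" if "t \<in> {a..b} - P" for t
      using tendsto_minus[OF h0[OF that]] by simp
  qed auto
  ultimately have "real_of_ereal (g (Some z)) = G z" by (simp add: h_def)
  then show ?thesis using fin[OF z] by (cases "g (Some z)") auto
qed

lemma green_inside_eq: "z \<in> - complex_of_real ` E' \<Longrightarrow> green_inside E (sphere_pt w) (Some z) = ereal (G z)"
  unfolding green_inside_def by (rule green_function_unique[OF someI[of "is_green_function E (sphere_pt w)"]]) (rule is_green_sphere_green)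

lemma green_outside_eq: "z \<in> - complex_of_real ` E' \<Longrightarrow> green E (sphere_pt w) (Some z) = ereal (G z)"
  using green_inside_eq[of z] Omega_U unfolding green_def by auto

text \<open>The explicit Green function is continuous across \<open>E\<close>, so the upper boundary value is its value.\<close>

lemma green_on_E:
  assumes t: "t \<in> E"
  shows "green E (sphere_pt w) (Some (complex_of_real t)) = ereal (G (complex_of_real t))"
proof -
  let ?F = "at (complex_of_real t) within - complex_of_real ` E"
  have ne: "w = Some y \<Longrightarrow> complex_of_real t \<noteq> complex_of_real y" for y using pole_outside(2) t by auto
  have "complex_of_real t islimpt - complex_of_real ` E"
    unfolding islimpt_approachable
  proof (intro allI impI)
    fix e :: real assume "0 < e"
    have "Complex t (e / 2) \<notin> complex_of_real ` E" using \<open>0 < e\<close> by (auto simp: complex_eq_iff)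
    moreover have "Complex t (e / 2) \<noteq> complex_of_real t" using \<open>0 < e\<close> by (auto simp: complex_eq_iff)
    moreover have "Complex t (e / 2) - complex_of_real t = \<i> * complex_of_real (e / 2)" by (simp add: complex_eq_iff)
    then have "dist (Complex t (e / 2)) (complex_of_real t) = e / 2" using \<open>0 < e\<close>
      unfolding dist_norm by (simp only: norm_mult norm_of_real) simp
    ultimately show "\<exists>x'\<in>- complex_of_real ` E. x' \<noteq> complex_of_real t \<and> dist x' (complex_of_real t) < e"
      using \<open>0 < e\<close> by (intro bexI[of _ "Complex t (e / 2)"]) auto
  qed
  then have nontriv: "?F \<noteq> bot" by (simp add: trivial_limit_within)
  have "(G \<longlongrightarrow> G (complex_of_real t)) ?F"
    using G_continuous[OF ne] by (simp add: isCont_def tendsto_within_subset[of _ _ _ UNIV])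
  then have "((\<lambda>z. ereal (G z)) \<longlongrightarrow> ereal (G (complex_of_real t))) ?F" by (rule tendsto_ereal)
  moreover have "eventually (\<lambda>z. z \<in> - complex_of_real ` E') ?F"
  proof (cases w)
    case None
    then show ?thesis unfolding E'_def by (auto simp: eventually_at_filter)
  next
    case (Some y)
    have "eventually (\<lambda>z. z \<noteq> complex_of_real y) (nhds (complex_of_real t))"
      by (rule t1_space_nhds) (use ne Some in auto)
    then show ?thesis unfolding E'_def using Some by (auto simp: eventually_at_filter elim: eventually_mono)
  qed
  then have "eventually (\<lambda>z. ereal (G z) = green_inside E (sphere_pt w) (Some z)) ?F"
    by (rule eventually_mono) (simp add: green_inside_eq)
  ultimately have "((\<lambda>z. green_inside E (sphere_pt w) (Some z)) \<longlongrightarrow> ereal (G (complex_of_real t))) ?F"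
    by (rule Lim_transform_eventually)
  from lim_imp_Limsup[OF nontriv this] show ?thesis using t by (simp add: green_def Omega_def)
qed

text \<open>The points added to the interval are interior points of the domain of the Green function of \<open>[a, b]\<close>,
  where it is positive.\<close>

lemma irregular_points_eq: "irregular_points E w = E - {a..b}"
proof -
  have "(0 < green E (sphere_pt w) (sphere_pt (Some t))) \<longleftrightarrow> t \<notin> {a..b}" if "t \<in> E" for t
    using green_on_E[OF that] G_interval[of t] G_outside[of t] w_notin that by (cases "t \<in> {a..b}") auto
  then show ?thesis unfolding irregular_points_def by blast
qed

lemma irregularity_coeff_eq: "irregularity_coeff E w = (\<Sum>\<^sub>\<infinity>t\<in>E - {a..b}. ereal (G (complex_of_real t)))"
  unfolding irregularity_coeff_def irregular_points_eq by (rule infsum_cong) (simp add: green_on_E)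

end

section \<open>Transfer of extremal polynomials and comparison of sums\<close>

definition shifted_poly :: "nat \<Rightarrow> (nat \<Rightarrow> 'a::field) \<Rightarrow> 'a \<Rightarrow> 'a poly" where
  "shifted_poly n d y = (\<Sum>j\<le>n. smult (d j) ([:- y, 1:] ^ j))"

lemma poly_shifted_poly: "poly (shifted_poly n d y) z = (\<Sum>j\<le>n. d j * (z - y) ^ j)"
  by (simp add: shifted_poly_def poly_sum poly_power)

lemma poly_shifted_poly_center: "poly (shifted_poly n d y) y = d 0"
proof -
  have "(\<Sum>j\<le>n. d j * (y - y) ^ j) = (\<Sum>j\<in>{0}. d j * (y - y) ^ j)" by (rule sum.mono_neutral_right) auto
  then show ?thesis by (simp add: poly_shifted_poly)
qed

lemma degree_shifted_poly: "degree (shifted_poly n d y) \<le> n"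
  unfolding shifted_poly_def
proof (rule degree_sum_le)
  fix j assume "j \<in> {..n}"
  then show "degree (smult (d j) ([:- y, 1:] ^ j)) \<le> n"
    using degree_smult_le[of "d j" "[:- y, 1:] ^ j"] by (simp add: degree_linear_power)
qed simp

lemma coeff_shifted_poly: "coeff (shifted_poly n d y) n = d n"
proof -
  have "coeff ([:- y, 1:] ^ j) n = (if j = n then 1 else 0)" if "j \<le> n" for j
    using that by (cases "j = n") (auto simp: coeff_linear_power degree_linear_power intro!: coeff_eq_0)
  then have "(\<Sum>j\<le>n. d j * coeff ([:- y, 1:] ^ j) n) = (\<Sum>j\<le>n. if j = n then d j else 0)"
    by (intro sum.cong) auto
  then show ?thesis by (simp add: shifted_poly_def coeff_sum)
qed

lemma poly_taylor:
  fixes Q :: "'a::field poly"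
  assumes "degree Q \<le> n"
  shows "poly Q z = (\<Sum>j\<le>n. coeff (pcompose Q [:y, 1:]) j * (z - y) ^ j)"
proof -
  let ?R = "pcompose Q [:y, 1:]"
  have d: "degree ?R \<le> n" using assms by (simp add: degree_pcompose)
  have "poly Q z = poly ?R (z - y)" by (simp add: poly_pcompose)
  also have "\<dots> = (\<Sum>j\<le>degree ?R. coeff ?R j * (z - y) ^ j)" by (rule poly_altdef)
  also have "\<dots> = (\<Sum>j\<le>n. coeff ?R j * (z - y) ^ j)"
    by (rule sum.mono_neutral_left) (use d in \<open>auto intro: coeff_eq_0\<close>)
  finally show ?thesis .
qed

lemma lead_coeff_taylor:
  fixes Q :: "'a::field poly"
  assumes "degree Q = n" "lead_coeff Q = 1"
  shows "coeff (pcompose Q [:y, 1:]) n = 1"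
  using assms lead_coeff_comp[of "[:y, 1:]" Q] by (simp add: degree_pcompose)

lemma coeff_0_taylor: "coeff (pcompose Q [:y, 1:]) 0 = poly Q y"
  by (simp add: poly_0_coeff_0[symmetric] poly_pcompose)

lemma Re_taylor:
  assumes "degree Q \<le> n"
  shows "Re (poly Q (complex_of_real t)) = (\<Sum>j\<le>n. Re (coeff (pcompose Q [:complex_of_real y, 1:]) j) * (t - y) ^ j)"
proof -
  have "Re (c * (complex_of_real t - complex_of_real y) ^ j) = Re c * (t - y) ^ j" for c j
  proof -
    have "(complex_of_real t - complex_of_real y) ^ j = complex_of_real ((t - y) ^ j)" by simp
    moreover have "Re (c * complex_of_real r) = Re c * r" for r by simp
    ultimately show ?thesis by metis
  qed
  then show ?thesis unfolding poly_taylor[OF assms, of "complex_of_real t" "complex_of_real y"] Re_sum by simp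
qed

lemma poly_shifted_of_real:
  "poly (shifted_poly n (\<lambda>j. complex_of_real (d j)) (complex_of_real y)) (complex_of_real t) = complex_of_real (\<Sum>j\<le>n. d j * (t - y) ^ j)"
  by (simp add: poly_shifted_poly)

text \<open>Passing from powers of \<open>t - y\<close> to powers of its reciprocal reverses the order of the coefficients. This is
  how polynomials in \<open>t\<close> correspond to polynomials in the Moebius image of \<open>t\<close>.\<close>

lemma reversed_power_sum:
  fixes u k :: "'a::field"
  assumes "u \<noteq> 0"
  shows "(\<Sum>j\<le>n. d (n - j) * k ^ (n - j) * u ^ j) = u ^ n * (\<Sum>j\<le>n. d j * (k / u) ^ j)"
  unfolding sum_distrib_left
proof (rule sum.reindex_bij_witness[of _ "\<lambda>j. n - j" "\<lambda>j. n - j"])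
  fix j assume "j \<in> {..n}"
  then have "u ^ n = u ^ j * u ^ (n - j)" by (simp add: power_add[symmetric])
  then show "u ^ n * (d (n - j) * (k / u) ^ (n - j)) = d (n - j) * k ^ (n - j) * u ^ j"
    using assms by (simp add: power_divide)
qed auto

lemma poly_le_sup_norm:
  assumes "compact E" "t \<in> E"
  shows "cmod (poly Q (complex_of_real t)) \<le> poly_sup_norm E Q"
  unfolding poly_sup_norm_def
proof (rule cSUP_upper[OF assms(2)])
  have "continuous_on E (\<lambda>t. cmod (poly Q (complex_of_real t)))" by (intro continuous_intros)
  then have "compact ((\<lambda>t. cmod (poly Q (complex_of_real t))) ` E)" using assms(1) by (rule compact_continuous_image)
  then show "bdd_above ((\<lambda>t. cmod (poly Q (complex_of_real t))) ` E)" by (intro bounded_imp_bdd_above compact_imp_bounded)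
qed

lemma sup_norm_extremal_poly:
  assumes "E \<noteq> {}" "admissible_poly n w P" "\<And>t. t \<in> E \<Longrightarrow> cmod (poly P (complex_of_real t)) \<le> m"
    and lower: "\<And>Q. admissible_poly n w Q \<Longrightarrow> m \<le> poly_sup_norm E Q"
  shows "poly_sup_norm E (extremal_poly E w n) = m"
proof -
  have P: "poly_sup_norm E P \<le> m" unfolding poly_sup_norm_def by (rule cSUP_least) (use assms in auto)
  show ?thesis unfolding extremal_poly_def
  proof (rule arg_minI[of "admissible_poly n w" P "poly_sup_norm E" "\<lambda>R. poly_sup_norm E R = m"])
    show "admissible_poly n w P" by fact
    show "\<not> poly_sup_norm E Q < poly_sup_norm E P" if "admissible_poly n w Q" for Q using lower[OF that] P by linarith
    fix R assume R: "admissible_poly n w R" "\<forall>Q. admissible_poly n w Q \<longrightarrow> \<not> poly_sup_norm E Q < poly_sup_norm E R"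
    have "\<not> poly_sup_norm E P < poly_sup_norm E R" using R(2) assms(2) by blast
    then show "poly_sup_norm E R = m" using lower[OF R(1)] P by linarith
  qed
qed

lemma ex_alternating_extremal:
  assumes "compact X" "infinite X" "\<And>s. s \<in> X \<Longrightarrow> poly (weight_poly r) s \<noteq> 0"
  shows "\<exists>p L. alternating_extremal r X n p L"
proof -
  have c: "continuous_on X (\<lambda>s. \<bar>poly (weight_poly r) s\<bar> ^ n)" by (intro continuous_intros)
  have pos: "0 < \<bar>poly (weight_poly r) s\<bar> ^ n" if "s \<in> X" for s using assms(3)[OF that] by simp
  obtain p L t where p: "degree p = n" "lead_coeff p = 1" "0 < L"
      "\<And>s. s \<in> X \<Longrightarrow> \<bar>poly p s\<bar> \<le> L * \<bar>poly (weight_poly r) s\<bar> ^ n"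
    and t: "increasing_upto n t" "\<And>i. i \<le> n \<Longrightarrow> t i \<in> X"
      "\<And>i. i \<le> n \<Longrightarrow> poly p (t i) = (-1) ^ (n - i) * (L * \<bar>poly (weight_poly r) (t i)\<bar> ^ n)"
    by (rule weighted_chebyshev_alternation[OF assms(1,2) c pos, where n = n]) (assumption, rule that)
  have "\<forall>i\<le>n. t i \<in> X \<and> poly p (t i) = (-1) ^ (n - i) * (L * \<bar>poly (weight_poly r) (t i)\<bar> ^ n)" using t(2,3) by simp
  then have "alternating_extremal r X n p L" unfolding alternating_extremal_def using p t(1)
    by (intro conjI exI[of _ t] ballI) assumption+
  then show ?thesis by blast
qed

text \<open>If \<open>s - s0 = k / (t - y)\<close>, then \<open>p(s) / (s - s0) ^ n\<close> is a polynomial of degree at most \<open>n\<close> in \<open>t\<close>, and its value at \<open>y\<close> is the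
  leading coefficient of \<open>p\<close> in powers of \<open>s - s0\<close>. The real part of any competitor arises in this way, and
  \<open>alternation_minimal\<close> bounds it from below.\<close>

theorem sup_norm_residual:
  assumes E: "compact E" "E \<noteq> {}" "y \<notin> E" and k: "k \<noteq> 0"
    and M: "\<And>t. t \<in> E \<Longrightarrow> M t - s0 = k / (t - y)"
    and ext: "alternating_extremal (Some s0) (M ` E) n p L"
  shows "poly_sup_norm E (extremal_poly E (Some y) n) = L"
proof -
  have w: "poly (weight_poly (Some s0)) s = s - s0" for s by (simp add: weight_poly_def)
  note e = ext[unfolded alternating_extremal_def w]
  have deg: "degree p = n" and lead: "lead_coeff p = 1" and bd: "\<And>t. t \<in> E \<Longrightarrow> \<bar>poly p (M t)\<bar> \<le> L * \<bar>M t - s0\<bar> ^ n"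
    using e by blast+
  obtain T where T: "increasing_upto n T" "\<And>i. i \<le> n \<Longrightarrow> T i \<in> M ` E"
    "\<And>i. i \<le> n \<Longrightarrow> poly p (T i) = (-1) ^ (n - i) * (L * \<bar>T i - s0\<bar> ^ n)" using e by blast
  have ty: "t - y \<noteq> 0" if "t \<in> E" for t using that E(3) by auto
  have v0: "M t - s0 \<noteq> 0" if "t \<in> E" for t using M[OF that] ty[OF that] k by simp
  define d where "d = coeff (pcompose p [:s0, 1:])"
  define P where "P = shifted_poly n (\<lambda>j. complex_of_real (d (n - j) * k ^ (n - j) / k ^ n)) (complex_of_real y)"
  show ?thesis
  proof (rule sup_norm_extremal_poly[OF E(2), of n _ P])
    have "d n = 1" unfolding d_def by (rule lead_coeff_taylor[OF deg lead])
    then show "admissible_poly n (Some y) P"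
      using k by (simp add: admissible_poly_def P_def degree_shifted_poly poly_shifted_poly_center)
    show "cmod (poly P (complex_of_real t)) \<le> L" if t: "t \<in> E" for t
    proof -
      have "(\<Sum>j\<le>n. d (n - j) * k ^ (n - j) / k ^ n * (t - y) ^ j) = (\<Sum>j\<le>n. d (n - j) * k ^ (n - j) * (t - y) ^ j) / k ^ n"
        by (simp add: sum_divide_distrib)
      also have "\<dots> = (t - y) ^ n * (\<Sum>j\<le>n. d j * (M t - s0) ^ j) / k ^ n"
        unfolding reversed_power_sum[OF ty[OF t]] M[OF t] ..
      also have "(\<Sum>j\<le>n. d j * (M t - s0) ^ j) = poly p (M t)"
        unfolding d_def by (rule poly_taylor[symmetric]) (simp add: deg)
      also have "(t - y) ^ n * poly p (M t) / k ^ n = poly p (M t) / (M t - s0) ^ n"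
        unfolding M[OF t] by (simp add: power_divide)
      finally have "poly P (complex_of_real t) = complex_of_real (poly p (M t) / (M t - s0) ^ n)"
        unfolding P_def poly_shifted_of_real by (rule arg_cong)
      then have "cmod (poly P (complex_of_real t)) = \<bar>poly p (M t)\<bar> / \<bar>M t - s0\<bar> ^ n"
        by (simp only: norm_of_real abs_divide power_abs)
      also have "\<dots> \<le> L" using bd[OF t] v0[OF t] by (subst pos_divide_le_eq) auto
      finally show ?thesis .
    qed
    fix Q assume "admissible_poly n (Some y) Q"
    then have Q: "degree Q \<le> n" "poly Q (complex_of_real y) = 1" by (auto simp: admissible_poly_def)
    define c where "c j = Re (coeff (pcompose Q [:complex_of_real y, 1:]) j)" for j
    define q where "q = shifted_poly n (\<lambda>j. c (n - j) * k ^ (n - j)) s0"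
    have qM: "poly q (M t) = (M t - s0) ^ n * Re (poly Q (complex_of_real t))" if t: "t \<in> E" for t
    proof -
      have "k / (M t - s0) = t - y" using M[OF t] ty[OF t] k by simp
      moreover have "poly q (M t) = (M t - s0) ^ n * (\<Sum>j\<le>n. c j * (k / (M t - s0)) ^ j)"
        unfolding q_def poly_shifted_poly by (rule reversed_power_sum[OF v0[OF t]])
      ultimately show ?thesis unfolding Re_taylor[OF Q(1), of t y] c_def by simp
    qed
    show "L \<le> poly_sup_norm E Q"
    proof (rule alternation_minimal[OF T(1) _ _ T(3)])
      show "degree p \<le> n" "coeff p n = 1" using deg lead by auto
      show "0 < \<bar>T i - s0\<bar> ^ n" if i: "i \<le> n" for i
      proof -
        obtain t where "t \<in> E" "T i = M t" using T(2)[OF i] by blast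
        then show ?thesis using v0[of t] by simp
      qed
      show "degree q \<le> n" unfolding q_def by (rule degree_shifted_poly)
      show "coeff q n = 1" using Q(2) by (simp add: q_def coeff_shifted_poly c_def coeff_0_taylor)
      fix i assume "i \<le> n"
      then obtain t where t: "t \<in> E" "T i = M t" using T(2) by blast
      have "\<bar>Re (poly Q (complex_of_real t))\<bar> \<le> poly_sup_norm E Q"
        using abs_Re_le_cmod poly_le_sup_norm[OF E(1) t(1)] order_trans by blast
      then show "\<bar>poly q (T i)\<bar> \<le> poly_sup_norm E Q * \<bar>T i - s0\<bar> ^ n"
        unfolding t(2) qM[OF t(1)] abs_mult power_abs mult.commute[of "\<bar>M t - s0\<bar> ^ n"] by (rule mult_right_mono) simp
    qed
  qed
qed

text \<open>An affine substitution; taking real parts of the Taylor coefficients of a competitor does not increase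
  its values on the real line.\<close>

theorem sup_norm_chebyshev:
  assumes E: "compact E" "E \<noteq> {}" and H: "0 < H"
    and M: "\<And>t. t \<in> E \<Longrightarrow> M t = (t - c) / H"
    and ext: "alternating_extremal None (M ` E) n p L"
  shows "poly_sup_norm E (extremal_poly E None n) = H ^ n * L"
proof -
  have w: "\<bar>poly (weight_poly None) s\<bar> ^ n = 1" for s :: real by (simp add: weight_poly_def)
  note e = ext[unfolded alternating_extremal_def w mult_1_right]
  have deg: "degree p = n" and lead: "lead_coeff p = 1" and bd: "\<And>t. t \<in> E \<Longrightarrow> \<bar>poly p (M t)\<bar> \<le> L"
    using e by blast+
  obtain T where T: "increasing_upto n T" "\<And>i. i \<le> n \<Longrightarrow> T i \<in> M ` E"
    "\<And>i. i \<le> n \<Longrightarrow> poly p (T i) = (-1) ^ (n - i) * L" using e by blast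
  define d where "d = coeff (pcompose p [:0, 1:])"
  define P where "P = shifted_poly n (\<lambda>j. complex_of_real (d j * H ^ n / H ^ j)) (complex_of_real c)"
  show ?thesis
  proof (rule sup_norm_extremal_poly[OF E(2), of n _ P])
    have "d n = 1" unfolding d_def by (rule lead_coeff_taylor[OF deg lead])
    then have cP: "coeff P n = 1" using H by (simp add: P_def coeff_shifted_poly)
    then have "degree P = n" using degree_shifted_poly[of n _ "complex_of_real c"] le_degree[of P n]
      by (simp add: P_def antisym)
    then show "admissible_poly n None P" using cP by (simp add: admissible_poly_def)
    show "cmod (poly P (complex_of_real t)) \<le> H ^ n * L" if t: "t \<in> E" for t
    proof -
      have "(\<Sum>j\<le>n. d j * H ^ n / H ^ j * (t - c) ^ j) = H ^ n * (\<Sum>j\<le>n. d j * (M t - 0) ^ j)"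
        unfolding sum_distrib_left M[OF t] by (intro sum.cong) (auto simp: power_divide)
      also have "(\<Sum>j\<le>n. d j * (M t - 0) ^ j) = poly p (M t)"
        unfolding d_def by (rule poly_taylor[symmetric]) (simp add: deg)
      finally have "poly P (complex_of_real t) = complex_of_real (H ^ n * poly p (M t))"
        unfolding P_def poly_shifted_of_real by (rule arg_cong)
      then have "cmod (poly P (complex_of_real t)) = H ^ n * \<bar>poly p (M t)\<bar>"
        using H by (simp only: norm_of_real abs_mult power_abs abs_of_pos)
      also have "\<dots> \<le> H ^ n * L" using bd[OF t] H by (intro mult_left_mono) auto
      finally show ?thesis .
    qed
    fix Q assume "admissible_poly n None Q"
    then have Q: "degree Q = n" "lead_coeff Q = 1" by (auto simp: admissible_poly_def)
    define \<beta> where "\<beta> j = Re (coeff (pcompose Q [:complex_of_real c, 1:]) j)" for j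
    define q where "q = shifted_poly n (\<lambda>j. \<beta> j * H ^ j / H ^ n) 0"
    have qM: "poly q (M t) = Re (poly Q (complex_of_real t)) / H ^ n" if t: "t \<in> E" for t
    proof -
      have "\<beta> j * H ^ j / H ^ n * (M t - 0) ^ j = \<beta> j * (t - c) ^ j / H ^ n" for j
        using H by (simp add: M[OF t] power_divide)
      then have "poly q (M t) = (\<Sum>j\<le>n. \<beta> j * (t - c) ^ j) / H ^ n"
        unfolding q_def poly_shifted_poly sum_divide_distrib by (intro sum.cong) auto
      then show ?thesis using Re_taylor[of Q n t c] Q(1) by (simp add: \<beta>_def)
    qed
    have "L \<le> poly_sup_norm E Q / H ^ n"
    proof (rule alternation_minimal[OF T(1), where \<kappa> = "\<lambda>_. 1" and p = p and q = q])
      show "degree p \<le> n" "coeff p n = 1" using deg lead by auto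
      show "poly p (T i) = (-1) ^ (n - i) * (L * 1)" if "i \<le> n" for i using T(3)[OF that] by simp
      show "degree q \<le> n" unfolding q_def by (rule degree_shifted_poly)
      show "coeff q n = 1" using H lead_coeff_taylor[OF Q, of "complex_of_real c"] by (simp add: q_def coeff_shifted_poly \<beta>_def)
      fix i assume "i \<le> n"
      then obtain t where t: "t \<in> E" "T i = M t" using T(2) by blast
      have "\<bar>Re (poly Q (complex_of_real t))\<bar> \<le> poly_sup_norm E Q"
        using abs_Re_le_cmod poly_le_sup_norm[OF E(1) t(1)] order_trans by blast
      then show "\<bar>poly q (T i)\<bar> \<le> poly_sup_norm E Q / H ^ n * 1"
        unfolding t(2) qM[OF t(1)] using H by (simp add: abs_divide divide_right_mono)
    qed simp
    then show "H ^ n * L \<le> poly_sup_norm E Q" using H by (simp add: le_divide_eq mult.commute)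
  qed
qed

lemma bounded_iff_limit_finite:
  fixes f :: "nat \<Rightarrow> real"
  assumes lim: "(\<lambda>n. ereal (f n)) \<longlonglongrightarrow> 2 * exp_ereal I" and I: "0 \<le> I"
  shows "bounded (f ` {1..}) \<longleftrightarrow> I \<noteq> \<infinity>"
proof
  assume "bounded (f ` {1..})"
  then obtain B where B: "\<And>n. 1 \<le> n \<Longrightarrow> \<bar>f n\<bar> \<le> B" unfolding bounded_real by auto
  show "I \<noteq> \<infinity>"
  proof
    assume "I = \<infinity>"
    moreover have "exp_ereal \<infinity> = \<infinity>" by (metis PInfty_eq_infinity exp_ereal.simps(2))
    ultimately have "(\<lambda>n. ereal (f n)) \<longlonglongrightarrow> \<infinity>" using lim by simp
    then obtain N where N: "\<And>n. N \<le> n \<Longrightarrow> ereal (B + 1) \<le> ereal (f n)" unfolding Lim_PInfty by blast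
    show False using N[of "max N 1"] B[of "max N 1"] by simp
  qed
next
  assume "I \<noteq> \<infinity>"
  then obtain r where "I = ereal r" using I by (cases I) auto
  then have "(\<lambda>n. ereal (f n)) \<longlonglongrightarrow> ereal (2 * exp r)" using lim by simp
  then have "f \<longlonglongrightarrow> 2 * exp r" by (simp only: lim_ereal)
  then have "bounded (range f)" by (rule convergent_imp_bounded)
  then show "bounded (f ` {1..})" by (rule bounded_subset) auto
qed

lemma infsum_ereal_finite_iff_summable:
  fixes g :: "nat \<Rightarrow> real"
  assumes g: "\<And>k. 0 \<le> g k"
  shows "(\<Sum>\<^sub>\<infinity>k\<in>UNIV. ereal (g k)) \<noteq> \<infinity> \<longleftrightarrow> summable g"
proof -
  have eq: "(\<Sum>\<^sub>\<infinity>k\<in>UNIV. ereal (g k)) = (SUP F\<in>{F. finite F \<and> F \<subseteq> UNIV}. (\<Sum>k\<in>F. ereal (g k)))"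
    by (rule nonneg_infsum_complete) (simp add: g)
  have le: "ereal (sum g F) \<le> (\<Sum>\<^sub>\<infinity>k\<in>UNIV. ereal (g k))" if "finite F" for F
    unfolding eq using that by (intro SUP_upper2[of F]) auto
  show ?thesis
  proof
    assume fin: "(\<Sum>\<^sub>\<infinity>k\<in>UNIV. ereal (g k)) \<noteq> \<infinity>"
    then obtain r where r: "(\<Sum>\<^sub>\<infinity>k\<in>UNIV. ereal (g k)) = ereal r" using le[of "{}"] by (cases "\<Sum>\<^sub>\<infinity>k\<in>UNIV. ereal (g k)") auto
    show "summable g"
      by (rule summableI_nonneg_bounded[OF g, where x = r]) (use le[of "{..<_}"] in \<open>simp add: r\<close>)
  next
    assume "summable g"
    then have "(\<Sum>\<^sub>\<infinity>k\<in>UNIV. ereal (g k)) \<le> ereal (suminf g)"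
      unfolding eq using g by (intro SUP_least) (auto intro!: sum_le_suminf)
    then show "(\<Sum>\<^sub>\<infinity>k\<in>UNIV. ereal (g k)) \<noteq> \<infinity>" by auto
  qed
qed

lemma summable_iff_comparable:
  fixes f g :: "nat \<Rightarrow> real"
  assumes "\<And>k. 0 \<le> f k" "\<And>k. 0 \<le> g k" "\<And>k. f k \<le> A * g k" "\<And>k. g k \<le> B * f k"
  shows "summable f \<longleftrightarrow> summable g"
proof
  assume "summable f"
  then have "summable (\<lambda>k. B * f k)" by (rule summable_mult)
  then show "summable g" by (rule summable_comparison_test') (use assms in auto)
next
  assume "summable g"
  then have "summable (\<lambda>k. A * g k)" by (rule summable_mult)
  then show "summable f" by (rule summable_comparison_test') (use assms in auto)
qed

text \<open>Outside an interval the nearest point is an end point.\<close>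

lemma infdist_Icc:
  fixes a b t :: real
  assumes "a \<le> b"
  shows "b \<le> t \<Longrightarrow> infdist t {a..b} = t - b" "t \<le> a \<Longrightarrow> infdist t {a..b} = a - t"
proof -
  have ne: "{a..b} \<noteq> {}" using assms by simp
  show "infdist t {a..b} = t - b" if "b \<le> t"
    unfolding infdist_notempty[OF ne]
  proof (rule cInf_eq_minimum)
    show "t - b \<in> dist t ` {a..b}" using assms that by (intro image_eqI[of _ _ b]) (auto simp: dist_real_def)
  qed (use that in \<open>auto simp: dist_real_def\<close>)
  show "infdist t {a..b} = a - t" if "t \<le> a"
    unfolding infdist_notempty[OF ne]
  proof (rule cInf_eq_minimum)
    show "a - t \<in> dist t ` {a..b}" using assms that by (intro image_eqI[of _ _ a]) (auto simp: dist_real_def)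
  qed (use that in \<open>auto simp: dist_real_def\<close>)
qed

text \<open>With \<open>v = cosh g\<close> the root is \<open>sinh g\<close>, and \<open>g \<le> sinh g \<le> g * exp g\<close>.\<close>

lemma arcosh_sqrt_bounds:
  fixes v :: real
  assumes "1 \<le> v" "v \<le> K"
  shows "arcosh v \<le> sqrt (v\<^sup>2 - 1)" "sqrt (v\<^sup>2 - 1) \<le> 2 * K * arcosh v"
proof -
  define g where "g = arcosh v"
  have g: "0 \<le> g" "cosh g = v" using assms by (auto simp: g_def)
  have "(sinh g)\<^sup>2 = v\<^sup>2 - 1" using cosh_square_eq[of g] g(2) by simp
  then have s: "sinh g = sqrt (v\<^sup>2 - 1)" using g(1) by (metis real_sqrt_unique sinh_real_nonneg_iff)
  have "g \<le> (exp g - inverse (exp g)) / 2" using g(1) by (rule real_le_x_sinh)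
  then show "arcosh v \<le> sqrt (v\<^sup>2 - 1)" unfolding s[symmetric] g_def[symmetric] by (simp add: sinh_field_def exp_minus)
  have "exp g / 2 \<le> cosh g" by (rule cosh_exp_bounds)
  then have e: "exp g \<le> 2 * v" using g(2) by simp
  have "1 + - (2 * g) \<le> exp (- (2 * g))" by (rule exp_ge_add_one_self)
  then have h: "1 - exp (- (2 * g)) \<le> 2 * g" by (simp only: diff_le_eq)
  have "sinh g = exp g * (1 - exp (- (2 * g))) / 2"
    by (simp add: sinh_field_def right_diff_distrib exp_add[symmetric])
  also have "\<dots> \<le> exp g * (2 * g) / 2" using h by (intro divide_right_mono mult_left_mono) auto
  also have "\<dots> = exp g * g" by simp
  also have "\<dots> \<le> (2 * K) * g" using e assms(2) g(1) by (intro mult_right_mono) auto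
  finally show "sqrt (v\<^sup>2 - 1) \<le> 2 * K * arcosh v" unfolding s[symmetric] g_def[symmetric] .
qed

section \<open>Limit of the Widom factors\<close>

lemma pole_map_real_Some:
  assumes "a < b"
  shows "pole_map_real a b (Some y) t - (2 * y - (a + b)) / (b - a) = 2 * (a - y) * (b - y) / (b - a) / (t - y)"
  using assms by (simp add: pole_map_real_def diff_divide_distrib add_divide_distrib)

text \<open>The zero of the weight: the image of infinity under \<open>pole_map\<close> and, at the same time, the image of the finite
  pole under the affine map of \<open>[a, b]\<close> onto \<open>[-1, 1]\<close>.\<close>

definition mapped_pole :: "real \<Rightarrow> real \<Rightarrow> real option \<Rightarrow> real option" where
  "mapped_pole a b w = map_option (\<lambda>y. (2 * y - (a + b)) / (b - a)) w"

text \<open>The product of the distances to the end points is what ties the Green function at a point outside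
  the interval to the square root of the distance.\<close>

lemma pole_map_real_square:
  assumes ab: "a < b" and t: "w \<noteq> Some t"
  shows "(pole_map_real a b w t)\<^sup>2 - 1 =
     (case w of None \<Rightarrow> 1 | Some y \<Rightarrow> (a - y) * (b - y) / (t - y)\<^sup>2) * (4 / (b - a)\<^sup>2) * ((t - a) * (t - b))"
proof (cases w)
  case None
  have "(2 * t - (a + b))\<^sup>2 = 4 * ((t - a) * (t - b)) + (b - a)\<^sup>2" by (simp add: power2_eq_square algebra_simps)
  then show ?thesis using None ab by (simp add: pole_map_real_def power_divide add_divide_distrib)
next
  case (Some y)
  define u where "u = t - y"
  define \<alpha> where "\<alpha> = a - y"
  define \<beta> where "\<beta> = b - y"
  have u: "u \<noteq> 0" using t Some by (auto simp: u_def)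
  have \<beta>\<alpha>: "\<beta> - \<alpha> \<noteq> 0" using ab by (simp add: \<alpha>_def \<beta>_def)
  have e: "t - a = u - \<alpha>" "t - b = u - \<beta>" "b - a = \<beta> - \<alpha>" "a + b - 2 * y = \<alpha> + \<beta>" by (auto simp: u_def \<alpha>_def \<beta>_def)
  have "((2 * \<alpha> * \<beta> / u - (\<alpha> + \<beta>)) / (\<beta> - \<alpha>))\<^sup>2 - 1 = ((2 * \<alpha> * \<beta> - (\<alpha> + \<beta>) * u)\<^sup>2 - (u * (\<beta> - \<alpha>))\<^sup>2) / (u * (\<beta> - \<alpha>))\<^sup>2"
  proof -
    have "(2 * \<alpha> * \<beta> / u - (\<alpha> + \<beta>)) / (\<beta> - \<alpha>) = (2 * \<alpha> * \<beta> - (\<alpha> + \<beta>) * u) / (u * (\<beta> - \<alpha>))"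
    proof -
      have "(X / u - q) / k = (X - q * u) / (u * k)" for X q k :: real using u by (simp add: diff_divide_distrib)
      then show ?thesis .
    qed
    moreover have "(A / v)\<^sup>2 - 1 = (A\<^sup>2 - v\<^sup>2) / v\<^sup>2" if "v \<noteq> 0" for A v :: real
      using that by (simp add: power_divide diff_divide_distrib)
    ultimately show ?thesis using u \<beta>\<alpha> by (metis mult_eq_0_iff)
  qed
  also have "(2 * \<alpha> * \<beta> - (\<alpha> + \<beta>) * u)\<^sup>2 - (u * (\<beta> - \<alpha>))\<^sup>2 = \<alpha> * \<beta> * 4 * ((u - \<alpha>) * (u - \<beta>))"
    by (simp add: power2_eq_square algebra_simps)
  also have "\<alpha> * \<beta> * 4 * ((u - \<alpha>) * (u - \<beta>)) / (u * (\<beta> - \<alpha>))\<^sup>2 = \<alpha> * \<beta> / u\<^sup>2 * (4 / (\<beta> - \<alpha>)\<^sup>2) * ((u - \<alpha>) * (u - \<beta>))"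
    by (simp add: power_mult_distrib)
  finally show ?thesis using Some unfolding pole_map_real_def by (simp only: option.case e u_def[symmetric] \<alpha>_def[symmetric] \<beta>_def[symmetric])
qed

context interval_with_points begin

abbreviation "M \<equiv> pole_map_real a b w"

lemma E_nonempty: "E \<noteq> {}"
  using E_interval ab by fastforce

lemma pole_off_E: "t \<in> E \<Longrightarrow> w = Some y \<Longrightarrow> t - y \<noteq> 0"
  using pole_outside(2) by auto

lemma pole_off_endpoints: "w = Some y \<Longrightarrow> a \<noteq> y \<and> b \<noteq> y"
  using pole_outside(1) ab by auto

lemma continuous_on_M: "continuous_on E M"
  unfolding pole_map_real_def[abs_def] using ab pole_off_E
  by (cases w) (auto intro!: continuous_intros)

lemma compact_M_image: "compact (M ` E)"
  by (rule compact_continuous_image[OF continuous_on_M E_compact])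

lemma inj_on_M: "inj_on M E"
proof (rule inj_onI)
  fix s t assume st: "s \<in> E" "t \<in> E" "M s = M t"
  show "s = t"
  proof (cases w)
    case None
    then show ?thesis using st(3) ab by (simp add: pole_map_real_def)
  next
    case (Some y)
    have "2 * (a - y) * (b - y) / (b - a) \<noteq> 0" using pole_off_endpoints[OF Some] ab by simp
    moreover have "2 * (a - y) * (b - y) / (b - a) / (s - y) = 2 * (a - y) * (b - y) / (b - a) / (t - y)"
      using st(3) unfolding Some pole_map_real_Some[OF ab, symmetric] by simp
    ultimately have "s - y = t - y" using pole_off_E[OF st(1) Some] pole_off_E[OF st(2) Some]
      by (metis divide_cancel_left)
    then show ?thesis by simp
  qed
qed

lemma M_endpoints: "{M a, M b} = {-1, 1}"
proof (cases w)
  case None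
  have "M a = -1" "M b = 1" using None ab by (auto simp: pole_map_real_def divide_eq_eq eq_divide_eq)
  then show ?thesis by simp
next
  case (Some y)
  have n: "a - y \<noteq> 0" "b - y \<noteq> 0" using pole_outside(1)[OF Some] ab by auto
  have c1: "2 * p * q / p = 2 * q" if "p \<noteq> 0" for p q :: real using that by simp
  have c2: "2 * p * q / q = 2 * p" if "q \<noteq> 0" for p q :: real using that by simp
  have "M a = (2 * (b - y) - (a + b - 2 * y)) / (b - a)" "M b = (2 * (a - y) - (a + b - 2 * y)) / (b - a)"
    unfolding Some pole_map_real_def option.case c1[OF n(1)] c2[OF n(2)] by (rule refl)+
  then have "M a = 1" "M b = -1" using ab by (auto simp: divide_eq_eq)
  then show ?thesis by auto
qed

lemma unit_interval_subset: "{-1..1} \<subseteq> M ` E"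
proof -
  have "connected (M ` {a..b})"
    by (rule connected_continuous_image[OF continuous_on_subset[OF continuous_on_M E_interval]]) simp
  moreover have "{M a, M b} \<subseteq> M ` {a..b}" using ab by auto
  then have "-1 \<in> M ` {a..b}" "1 \<in> M ` {a..b}" unfolding M_endpoints by auto
  ultimately have "{-1..1} \<subseteq> M ` {a..b}" by (rule connected_contains_Icc)
  then show ?thesis using E_interval by blast
qed

lemma M_image_outside: "M ` E - {-1..1} = M ` (E - {a..b})"
proof -
  have "M t \<in> {-1..1} \<longleftrightarrow> t \<in> {a..b}" if "t \<in> E" for t
  proof
    assume "M t \<in> {-1..1}"
    then have "\<not> 1 < \<bar>M t\<bar>" by (auto simp: abs_if)
    then show "t \<in> {a..b}" using pole_map_real_outside[where w = w and t = t, OF ab pole_outside(1)] w_notin that by blast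
  qed (rule pole_map_real_interval[OF ab pole_outside(1)])
  then show ?thesis by blast
qed

lemma mapped_weight_nonzero:
  assumes "s \<in> M ` E"
  shows "poly (weight_poly (mapped_pole a b w)) s \<noteq> 0"
proof (cases w)
  case (Some y)
  obtain t where t: "t \<in> E" "s = M t" using assms by blast
  have "s - (2 * y - (a + b)) / (b - a) \<noteq> 0"
    unfolding t(2) unfolding Some pole_map_real_Some[OF ab]
    using pole_off_endpoints[OF Some] pole_off_E[OF t(1) Some] ab by simp
  then show ?thesis using Some by (simp add: weight_poly_def mapped_pole_def)
qed (simp add: weight_poly_def mapped_pole_def)

lemma Cap_at_eq:
  assumes "y \<notin> E"
  shows "Cap_at E y = exp (- green_slit (complex_of_real ((2 * y - (a + b)) / (b - a))))"
proof -
  interpret unweighted: interval_with_points a b E None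
    by standard (use ab E_compact E_interval E_countable in auto)
  have "complex_of_real y \<in> - complex_of_real ` unweighted.E'" using assms by (auto simp: unweighted.E'_def)
  from unweighted.green_outside_eq[OF this]
  have "green E None (Some (complex_of_real y)) = ereal (green_slit (complex_of_real (pole_map_real a b None y)))"
    by (simp add: unweighted.G_real)
  then show ?thesis by (simp add: Cap_at_def pole_map_real_def)
qed

lemma widom_factor_eq:
  assumes "alternating_extremal (mapped_pole a b w) (M ` E) n p L"
  shows "widom_factor E w n = L * widom_scale (mapped_pole a b w) n"
proof (cases w)
  case None
  define H where "H = (b - a) / 2"
  have H: "0 < H" using ab by (simp add: H_def)
  have "poly_sup_norm E (extremal_poly E None n) = H ^ n * L"
  proof (rule sup_norm_chebyshev[OF E_compact E_nonempty H, of M "(a + b) / 2"])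
    show "M t = (t - (a + b) / 2) / H" if "t \<in> E" for t
      using ab None by (simp add: pole_map_real_def H_def field_simps)
    show "alternating_extremal None (M ` E) n p L" using assms None by (simp add: mapped_pole_def)
  qed
  moreover have "Cap E = H / 2"
    using Cap_interval_countable[OF ab _ E_countable E_compact] E_interval by (simp add: H_def Un_absorb1)
  ultimately have "widom_factor E None n = H ^ n * L / (H / 2) ^ n" by (simp only: widom_factor_def option.case)
  then show ?thesis using None H by (simp add: widom_scale_def mapped_pole_def power_divide)
next
  case (Some y)
  define s0 where "s0 = (2 * y - (a + b)) / (b - a)"
  define g where "g = green_slit (complex_of_real s0)"
  have y: "y \<notin> E" by (rule pole_outside(2)[OF Some])
  have "poly_sup_norm E (extremal_poly E (Some y) n) = L"
  proof (rule sup_norm_residual[OF E_compact E_nonempty y, of "2 * (a - y) * (b - y) / (b - a)" M s0])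
    show "2 * (a - y) * (b - y) / (b - a) \<noteq> 0" using pole_off_endpoints[OF Some] ab by simp
    show "M t - s0 = 2 * (a - y) * (b - y) / (b - a) / (t - y)" for t
      unfolding Some s0_def by (rule pole_map_real_Some[OF ab])
    show "alternating_extremal (Some s0) (M ` E) n p L" using assms Some by (simp add: mapped_pole_def s0_def)
  qed
  moreover have "Cap_at E y ^ n + inverse (Cap_at E y) ^ n = 2 * cosh (n * g)"
    unfolding Cap_at_eq[OF y] s0_def[symmetric] g_def[symmetric]
    by (simp add: exp_minus[symmetric] exp_of_nat_mult[symmetric] cosh_field_def)
  ultimately show ?thesis using Some
    by (simp add: widom_factor_def widom_scale_def mapped_pole_def s0_def[symmetric] g_def[symmetric])
qed

theorem widom_factor_limit:
  "(\<lambda>n. ereal (widom_factor E w n)) \<longlonglongrightarrow> 2 * exp_ereal (irregularity_coeff E w)"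
proof -
  have inf: "infinite (M ` E)" using infinite_super[OF unit_interval_subset] by simp
  have "\<exists>L. \<exists>p. alternating_extremal (mapped_pole a b w) (M ` E) n p L" for n
    using ex_alternating_extremal[OF compact_M_image inf mapped_weight_nonzero] by blast
  then obtain L where L: "\<And>n. \<exists>p. alternating_extremal (mapped_pole a b w) (M ` E) n p (L n)" by metis
  have eq: "widom_factor E w n = L n * widom_scale (mapped_pole a b w) n" for n
    using L[of n] widom_factor_eq by blast
  have "(\<Sum>\<^sub>\<infinity>s\<in>M ` E - {-1..1}. ereal (green_slit (complex_of_real s))) = irregularity_coeff E w"
    unfolding M_image_outside irregularity_coeff_eq
    by (subst infsum_reindex[OF inj_on_subset[OF inj_on_M]]) (auto simp: o_def G_real)
  then show ?thesis
    using normalized_widom_limit[OF unit_interval_subset mapped_weight_nonzero L] unfolding eq by simp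
qed

text \<open>On the compact set \<open>E\<close> the quotient of \<open>M t ^ 2 - 1\<close> by the distance is the function \<open>f\<close> below, which is
  continuous and positive, hence bounded from both sides.\<close>

lemma G_comparable_sqrt_dist:
  "\<exists>A B. \<forall>t\<in>E - {a..b}. G (complex_of_real t) \<le> A * sqrt (infdist t {a..b}) \<and> sqrt (infdist t {a..b}) \<le> B * G (complex_of_real t)"
proof -
  let ?d = "\<lambda>t. infdist t {a..b}"
  define f where "f t = (case w of None \<Rightarrow> 1 | Some y \<Rightarrow> (a - y) * (b - y) / (t - y)\<^sup>2) * (4 / (b - a)\<^sup>2) * (?d t + (b - a))" for t
  have fpos: "0 < f t" if "t \<in> E" for t
  proof -
    have "0 < (case w of None \<Rightarrow> 1 | Some y \<Rightarrow> (a - y) * (b - y) / (t - y)\<^sup>2)"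
      using pole_outside_product_pos[OF ab pole_outside(1)] pole_off_E[OF that] by (cases w) auto
    then show ?thesis unfolding f_def using ab infdist_nonneg[of t "{a..b}"] by (intro mult_pos_pos) auto
  qed
  have "continuous_on E f"
    unfolding f_def using pole_off_E ab by (cases w) (auto intro!: continuous_intros)
  then obtain t1 t2 where t1: "t1 \<in> E" "\<And>t. t \<in> E \<Longrightarrow> f t1 \<le> f t" and t2: "t2 \<in> E" "\<And>t. t \<in> E \<Longrightarrow> f t \<le> f t2"
    using continuous_attains_inf[OF E_compact E_nonempty] continuous_attains_sup[OF E_compact E_nonempty] by metis
  have "continuous_on E (\<lambda>t. \<bar>M t\<bar>)" by (intro continuous_intros continuous_on_M)
  then obtain t3 where t3: "\<And>t. t \<in> E \<Longrightarrow> \<bar>M t\<bar> \<le> \<bar>M t3\<bar>"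
    using continuous_attains_sup[OF E_compact E_nonempty] by metis
  define K where "K = \<bar>M t3\<bar>"
  have "G (complex_of_real t) \<le> sqrt (f t2) * sqrt (?d t) \<and> sqrt (?d t) \<le> (2 * K / sqrt (f t1)) * G (complex_of_real t)"
    if t: "t \<in> E - {a..b}" for t
  proof -
    have wt: "w \<noteq> Some t" using w_notin t by blast
    have "1 < \<bar>M t\<bar>" using pole_map_real_outside[where w = w and t = t, OF ab pole_outside(1)] wt t by blast
    then have M1: "1 \<le> \<bar>M t\<bar>" "\<bar>M t\<bar> \<le> K" using t3[of t] t by (auto simp: K_def)
    have G: "G (complex_of_real t) = arcosh \<bar>M t\<bar>" using M1(1) by (simp add: G_real green_slit_real max_absorb2)
    have "(t - a) * (t - b) = (?d t + (b - a)) * ?d t"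
    proof (cases "b \<le> t")
      case True
      then show ?thesis using ab by (simp add: infdist_Icc)
    next
      case False
      then show ?thesis using ab t by (simp add: infdist_Icc algebra_simps)
    qed
    then have sq: "\<bar>M t\<bar>\<^sup>2 - 1 = f t * ?d t"
      unfolding power2_abs f_def by (subst pole_map_real_square[OF ab wt]) auto
    note b = arcosh_sqrt_bounds[OF M1, unfolded G[symmetric] sq real_sqrt_mult]
    have "sqrt (f t) * sqrt (?d t) \<le> sqrt (f t2) * sqrt (?d t)"
      using t2(2)[of t] t by (intro mult_right_mono) (auto simp: infdist_nonneg)
    moreover have "sqrt (f t1) * sqrt (?d t) \<le> sqrt (f t) * sqrt (?d t)"
      using t1(2)[of t] t by (intro mult_right_mono) (auto simp: infdist_nonneg)
    moreover have "0 < sqrt (f t1)" using fpos[OF t1(1)] by simp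
    ultimately show ?thesis using b by (simp add: le_divide_eq mult.commute mult.left_commute)
  qed
  then show ?thesis by blast
qed

end

theorem theorem5p4:
  fixes a b :: real and E :: "real set" and x :: "nat \<Rightarrow> real" and w :: "real option"
  assumes "a < b"
    and "E = {a..b} \<union> x ` {1..}"
    and "compact E"
    and "\<forall>k\<ge>1. x k \<notin> {a..b}"
    and "inj_on x {1..}"
    and "w \<notin> Some ` E"
  shows "(bounded (widom_factor E w ` {1..}) \<longleftrightarrow>
            summable (\<lambda>k. infdist (x (Suc k)) {a..b} powr (1/2)))
       \<and> (\<lambda>n. ereal (widom_factor E w n))
            \<longlonglongrightarrow> 2 * exp_ereal (irregularity_coeff E w)"
proof -
  have points: "E - {a..b} = x ` {1..}" using assms(2,4) by auto
  interpret interval_with_points a b E w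
    by standard (use assms points in auto)
  have x_in: "x (Suc k) \<in> E - {a..b}" for k unfolding points by simp
  define g where "g k = G (complex_of_real (x (Suc k)))" for k
  have g0: "0 \<le> g k" for k by (simp add: g_def G_nonneg)
  have range: "E - {a..b} = (\<lambda>k. x (Suc k)) ` UNIV"
    unfolding points by (auto simp: image_iff Bex_def) (metis Suc_le_D One_nat_def)
  have inj: "inj (\<lambda>k. x (Suc k))"
    using assms(5) by (auto simp: inj_on_def)
  have IR: "irregularity_coeff E w = (\<Sum>\<^sub>\<infinity>k\<in>UNIV. ereal (g k))"
    unfolding irregularity_coeff_eq range infsum_reindex[OF inj] by (simp add: o_def g_def)
  obtain A B where AB: "\<And>t. t \<in> E - {a..b} \<Longrightarrow> G (complex_of_real t) \<le> A * sqrt (infdist t {a..b})"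
      "\<And>t. t \<in> E - {a..b} \<Longrightarrow> sqrt (infdist t {a..b}) \<le> B * G (complex_of_real t)"
    using G_comparable_sqrt_dist by blast
  have "bounded (widom_factor E w ` {1..}) \<longleftrightarrow> irregularity_coeff E w \<noteq> \<infinity>"
    by (rule bounded_iff_limit_finite[OF widom_factor_limit]) (simp add: IR infsum_nonneg g0)
  also have "\<dots> \<longleftrightarrow> summable g" unfolding IR by (rule infsum_ereal_finite_iff_summable[OF g0])
  also have "\<dots> \<longleftrightarrow> summable (\<lambda>k. sqrt (infdist (x (Suc k)) {a..b}))"
    by (rule summable_iff_comparable[of _ _ A B]) (use AB[OF x_in] g0 in \<open>auto simp: g_def infdist_nonneg\<close>)
  also have "(\<lambda>k. sqrt (infdist (x (Suc k)) {a..b})) = (\<lambda>k. infdist (x (Suc k)) {a..b} powr (1/2))"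
    by (simp add: powr_half_sqrt infdist_nonneg)
  finally show ?thesis using widom_factor_limit by blast
qed

end
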